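(* Let $\mathrm S$ be a dependent type theory with identity types and discrete identity types, and let $p\colon\mathfrak T_{\mathrm S}\to\mathfrak C_{\mathrm S}$ be the $2$-functor from the $2$-category of types-in-context to the $2$-category of contexts of $\mathrm S$ which sends $(\Gamma,A)$ to $\Gamma$. Then $p$ is a globally split $2$-fibration.
   Context: **Type theory.** $\mathrm S$ is a dependent type theory with the four judgement forms $A\ \mathsf{type}$, $a:A$, $A=B\ \mathsf{type}$, $a=b:A$ (the last two are definitional equality), made relative to contexts $\Gamma=(x_1:A_1,\dots,x_n:A_n)$ with each $A_i$ a type in context $(x_1:A_1,\dots,x_{i-1}:A_{i-1})$. It has the equality rules (definitional equality is a congruence) and the structural rules (weakening, contraction, exchange, substitution). Every rule is read relative to an arbitrary ambient context and every operation is stable under substitution in it. Furthermore $\mathrm S$ has: - identity types: from $a,b:A$ form $\mathrm{Id}_A(a,b)$; $\mathrm r(a):\mathrm{Id}_A(a,a)$; from $x,y:A,\,p:\mathrm{Id}_A(x,y),\,\Delta\vdash C(x,y,p)\ \mathsf{type}$ and $x:A,\,\Delta[x,x,\mathrm r(x)/x,y,p]\vdash d(x):C(x,x,\mathrm r(x))$ infer $x,y:A,\,p:\mathrm{Id}_A(x,y),\,\Delta\vdash\mathrm J_d(x,y,p):C(x,y,p)$, with $\mathrm J_d(x,x,\mathrm r(x))=d(x)$; - discrete identity types: if $p,q:\mathrm{Id}_A(a,b)$ and $\alpha:\mathrm{Id}_{\mathrm{Id}_A(a,b)}(p,q)$ then $p=q$ and $\alpha=\mathrm r(p)$ definitionally.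 Vector notation is used: an element $a:\Gamma$ of a context is a list of terms of the successive types, and $x:\Gamma\vdash\Delta(x)\ \mathsf{ctxt}$ denotes a telescope over $\Gamma$. **Identity contexts.** The identity rules extend from types to contexts by induction on length. For a single type, elimination into a context $\Theta=(u:\Lambda,v:D(u))$ is componentwise: from $d=(d_1,d_2)$ form $\mathrm J_{d_1}$, then $\mathrm J_{d_2}$ eliminating into $D(x,y,p,\mathrm J_{d_1}(x,y,p))$. For the empty context, $\mathrm{Id}_{()}=()$ and $\mathrm J_d=d$. For $\Phi=(x:\Lambda,y:D(x))$: transport $p^*(z):\Upsilon(x)$ for $x:\Lambda\vdash\Upsilon(x)\ \mathsf{ctxt}$, $p:\mathrm{Id}_\Lambda(x,x')$, $z:\Upsilon(x')$ is defined by $\mathrm{Id}_\Lambda$-elimination from $\mathrm r(x)^*(z)=z$; $\mathrm{Id}_\Phi((x,y),(x',y')):=(p:\mathrm{Id}_\Lambda(x,x'),\,q:\mathrm{Id}_{D(x)}(y,p^*y'))$; $\mathrm r(x,y):=(\mathrm r(x),\mathrm r(y))$; elimination for $\mathrm{Id}_\Phi$ is obtained by first applying elimination for $\mathrm{Id}_{D(x)}$ to $d$, giving $d'(x,y,y',q)$, and then applying $\mathrm{Id}_\Lambda$-elimination with post-context $(y,y',q)$ to $d'$. **The 2-category $\mathfrak C_{\mathrm S}$.** (All modulo $\alpha$-conversion and definitional equality.) Objects: contexts. 1-cells $\Gamma\to\Delta$: judgements $x:\Gamma\vdash f(x):\Delta$, composed by substitution. 2-cells $f\Rightarrow g$: judgements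 $x:\Gamma\vdash\alpha(x):\mathrm{Id}_\Delta(fx,gx)$. Here $q\circ p$ is defined by elimination on $q$ with $\mathrm r(y)\circ p=p$, and $h^\bullet(p):\mathrm{Id}_\Delta(hx,hy)$ by elimination on $p$ with $h^\bullet(\mathrm r(x))=\mathrm r(hx)$; vertical composition is $\beta(x)\circ\alpha(x)$, identities are $\mathrm r(fx)$, whiskerings are $(\alpha k)(x)=\alpha(kx)$, $(h\alpha)(x)=h^\bullet(\alpha(x))$. It is locally groupoidal. **The 2-category $\mathfrak T_{\mathrm S}$ and the functors $E$, $p$.** Objects: pairs $(\Gamma,A)$ with $\Gamma$ a context and $A$ a type in context $\Gamma$. 1-cells $(\Gamma,A)\to(\Delta,B)$: pairs $(f,g)$ with $f\colon\Gamma\to\Delta$ and $x:\Gamma,y:A(x)\vdash g(x,y):B(fx)$. Let $\Gamma.A=(x:\Gamma,y:A(x))$, $\pi_A\colon\Gamma.A\to\Gamma$ the projection, and $f.g\colon\Gamma.A\to\Delta.B$ the map $(x,y)\mapsto(fx,g(x,y))$. 2-cells $(f,g)\Rightarrow(f',g')$: pairs $(\gamma\colon f.g\Rightarrow f'.g',\ \alpha\colon f\Rightarrow f')$ of 2-cells of $\mathfrak C_{\mathrm S}$ with $\pi_B\gamma=\alpha\pi_A$; compositions as in the arrow 2-category $\mathfrak C_{\mathrm S}^{\mathbf 2}$. The 2-functor $p\colon\mathfrak T_{\mathrm S}\to\mathfrak C_{\mathrm S}$ sends $(\Gamma,A)\mapsto\Gamma$, $(f,g)\mapsto f$, $(\gamma,\alpha)\mapsto\alpha$.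 The chosen cartesian lift of $f\colon\Gamma\to\Delta$ at $(\Delta,B)$ is $(f,\iota)\colon(\Gamma,f^*B)\to(\Delta,B)$, where $f^*B$ is $x:\Gamma\vdash B(fx)\ \mathsf{type}$ and $\iota$ is $x:\Gamma,y:B(fx)\vdash y:B(fx)$. **2-fibrations.** A 2-functor $p\colon\mathbf E\to\mathbf B$ is a *cloven 2-fibration* if: (i) its underlying ordinary functor is a cloven fibration; (ii) each cartesian 1-cell $f\colon y\to z$ has the property that for each 2-cell $\alpha\colon g\Rightarrow h\colon x\to z$ of $\mathbf E$ and each factorisation $p(\alpha)=p(f)\gamma$ with $\gamma\colon k\Rightarrow l\colon p(x)\to p(y)$, there is a unique factorisation $\alpha=f\gamma'$ with $\gamma'\colon k'\Rightarrow l'\colon x\to y$ and $p(\gamma')=\gamma$; (iii) each functor $\mathbf E(x,y)\to\mathbf B(px,py)$ is a cloven fibration of categories; (iv) for each $f\colon x\to y$, the functor $(-)\cdot f\colon\mathbf E(y,z)\to\mathbf E(x,z)$ preserves cartesian liftings of 2-cells. It is *globally split* if the fibration in (i) is split. *)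

theory Defs
  imports Main
begin

section \<open>Categories, 2-categories and 2-fibrations\<close>

record ('o, 'm) cat =
  Obj :: "'o set"
  Arr :: "'m set"
  Dom :: "'m \<Rightarrow> 'o"
  Cod :: "'m \<Rightarrow> 'o"
  Ident :: "'o \<Rightarrow> 'm"
  Comp :: "'m \<Rightarrow> 'm \<Rightarrow> 'm"

text \<open>
  \<open>Comp C g f\<close> is \<open>g \<circ> f\<close>.  All operations are only meaningful on composable arguments.
\<close>

locale category =
  fixes C :: "('o, 'm, 'z) cat_scheme"
  assumes dom_obj: "f \<in> Arr C \<Longrightarrow> Dom C f \<in> Obj C"
    and cod_obj: "f \<in> Arr C \<Longrightarrow> Cod C f \<in> Obj C"
    and ident_arr: "x \<in> Obj C \<Longrightarrow> Ident C x \<in> Arr C"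
    and dom_ident: "x \<in> Obj C \<Longrightarrow> Dom C (Ident C x) = x"
    and cod_ident: "x \<in> Obj C \<Longrightarrow> Cod C (Ident C x) = x"
    and comp_arr: "\<lbrakk>g \<in> Arr C; f \<in> Arr C; Dom C g = Cod C f\<rbrakk> \<Longrightarrow> Comp C g f \<in> Arr C"
    and dom_comp: "\<lbrakk>g \<in> Arr C; f \<in> Arr C; Dom C g = Cod C f\<rbrakk> \<Longrightarrow> Dom C (Comp C g f) = Dom C f"
    and cod_comp: "\<lbrakk>g \<in> Arr C; f \<in> Arr C; Dom C g = Cod C f\<rbrakk> \<Longrightarrow> Cod C (Comp C g f) = Cod C g"
    and comp_ident_left: "f \<in> Arr C \<Longrightarrow> Comp C (Ident C (Cod C f)) f = f"
    and comp_ident_right: "f \<in> Arr C \<Longrightarrow> Comp C f (Ident C (Dom C f)) = f"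
    and comp_assoc: "\<lbrakk>h \<in> Arr C; g \<in> Arr C; f \<in> Arr C; Dom C h = Cod C g; Dom C g = Cod C f\<rbrakk>
          \<Longrightarrow> Comp C (Comp C h g) f = Comp C h (Comp C g f)"

locale cat_functor = E: category E + B: category B
  for E :: "('o, 'm, 'z) cat_scheme" and B :: "('p, 'n, 'y) cat_scheme" +
  fixes P0 :: "'o \<Rightarrow> 'p" and P1 :: "'m \<Rightarrow> 'n"
  assumes obj_map: "x \<in> Obj E \<Longrightarrow> P0 x \<in> Obj B"
    and arr_map: "f \<in> Arr E \<Longrightarrow> P1 f \<in> Arr B"
    and dom_map: "f \<in> Arr E \<Longrightarrow> Dom B (P1 f) = P0 (Dom E f)"
    and cod_map: "f \<in> Arr E \<Longrightarrow> Cod B (P1 f) = P0 (Cod E f)"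
    and ident_map: "x \<in> Obj E \<Longrightarrow> P1 (Ident E x) = Ident B (P0 x)"
    and comp_map: "\<lbrakk>g \<in> Arr E; f \<in> Arr E; Dom E g = Cod E f\<rbrakk>
          \<Longrightarrow> P1 (Comp E g f) = Comp B (P1 g) (P1 f)"

definition cartesian ::
    "('o, 'm, 'z) cat_scheme \<Rightarrow> ('p, 'n, 'y) cat_scheme \<Rightarrow> ('o \<Rightarrow> 'p) \<Rightarrow> ('m \<Rightarrow> 'n) \<Rightarrow> 'm \<Rightarrow> bool" where
  "cartesian E B P0 P1 f \<longleftrightarrow> f \<in> Arr E \<and>
    (\<forall>g \<in> Arr E. \<forall>k \<in> Arr B.
       Cod E g = Cod E f \<and> Dom B k = P0 (Dom E g) \<and> Cod B k = P0 (Dom E f) \<and> P1 g = Comp B (P1 f) k \<longrightarrow>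
       (\<exists>!k'. k' \<in> Arr E \<and> Dom E k' = Dom E g \<and> Cod E k' = Dom E f \<and> P1 k' = k \<and> Comp E f k' = g))"

text \<open>\<open>lift u z\<close> is the chosen cartesian arrow over \<open>u\<close> with codomain \<open>z\<close>.\<close>

locale cloven_fibration = cat_functor E B P0 P1
  for E :: "('o, 'm, 'z) cat_scheme" and B :: "('p, 'n, 'y) cat_scheme"
    and P0 :: "'o \<Rightarrow> 'p" and P1 :: "'m \<Rightarrow> 'n" +
  fixes lift :: "'n \<Rightarrow> 'o \<Rightarrow> 'm"
  assumes lift_cartesian: "\<lbrakk>z \<in> Obj E; u \<in> Arr B; Cod B u = P0 z\<rbrakk> \<Longrightarrow> cartesian E B P0 P1 (lift u z)"
    and cod_lift: "\<lbrakk>z \<in> Obj E; u \<in> Arr B; Cod B u = P0 z\<rbrakk> \<Longrightarrow> Cod E (lift u z) = z"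
    and lift_over: "\<lbrakk>z \<in> Obj E; u \<in> Arr B; Cod B u = P0 z\<rbrakk> \<Longrightarrow> P1 (lift u z) = u"

locale split_fibration = cloven_fibration E B P0 P1 lift
  for E :: "('o, 'm, 'z) cat_scheme" and B :: "('p, 'n, 'y) cat_scheme"
    and P0 :: "'o \<Rightarrow> 'p" and P1 :: "'m \<Rightarrow> 'n" and lift :: "'n \<Rightarrow> 'o \<Rightarrow> 'm" +
  assumes lift_ident: "z \<in> Obj E \<Longrightarrow> lift (Ident B (P0 z)) z = Ident E z"
    and lift_comp: "\<lbrakk>z \<in> Obj E; u \<in> Arr B; v \<in> Arr B; Cod B u = P0 z; Cod B v = Dom B u\<rbrakk>
          \<Longrightarrow> lift (Comp B u v) z = Comp E (lift u z) (lift v (Dom E (lift u z)))"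

text \<open>
  A 2-category is presented by its vertical compositions and its whiskerings:
  \<open>WhL C h \<alpha>\<close> is \<open>h \<alpha>\<close>, \<open>WhR C \<alpha> k\<close> is \<open>\<alpha> k\<close>, and \<open>VComp C \<beta> \<alpha>\<close> is \<open>\<alpha>\<close> followed by \<open>\<beta>\<close>.
  Horizontal composition is derived, and the interchange law makes it unambiguous.
\<close>

record ('o, 'm, 't) cat2 = "('o, 'm) cat" +
  Cell :: "'t set"
  Src :: "'t \<Rightarrow> 'm"
  Trg :: "'t \<Rightarrow> 'm"
  VId :: "'m \<Rightarrow> 't"
  VComp :: "'t \<Rightarrow> 't \<Rightarrow> 't"
  WhL :: "'m \<Rightarrow> 't \<Rightarrow> 't"
  WhR :: "'t \<Rightarrow> 'm \<Rightarrow> 't"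

definition hom_cat :: "('o, 'm, 't, 'z) cat2_scheme \<Rightarrow> 'o \<Rightarrow> 'o \<Rightarrow> ('m, 't) cat" where
  "hom_cat C x y =
    \<lparr>Obj = {f \<in> Arr C. Dom C f = x \<and> Cod C f = y},
     Arr = {\<alpha> \<in> Cell C. Dom C (Src C \<alpha>) = x \<and> Cod C (Src C \<alpha>) = y},
     Dom = Src C, Cod = Trg C, Ident = VId C, Comp = VComp C\<rparr>"

locale two_category = category C
  for C :: "('o, 'm, 't, 'z) cat2_scheme" +
  assumes src_arr: "\<alpha> \<in> Cell C \<Longrightarrow> Src C \<alpha> \<in> Arr C"
    and trg_arr: "\<alpha> \<in> Cell C \<Longrightarrow> Trg C \<alpha> \<in> Arr C"
    and cell_dom: "\<alpha> \<in> Cell C \<Longrightarrow> Dom C (Src C \<alpha>) = Dom C (Trg C \<alpha>)"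
    and cell_cod: "\<alpha> \<in> Cell C \<Longrightarrow> Cod C (Src C \<alpha>) = Cod C (Trg C \<alpha>)"
    and hom_category: "\<lbrakk>x \<in> Obj C; y \<in> Obj C\<rbrakk> \<Longrightarrow> category (hom_cat C x y)"
    and whl_cell: "\<lbrakk>h \<in> Arr C; \<alpha> \<in> Cell C; Dom C h = Cod C (Src C \<alpha>)\<rbrakk> \<Longrightarrow>
          WhL C h \<alpha> \<in> Cell C \<and> Src C (WhL C h \<alpha>) = Comp C h (Src C \<alpha>) \<and> Trg C (WhL C h \<alpha>) = Comp C h (Trg C \<alpha>)"
    and whr_cell: "\<lbrakk>k \<in> Arr C; \<alpha> \<in> Cell C; Dom C (Src C \<alpha>) = Cod C k\<rbrakk> \<Longrightarrow>
          WhR C \<alpha> k \<in> Cell C \<and> Src C (WhR C \<alpha> k) = Comp C (Src C \<alpha>) k \<and> Trg C (WhR C \<alpha> k) = Comp C (Trg C \<alpha>) k"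
    and whl_vid: "\<lbrakk>h \<in> Arr C; f \<in> Arr C; Dom C h = Cod C f\<rbrakk> \<Longrightarrow> WhL C h (VId C f) = VId C (Comp C h f)"
    and whr_vid: "\<lbrakk>f \<in> Arr C; k \<in> Arr C; Dom C f = Cod C k\<rbrakk> \<Longrightarrow> WhR C (VId C f) k = VId C (Comp C f k)"
    and whl_vcomp: "\<lbrakk>h \<in> Arr C; \<beta> \<in> Cell C; \<alpha> \<in> Cell C; Src C \<beta> = Trg C \<alpha>; Dom C h = Cod C (Src C \<alpha>)\<rbrakk> \<Longrightarrow>
          WhL C h (VComp C \<beta> \<alpha>) = VComp C (WhL C h \<beta>) (WhL C h \<alpha>)"
    and whr_vcomp: "\<lbrakk>k \<in> Arr C; \<beta> \<in> Cell C; \<alpha> \<in> Cell C; Src C \<beta> = Trg C \<alpha>; Dom C (Src C \<alpha>) = Cod C k\<rbrakk> \<Longrightarrow>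
          WhR C (VComp C \<beta> \<alpha>) k = VComp C (WhR C \<beta> k) (WhR C \<alpha> k)"
    and whl_ident: "\<alpha> \<in> Cell C \<Longrightarrow> WhL C (Ident C (Cod C (Src C \<alpha>))) \<alpha> = \<alpha>"
    and whr_ident: "\<alpha> \<in> Cell C \<Longrightarrow> WhR C \<alpha> (Ident C (Dom C (Src C \<alpha>))) = \<alpha>"
    and whl_comp: "\<lbrakk>h \<in> Arr C; k \<in> Arr C; \<alpha> \<in> Cell C; Dom C h = Cod C k; Dom C k = Cod C (Src C \<alpha>)\<rbrakk> \<Longrightarrow>
          WhL C (Comp C h k) \<alpha> = WhL C h (WhL C k \<alpha>)"
    and whr_comp: "\<lbrakk>h \<in> Arr C; k \<in> Arr C; \<alpha> \<in> Cell C; Dom C (Src C \<alpha>) = Cod C h; Dom C h = Cod C k\<rbrakk> \<Longrightarrow>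
          WhR C \<alpha> (Comp C h k) = WhR C (WhR C \<alpha> h) k"
    and whl_whr: "\<lbrakk>h \<in> Arr C; k \<in> Arr C; \<alpha> \<in> Cell C; Dom C h = Cod C (Src C \<alpha>); Dom C (Src C \<alpha>) = Cod C k\<rbrakk> \<Longrightarrow>
          WhR C (WhL C h \<alpha>) k = WhL C h (WhR C \<alpha> k)"
    and interchange: "\<lbrakk>\<beta> \<in> Cell C; \<alpha> \<in> Cell C; Dom C (Src C \<beta>) = Cod C (Src C \<alpha>)\<rbrakk> \<Longrightarrow>
          VComp C (WhL C (Trg C \<beta>) \<alpha>) (WhR C \<beta> (Src C \<alpha>)) = VComp C (WhR C \<beta> (Trg C \<alpha>)) (WhL C (Src C \<beta>) \<alpha>)"

locale two_functor = E: two_category E + B: two_category B + cat_functor E B P0 P1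
  for E :: "('o, 'm, 't, 'z) cat2_scheme" and B :: "('p, 'n, 's, 'y) cat2_scheme"
    and P0 :: "'o \<Rightarrow> 'p" and P1 :: "'m \<Rightarrow> 'n" +
  fixes P2 :: "'t \<Rightarrow> 's"
  assumes cell_map: "\<alpha> \<in> Cell E \<Longrightarrow> P2 \<alpha> \<in> Cell B"
    and src_map: "\<alpha> \<in> Cell E \<Longrightarrow> Src B (P2 \<alpha>) = P1 (Src E \<alpha>)"
    and trg_map: "\<alpha> \<in> Cell E \<Longrightarrow> Trg B (P2 \<alpha>) = P1 (Trg E \<alpha>)"
    and vid_map: "f \<in> Arr E \<Longrightarrow> P2 (VId E f) = VId B (P1 f)"
    and vcomp_map: "\<lbrakk>\<beta> \<in> Cell E; \<alpha> \<in> Cell E; Src E \<beta> = Trg E \<alpha>\<rbrakk> \<Longrightarrow>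
          P2 (VComp E \<beta> \<alpha>) = VComp B (P2 \<beta>) (P2 \<alpha>)"
    and whl_map: "\<lbrakk>h \<in> Arr E; \<alpha> \<in> Cell E; Dom E h = Cod E (Src E \<alpha>)\<rbrakk> \<Longrightarrow>
          P2 (WhL E h \<alpha>) = WhL B (P1 h) (P2 \<alpha>)"
    and whr_map: "\<lbrakk>k \<in> Arr E; \<alpha> \<in> Cell E; Dom E (Src E \<alpha>) = Cod E k\<rbrakk> \<Longrightarrow>
          P2 (WhR E \<alpha> k) = WhR B (P2 \<alpha>) (P1 k)"

text \<open>
  \<open>lift\<close> is the cleavage of the underlying functor and \<open>lift2 x y\<close> is the cleavage of the functor
  on hom-categories from \<open>x\<close> to \<open>y\<close>.  Cartesian liftings of 2-cells are the cartesian arrows of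
  the latter; they need not be chosen ones.
\<close>

locale cloven_two_fibration = two_functor E B P0 P1 P2
  for E :: "('o, 'm, 't, 'z) cat2_scheme" and B :: "('p, 'n, 's, 'y) cat2_scheme"
    and P0 :: "'o \<Rightarrow> 'p" and P1 :: "'m \<Rightarrow> 'n" and P2 :: "'t \<Rightarrow> 's" +
  fixes lift :: "'n \<Rightarrow> 'o \<Rightarrow> 'm" and lift2 :: "'o \<Rightarrow> 'o \<Rightarrow> 's \<Rightarrow> 'm \<Rightarrow> 't"
  assumes cloven: "cloven_fibration E B P0 P1 lift"
    and cartesian_2cells: "\<And>f \<alpha> \<gamma>.
          \<lbrakk>cartesian E B P0 P1 f; \<alpha> \<in> Cell E; Cod E (Src E \<alpha>) = Cod E f;
           \<gamma> \<in> Cell B; Dom B (Src B \<gamma>) = P0 (Dom E (Src E \<alpha>)); Cod B (Src B \<gamma>) = P0 (Dom E f);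
           P2 \<alpha> = WhL B (P1 f) \<gamma>\<rbrakk> \<Longrightarrow>
          \<exists>!\<gamma>'. \<gamma>' \<in> Cell E \<and> Dom E (Src E \<gamma>') = Dom E (Src E \<alpha>) \<and> Cod E (Src E \<gamma>') = Dom E f \<and>
                P2 \<gamma>' = \<gamma> \<and> WhL E f \<gamma>' = \<alpha>"
    and locally_cloven: "\<And>x y. \<lbrakk>x \<in> Obj E; y \<in> Obj E\<rbrakk> \<Longrightarrow>
          cloven_fibration (hom_cat E x y) (hom_cat B (P0 x) (P0 y)) P1 P2 (lift2 x y)"
    and whr_cartesian: "\<And>f z \<alpha>.
          \<lbrakk>f \<in> Arr E; z \<in> Obj E;
           cartesian (hom_cat E (Cod E f) z) (hom_cat B (P0 (Cod E f)) (P0 z)) P1 P2 \<alpha>\<rbrakk> \<Longrightarrow>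
          cartesian (hom_cat E (Dom E f) z) (hom_cat B (P0 (Dom E f)) (P0 z)) P1 P2 (WhR E \<alpha> f)"

locale globally_split_two_fibration = cloven_two_fibration E B P0 P1 P2 lift lift2
  for E :: "('o, 'm, 't, 'z) cat2_scheme" and B :: "('p, 'n, 's, 'y) cat2_scheme"
    and P0 :: "'o \<Rightarrow> 'p" and P1 :: "'m \<Rightarrow> 'n" and P2 :: "'t \<Rightarrow> 's"
    and lift :: "'n \<Rightarrow> 'o \<Rightarrow> 'm" and lift2 :: "'o \<Rightarrow> 'o \<Rightarrow> 's \<Rightarrow> 'm \<Rightarrow> 't" +
  assumes split: "split_fibration E B P0 P1 lift"


section \<open>Raw syntax\<close>

text \<open>
  Expressions over an arbitrary signature of further operations \<open>Ext c\<close>, with de Bruijn indices, so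
  that \<open>\<alpha>\<close>-equivalence is equality.  Each argument of an operation carries the number of variables
  which the operation binds in it.
\<close>

datatype 'c sym = IdSym | ReflSym | JSym | Ext 'c

datatype 'c expr = Var nat | Op "'c sym" "(nat \<times> 'c expr) list"

text \<open>
  Contexts and telescopes are lists with the \<^emph>\<open>last\<close> declaration first: the head of the list is
  the type of \<open>Var 0\<close>, and it may mention the variables declared in the tail.  Accordingly
  \<open>\<Delta> @ \<Gamma>\<close> is the context \<open>\<Gamma>\<close> extended by the telescope \<open>\<Delta>\<close>, and
  elements of a telescope are lists of terms in the same order.
\<close>

type_synonym 'c ctx = "'c expr list"

fun lift_ren :: "nat \<Rightarrow> (nat \<Rightarrow> nat) \<Rightarrow> nat \<Rightarrow> nat" where
  "lift_ren k \<rho> i = (if i < k then i else \<rho> (i - k) + k)"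

fun rename :: "(nat \<Rightarrow> nat) \<Rightarrow> 'c expr \<Rightarrow> 'c expr" where
  "rename \<rho> (Var i) = Var (\<rho> i)"
| "rename \<rho> (Op c args) = Op c (map (\<lambda>(k, e). (k, rename (lift_ren k \<rho>) e)) args)"

definition shift :: "nat \<Rightarrow> 'c expr \<Rightarrow> 'c expr" where
  "shift n = rename (\<lambda>i. i + n)"

definition lift_sub :: "nat \<Rightarrow> (nat \<Rightarrow> 'c expr) \<Rightarrow> nat \<Rightarrow> 'c expr" where
  "lift_sub k \<sigma> i = (if i < k then Var i else shift k (\<sigma> (i - k)))"

fun subst :: "(nat \<Rightarrow> 'c expr) \<Rightarrow> 'c expr \<Rightarrow> 'c expr" where
  "subst \<sigma> (Var i) = \<sigma> i"
| "subst \<sigma> (Op c args) = Op c (map (\<lambda>(k, e). (k, subst (lift_sub k \<sigma>) e)) args)"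

fun scoped :: "nat \<Rightarrow> 'c expr \<Rightarrow> bool" where
  "scoped n (Var i) \<longleftrightarrow> i < n"
| "scoped n (Op c args) \<longleftrightarrow> (\<forall>(k, e) \<in> set args. scoped (n + k) e)"

primrec subst_tele :: "(nat \<Rightarrow> 'c expr) \<Rightarrow> 'c ctx \<Rightarrow> 'c ctx" where
  "subst_tele \<sigma> [] = []"
| "subst_tele \<sigma> (A # \<Delta>) = subst (lift_sub (length \<Delta>) \<sigma>) A # subst_tele \<sigma> \<Delta>"

definition shift_tele :: "nat \<Rightarrow> 'c ctx \<Rightarrow> 'c ctx" where
  "shift_tele n = subst_tele (\<lambda>i. Var (i + n))"

definition vars :: "nat \<Rightarrow> 'c expr list" where
  "vars n = map Var [0..<n]"

text \<open>
  \<open>inst k \<delta>\<close> replaces the last \<open>length \<delta>\<close> variables by \<open>\<delta>\<close>; the remaining (ambient)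
  variables are kept, and \<open>\<delta>\<close> lives in the ambient context extended by \<open>k\<close> variables.
\<close>

definition inst :: "nat \<Rightarrow> 'c expr list \<Rightarrow> nat \<Rightarrow> 'c expr" where
  "inst k \<delta> i = (if i < length \<delta> then \<delta> ! i else Var (i - length \<delta> + k))"

definition IdT :: "'c expr \<Rightarrow> 'c expr \<Rightarrow> 'c expr \<Rightarrow> 'c expr" where
  "IdT A a b = Op IdSym [(0, A), (0, a), (0, b)]"

definition Refl :: "'c expr \<Rightarrow> 'c expr \<Rightarrow> 'c expr" where
  "Refl A a = Op ReflSym [(0, A), (0, a)]"

primrec tele_args :: "nat \<Rightarrow> 'c ctx \<Rightarrow> (nat \<times> 'c expr) list" where
  "tele_args k [] = []"
| "tele_args k (A # \<Delta>) = (k + length \<Delta>, A) # tele_args k \<Delta>"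

text \<open>
  \<open>J A \<Delta> C d a b p \<delta>\<close> is \<open>J\<^sub>d(a, b, p)\<close> at the element \<open>\<delta>\<close> of the post-context.  The data
  \<open>A\<close>, \<open>\<Delta>\<close>, \<open>C\<close> of the eliminator are recorded in the term; \<open>\<Delta>\<close> is a telescope over \<open>x, y, p\<close>,
  \<open>C\<close> binds \<open>x, y, p, \<Delta>\<close>, and \<open>d\<close> binds \<open>x\<close> and the restriction of \<open>\<Delta>\<close> to the diagonal.
\<close>

definition J ::
    "'c expr \<Rightarrow> 'c ctx \<Rightarrow> 'c expr \<Rightarrow> 'c expr \<Rightarrow> 'c expr \<Rightarrow> 'c expr \<Rightarrow> 'c expr \<Rightarrow> 'c expr list \<Rightarrow> 'c expr" where
  "J A \<Delta> C d a b p \<delta> =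
    Op JSym ((0, A) # tele_args 3 \<Delta> @ [(3 + length \<Delta>, C), (1 + length \<Delta>, d), (0, a), (0, b), (0, p)]
             @ map (Pair 0) \<delta>)"

text \<open>\<open>J_gen A \<Delta> C d\<close> is \<open>J\<^sub>d(x, y, p)\<close> in the generic context \<open>x : A, y : A, p : Id\<^sub>A(x, y), \<Delta>\<close>.\<close>

definition J_gen :: "'c expr \<Rightarrow> 'c ctx \<Rightarrow> 'c expr \<Rightarrow> 'c expr \<Rightarrow> 'c expr" where
  "J_gen A \<Delta> C d =
    (let m = length \<Delta>; w = (\<lambda>i. Var (i + (m + 3)))
     in J (subst w A) (subst_tele (lift_sub 3 w) \<Delta>) (subst (lift_sub (3 + m) w) C)
          (subst (lift_sub (1 + m) w) d) (Var (m + 2)) (Var (m + 1)) (Var m) (vars m))"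

definition id_tele :: "'c expr \<Rightarrow> 'c ctx" where
  "id_tele A = [IdT (shift 2 A) (Var 1) (Var 0), shift 1 A, A]"

text \<open>The substitution of \<open>x, x, r(x)\<close> for \<open>x, y, p\<close>.\<close>

definition diag :: "'c expr \<Rightarrow> nat \<Rightarrow> 'c expr" where
  "diag A = inst 1 [Refl (shift 1 A) (Var 0), Var 0, Var 0]"


section \<open>Dependent type theories\<close>

datatype 'e judgement = IsType 'e | HasType 'e 'e | EqType 'e 'e | EqTerm 'e 'e 'e

text \<open>
  \<open>HasType a A\<close> is \<open>a : A\<close> and \<open>EqTerm a b A\<close> is \<open>a = b : A\<close>.  A theory is given by the set of
  its derivable judgements in context.
\<close>

type_synonym 'c type_theory = "('c ctx \<times> 'c expr judgement) set"

abbreviation derivable :: "'c ctx \<Rightarrow> 'c type_theory \<Rightarrow> 'c expr judgement \<Rightarrow> bool"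
    ("(_ \<turnstile>\<^bsub>_\<^esub>/ _)" [51, 0, 51] 50) where
  "\<Gamma> \<turnstile>\<^bsub>S\<^esub> \<J> \<equiv> (\<Gamma>, \<J>) \<in> S"

abbreviation subst_judgement :: "(nat \<Rightarrow> 'c expr) \<Rightarrow> 'c expr judgement \<Rightarrow> 'c expr judgement" where
  "subst_judgement \<sigma> \<equiv> map_judgement (subst \<sigma>)"

primrec ctxt :: "'c type_theory \<Rightarrow> 'c ctx \<Rightarrow> bool" where
  "ctxt S [] \<longleftrightarrow> True"
| "ctxt S (A # \<Gamma>) \<longleftrightarrow> ctxt S \<Gamma> \<and> \<Gamma> \<turnstile>\<^bsub>S\<^esub> IsType A"

fun ctxt_eq :: "'c type_theory \<Rightarrow> 'c ctx \<Rightarrow> 'c ctx \<Rightarrow> bool" where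
  "ctxt_eq S [] [] \<longleftrightarrow> True"
| "ctxt_eq S (A # \<Gamma>) (A' # \<Gamma>') \<longleftrightarrow> ctxt_eq S \<Gamma> \<Gamma>' \<and> \<Gamma> \<turnstile>\<^bsub>S\<^esub> EqType A A'"
| "ctxt_eq S _ _ \<longleftrightarrow> False"

text \<open>
  The rules are closure conditions on the set of derivable judgements, so a theory may have any
  further operations and rules, including the congruence rules which go with its \<open>Ext\<close> operations.
\<close>

locale dependent_type_theory =
  fixes S :: "'c type_theory"
  assumes in_context: "\<Gamma> \<turnstile>\<^bsub>S\<^esub> \<J> \<Longrightarrow> ctxt S \<Gamma>"
    and in_scope: "\<lbrakk>\<Gamma> \<turnstile>\<^bsub>S\<^esub> \<J>; e \<in> set_judgement \<J>\<rbrakk> \<Longrightarrow> scoped (length \<Gamma>) e"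
    and has_type_presup: "\<Gamma> \<turnstile>\<^bsub>S\<^esub> HasType a A \<Longrightarrow> \<Gamma> \<turnstile>\<^bsub>S\<^esub> IsType A"
    and eq_type_presup: "\<Gamma> \<turnstile>\<^bsub>S\<^esub> EqType A B \<Longrightarrow> \<Gamma> \<turnstile>\<^bsub>S\<^esub> IsType A \<and> \<Gamma> \<turnstile>\<^bsub>S\<^esub> IsType B"
    and eq_term_presup: "\<Gamma> \<turnstile>\<^bsub>S\<^esub> EqTerm a b A \<Longrightarrow> \<Gamma> \<turnstile>\<^bsub>S\<^esub> HasType a A \<and> \<Gamma> \<turnstile>\<^bsub>S\<^esub> HasType b A"

    and eq_type_refl: "\<Gamma> \<turnstile>\<^bsub>S\<^esub> IsType A \<Longrightarrow> \<Gamma> \<turnstile>\<^bsub>S\<^esub> EqType A A"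
    and eq_type_sym: "\<Gamma> \<turnstile>\<^bsub>S\<^esub> EqType A B \<Longrightarrow> \<Gamma> \<turnstile>\<^bsub>S\<^esub> EqType B A"
    and eq_type_trans: "\<lbrakk>\<Gamma> \<turnstile>\<^bsub>S\<^esub> EqType A B; \<Gamma> \<turnstile>\<^bsub>S\<^esub> EqType B C\<rbrakk> \<Longrightarrow> \<Gamma> \<turnstile>\<^bsub>S\<^esub> EqType A C"
    and eq_term_refl: "\<Gamma> \<turnstile>\<^bsub>S\<^esub> HasType a A \<Longrightarrow> \<Gamma> \<turnstile>\<^bsub>S\<^esub> EqTerm a a A"
    and eq_term_sym: "\<Gamma> \<turnstile>\<^bsub>S\<^esub> EqTerm a b A \<Longrightarrow> \<Gamma> \<turnstile>\<^bsub>S\<^esub> EqTerm b a A"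
    and eq_term_trans: "\<lbrakk>\<Gamma> \<turnstile>\<^bsub>S\<^esub> EqTerm a b A; \<Gamma> \<turnstile>\<^bsub>S\<^esub> EqTerm b c A\<rbrakk> \<Longrightarrow> \<Gamma> \<turnstile>\<^bsub>S\<^esub> EqTerm a c A"
    and conversion: "\<lbrakk>\<Gamma> \<turnstile>\<^bsub>S\<^esub> HasType a A; \<Gamma> \<turnstile>\<^bsub>S\<^esub> EqType A B\<rbrakk> \<Longrightarrow> \<Gamma> \<turnstile>\<^bsub>S\<^esub> HasType a B"
    and eq_conversion: "\<lbrakk>\<Gamma> \<turnstile>\<^bsub>S\<^esub> EqTerm a b A; \<Gamma> \<turnstile>\<^bsub>S\<^esub> EqType A B\<rbrakk> \<Longrightarrow> \<Gamma> \<turnstile>\<^bsub>S\<^esub> EqTerm a b B"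
    and type_subst_cong: "\<lbrakk>\<Delta> @ A # \<Gamma> \<turnstile>\<^bsub>S\<^esub> IsType B; \<Gamma> \<turnstile>\<^bsub>S\<^esub> EqTerm a a' A\<rbrakk> \<Longrightarrow>
          subst_tele (inst 0 [a]) \<Delta> @ \<Gamma> \<turnstile>\<^bsub>S\<^esub>
            EqType (subst (lift_sub (length \<Delta>) (inst 0 [a])) B) (subst (lift_sub (length \<Delta>) (inst 0 [a'])) B)"
    and term_subst_cong: "\<lbrakk>\<Delta> @ A # \<Gamma> \<turnstile>\<^bsub>S\<^esub> HasType b B; \<Gamma> \<turnstile>\<^bsub>S\<^esub> EqTerm a a' A\<rbrakk> \<Longrightarrow>
          subst_tele (inst 0 [a]) \<Delta> @ \<Gamma> \<turnstile>\<^bsub>S\<^esub>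
            EqTerm (subst (lift_sub (length \<Delta>) (inst 0 [a])) b) (subst (lift_sub (length \<Delta>) (inst 0 [a'])) b)
              (subst (lift_sub (length \<Delta>) (inst 0 [a])) B)"

    and variable: "ctxt S (A # \<Gamma>) \<Longrightarrow> A # \<Gamma> \<turnstile>\<^bsub>S\<^esub> HasType (Var 0) (shift 1 A)"
    and weakening: "\<lbrakk>\<Delta> @ \<Gamma> \<turnstile>\<^bsub>S\<^esub> \<J>; \<Gamma> \<turnstile>\<^bsub>S\<^esub> IsType A\<rbrakk> \<Longrightarrow>
          subst_tele (\<lambda>i. Var (i + 1)) \<Delta> @ A # \<Gamma> \<turnstile>\<^bsub>S\<^esub>
            subst_judgement (lift_sub (length \<Delta>) (\<lambda>i. Var (i + 1))) \<J>"
    and contraction: "\<Delta> @ shift 1 A # A # \<Gamma> \<turnstile>\<^bsub>S\<^esub> \<J> \<Longrightarrow>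
          subst_tele (inst 0 [Var 0]) \<Delta> @ A # \<Gamma> \<turnstile>\<^bsub>S\<^esub>
            subst_judgement (lift_sub (length \<Delta>) (inst 0 [Var 0])) \<J>"
    and exchange: "\<lbrakk>\<Delta> @ shift 1 B # A # \<Gamma> \<turnstile>\<^bsub>S\<^esub> \<J>; \<Gamma> \<turnstile>\<^bsub>S\<^esub> IsType B\<rbrakk> \<Longrightarrow>
          subst_tele (inst 2 [Var 1, Var 0]) \<Delta> @ shift 1 A # B # \<Gamma> \<turnstile>\<^bsub>S\<^esub>
            subst_judgement (lift_sub (length \<Delta>) (inst 2 [Var 1, Var 0])) \<J>"
    and substitution: "\<lbrakk>\<Delta> @ A # \<Gamma> \<turnstile>\<^bsub>S\<^esub> \<J>; \<Gamma> \<turnstile>\<^bsub>S\<^esub> HasType a A\<rbrakk> \<Longrightarrow>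
          subst_tele (inst 0 [a]) \<Delta> @ \<Gamma> \<turnstile>\<^bsub>S\<^esub>
            subst_judgement (lift_sub (length \<Delta>) (inst 0 [a])) \<J>"

locale identity_types = dependent_type_theory S for S :: "'c type_theory" +
  assumes Id_form: "\<lbrakk>\<Gamma> \<turnstile>\<^bsub>S\<^esub> HasType a A; \<Gamma> \<turnstile>\<^bsub>S\<^esub> HasType b A\<rbrakk> \<Longrightarrow> \<Gamma> \<turnstile>\<^bsub>S\<^esub> IsType (IdT A a b)"
    and Id_cong: "\<lbrakk>\<Gamma> \<turnstile>\<^bsub>S\<^esub> EqType A A'; \<Gamma> \<turnstile>\<^bsub>S\<^esub> EqTerm a a' A; \<Gamma> \<turnstile>\<^bsub>S\<^esub> EqTerm b b' A\<rbrakk> \<Longrightarrow>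
          \<Gamma> \<turnstile>\<^bsub>S\<^esub> EqType (IdT A a b) (IdT A' a' b')"
    and Id_intro: "\<Gamma> \<turnstile>\<^bsub>S\<^esub> HasType a A \<Longrightarrow> \<Gamma> \<turnstile>\<^bsub>S\<^esub> HasType (Refl A a) (IdT A a a)"
    and Refl_cong: "\<lbrakk>\<Gamma> \<turnstile>\<^bsub>S\<^esub> EqType A A'; \<Gamma> \<turnstile>\<^bsub>S\<^esub> EqTerm a a' A\<rbrakk> \<Longrightarrow>
          \<Gamma> \<turnstile>\<^bsub>S\<^esub> EqTerm (Refl A a) (Refl A' a') (IdT A a a)"
    and Id_elim: "\<lbrakk>\<Delta> @ id_tele A @ \<Gamma> \<turnstile>\<^bsub>S\<^esub> IsType C;
            subst_tele (diag A) \<Delta> @ A # \<Gamma> \<turnstile>\<^bsub>S\<^esub> HasType d (subst (lift_sub (length \<Delta>) (diag A)) C)\<rbrakk> \<Longrightarrow>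
          \<Delta> @ id_tele A @ \<Gamma> \<turnstile>\<^bsub>S\<^esub> HasType (J_gen A \<Delta> C d) C"
    and Id_comp: "\<lbrakk>\<Delta> @ id_tele A @ \<Gamma> \<turnstile>\<^bsub>S\<^esub> IsType C;
            subst_tele (diag A) \<Delta> @ A # \<Gamma> \<turnstile>\<^bsub>S\<^esub> HasType d (subst (lift_sub (length \<Delta>) (diag A)) C)\<rbrakk> \<Longrightarrow>
          subst_tele (diag A) \<Delta> @ A # \<Gamma> \<turnstile>\<^bsub>S\<^esub>
            EqTerm (subst (lift_sub (length \<Delta>) (diag A)) (J_gen A \<Delta> C d)) d (subst (lift_sub (length \<Delta>) (diag A)) C)"
    and J_cong: "\<lbrakk>ctxt_eq S (\<Delta> @ id_tele A @ \<Gamma>) (\<Delta>' @ id_tele A' @ \<Gamma>); length \<Delta> = length \<Delta>';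
            \<Delta> @ id_tele A @ \<Gamma> \<turnstile>\<^bsub>S\<^esub> EqType C C';
            subst_tele (diag A) \<Delta> @ A # \<Gamma> \<turnstile>\<^bsub>S\<^esub> EqTerm d d' (subst (lift_sub (length \<Delta>) (diag A)) C)\<rbrakk> \<Longrightarrow>
          \<Delta> @ id_tele A @ \<Gamma> \<turnstile>\<^bsub>S\<^esub> EqTerm (J_gen A \<Delta> C d) (J_gen A' \<Delta>' C' d') C"

locale discrete_identity_types = identity_types S for S :: "'c type_theory" +
  assumes reflection: "\<lbrakk>\<Gamma> \<turnstile>\<^bsub>S\<^esub> HasType p (IdT A a b); \<Gamma> \<turnstile>\<^bsub>S\<^esub> HasType q (IdT A a b);
            \<Gamma> \<turnstile>\<^bsub>S\<^esub> HasType \<alpha> (IdT (IdT A a b) p q)\<rbrakk> \<Longrightarrow>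
          \<Gamma> \<turnstile>\<^bsub>S\<^esub> EqTerm p q (IdT A a b)"
    and reflection_refl: "\<lbrakk>\<Gamma> \<turnstile>\<^bsub>S\<^esub> HasType p (IdT A a b); \<Gamma> \<turnstile>\<^bsub>S\<^esub> HasType q (IdT A a b);
            \<Gamma> \<turnstile>\<^bsub>S\<^esub> HasType \<alpha> (IdT (IdT A a b) p q)\<rbrakk> \<Longrightarrow>
          \<Gamma> \<turnstile>\<^bsub>S\<^esub> EqTerm \<alpha> (Refl (IdT A a b) p) (IdT (IdT A a b) p q)"

text \<open>Elements of a telescope \<open>\<Delta>\<close> over \<open>\<Gamma>\<close>; a closed context is such a telescope over any \<open>\<Gamma>\<close>.\<close>

fun elems :: "'c type_theory \<Rightarrow> 'c ctx \<Rightarrow> 'c ctx \<Rightarrow> 'c expr list \<Rightarrow> bool" where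
  "elems S \<Gamma> [] [] \<longleftrightarrow> True"
| "elems S \<Gamma> (A # \<Delta>) (a # \<delta>) \<longleftrightarrow> elems S \<Gamma> \<Delta> \<delta> \<and> \<Gamma> \<turnstile>\<^bsub>S\<^esub> HasType a (subst (inst 0 \<delta>) A)"
| "elems S \<Gamma> _ _ \<longleftrightarrow> False"

fun elems_eq :: "'c type_theory \<Rightarrow> 'c ctx \<Rightarrow> 'c ctx \<Rightarrow> 'c expr list \<Rightarrow> 'c expr list \<Rightarrow> bool" where
  "elems_eq S \<Gamma> [] [] [] \<longleftrightarrow> True"
| "elems_eq S \<Gamma> (A # \<Delta>) (a # \<delta>) (a' # \<delta>') \<longleftrightarrow>
     elems_eq S \<Gamma> \<Delta> \<delta> \<delta>' \<and> \<Gamma> \<turnstile>\<^bsub>S\<^esub> EqTerm a a' (subst (inst 0 \<delta>) A)"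
| "elems_eq S \<Gamma> _ _ _ \<longleftrightarrow> False"


section \<open>Identity contexts\<close>

text \<open>Elimination of a single identity type into a telescope \<open>\<Theta>\<close> over \<open>x, y, p, \<Delta>\<close>.\<close>

primrec J_tele :: "'c expr \<Rightarrow> 'c ctx \<Rightarrow> 'c ctx \<Rightarrow> 'c expr list \<Rightarrow> 'c expr list" where
  "J_tele A \<Delta> [] d = []"
| "J_tele A \<Delta> (D # \<Lambda>) d =
    (let j = J_tele A \<Delta> \<Lambda> (tl d) in J_gen A \<Delta> (subst (inst 0 j) D) (hd d) # j)"

text \<open>The element \<open>r(x)\<close> in context \<open>x : \<Phi>\<close>.\<close>

primrec refl_ctx :: "'c ctx \<Rightarrow> 'c expr list" where
  "refl_ctx [] = []"
| "refl_ctx (D # \<Lambda>) = Refl (shift 1 D) (Var 0) # map (shift 1) (refl_ctx \<Lambda>)"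

text \<open>
  \<open>J_ctx \<Phi> \<Delta> \<Theta> d\<close> eliminates \<open>Id\<^sub>\<Phi>\<close> with post-context \<open>\<Delta>\<close> into the telescope \<open>\<Theta>\<close>.  The result lives in
  the generic context \<open>x : \<Phi>, x' : \<Phi>, p : Id\<^sub>\<Phi>(x, x'), \<Delta>\<close> over the ambient one.
  \<open>transport \<Lambda> \<Upsilon>\<close> is \<open>p\<^sup>*(z)\<close> in the generic context \<open>x : \<Lambda>, x' : \<Lambda>, p : Id\<^sub>\<Lambda>(x, x'), z : \<Upsilon>(x')\<close>.

  In the step for \<open>\<Phi> = (x : \<Lambda>, y : D(x))\<close>, \<open>diag_y\<close> is the substitution
  \<open>(x, y), (x, y'), (r(x), q)\<close> for the generic \<open>(x, y), (x', y'), (p, q)\<close>, and \<open>Q\<close> is the type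
  \<open>Id\<^sub>D\<^sub>(\<^sub>x\<^sub>)(y, p\<^sup>*y')\<close>.  The renaming \<open>\<pi>\<close> takes the order \<open>x, y, x', y', p, q\<close> of the variables
  of the generic context to the order \<open>x, x', p, y, y', q\<close> in which \<open>y, y', q\<close> are a
  post-context for \<open>Id\<^sub>\<Lambda>\<close>, and \<open>\<pi>'\<close> is its inverse.
\<close>

fun J_ctx :: "'c ctx \<Rightarrow> 'c ctx \<Rightarrow> 'c ctx \<Rightarrow> 'c expr list \<Rightarrow> 'c expr list"
  and transport :: "'c ctx \<Rightarrow> 'c ctx \<Rightarrow> 'c expr list" where
  "J_ctx [] \<Delta> \<Theta> d = d"
| "J_ctx (D # \<Lambda>) \<Delta> \<Theta> d =
    (let n = length \<Lambda>; m = length \<Delta>;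
         diag_y = (\<lambda>i. if i = 0 then Var 0
                       else if i \<le> n then shift 3 (refl_ctx \<Lambda> ! (i - 1))
                       else if i = n + 1 then Var 1
                       else if i \<le> 2 * n + 1 then Var (i - n + 1)
                       else Var (i - 2 * n));
         d' = J_tele D (subst_tele diag_y \<Delta>) (subst_tele (lift_sub m diag_y) \<Theta>) d;
         Q = IdT (shift (2 * n + 2) D) (Var 1)
               (rename (\<lambda>i. if i = 0 then 0 else i + 1) (hd (transport \<Lambda> [D])));
         post = [Q, rename (\<lambda>i. if i < n then i + n + 1 else i + 2 * n + 1) D, shift (2 * n) D];
         \<pi> = (\<lambda>i. if i = 0 then 0
                  else if i \<le> n then i + 2
                  else if i = n + 1 then 1
                  else if i \<le> 2 * n + 1 then i + 1
                  else if i = 2 * n + 2 then 2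
                  else i);
         \<pi>' = (\<lambda>i. if i = 0 then 0
                   else if i = 1 then n + 1
                   else if i = 2 then 2 * n + 2
                   else if i \<le> n + 2 then i - 2
                   else if i \<le> 2 * n + 2 then i - 1
                   else i)
     in map (rename (lift_ren m \<pi>'))
          (J_ctx \<Lambda> (subst_tele (\<lambda>i. Var (\<pi> i)) \<Delta> @ post)
                   (subst_tele (lift_sub m (\<lambda>i. Var (\<pi> i))) \<Theta>) d'))"
| "transport \<Lambda> \<Upsilon> =
    (let n = length \<Lambda>; m = length \<Upsilon>
     in J_ctx \<Lambda> (subst_tele (\<lambda>i. Var (if i < n then i + n else i + 2 * n)) \<Upsilon>)
          (shift_tele (m + 2 * n) \<Upsilon>) (vars m))"

text \<open>
  \<open>Id_ctx \<Phi>\<close> is \<open>Id\<^sub>\<Phi>(x, x')\<close> as a telescope over \<open>x : \<Phi>, x' : \<Phi>\<close>.  In the step, the telescope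
  \<open>p : Id\<^sub>\<Lambda>(x, x')\<close> is moved to the context \<open>x, y, x', y'\<close>, and \<open>p\<^sup>*(z)\<close> from the context
  \<open>x, x', p, z\<close> to \<open>x, y, x', y', p\<close> with \<open>y'\<close> for \<open>z\<close>.
\<close>

primrec Id_ctx :: "'c ctx \<Rightarrow> 'c ctx" where
  "Id_ctx [] = []"
| "Id_ctx (D # \<Lambda>) =
    (let n = length \<Lambda>
     in IdT (shift (2 * n + 2) D) (Var (2 * n + 1))
          (rename (\<lambda>i. if i = 0 then n else if i \<le> n then i - 1 else if i \<le> 2 * n then i else i + 1)
            (hd (transport \<Lambda> [D])))
        # subst_tele (\<lambda>i. Var (if i < n then i + 1 else i + 2)) (Id_ctx \<Lambda>))"

text \<open>
  From here on contexts are closed; \<open>Id_at \<Delta> f g\<close> is \<open>Id\<^sub>\<Delta>(f, g)\<close>.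
\<close>

definition Id_at :: "'c ctx \<Rightarrow> 'c expr list \<Rightarrow> 'c expr list \<Rightarrow> 'c ctx" where
  "Id_at \<Delta> f g = subst_tele (inst 0 (g @ f)) (Id_ctx \<Delta>)"

definition compose :: "'c expr list \<Rightarrow> 'c expr list \<Rightarrow> 'c expr list" where
  "compose g f = map (subst (inst 0 f)) g"

text \<open>
  \<open>q \<circ> p\<close> in context \<open>x, y, z, q : Id(y, z), p : Id(x, y)\<close>: elimination on \<open>q\<close> in the ambient context
  \<open>x : \<Delta>\<close> with post-context \<open>p : Id(x, y)\<close>.
\<close>

definition path_comp_gen :: "'c ctx \<Rightarrow> 'c expr list" where
  "path_comp_gen \<Delta> =
    (let n = length \<Delta>
     in J_ctx (shift_tele n \<Delta>) (shift_tele (2 * n) (Id_ctx \<Delta>))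
          (subst_tele (\<lambda>i. Var (if i < n then i + 2 * n else i + 3 * n)) (Id_ctx \<Delta>)) (vars n))"

definition path_comp ::
    "'c ctx \<Rightarrow> 'c expr list \<Rightarrow> 'c expr list \<Rightarrow> 'c expr list \<Rightarrow> 'c expr list \<Rightarrow> 'c expr list \<Rightarrow> 'c expr list" where
  "path_comp \<Delta> f g h q p = compose (path_comp_gen \<Delta>) (p @ q @ h @ g @ f)"

text \<open>\<open>h\<^sup>\<bullet>(p)\<close> for \<open>h : \<Delta> \<rightarrow> \<Theta>\<close>, in context \<open>x : \<Delta>, y : \<Delta>, p : Id\<^sub>\<Delta>(x, y)\<close>.\<close>

definition path_map_gen :: "'c ctx \<Rightarrow> 'c ctx \<Rightarrow> 'c expr list \<Rightarrow> 'c expr list" where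
  "path_map_gen \<Delta> \<Theta> h =
    (let n = length \<Delta>
     in J_ctx \<Delta> [] (Id_at \<Theta> (map (shift (2 * n)) h) (map (shift n) h)) (compose (refl_ctx \<Theta>) h))"

definition path_map ::
    "'c ctx \<Rightarrow> 'c ctx \<Rightarrow> 'c expr list \<Rightarrow> 'c expr list \<Rightarrow> 'c expr list \<Rightarrow> 'c expr list \<Rightarrow> 'c expr list" where
  "path_map \<Delta> \<Theta> h f g p = compose (path_map_gen \<Delta> \<Theta> h) (p @ g @ f)"


section \<open>The 2-category of contexts\<close>

text \<open>
  Objects and cells are equivalence classes of judgements modulo definitional equality.  A judgement
  \<open>x : \<Gamma> \<turnstile> f(x) : \<Delta>\<close> is represented by \<open>(\<Gamma>, \<Delta>, f)\<close>, and a judgement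
  \<open>x : \<Gamma> \<turnstile> \<alpha>(x) : Id\<^sub>\<Delta>(f x, g x)\<close> by \<open>(\<Gamma>, \<Delta>, f, g, \<alpha>)\<close>.
\<close>

type_synonym 'c mor = "'c ctx \<times> 'c ctx \<times> 'c expr list"
type_synonym 'c cell = "'c ctx \<times> 'c ctx \<times> 'c expr list \<times> 'c expr list \<times> 'c expr list"

definition ctx_rel :: "'c type_theory \<Rightarrow> 'c ctx rel" where
  "ctx_rel S = {(\<Gamma>, \<Gamma>'). ctxt_eq S \<Gamma> \<Gamma>'}"

definition mors :: "'c type_theory \<Rightarrow> 'c mor set" where
  "mors S = {(\<Gamma>, \<Delta>, f). ctxt S \<Gamma> \<and> ctxt S \<Delta> \<and> elems S \<Gamma> \<Delta> f}"

definition mor_rel :: "'c type_theory \<Rightarrow> 'c mor rel" where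
  "mor_rel S = {((\<Gamma>, \<Delta>, f), (\<Gamma>', \<Delta>', f')).
     ctxt_eq S \<Gamma> \<Gamma>' \<and> ctxt_eq S \<Delta> \<Delta>' \<and> elems_eq S \<Gamma> \<Delta> f f'}"

definition cells :: "'c type_theory \<Rightarrow> 'c cell set" where
  "cells S = {(\<Gamma>, \<Delta>, f, g, \<alpha>).
     (\<Gamma>, \<Delta>, f) \<in> mors S \<and> (\<Gamma>, \<Delta>, g) \<in> mors S \<and> elems S \<Gamma> (Id_at \<Delta> f g) \<alpha>}"

definition cell_rel :: "'c type_theory \<Rightarrow> 'c cell rel" where
  "cell_rel S = {((\<Gamma>, \<Delta>, f, g, \<alpha>), (\<Gamma>', \<Delta>', f', g', \<alpha>')).
     ((\<Gamma>, \<Delta>, f), (\<Gamma>', \<Delta>', f')) \<in> mor_rel S \<and> ((\<Gamma>, \<Delta>, g), (\<Gamma>', \<Delta>', g')) \<in> mor_rel S \<and>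
     elems_eq S \<Gamma> (Id_at \<Delta> f g) \<alpha> \<alpha>'}"

definition Ctx :: "'c type_theory \<Rightarrow> ('c ctx set, 'c mor set, 'c cell set) cat2" where
  "Ctx S =
    \<lparr>Obj = {\<Gamma>. ctxt S \<Gamma>} // ctx_rel S,
     Arr = mors S // mor_rel S,
     Dom = (\<lambda>F. \<Union>(\<Gamma>, \<Delta>, f) \<in> F. ctx_rel S `` {\<Gamma>}),
     Cod = (\<lambda>F. \<Union>(\<Gamma>, \<Delta>, f) \<in> F. ctx_rel S `` {\<Delta>}),
     Ident = (\<lambda>X. \<Union>\<Gamma> \<in> X. mor_rel S `` {(\<Gamma>, \<Gamma>, vars (length \<Gamma>))}),
     Comp = (\<lambda>G F. \<Union>(\<Delta>', \<Theta>, g) \<in> G. \<Union>(\<Gamma>, \<Delta>, f) \<in> F. mor_rel S `` {(\<Gamma>, \<Theta>, compose g f)}),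
     Cell = cells S // cell_rel S,
     Src = (\<lambda>A. \<Union>(\<Gamma>, \<Delta>, f, g, \<alpha>) \<in> A. mor_rel S `` {(\<Gamma>, \<Delta>, f)}),
     Trg = (\<lambda>A. \<Union>(\<Gamma>, \<Delta>, f, g, \<alpha>) \<in> A. mor_rel S `` {(\<Gamma>, \<Delta>, g)}),
     VId = (\<lambda>F. \<Union>(\<Gamma>, \<Delta>, f) \<in> F. cell_rel S `` {(\<Gamma>, \<Delta>, f, f, compose (refl_ctx \<Delta>) f)}),
     VComp = (\<lambda>B A. \<Union>(\<Gamma>', \<Delta>', g', h, \<beta>) \<in> B. \<Union>(\<Gamma>, \<Delta>, f, g, \<alpha>) \<in> A.
               cell_rel S `` {(\<Gamma>, \<Delta>, f, h, path_comp \<Delta> f g h \<beta> \<alpha>)}),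
     WhL = (\<lambda>H A. \<Union>(\<Delta>', \<Theta>, h) \<in> H. \<Union>(\<Gamma>, \<Delta>, f, g, \<alpha>) \<in> A.
               cell_rel S `` {(\<Gamma>, \<Theta>, compose h f, compose h g, path_map \<Delta> \<Theta> h f g \<alpha>)}),
     WhR = (\<lambda>A K. \<Union>(\<Gamma>, \<Delta>, f, g, \<alpha>) \<in> A. \<Union>(\<Xi>, \<Gamma>', k) \<in> K.
               cell_rel S `` {(\<Xi>, \<Delta>, compose f k, compose g k, compose \<alpha> k)})\<rparr>"


section \<open>The 2-category of types-in-context\<close>

type_synonym 'c tobj = "'c ctx \<times> 'c expr"
type_synonym 'c tmor = "'c tobj \<times> 'c tobj \<times> 'c expr list \<times> 'c expr"
type_synonym 'c tcell = "'c tmor set \<times> 'c tmor set \<times> 'c cell set \<times> 'c cell set"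

definition tobjs :: "'c type_theory \<Rightarrow> 'c tobj set" where
  "tobjs S = {(\<Gamma>, A). ctxt S \<Gamma> \<and> \<Gamma> \<turnstile>\<^bsub>S\<^esub> IsType A}"

definition tobj_rel :: "'c type_theory \<Rightarrow> 'c tobj rel" where
  "tobj_rel S = {((\<Gamma>, A), (\<Gamma>', A')). ctxt_eq S \<Gamma> \<Gamma>' \<and> \<Gamma> \<turnstile>\<^bsub>S\<^esub> EqType A A'}"

text \<open>\<open>((\<Gamma>, A), (\<Delta>, B), f, g)\<close> represents the 1-cell \<open>(f, g) : (\<Gamma>, A) \<rightarrow> (\<Delta>, B)\<close>.\<close>

definition tmors :: "'c type_theory \<Rightarrow> 'c tmor set" where
  "tmors S = {((\<Gamma>, A), (\<Delta>, B), f, g).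
     (\<Gamma>, A) \<in> tobjs S \<and> (\<Delta>, B) \<in> tobjs S \<and> elems S \<Gamma> \<Delta> f \<and>
     A # \<Gamma> \<turnstile>\<^bsub>S\<^esub> HasType g (shift 1 (subst (inst 0 f) B))}"

definition tmor_rel :: "'c type_theory \<Rightarrow> 'c tmor rel" where
  "tmor_rel S = {((X, (\<Delta>, B), f, g), (X', Y', f', g')).
     (X, X') \<in> tobj_rel S \<and> ((\<Delta>, B), Y') \<in> tobj_rel S \<and> elems_eq S (fst X) \<Delta> f f' \<and>
     snd X # fst X \<turnstile>\<^bsub>S\<^esub> EqTerm g g' (shift 1 (subst (inst 0 f) B))}"

definition base_obj :: "'c type_theory \<Rightarrow> 'c tobj set \<Rightarrow> 'c ctx set" where
  "base_obj S X = (\<Union>(\<Gamma>, A) \<in> X. ctx_rel S `` {\<Gamma>})"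

definition base_mor :: "'c type_theory \<Rightarrow> 'c tmor set \<Rightarrow> 'c mor set" where
  "base_mor S F = (\<Union>((\<Gamma>, A), (\<Delta>, B), f, g) \<in> F. mor_rel S `` {(\<Gamma>, \<Delta>, f)})"

definition base_cell :: "'c tcell \<Rightarrow> 'c cell set" where
  "base_cell = (\<lambda>(F, F', \<gamma>, \<alpha>). \<alpha>)"

text \<open>The 1-cells \<open>\<pi>\<^sub>A : \<Gamma>.A \<rightarrow> \<Gamma>\<close> and \<open>f.g : \<Gamma>.A \<rightarrow> \<Delta>.B\<close>.\<close>

definition proj :: "'c type_theory \<Rightarrow> 'c tobj set \<Rightarrow> 'c mor set" where
  "proj S X = (\<Union>(\<Gamma>, A) \<in> X. mor_rel S `` {(A # \<Gamma>, \<Gamma>, map (shift 1) (vars (length \<Gamma>)))})"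

definition ext_mor :: "'c type_theory \<Rightarrow> 'c tmor set \<Rightarrow> 'c mor set" where
  "ext_mor S F = (\<Union>((\<Gamma>, A), (\<Delta>, B), f, g) \<in> F. mor_rel S `` {(A # \<Gamma>, B # \<Delta>, g # map (shift 1) f)})"

definition tdom :: "'c type_theory \<Rightarrow> 'c tmor set \<Rightarrow> 'c tobj set" where
  "tdom S F = (\<Union>(X, Y, f, g) \<in> F. tobj_rel S `` {X})"

definition tcod :: "'c type_theory \<Rightarrow> 'c tmor set \<Rightarrow> 'c tobj set" where
  "tcod S F = (\<Union>(X, Y, f, g) \<in> F. tobj_rel S `` {Y})"

definition tident :: "'c type_theory \<Rightarrow> 'c tobj set \<Rightarrow> 'c tmor set" where
  "tident S X = (\<Union>(\<Gamma>, A) \<in> X. tmor_rel S `` {((\<Gamma>, A), (\<Gamma>, A), vars (length \<Gamma>), Var 0)})"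

definition tcomp :: "'c type_theory \<Rightarrow> 'c tmor set \<Rightarrow> 'c tmor set \<Rightarrow> 'c tmor set" where
  "tcomp S G F = (\<Union>(Y', Z, f', g') \<in> G. \<Union>(X, Y, f, g) \<in> F.
     tmor_rel S `` {(X, Z, compose f' f, subst (inst 0 (g # map (shift 1) f)) g')})"

text \<open>
  A 2-cell is a pair \<open>(\<gamma>, \<alpha>)\<close> of 2-cells of \<open>Ctx S\<close>, together with its source and target.
\<close>

definition tcells :: "'c type_theory \<Rightarrow> 'c tcell set" where
  "tcells S = {(F, F', \<gamma>, \<alpha>).
     F \<in> tmors S // tmor_rel S \<and> F' \<in> tmors S // tmor_rel S \<and> tdom S F = tdom S F' \<and> tcod S F = tcod S F' \<and>
     \<gamma> \<in> Cell (Ctx S) \<and> Src (Ctx S) \<gamma> = ext_mor S F \<and> Trg (Ctx S) \<gamma> = ext_mor S F' \<and>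
     \<alpha> \<in> Cell (Ctx S) \<and> Src (Ctx S) \<alpha> = base_mor S F \<and> Trg (Ctx S) \<alpha> = base_mor S F' \<and>
     WhL (Ctx S) (proj S (tcod S F)) \<gamma> = WhR (Ctx S) \<alpha> (proj S (tdom S F))}"

definition Typ :: "'c type_theory \<Rightarrow> ('c tobj set, 'c tmor set, 'c tcell) cat2" where
  "Typ S =
    \<lparr>Obj = tobjs S // tobj_rel S,
     Arr = tmors S // tmor_rel S,
     Dom = tdom S,
     Cod = tcod S,
     Ident = tident S,
     Comp = tcomp S,
     Cell = tcells S,
     Src = (\<lambda>(F, F', \<gamma>, \<alpha>). F),
     Trg = (\<lambda>(F, F', \<gamma>, \<alpha>). F'),
     VId = (\<lambda>F. (F, F, VId (Ctx S) (ext_mor S F), VId (Ctx S) (base_mor S F))),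
     VComp = (\<lambda>(G, G', \<delta>, \<beta>) (F, F', \<gamma>, \<alpha>). (F, G', VComp (Ctx S) \<delta> \<gamma>, VComp (Ctx S) \<beta> \<alpha>)),
     WhL = (\<lambda>H (F, F', \<gamma>, \<alpha>).
       (tcomp S H F, tcomp S H F', WhL (Ctx S) (ext_mor S H) \<gamma>, WhL (Ctx S) (base_mor S H) \<alpha>)),
     WhR = (\<lambda>(F, F', \<gamma>, \<alpha>) K.
       (tcomp S F K, tcomp S F' K, WhR (Ctx S) \<gamma> (ext_mor S K), WhR (Ctx S) \<alpha> (base_mor S K)))\<rparr>"

text \<open>The chosen cartesian lift \<open>(f, \<iota>) : (\<Gamma>, f\<^sup>*B) \<rightarrow> (\<Delta>, B)\<close> of \<open>f : \<Gamma> \<rightarrow> \<Delta>\<close>.\<close>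

definition chosen_lift :: "'c type_theory \<Rightarrow> 'c mor set \<Rightarrow> 'c tobj set \<Rightarrow> 'c tmor set" where
  "chosen_lift S F Y = (\<Union>(\<Gamma>, \<Delta>', f) \<in> F. \<Union>(\<Delta>, B) \<in> Y.
     tmor_rel S `` {((\<Gamma>, subst (inst 0 f) B), (\<Delta>, B), f, Var 0)})"

end

theory Submission
  imports Defs
begin

text \<open>
  Parallel elements of an identity context which agree on the diagonal are definitionally equal:
  elimination produces an element of their identity type, which discreteness reflects.  Hence each law
  of the 2-category of contexts, and each equation between transports and images of paths, only has to
  be checked at reflexivities.

  In particular all 2-cells are invertible.  So every 2-cell of the 2-category of types-in-context is
  cartesian, whiskering trivially preserves cartesian 2-cells, and local liftings merely have to exist;
  transport along a path provides them.  After composition with inverses of such liftings, the condition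
  on cartesian 1-cells concerns only 2-cells over identities.  For the lift of \<open>f\<close> these are, on
  both sides, paths in the same fibre \<open>B(f k)\<close>.  The underlying fibration is split because substitution is
  strictly functorial.
\<close>

section \<open>Substitution\<close>

text \<open>Contexts, morphisms and cells are classes modulo definitional equality, so each
  operation must respect that equality besides being well typed. Both are obtained at once: most
  typing statements are binary, about two equal inputs, and typing is the diagonal case. The
  delicate point is elimination for identity contexts. The last type of
  \<open>Id_ctx (D # \<Lambda>)\<close> mentions a transport, itself an elimination over
  \<open>\<Lambda>\<close>. The generic context of a longer context can be formed only after typing,
  congruence and computation are known for the shorter one, so all three pass through one induction
  on length. A second obstacle is the fixed order of de Bruijn variables: the generic path of
  \<open>D # \<Lambda>\<close> lists x, y, x', y', p, q, whereas elimination over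
  \<open>\<Lambda>\<close> needs x, x', p before y, y', q. Explicit renamings exchange the two
  orders, and the type of every block has to be followed along them. Substitutions are total
  functions on indices, hence equations between instances often hold only on the variables in scope;
  scoping facts remove the rest.\<close>

lemma shift_eq_subst: "shift n e = subst (\<lambda>i. Var (i + n)) e"
  and rename_eq_subst: "rename \<rho> e = subst (\<lambda>i. Var (\<rho> i)) e"
proof -
  have *: "rename \<rho> e = subst (\<lambda>i. Var (\<rho> i)) e" for \<rho> e
  proof (induction e arbitrary: \<rho>)
    case (Op c args)
    have "(\<lambda>i. Var (lift_ren k \<rho> i)) = lift_sub k (\<lambda>i. Var (\<rho> i))" for k
      by (auto simp: lift_sub_def shift_def)
    then have "rename (lift_ren k \<rho>) a = subst (lift_sub k (\<lambda>i. Var (\<rho> i))) a" if "(k, a) \<in> set args" for k a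
      using Op[OF that, of a "lift_ren k \<rho>"] by (metis snds.intros snd_conv)
    then show ?case by (auto simp del: lift_ren.simps)
  qed simp
  show "rename \<rho> e = subst (\<lambda>i. Var (\<rho> i)) e" by (rule *)
  show "shift n e = subst (\<lambda>i. Var (i + n)) e" by (simp add: shift_def *)
qed

lemma shift_Var [simp]: "shift n (Var i) = Var (i + n)"
  by (simp add: shift_def)

lemma lift_sub_Var [simp]: "lift_sub k Var = Var"
  by (auto simp: lift_sub_def)

lemma lift_sub_0 [simp]: "lift_sub 0 \<sigma> = \<sigma>"
proof -
  have "rename (\<lambda>i. i) e = e" for e :: "'a expr"
  proof (induction e)
    case (Op c args)
    have "lift_ren k (\<lambda>i. i) = (\<lambda>i. i)" for k by auto
    then have "rename (lift_ren k (\<lambda>i. i)) a = a" if "(k, a) \<in> set args" for k a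
      using Op[OF that, of a] by (simp add: snds.simps del: lift_ren.simps)
    then show ?case by (auto intro!: map_idI simp del: lift_ren.simps)
  qed simp
  then show ?thesis by (auto simp: lift_sub_def shift_def)
qed

lemma subst_Var [simp]: "subst Var e = e"
  by (induction e) (auto intro!: map_idI simp: snds.simps)

lemma subst_VarI: "(\<And>i. \<sigma> i = Var i) \<Longrightarrow> subst \<sigma> e = e"
  using subst_Var[of e] by (metis ext)

text \<open>One direct induction cannot compute a composite of substitutions: under a binder the
  images are shifted, so the step already needs to know how substitutions interact with renamings.
  Renaming first is treated here, renaming last in \<open>ren_subst\<close>, and the general case
  \<open>subst_subst\<close> then follows by the same induction.\<close>

lemma subst_ren:
  fixes e :: "'c expr"
  shows "subst \<tau> (subst (\<lambda>i. Var (\<rho> i)) e) = subst (\<lambda>i. \<tau> (\<rho> i)) e"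
proof (induction e arbitrary: \<tau> \<rho>)
  case (Op c args)
  have 1: "lift_sub k (\<lambda>i. Var (\<rho> i)) = (\<lambda>i. Var (lift_ren k \<rho> i))" for k
    by (auto simp: lift_sub_def)
  have 2: "(\<lambda>i. lift_sub k \<tau> (lift_ren k \<rho> i)) = lift_sub k (\<lambda>i. \<tau> (\<rho> i))" for k
    by (auto simp: lift_sub_def)
  have 3: "subst (lift_sub k \<tau>) (subst (lift_sub k (\<lambda>i. Var (\<rho> i))) a) = subst (lift_sub k (\<lambda>i. \<tau> (\<rho> i))) a"
    if "(k, a) \<in> set args" for k a
    unfolding 1 using Op[OF that, of a "lift_sub k \<tau>" "lift_ren k \<rho>"] unfolding 2 by (simp add: snds.simps)
  show ?case by (auto simp: 3)
qed simp

lemma ren_subst: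
  fixes e :: "'c expr"
  shows "subst (\<lambda>i. Var (\<rho> i)) (subst \<sigma> e) = subst (\<lambda>i. subst (\<lambda>i. Var (\<rho> i)) (\<sigma> i)) e"
proof (induction e arbitrary: \<sigma> \<rho>)
  case (Op c args)
  have 1: "lift_sub k (\<lambda>i. Var (\<rho> i)) = (\<lambda>i. Var (lift_ren k \<rho> i))" for k
    by (auto simp: lift_sub_def)
  have 2: "(\<lambda>i. subst (\<lambda>i. Var (lift_ren k \<rho> i)) (lift_sub k \<sigma> i)) = lift_sub k (\<lambda>i. subst (\<lambda>i. Var (\<rho> i)) (\<sigma> i))" for k
    by (auto simp: lift_sub_def shift_eq_subst subst_ren)
  have 3: "subst (lift_sub k (\<lambda>i. Var (\<rho> i))) (subst (lift_sub k \<sigma>) a) = subst (lift_sub k (\<lambda>i. subst (\<lambda>i. Var (\<rho> i)) (\<sigma> i))) a"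
    if "(k, a) \<in> set args" for k a
    unfolding 1 using Op[OF that, of a "lift_ren k \<rho>" "lift_sub k \<sigma>"] unfolding 2 by (simp add: snds.simps)
  show ?case by (auto simp: 3)
qed simp

lemma subst_lift_lift: "subst (lift_sub k \<tau>) (lift_sub k \<sigma> i) = lift_sub k (\<lambda>i. subst \<tau> (\<sigma> i)) i"
  by (auto simp: lift_sub_def shift_eq_subst subst_ren ren_subst)

lemma subst_subst [simp]: "subst \<tau> (subst \<sigma> e) = subst (\<lambda>i. subst \<tau> (\<sigma> i)) e"
proof (induction e arbitrary: \<sigma> \<tau>)
  case (Op c args)
  have "subst (lift_sub k \<tau>) (subst (lift_sub k \<sigma>) a) = subst (lift_sub k (\<lambda>i. subst \<tau> (\<sigma> i))) a"
    if "(k, a) \<in> set args" for k a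
    using Op[OF that, of a "lift_sub k \<tau>" "lift_sub k \<sigma>"] by (simp add: snds.simps subst_lift_lift)
  then show ?case by auto
qed simp

lemma subst_shift [simp]: "subst \<sigma> (shift n e) = subst (\<lambda>i. \<sigma> (i + n)) e"
  by (simp add: shift_eq_subst)

lemma shift_subst [simp]: "shift n (subst \<sigma> e) = subst (\<lambda>i. shift n (\<sigma> i)) e"
  by (simp add: shift_eq_subst)

lemma shift_shift [simp]: "shift n (shift m e) = shift (m + n) e"
  by (simp add: shift_eq_subst ac_simps)

lemma lift_sub_lift_sub [simp]: "lift_sub j (lift_sub k \<sigma>) = lift_sub (j + k) \<sigma>"
  by (auto simp: lift_sub_def fun_eq_iff add.commute)

text \<open>Two functions on indices that describe the same morphism may differ out of scope; this
  is how such junk values are discarded.\<close>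

lemma subst_cong_scoped:
  "scoped n e \<Longrightarrow> (\<And>i. i < n \<Longrightarrow> \<sigma> i = \<tau> i) \<Longrightarrow> subst \<sigma> e = subst \<tau> e"
proof (induction e arbitrary: n \<sigma> \<tau>)
  case (Op c args)
  have "subst (lift_sub k \<sigma>) a = subst (lift_sub k \<tau>) a" if "(k, a) \<in> set args" for k a
  proof -
    have "scoped (n + k) a" using Op.prems that by auto
    moreover have "lift_sub k \<sigma> i = lift_sub k \<tau> i" if "i < n + k" for i
      using Op.prems(2) that by (auto simp: lift_sub_def)
    ultimately show ?thesis by (intro Op.IH[OF that, of a "n + k"]) (auto simp: snds.simps)
  qed
  then show ?case by auto
qed simp

section \<open>Substitution in telescopes\<close>

lemma subst_tele_length [simp]: "length (subst_tele \<sigma> \<Delta>) = length \<Delta>"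
  by (induction \<Delta>) auto

lemma shift_tele_length [simp]: "length (shift_tele n \<Delta>) = length \<Delta>"
  by (simp add: shift_tele_def)

lemma lift_sub_lift_comp: "(\<lambda>i. subst (lift_sub k \<tau>) (lift_sub k \<sigma> i)) = lift_sub k (\<lambda>i. subst \<tau> (\<sigma> i))"
  using subst_lift_lift by blast

lemma subst_tele_subst_tele [simp]: "subst_tele \<tau> (subst_tele \<sigma> \<Delta>) = subst_tele (\<lambda>i. subst \<tau> (\<sigma> i)) \<Delta>"
  by (induction \<Delta>) (auto simp: lift_sub_lift_comp)

lemma subst_tele_shift_tele [simp]: "subst_tele \<tau> (shift_tele n \<Delta>) = subst_tele (\<lambda>i. \<tau> (i + n)) \<Delta>"
  by (simp add: shift_tele_def)

lemma subst_tele_append [simp]: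
  "subst_tele \<sigma> (\<Delta> @ \<Delta>') = subst_tele (lift_sub (length \<Delta>') \<sigma>) \<Delta> @ subst_tele \<sigma> \<Delta>'"
  by (induction \<Delta>) auto

lemma subst_tele_Var [simp]: "subst_tele Var \<Delta> = \<Delta>"
  by (induction \<Delta>) auto

text \<open>The number counts the ambient variables below the telescope, so
  \<open>scoped_tele 0\<close> characterises closed contexts.\<close>

primrec scoped_tele :: "nat \<Rightarrow> 'c ctx \<Rightarrow> bool" where
  "scoped_tele k [] \<longleftrightarrow> True"
| "scoped_tele k (A # \<Delta>) \<longleftrightarrow> scoped (k + length \<Delta>) A \<and> scoped_tele k \<Delta>"

lemma subst_tele_cong_scoped:
  assumes "scoped_tele k \<Delta>" and eq: "\<And>i. i < k \<Longrightarrow> \<sigma> i = \<tau> i"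
  shows "subst_tele \<sigma> \<Delta> = subst_tele \<tau> \<Delta>"
  using assms(1)
proof (induction \<Delta>)
  case (Cons A \<Delta>)
  have "lift_sub (length \<Delta>) \<sigma> i = lift_sub (length \<Delta>) \<tau> i" if "i < k + length \<Delta>" for i
    using that eq by (auto simp: lift_sub_def)
  then have "subst (lift_sub (length \<Delta>) \<sigma>) A = subst (lift_sub (length \<Delta>) \<tau>) A"
    using Cons.prems by (intro subst_cong_scoped[of "k + length \<Delta>"]) auto
  then show ?case using Cons by auto
qed simp

lemma subst_tele_closed: "scoped_tele 0 \<Delta> \<Longrightarrow> subst_tele \<sigma> \<Delta> = \<Delta>"
  using subst_tele_cong_scoped[of 0 \<Delta> \<sigma> Var] by simp

lemma vars_length [simp]: "length (vars n) = n"
  by (simp add: vars_def)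

lemma vars_nth [simp]: "i < n \<Longrightarrow> vars n ! i = Var i"
  by (simp add: vars_def)

section \<open>Derivability under simultaneous substitution\<close>

text \<open>
  Definitional equality of context morphisms \<open>\<Gamma> \<rightarrow> \<Delta>\<close>.  Only the values of \<open>\<sigma>\<close> and \<open>\<tau>\<close> at indices below
  \<open>length \<Delta>\<close> matter; contexts are scoped, so the other values never enter a judgement.
\<close>

primrec sub_eq :: "'c type_theory \<Rightarrow> 'c ctx \<Rightarrow> 'c ctx \<Rightarrow> (nat \<Rightarrow> 'c expr) \<Rightarrow> (nat \<Rightarrow> 'c expr) \<Rightarrow> bool" where
  "sub_eq S \<Gamma> [] \<sigma> \<tau> \<longleftrightarrow> ctxt S \<Gamma>"
| "sub_eq S \<Gamma> (A # \<Delta>) \<sigma> \<tau> \<longleftrightarrow>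
     sub_eq S \<Gamma> \<Delta> (\<lambda>i. \<sigma> (Suc i)) (\<lambda>i. \<tau> (Suc i)) \<and> \<Delta> \<turnstile>\<^bsub>S\<^esub> IsType A \<and> \<Gamma> \<turnstile>\<^bsub>S\<^esub> EqTerm (\<sigma> 0) (\<tau> 0) (subst (\<lambda>i. \<sigma> (Suc i)) A)"

abbreviation sub :: "'c type_theory \<Rightarrow> 'c ctx \<Rightarrow> 'c ctx \<Rightarrow> (nat \<Rightarrow> 'c expr) \<Rightarrow> bool" where
  "sub S \<Gamma> \<Delta> \<sigma> \<equiv> sub_eq S \<Gamma> \<Delta> \<sigma> \<sigma>"

lemma ctxt_appendD: "ctxt S (\<Delta> @ \<Gamma>) \<Longrightarrow> ctxt S \<Gamma>"
  by (induction \<Delta>) auto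

lemma ctxt_eq_lengthD: "ctxt_eq S \<Gamma> \<Gamma>' \<Longrightarrow> length \<Gamma> = length \<Gamma>'"
  by (induction S \<Gamma> \<Gamma>' rule: ctxt_eq.induct) auto

lemma ctxt_eq_Cons_iff: "ctxt_eq S (A # \<Gamma>) \<Gamma>'' \<longleftrightarrow> (\<exists>A' \<Gamma>'. \<Gamma>'' = A' # \<Gamma>' \<and> ctxt_eq S \<Gamma> \<Gamma>' \<and> \<Gamma> \<turnstile>\<^bsub>S\<^esub> EqType A A')"
  by (cases \<Gamma>'') auto

lemma ctxt_eq_Nil_iff [simp]: "ctxt_eq S [] \<Gamma>' \<longleftrightarrow> \<Gamma>' = []" "ctxt_eq S \<Gamma>' [] \<longleftrightarrow> \<Gamma>' = []"
  by (cases \<Gamma>'; simp)+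

lemma lift_sub_Suc_Suc: "lift_sub (Suc k) \<sigma> (Suc i) = shift 1 (lift_sub k \<sigma> i)"
  by (auto simp: lift_sub_def)

lemma lift_sub_Suc_0 [simp]: "lift_sub (Suc k) \<sigma> 0 = Var 0"
  by (auto simp: lift_sub_def)

section \<open>Simultaneous substitution derived from the structural rules\<close>

context dependent_type_theory
begin

lemma sub_eq_ctxt: "sub_eq S \<Gamma> \<Delta> \<sigma> \<tau> \<Longrightarrow> ctxt S \<Gamma> \<and> ctxt S \<Delta>"
  by (induction \<Delta> arbitrary: \<sigma> \<tau>) auto

lemma ctxt_eq_ctxt1: "ctxt_eq S \<Gamma> \<Gamma>' \<Longrightarrow> ctxt S \<Gamma>"
  by (induction \<Gamma> arbitrary: \<Gamma>') (auto simp: ctxt_eq_Cons_iff dest: eq_type_presup)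

lemma is_type_scoped: "\<Gamma> \<turnstile>\<^bsub>S\<^esub> IsType A \<Longrightarrow> scoped (length \<Gamma>) A"
  using in_scope[of \<Gamma> "IsType A" A] by simp

lemma has_type_scoped: "\<Gamma> \<turnstile>\<^bsub>S\<^esub> HasType a A \<Longrightarrow> scoped (length \<Gamma>) a \<and> scoped (length \<Gamma>) A"
  using in_scope[of \<Gamma> "HasType a A"] by simp

lemma ctxt_scoped_tele: "ctxt S (\<Delta> @ \<Gamma>) \<Longrightarrow> scoped_tele (length \<Gamma>) \<Delta>"
  by (induction \<Delta>) (auto dest: is_type_scoped simp: add.commute)

lemma judgement_closed: "(\<Gamma>, \<J>) \<in> S \<Longrightarrow> (\<And>i. i < length \<Gamma> \<Longrightarrow> \<sigma> i = \<tau> i) \<Longrightarrow> subst_judgement \<sigma> \<J> = subst_judgement \<tau> \<J>"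
  by (rule judgement.map_cong0) (use in_scope subst_cong_scoped in blast)

lemma subst_judgement_comp: "subst_judgement \<tau> (subst_judgement \<sigma> \<J>) = subst_judgement (\<lambda>i. subst \<tau> (\<sigma> i)) \<J>"
  by (simp add: judgement.map_comp comp_def)

lemma subst_judgement_Var [simp]: "subst_judgement Var \<J> = \<J>"
  by (cases \<J>) auto

text \<open>The renaming caused by weakening beneath \<open>\<Theta>\<close> only moves indices
  outside \<open>\<Theta>\<close>, and none of those occur in a closed judgement. This is the base
  case of simultaneous substitution.\<close>

lemma weaken_closed:
  assumes "\<Theta> \<turnstile>\<^bsub>S\<^esub> \<J>" and "ctxt S \<Gamma>"
  shows "\<Theta> @ \<Gamma> \<turnstile>\<^bsub>S\<^esub> \<J>"
  using assms(2)
proof (induction \<Gamma>)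
  case Nil
  then show ?case using assms by simp
next
  case (Cons A \<Gamma>)
  then have *: "\<Theta> @ \<Gamma> \<turnstile>\<^bsub>S\<^esub> \<J>" by simp
  from weakening[OF this] Cons.prems
  have "subst_tele (\<lambda>i. Var (i + 1)) \<Theta> @ A # \<Gamma> \<turnstile>\<^bsub>S\<^esub> subst_judgement (lift_sub (length \<Theta>) (\<lambda>i. Var (i + 1))) \<J>"
    by simp
  moreover have "ctxt S \<Theta>" using assms(1) in_context by blast
  then have "scoped_tele 0 \<Theta>" using ctxt_scoped_tele[of \<Theta> "[]"] by simp
  then have "subst_tele (\<lambda>i. Var (i + 1)) \<Theta> = \<Theta>" by (rule subst_tele_closed)
  moreover have "subst_judgement (lift_sub (length \<Theta>) (\<lambda>i. Var (i + 1))) \<J> = subst_judgement Var \<J>"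
    using assms(1) by (rule judgement_closed) (simp add: lift_sub_def)
  ultimately show ?case by simp
qed

text \<open>A simultaneous substitution is the substitution for all variables but the last, followed
  by the one-variable substitution of \<open>\<sigma> 0\<close>. The rules of the theory substitute
  one variable at a time, and this identity lets them be iterated.\<close>

lemma inst_lift_comp: "(\<lambda>i. subst (lift_sub m (inst 0 [\<sigma> 0])) (lift_sub (Suc m) (\<lambda>i. \<sigma> (Suc i)) i)) = lift_sub m \<sigma>"
proof -
  have "(\<lambda>i. subst (inst 0 [\<sigma> 0]) (lift_sub 1 (\<lambda>i. \<sigma> (Suc i)) i)) = \<sigma>"
    by (auto simp: lift_sub_def inst_def intro!: subst_VarI)
  then have "(\<lambda>i. subst (lift_sub m (inst 0 [\<sigma> 0])) (lift_sub m (lift_sub 1 (\<lambda>i. \<sigma> (Suc i))) i)) = lift_sub m \<sigma>"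
    by (simp only: lift_sub_lift_comp)
  then show ?thesis by simp
qed

text \<open>Induction on the codomain \<open>\<Delta>\<close>. Its last type is moved into the
  telescope, so that the hypothesis substitutes for the remaining variables underneath it, and the
  one-variable rule then removes it. This is why a telescope is part of the statement.\<close>

lemma subst_under:
  assumes "sub S \<Gamma> \<Delta> \<sigma>" and "\<Theta> @ \<Delta> \<turnstile>\<^bsub>S\<^esub> \<J>"
  shows "subst_tele \<sigma> \<Theta> @ \<Gamma> \<turnstile>\<^bsub>S\<^esub> subst_judgement (lift_sub (length \<Theta>) \<sigma>) \<J>"
  using assms
proof (induction \<Delta> arbitrary: \<Theta> \<sigma>)
  case Nil
  have "ctxt S \<Theta>" using Nil(2) in_context by force
  then have "scoped_tele 0 \<Theta>" using ctxt_scoped_tele[of \<Theta> "[]"] by simp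
  then have "subst_tele \<sigma> \<Theta> = \<Theta>" by (rule subst_tele_closed)
  moreover have "subst_judgement (lift_sub (length \<Theta>) \<sigma>) \<J> = subst_judgement Var \<J>"
    using Nil(2) by (intro judgement_closed[of \<Theta>]) (auto simp add: lift_sub_def)
  ultimately show ?case using weaken_closed Nil by simp
next
  case (Cons A \<Delta>)
  from Cons.prems(1) have 1: "sub S \<Gamma> \<Delta> (\<lambda>i. \<sigma> (Suc i))" and 2: "\<Gamma> \<turnstile>\<^bsub>S\<^esub> HasType (\<sigma> 0) (subst (\<lambda>i. \<sigma> (Suc i)) A)"
    using eq_term_presup by auto
  have "(\<Theta> @ [A]) @ \<Delta> \<turnstile>\<^bsub>S\<^esub> \<J>" using Cons.prems(2) by simp
  from Cons.IH[OF 1 this]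
  have "subst_tele (lift_sub 1 (\<lambda>i. \<sigma> (Suc i))) \<Theta> @ subst (\<lambda>i. \<sigma> (Suc i)) A # \<Gamma> \<turnstile>\<^bsub>S\<^esub> subst_judgement (lift_sub (Suc (length \<Theta>)) (\<lambda>i. \<sigma> (Suc i))) \<J>"
    by simp
  from substitution[OF this 2] show ?case
    using inst_lift_comp[of 0 \<sigma>] by (simp add: subst_judgement_comp inst_lift_comp)
qed

lemma subst_sub: "sub S \<Gamma> \<Delta> \<sigma> \<Longrightarrow> \<Delta> \<turnstile>\<^bsub>S\<^esub> \<J> \<Longrightarrow> \<Gamma> \<turnstile>\<^bsub>S\<^esub> subst_judgement \<sigma> \<J>"
  using subst_under[of \<Gamma> \<Delta> \<sigma> "[]"] by simp

lemma sub_eq_weaken: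
  assumes "sub_eq S \<Gamma> \<Delta> \<sigma> \<tau>" "\<Gamma> \<turnstile>\<^bsub>S\<^esub> IsType A"
  shows "sub_eq S (A # \<Gamma>) \<Delta> (\<lambda>i. shift 1 (\<sigma> i)) (\<lambda>i. shift 1 (\<tau> i))"
  using assms
proof (induction \<Delta> arbitrary: \<sigma> \<tau>)
  case (Cons B \<Delta>)
  have "A # \<Gamma> \<turnstile>\<^bsub>S\<^esub> subst_judgement (\<lambda>i. Var (i + 1)) (EqTerm (\<sigma> 0) (\<tau> 0) (subst (\<lambda>i. \<sigma> (Suc i)) B))"
    using weakening[of "[]" \<Gamma> "EqTerm (\<sigma> 0) (\<tau> 0) (subst (\<lambda>i. \<sigma> (Suc i)) B)" A] Cons.prems by auto
  then show ?case using Cons by (auto simp: shift_eq_subst)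
qed simp

lemma sub_Var: "ctxt S \<Gamma> \<Longrightarrow> sub S \<Gamma> \<Gamma> Var"
proof (induction \<Gamma>)
  case (Cons A \<Gamma>)
  then have "sub S \<Gamma> \<Gamma> Var" "\<Gamma> \<turnstile>\<^bsub>S\<^esub> IsType A" by auto
  from sub_eq_weaken[OF this] have "sub S (A # \<Gamma>) \<Gamma> (\<lambda>i. Var (Suc i))" by (simp add: comp_def)
  moreover have "A # \<Gamma> \<turnstile>\<^bsub>S\<^esub> HasType (Var 0) (shift 1 A)" using variable Cons by simp
  ultimately show ?case using \<open>\<Gamma> \<turnstile>\<^bsub>S\<^esub> IsType A\<close> by (auto intro!: eq_term_refl simp: shift_eq_subst comp_def)
qed simp

text \<open>Conversion of contexts becomes a special case of substitution: between equal contexts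
  the identity assignment is a morphism, because each variable can be converted to the other
  type.\<close>

lemma ctxt_eq_sub: "ctxt_eq S \<Gamma> \<Gamma>' \<Longrightarrow> sub S \<Gamma>' \<Gamma> Var"
proof (induction \<Gamma> arbitrary: \<Gamma>')
  case (Cons A \<Delta>)
  then obtain A' \<Delta>' where \<Gamma>': "\<Gamma>' = A' # \<Delta>'" and eq: "ctxt_eq S \<Delta> \<Delta>'" "\<Delta> \<turnstile>\<^bsub>S\<^esub> EqType A A'"
    by (auto simp: ctxt_eq_Cons_iff)
  have s: "sub S \<Delta>' \<Delta> Var" using Cons eq by blast
  have 1: "\<Delta>' \<turnstile>\<^bsub>S\<^esub> EqType A A'" using subst_sub[OF s eq(2)] by simp
  then have A': "\<Delta>' \<turnstile>\<^bsub>S\<^esub> IsType A'" using eq_type_presup by blast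
  from sub_eq_weaken[OF s A'] have 2: "sub S (A' # \<Delta>') \<Delta> (\<lambda>i. Var (Suc i))" by (simp add: comp_def)
  have c: "ctxt S (A' # \<Delta>')" using A' in_context by simp
  have "A' # \<Delta>' \<turnstile>\<^bsub>S\<^esub> EqType (shift 1 A') (shift 1 A)"
    using weakening[of "[]" \<Delta>' "EqType A' A" A'] 1 A' eq_type_sym by (simp add: shift_eq_subst)
  then have "A' # \<Delta>' \<turnstile>\<^bsub>S\<^esub> EqTerm (Var 0) (Var 0) (shift 1 A)"
    using variable[OF c] conversion eq_term_refl by blast
  then show ?case using 2 eq(2) eq_type_presup by (auto simp: \<Gamma>' comp_def shift_eq_subst)
qed simp

lemma ctxt_eq_convert: "ctxt_eq S \<Gamma> \<Gamma>' \<Longrightarrow> \<Gamma> \<turnstile>\<^bsub>S\<^esub> \<J> \<Longrightarrow> \<Gamma>' \<turnstile>\<^bsub>S\<^esub> \<J>"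
  using subst_sub[OF ctxt_eq_sub] by fastforce

lemma ctxt_eq_ctxt2: "ctxt_eq S \<Gamma> \<Gamma>' \<Longrightarrow> ctxt S \<Gamma>'"
  using ctxt_eq_sub sub_eq_ctxt by blast

lemma ctxt_eq_refl: "ctxt S \<Gamma> \<Longrightarrow> ctxt_eq S \<Gamma> \<Gamma>"
  by (induction \<Gamma>) (auto intro: eq_type_refl)

lemma ctxt_eq_sym: "ctxt_eq S \<Gamma> \<Gamma>' \<Longrightarrow> ctxt_eq S \<Gamma>' \<Gamma>"
proof (induction \<Gamma> arbitrary: \<Gamma>')
  case (Cons A \<Delta>)
  then obtain A' \<Delta>' where *: "\<Gamma>' = A' # \<Delta>'" "ctxt_eq S \<Delta> \<Delta>'" "\<Delta> \<turnstile>\<^bsub>S\<^esub> EqType A A'"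
    by (auto simp: ctxt_eq_Cons_iff)
  show ?case using Cons.IH[OF *(2)] ctxt_eq_convert[OF *(2) eq_type_sym[OF *(3)]] * by simp
qed simp

lemma ctxt_eq_trans: "ctxt_eq S \<Gamma> \<Gamma>' \<Longrightarrow> ctxt_eq S \<Gamma>' \<Gamma>'' \<Longrightarrow> ctxt_eq S \<Gamma> \<Gamma>''"
proof (induction \<Gamma> arbitrary: \<Gamma>' \<Gamma>'')
  case (Cons A \<Delta>)
  from Cons.prems obtain A' \<Delta>' A'' \<Delta>'' where *: "\<Gamma>' = A' # \<Delta>'" "\<Gamma>'' = A'' # \<Delta>''"
     "ctxt_eq S \<Delta> \<Delta>'" "\<Delta> \<turnstile>\<^bsub>S\<^esub> EqType A A'" "ctxt_eq S \<Delta>' \<Delta>''" "\<Delta>' \<turnstile>\<^bsub>S\<^esub> EqType A' A''"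
    by (auto simp: ctxt_eq_Cons_iff)
  then have "\<Delta> \<turnstile>\<^bsub>S\<^esub> EqType A' A''" using ctxt_eq_convert ctxt_eq_sym by blast
  with * Cons.IH show ?case by (auto intro: eq_type_trans)
qed simp

section \<open>Definitional equality of substitutions\<close>

lemma eq_term_left: "\<Gamma> \<turnstile>\<^bsub>S\<^esub> EqTerm a b A \<Longrightarrow> \<Gamma> \<turnstile>\<^bsub>S\<^esub> EqTerm a a A"
  using eq_term_refl eq_term_presup by blast

lemma eq_term_right: "\<Gamma> \<turnstile>\<^bsub>S\<^esub> EqTerm a b A \<Longrightarrow> \<Gamma> \<turnstile>\<^bsub>S\<^esub> EqTerm b b A"
  using eq_term_refl eq_term_presup by blast

lemma sub_eq_left: "sub_eq S \<Gamma> \<Delta> \<sigma> \<tau> \<Longrightarrow> sub S \<Gamma> \<Delta> \<sigma>"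
  by (induction \<Delta> arbitrary: \<sigma> \<tau>) (simp, simp, blast intro: eq_term_left)

text \<open>The congruence of types enters as a hypothesis because the lemma is applied inside the
  proof of that very congruence, at a stage where only one of its two halves is available.\<close>

lemma ctxt_eq_appendI:
  assumes "ctxt S (\<Theta> @ \<Delta>)" "ctxt S \<Gamma>"
    and "\<And>\<Theta> B. \<Theta> @ \<Delta> \<turnstile>\<^bsub>S\<^esub> IsType B \<Longrightarrow>
      subst_tele \<sigma> \<Theta> @ \<Gamma> \<turnstile>\<^bsub>S\<^esub> EqType (subst (lift_sub (length \<Theta>) \<sigma>) B) (subst (lift_sub (length \<Theta>) \<tau>) B)"
  shows "ctxt_eq S (subst_tele \<sigma> \<Theta> @ \<Gamma>) (subst_tele \<tau> \<Theta> @ \<Gamma>)"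
  using assms(1)
proof (induction \<Theta>)
  case Nil
  then show ?case using assms(2) by (simp add: ctxt_eq_refl)
next
  case (Cons A \<Theta>)
  then show ?case using assms(3)[of \<Theta> A] by simp
qed

lemma inst_lift_comp2:
  "(\<lambda>i. subst (lift_sub m (inst 0 [a])) (lift_sub (Suc m) \<sigma> i)) = lift_sub m (case_nat a \<sigma>)"
  using inst_lift_comp[of m "case_nat a \<sigma>"] by simp

text \<open>
  The induction passes from \<open>\<sigma>\<close> to \<open>\<tau>\<close> through the substitution which agrees with \<open>\<sigma>\<close> on the last
  variable and with \<open>\<tau>\<close> on the others: the first step is the induction hypothesis, the second one
  is a congruence rule of the theory.
\<close>

lemma sub_eq_cong:
  assumes "sub_eq S \<Gamma> \<Delta> \<sigma> \<tau>"
  shows "sub S \<Gamma> \<Delta> \<tau>"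
    and "\<Theta> @ \<Delta> \<turnstile>\<^bsub>S\<^esub> IsType B \<Longrightarrow>
      subst_tele \<sigma> \<Theta> @ \<Gamma> \<turnstile>\<^bsub>S\<^esub> EqType (subst (lift_sub (length \<Theta>) \<sigma>) B) (subst (lift_sub (length \<Theta>) \<tau>) B)"
    and "\<Theta> @ \<Delta> \<turnstile>\<^bsub>S\<^esub> HasType b B \<Longrightarrow>
      subst_tele \<sigma> \<Theta> @ \<Gamma> \<turnstile>\<^bsub>S\<^esub> EqTerm (subst (lift_sub (length \<Theta>) \<sigma>) b) (subst (lift_sub (length \<Theta>) \<tau>) b)
        (subst (lift_sub (length \<Theta>) \<sigma>) B)"
  using assms
proof (induction \<Delta> arbitrary: \<Theta> \<sigma> \<tau> B b)
  case Nil
  {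
    case 1 then show ?case by simp
  next
    case 2
    have "scoped (length \<Theta>) B" using 2(1) is_type_scoped by fastforce
    then have "subst (lift_sub (length \<Theta>) \<sigma>) B = subst (lift_sub (length \<Theta>) \<tau>) B"
      by (rule subst_cong_scoped) (simp add: lift_sub_def)
    then show ?case using subst_under[of \<Gamma> "[]" \<sigma> \<Theta> "IsType B"] 2 by (auto intro: eq_type_refl)
  next
    case 3
    have "scoped (length \<Theta>) b" using 3(1) has_type_scoped by fastforce
    then have "subst (lift_sub (length \<Theta>) \<sigma>) b = subst (lift_sub (length \<Theta>) \<tau>) b"
      by (rule subst_cong_scoped) (simp add: lift_sub_def)
    then show ?case using subst_under[of \<Gamma> "[]" \<sigma> \<Theta> "HasType b B"] 3 by (auto intro: eq_term_refl)
  }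
next
  case (Cons A \<Delta>)
  have main: "sub S \<Gamma> (A # \<Delta>) \<tau> \<and>
    (\<forall>\<Theta> B. \<Theta> @ A # \<Delta> \<turnstile>\<^bsub>S\<^esub> IsType B \<longrightarrow>
      subst_tele \<sigma> \<Theta> @ \<Gamma> \<turnstile>\<^bsub>S\<^esub> EqType (subst (lift_sub (length \<Theta>) \<sigma>) B) (subst (lift_sub (length \<Theta>) \<tau>) B)) \<and>
    (\<forall>\<Theta> b B. \<Theta> @ A # \<Delta> \<turnstile>\<^bsub>S\<^esub> HasType b B \<longrightarrow>
      subst_tele \<sigma> \<Theta> @ \<Gamma> \<turnstile>\<^bsub>S\<^esub> EqTerm (subst (lift_sub (length \<Theta>) \<sigma>) b) (subst (lift_sub (length \<Theta>) \<tau>) b)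
        (subst (lift_sub (length \<Theta>) \<sigma>) B))"
    if eq: "sub_eq S \<Gamma> (A # \<Delta>) \<sigma> \<tau>" for \<sigma> \<tau>
  proof -
    define \<sigma>' \<tau>' where "\<sigma>' = (\<lambda>i. \<sigma> (Suc i))" and "\<tau>' = (\<lambda>i. \<tau> (Suc i))"
    have \<sigma>\<tau>: "\<sigma> = case_nat (\<sigma> 0) \<sigma>'" "\<tau> = case_nat (\<tau> 0) \<tau>'"
      by (auto simp: fun_eq_iff \<sigma>'_def \<tau>'_def split: nat.split)
    define \<rho> where "\<rho> = case_nat (\<sigma> 0) \<tau>'"
    have eq': "sub_eq S \<Gamma> \<Delta> \<sigma>' \<tau>'" and A: "\<Delta> \<turnstile>\<^bsub>S\<^esub> IsType A" and 0: "\<Gamma> \<turnstile>\<^bsub>S\<^esub> EqTerm (\<sigma> 0) (\<tau> 0) (subst \<sigma>' A)"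
      using eq by (auto simp: \<sigma>'_def \<tau>'_def)
    have s\<tau>': "sub S \<Gamma> \<Delta> \<tau>'" using Cons(1)[OF eq'] .
    have AA: "\<Gamma> \<turnstile>\<^bsub>S\<^esub> EqType (subst \<sigma>' A) (subst \<tau>' A)"
      using Cons(2)[OF _ eq', of "[]" A] A by simp
    have z': "\<Gamma> \<turnstile>\<^bsub>S\<^esub> EqTerm (\<sigma> 0) (\<tau> 0) (subst \<tau>' A)"
      using 0 AA eq_conversion by blast
    have s0: "\<Gamma> \<turnstile>\<^bsub>S\<^esub> HasType (\<sigma> 0) (subst \<sigma>' A)" using 0 eq_term_presup by blast
    have s\<tau>: "sub S \<Gamma> (A # \<Delta>) \<tau>"
      using s\<tau>' A eq_term_right[OF z'] by (simp add: \<tau>'_def)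
    have i_type: "subst_tele \<sigma> \<Theta> @ \<Gamma> \<turnstile>\<^bsub>S\<^esub> EqType (subst (lift_sub (length \<Theta>) \<sigma>) B) (subst (lift_sub (length \<Theta>) \<rho>) B)"
      if "\<Theta> @ A # \<Delta> \<turnstile>\<^bsub>S\<^esub> IsType B" for \<Theta> B
    proof -
      have "subst_tele (lift_sub 1 \<sigma>') \<Theta> @ subst \<sigma>' A # \<Gamma> \<turnstile>\<^bsub>S\<^esub>
         EqType (subst (lift_sub (Suc (length \<Theta>)) \<sigma>') B) (subst (lift_sub (Suc (length \<Theta>)) \<tau>') B)"
        using Cons(2)[OF _ eq', of "\<Theta> @ [A]" B] that by simp
      from substitution[OF this s0] show ?thesis
        using inst_lift_comp2[of 0 "\<sigma> 0" \<sigma>'] by (simp add: inst_lift_comp2 \<rho>_def flip: \<sigma>\<tau>)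
    qed
    have i_term: "subst_tele \<sigma> \<Theta> @ \<Gamma> \<turnstile>\<^bsub>S\<^esub> EqTerm (subst (lift_sub (length \<Theta>) \<sigma>) b) (subst (lift_sub (length \<Theta>) \<rho>) b) (subst (lift_sub (length \<Theta>) \<sigma>) B)"
      if "\<Theta> @ A # \<Delta> \<turnstile>\<^bsub>S\<^esub> HasType b B" for \<Theta> b B
    proof -
      have "subst_tele (lift_sub 1 \<sigma>') \<Theta> @ subst \<sigma>' A # \<Gamma> \<turnstile>\<^bsub>S\<^esub>
         EqTerm (subst (lift_sub (Suc (length \<Theta>)) \<sigma>') b) (subst (lift_sub (Suc (length \<Theta>)) \<tau>') b) (subst (lift_sub (Suc (length \<Theta>)) \<sigma>') B)"
        using Cons(3)[OF _ eq', of "\<Theta> @ [A]" b B] that by simp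
      from substitution[OF this s0] show ?thesis
        using inst_lift_comp2[of 0 "\<sigma> 0" \<sigma>'] by (simp add: inst_lift_comp2 \<rho>_def flip: \<sigma>\<tau>)
    qed
    \<comment> \<open>The two halves live over \<open>subst_tele \<sigma> \<Theta>\<close> and
      \<open>subst_tele \<rho> \<Theta>\<close>. The first half itself shows that these telescopes
      agree, so the second can be moved over.\<close>
    have conv: "ctxt_eq S (subst_tele \<rho> \<Theta> @ \<Gamma>) (subst_tele \<sigma> \<Theta> @ \<Gamma>)" if "ctxt S (\<Theta> @ A # \<Delta>)" for \<Theta>
      using ctxt_eq_appendI[OF that _ i_type] eq sub_eq_ctxt ctxt_eq_sym by blast
    have ii_type: "subst_tele \<rho> \<Theta> @ \<Gamma> \<turnstile>\<^bsub>S\<^esub> EqType (subst (lift_sub (length \<Theta>) \<rho>) B) (subst (lift_sub (length \<Theta>) \<tau>) B)"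
      if "\<Theta> @ A # \<Delta> \<turnstile>\<^bsub>S\<^esub> IsType B" for \<Theta> B
    proof -
      have "subst_tele (lift_sub 1 \<tau>') \<Theta> @ subst \<tau>' A # \<Gamma> \<turnstile>\<^bsub>S\<^esub> IsType (subst (lift_sub (Suc (length \<Theta>)) \<tau>') B)"
        using subst_under[OF s\<tau>', of "\<Theta> @ [A]" "IsType B"] that by simp
      from type_subst_cong[OF this z'] show ?thesis
        using inst_lift_comp2[of 0 "\<sigma> 0" \<tau>'] by (simp add: inst_lift_comp2 \<rho>_def flip: \<sigma>\<tau>)
    qed
    have ii_term: "subst_tele \<rho> \<Theta> @ \<Gamma> \<turnstile>\<^bsub>S\<^esub> EqTerm (subst (lift_sub (length \<Theta>) \<rho>) b) (subst (lift_sub (length \<Theta>) \<tau>) b) (subst (lift_sub (length \<Theta>) \<rho>) B)"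
      if "\<Theta> @ A # \<Delta> \<turnstile>\<^bsub>S\<^esub> HasType b B" for \<Theta> b B
    proof -
      have "subst_tele (lift_sub 1 \<tau>') \<Theta> @ subst \<tau>' A # \<Gamma> \<turnstile>\<^bsub>S\<^esub> HasType (subst (lift_sub (Suc (length \<Theta>)) \<tau>') b) (subst (lift_sub (Suc (length \<Theta>)) \<tau>') B)"
        using subst_under[OF s\<tau>', of "\<Theta> @ [A]" "HasType b B"] that by simp
      from term_subst_cong[OF this z'] show ?thesis
        using inst_lift_comp2[of 0 "\<sigma> 0" \<tau>'] by (simp add: inst_lift_comp2 \<rho>_def flip: \<sigma>\<tau>)
    qed
    show ?thesis
    proof (intro conjI allI impI)
      show "sub S \<Gamma> (A # \<Delta>) \<tau>" by (rule s\<tau>)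
    next
      fix \<Theta> B assume B: "\<Theta> @ A # \<Delta> \<turnstile>\<^bsub>S\<^esub> IsType B"
      show "subst_tele \<sigma> \<Theta> @ \<Gamma> \<turnstile>\<^bsub>S\<^esub> EqType (subst (lift_sub (length \<Theta>) \<sigma>) B) (subst (lift_sub (length \<Theta>) \<tau>) B)"
        using i_type[OF B] ctxt_eq_convert[OF conv[OF in_context[OF B]] ii_type[OF B]] eq_type_trans by blast
    next
      fix \<Theta> b B assume b: "\<Theta> @ A # \<Delta> \<turnstile>\<^bsub>S\<^esub> HasType b B"
      then have B: "\<Theta> @ A # \<Delta> \<turnstile>\<^bsub>S\<^esub> IsType B" by (rule has_type_presup)
      show "subst_tele \<sigma> \<Theta> @ \<Gamma> \<turnstile>\<^bsub>S\<^esub> EqTerm (subst (lift_sub (length \<Theta>) \<sigma>) b) (subst (lift_sub (length \<Theta>) \<tau>) b) (subst (lift_sub (length \<Theta>) \<sigma>) B)"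
        using i_term[OF b] ctxt_eq_convert[OF conv[OF in_context[OF b]] ii_term[OF b]] eq_term_trans
          eq_conversion eq_type_sym[OF i_type[OF B]] by blast
    qed
  qed
  {
    case 1 show ?case using main[OF 1] by blast
  next
    case 2 show ?case using main[OF 2(2)] 2(1) by blast
  next
    case 3 show ?case using main[OF 3(2)] 3(1) by blast
  }
qed

lemma sub_eq_right: "sub_eq S \<Gamma> \<Delta> \<sigma> \<tau> \<Longrightarrow> sub S \<Gamma> \<Delta> \<tau>"
  by (rule sub_eq_cong)

lemma eq_type_subst:
  assumes "sub_eq S \<Gamma> \<Delta> \<sigma> \<tau>" "\<Delta> \<turnstile>\<^bsub>S\<^esub> EqType A B"
  shows "\<Gamma> \<turnstile>\<^bsub>S\<^esub> EqType (subst \<sigma> A) (subst \<tau> B)"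
proof -
  have "\<Gamma> \<turnstile>\<^bsub>S\<^esub> EqType (subst \<sigma> A) (subst \<tau> A)"
    using sub_eq_cong(2)[OF assms(1), of "[]" A] eq_type_presup[OF assms(2)] by simp
  moreover have "\<Gamma> \<turnstile>\<^bsub>S\<^esub> EqType (subst \<tau> A) (subst \<tau> B)"
    using subst_sub[OF sub_eq_right[OF assms(1)] assms(2)] by simp
  ultimately show ?thesis by (rule eq_type_trans)
qed

lemma eq_term_subst:
  assumes "sub_eq S \<Gamma> \<Delta> \<sigma> \<tau>" "\<Delta> \<turnstile>\<^bsub>S\<^esub> EqTerm a b A"
  shows "\<Gamma> \<turnstile>\<^bsub>S\<^esub> EqTerm (subst \<sigma> a) (subst \<tau> b) (subst \<sigma> A)"
proof -
  have "\<Gamma> \<turnstile>\<^bsub>S\<^esub> EqTerm (subst \<sigma> a) (subst \<sigma> b) (subst \<sigma> A)"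
    using subst_sub[OF sub_eq_left[OF assms(1)] assms(2)] by simp
  moreover have "\<Gamma> \<turnstile>\<^bsub>S\<^esub> EqTerm (subst \<sigma> b) (subst \<tau> b) (subst \<sigma> A)"
    using sub_eq_cong(3)[OF assms(1), of "[]" b A] eq_term_presup[OF assms(2)] by simp
  ultimately show ?thesis by (rule eq_term_trans)
qed

lemma has_type_eq: "\<Gamma> \<turnstile>\<^bsub>S\<^esub> HasType a A \<longleftrightarrow> \<Gamma> \<turnstile>\<^bsub>S\<^esub> EqTerm a a A"
  using eq_term_refl eq_term_presup by blast

lemma sub_eq_sym: "sub_eq S \<Gamma> \<Delta> \<sigma> \<tau> \<Longrightarrow> sub_eq S \<Gamma> \<Delta> \<tau> \<sigma>"
proof (induction \<Delta> arbitrary: \<sigma> \<tau>)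
  case (Cons A \<Delta>)
  then have "\<Gamma> \<turnstile>\<^bsub>S\<^esub> EqType (subst (\<lambda>i. \<sigma> (Suc i)) A) (subst (\<lambda>i. \<tau> (Suc i)) A)"
    by (intro eq_type_subst[of _ \<Delta>] eq_type_refl) auto
  with Cons.prems have "\<Gamma> \<turnstile>\<^bsub>S\<^esub> EqTerm (\<tau> 0) (\<sigma> 0) (subst (\<lambda>i. \<tau> (Suc i)) A)"
    by (auto intro: eq_term_sym[OF eq_conversion, of _ "\<sigma> 0" "\<tau> 0"])
  then show ?case using Cons.IH[of "\<lambda>i. \<sigma> (Suc i)" "\<lambda>i. \<tau> (Suc i)"] Cons.prems by simp
qed simp

lemma sub_eq_trans: "sub_eq S \<Gamma> \<Delta> \<sigma> \<tau> \<Longrightarrow> sub_eq S \<Gamma> \<Delta> \<tau> \<rho> \<Longrightarrow> sub_eq S \<Gamma> \<Delta> \<sigma> \<rho>"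
proof (induction \<Delta> arbitrary: \<sigma> \<tau> \<rho>)
  case (Cons A \<Delta>)
  then have "\<Gamma> \<turnstile>\<^bsub>S\<^esub> EqType (subst (\<lambda>i. \<tau> (Suc i)) A) (subst (\<lambda>i. \<sigma> (Suc i)) A)"
    by (intro eq_type_subst[OF sub_eq_sym, of _ \<Delta>] eq_type_refl) auto
  with Cons.prems have "\<Gamma> \<turnstile>\<^bsub>S\<^esub> EqTerm (\<sigma> 0) (\<rho> 0) (subst (\<lambda>i. \<sigma> (Suc i)) A)"
    by (auto intro: eq_term_trans[OF _ eq_conversion, of _ "\<sigma> 0" "\<tau> 0" _ "\<rho> 0"])
  then show ?case using Cons.IH[of "\<lambda>i. \<sigma> (Suc i)" "\<lambda>i. \<tau> (Suc i)" "\<lambda>i. \<rho> (Suc i)"] Cons.prems by simp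
qed simp

lemma sub_eq_comp:
  assumes "sub_eq S \<Gamma> \<Delta> \<sigma> \<sigma>'"
  shows "sub_eq S \<Delta> \<Theta> \<tau> \<tau>' \<Longrightarrow> sub_eq S \<Gamma> \<Theta> (\<lambda>i. subst \<sigma> (\<tau> i)) (\<lambda>i. subst \<sigma>' (\<tau>' i))"
proof (induction \<Theta> arbitrary: \<tau> \<tau>')
  case Nil
  then show ?case using assms sub_eq_ctxt by auto
next
  case (Cons A \<Theta>)
  then show ?case using eq_term_subst[OF assms, of "\<tau> 0" "\<tau>' 0" "subst (\<lambda>i. \<tau> (Suc i)) A"] by auto
qed

lemma ctxt_eq_subst:
  assumes "sub_eq S \<Gamma> \<Delta> \<sigma> \<tau>" "ctxt S (\<Theta> @ \<Delta>)"
  shows "ctxt_eq S (subst_tele \<sigma> \<Theta> @ \<Gamma>) (subst_tele \<tau> \<Theta> @ \<Gamma>)"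
  using ctxt_eq_appendI[OF assms(2)] sub_eq_cong(2)[OF assms(1)] sub_eq_ctxt assms(1) by blast

lemma ctxt_subst: "sub S \<Gamma> \<Delta> \<sigma> \<Longrightarrow> ctxt S (\<Theta> @ \<Delta>) \<Longrightarrow> ctxt S (subst_tele \<sigma> \<Theta> @ \<Gamma>)"
  using ctxt_eq_subst ctxt_eq_ctxt1 by blast

lemma sub_eq_lift:
  assumes "sub_eq S \<Gamma> \<Delta> \<sigma> \<tau>" "ctxt S (\<Theta> @ \<Delta>)"
  shows "sub_eq S (subst_tele \<sigma> \<Theta> @ \<Gamma>) (\<Theta> @ \<Delta>) (lift_sub (length \<Theta>) \<sigma>) (lift_sub (length \<Theta>) \<tau>)"
  using assms(2)
proof (induction \<Theta>)
  case Nil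
  then show ?case using assms by simp
next
  case (Cons A \<Theta>)
  then have IH: "sub_eq S (subst_tele \<sigma> \<Theta> @ \<Gamma>) (\<Theta> @ \<Delta>) (lift_sub (length \<Theta>) \<sigma>) (lift_sub (length \<Theta>) \<tau>)"
    and A: "\<Theta> @ \<Delta> \<turnstile>\<^bsub>S\<^esub> IsType A" by auto
  have A': "subst_tele \<sigma> \<Theta> @ \<Gamma> \<turnstile>\<^bsub>S\<^esub> IsType (subst (lift_sub (length \<Theta>) \<sigma>) A)"
    using subst_sub[OF sub_eq_left[OF IH] A] by simp
  have "ctxt S (subst (lift_sub (length \<Theta>) \<sigma>) A # subst_tele \<sigma> \<Theta> @ \<Gamma>)"
    using A' in_context by auto
  from eq_term_refl[OF variable[OF this]] sub_eq_weaken[OF IH A'] A show ?case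
    by (simp add: lift_sub_Suc_Suc)
qed

lemma sub_eq_trivial: "ctxt S \<Delta> \<Longrightarrow> sub S \<Gamma> \<Delta> \<sigma> \<Longrightarrow> (\<And>i. i < length \<Delta> \<Longrightarrow> \<sigma> i = \<tau> i) \<Longrightarrow> sub_eq S \<Gamma> \<Delta> \<sigma> \<tau>"
  by (induction \<Delta> arbitrary: \<sigma> \<tau>) auto

lemma sub_shift: "ctxt S (\<Xi> @ \<Gamma>) \<Longrightarrow> sub S (\<Xi> @ \<Gamma>) \<Gamma> (\<lambda>i. Var (i + length \<Xi>))"
proof (induction \<Xi>)
  case Nil
  then show ?case by (simp add: sub_Var)
next
  case (Cons A \<Xi>)
  then show ?case using sub_eq_weaken[of "\<Xi> @ \<Gamma>" \<Gamma> "\<lambda>i. Var (i + length \<Xi>)" "\<lambda>i. Var (i + length \<Xi>)" A] by simp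
qed

end

section \<open>Elements of telescopes\<close>

text \<open>Generalises \<open>inst 0 \<delta>\<close>, whose tail is \<open>Var\<close>, to an
  arbitrary tail. The blocks of a generic context such as x, x', p are then filled by nested uses,
  one list of terms per block.\<close>

definition ext :: "'c expr list \<Rightarrow> (nat \<Rightarrow> 'c expr) \<Rightarrow> nat \<Rightarrow> 'c expr" where
  "ext \<delta> \<sigma> i = (if i < length \<delta> then \<delta> ! i else \<sigma> (i - length \<delta>))"

lemma ext_simps [simp]:
  "ext [] \<sigma> = \<sigma>" "ext (a # \<delta>) \<sigma> 0 = a" "ext (a # \<delta>) \<sigma> (Suc i) = ext \<delta> \<sigma> i"
  by (auto simp: ext_def)

lemma ext_add [simp]: "length \<delta> = n \<Longrightarrow> ext \<delta> \<sigma> (i + n) = \<sigma> i" "length \<delta> = n \<Longrightarrow> ext \<delta> \<sigma> (n + i) = \<sigma> i"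
  by (auto simp: ext_def)

lemma ext_append [simp]: "ext (\<delta> @ \<delta>') \<sigma> = ext \<delta> (ext \<delta>' \<sigma>)"
  by (auto simp: ext_def nth_append fun_eq_iff)

lemma subst_ext [simp]: "subst \<tau> (ext \<delta> \<sigma> i) = ext (map (subst \<tau>) \<delta>) (\<lambda>i. subst \<tau> (\<sigma> i)) i"
  by (auto simp: ext_def)

lemma map_ext_upt [simp]: "length \<delta> = n \<Longrightarrow> map (ext \<delta> \<sigma>) [0..<n] = \<delta>"
  by (rule nth_equalityI) (auto simp: ext_def)

lemma inst_eq_ext: "inst 0 \<delta> = ext \<delta> Var"
  by (auto simp: inst_def ext_def)

lemma ext_split: "ext (map \<sigma> [0..<n]) (\<lambda>i. \<sigma> (i + n)) = \<sigma>"
  by (auto simp: ext_def)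

lemma subst_IdT [simp]: "subst \<sigma> (IdT A a b) = IdT (subst \<sigma> A) (subst \<sigma> a) (subst \<sigma> b)"
  by (simp add: IdT_def)

lemma subst_Refl [simp]: "subst \<sigma> (Refl A a) = Refl (subst \<sigma> A) (subst \<sigma> a)"
  by (simp add: Refl_def)

lemma ext_lift_sub [simp]: "length \<delta> = k \<Longrightarrow> subst (ext \<delta> \<tau>) (lift_sub k \<sigma> i) = ext \<delta> (\<lambda>i. subst \<tau> (\<sigma> i)) i"
  by (auto simp: lift_sub_def ext_def)

lemma elems_eq_length: "elems_eq S \<Gamma> \<Theta> t t' \<Longrightarrow> length t = length \<Theta> \<and> length t' = length \<Theta>"
  by (induction S \<Gamma> \<Theta> t t' rule: elems_eq.induct) auto

lemma elems_eq_Nil [simp]: "elems_eq S \<Gamma> [] t t' \<longleftrightarrow> t = [] \<and> t' = []"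
  by (cases t; cases t') auto

lemma elems_eq_Cons:
  "elems_eq S \<Gamma> (A # \<Theta>) t t' \<longleftrightarrow> (\<exists>a b s s'. t = a # s \<and> t' = b # s' \<and> elems_eq S \<Gamma> \<Theta> s s' \<and> \<Gamma> \<turnstile>\<^bsub>S\<^esub> EqTerm a b (subst (ext s Var) A))"
  by (cases t; cases t') (auto simp: inst_eq_ext)

context dependent_type_theory
begin

lemma elems_eq_refl_iff: "elems S \<Gamma> \<Theta> t \<longleftrightarrow> elems_eq S \<Gamma> \<Theta> t t"
proof (induction \<Theta> arbitrary: t)
  case (Cons A \<Theta>) then show ?case by (cases t) (auto simp: has_type_eq)
next
  case Nil show ?case by (cases t) auto
qed

text \<open>Passes between two descriptions of a morphism into an extended context: a function on
  indices, or a morphism into the base together with the list of values at the indices below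
  \<open>n\<close>. Functions compose well, while lists match the recursion over telescopes.\<close>

lemma sub_eq_append_iff:
  "length \<Theta> = n \<Longrightarrow> sub_eq S \<Gamma> (\<Theta> @ \<Delta>) \<sigma> \<tau> \<longleftrightarrow> sub_eq S \<Gamma> \<Delta> (\<lambda>i. \<sigma> (i + n)) (\<lambda>i. \<tau> (i + n)) \<and> ctxt S (\<Theta> @ \<Delta>) \<and>
     elems_eq S \<Gamma> (subst_tele (\<lambda>i. \<sigma> (i + n)) \<Theta>) (map \<sigma> [0..<n]) (map \<tau> [0..<n])"
proof (induction \<Theta> arbitrary: \<sigma> \<tau> n)
  case Nil
  then show ?case using sub_eq_ctxt by auto
next
  case (Cons A \<Theta>)
  then obtain m where n: "n = Suc m" "m = length \<Theta>" by auto
  have 1: "map \<sigma> [0..<n] = \<sigma> 0 # map (\<lambda>i. \<sigma> (Suc i)) [0..<m]" for \<sigma> :: "nat \<Rightarrow> 'c expr"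
    unfolding n by (simp add: upt_conv_Cons map_Suc_upt[symmetric] comp_def del: upt_Suc)
  have 2: "subst (ext (map (\<lambda>i. \<sigma> (Suc i)) [0..<m]) Var) (subst (lift_sub m (\<lambda>i. \<sigma> (i + n))) A) = subst (\<lambda>i. \<sigma> (Suc i)) A"
    using ext_split[of "\<lambda>i. \<sigma> (Suc i)" m] by (simp add: ext_lift_sub n)
  show ?case
    using Cons.IH[of m "\<lambda>i. \<sigma> (Suc i)" "\<lambda>i. \<tau> (Suc i)"] 2
    by (auto simp: 1 n(2)[symmetric] inst_eq_ext) (auto simp: n)
qed

lemma sub_eq_ext:
  assumes "sub_eq S \<Gamma> \<Delta> \<sigma> \<tau>" "ctxt S (\<Theta> @ \<Delta>)" "elems_eq S \<Gamma> (subst_tele \<sigma> \<Theta>) \<delta> \<delta>'"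
  shows "sub_eq S \<Gamma> (\<Theta> @ \<Delta>) (ext \<delta> \<sigma>) (ext \<delta>' \<tau>)"
  using assms elems_eq_length[OF assms(3)] by (simp add: sub_eq_append_iff)

lemma sub_eq_extD:
  assumes "sub_eq S \<Gamma> (\<Theta> @ \<Delta>) (ext \<delta> \<sigma>) (ext \<delta>' \<tau>)" "length \<delta> = length \<Theta>" "length \<delta>' = length \<Theta>"
  shows "sub_eq S \<Gamma> \<Delta> \<sigma> \<tau>" "elems_eq S \<Gamma> (subst_tele \<sigma> \<Theta>) \<delta> \<delta>'"
  using assms by (auto simp: sub_eq_append_iff)

lemma elems_eq_sub: "ctxt S (\<Theta> @ \<Gamma>) \<Longrightarrow> elems_eq S \<Gamma> \<Theta> t t' \<Longrightarrow> sub_eq S \<Gamma> (\<Theta> @ \<Gamma>) (ext t Var) (ext t' Var)"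
  using sub_eq_ext[of \<Gamma> \<Gamma> Var Var \<Theta> t t'] sub_Var ctxt_appendD by fastforce

lemma elems_eq_iff_sub: "ctxt S (\<Theta> @ \<Gamma>) \<Longrightarrow> length t = length \<Theta> \<Longrightarrow> length t' = length \<Theta> \<Longrightarrow>
  elems_eq S \<Gamma> \<Theta> t t' \<longleftrightarrow> sub_eq S \<Gamma> (\<Theta> @ \<Gamma>) (ext t Var) (ext t' Var)"
  using elems_eq_sub sub_eq_extD(2)[of \<Gamma> \<Theta> \<Gamma> t Var t' Var] by auto

lemma elems_eq_subst:
  assumes "sub_eq S \<Gamma>' \<Gamma> \<sigma> \<sigma>'" "ctxt S (\<Theta> @ \<Gamma>)" "elems_eq S \<Gamma> \<Theta> t t'"
  shows "elems_eq S \<Gamma>' (subst_tele \<sigma> \<Theta>) (map (subst \<sigma>) t) (map (subst \<sigma>') t')"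
proof -
  have "sub_eq S \<Gamma>' (\<Theta> @ \<Gamma>) (ext (map (subst \<sigma>) t) \<sigma>) (ext (map (subst \<sigma>') t') \<sigma>')"
    using sub_eq_comp[OF assms(1) elems_eq_sub[OF assms(2,3)]] by (simp add: subst_ext)
  then show ?thesis using elems_eq_length[OF assms(3)] by (auto dest: sub_eq_extD(2))
qed

lemma sub_eq_convert: "sub_eq S \<Gamma> \<Delta> \<sigma> \<tau> \<Longrightarrow> ctxt_eq S \<Delta> \<Delta>' \<Longrightarrow> sub_eq S \<Gamma> \<Delta>' \<sigma> \<tau>"
  using sub_eq_comp[of \<Gamma> \<Delta> \<sigma> \<tau> \<Delta>' Var Var] ctxt_eq_sub[OF ctxt_eq_sym] by simp

lemma sub_eq_convert_dom: "sub_eq S \<Gamma> \<Delta> \<sigma> \<tau> \<Longrightarrow> ctxt_eq S \<Gamma> \<Gamma>' \<Longrightarrow> sub_eq S \<Gamma>' \<Delta> \<sigma> \<tau>"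
  using sub_eq_comp[of \<Gamma>' \<Gamma> Var Var \<Delta> \<sigma> \<tau>] ctxt_eq_sub by simp

lemma elems_eq_convert:
  assumes "elems_eq S \<Gamma> \<Theta> t t'" "ctxt_eq S (\<Theta> @ \<Gamma>) (\<Theta>' @ \<Gamma>)"
  shows "elems_eq S \<Gamma> \<Theta>' t t'"
proof -
  have "sub_eq S \<Gamma> (\<Theta>' @ \<Gamma>) (ext t Var) (ext t' Var)"
    using sub_eq_convert[OF elems_eq_sub] assms ctxt_eq_ctxt1 by blast
  then show ?thesis using elems_eq_length[OF assms(1)] ctxt_eq_lengthD[OF assms(2)] by (auto dest: sub_eq_extD(2))
qed

lemma elems_eq_convert_dom:
  assumes "elems_eq S \<Gamma> \<Theta> t t'" "ctxt_eq S \<Gamma> \<Gamma>'"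
  shows "elems_eq S \<Gamma>' \<Theta> t t'"
  using assms(1)
proof (induction \<Theta> arbitrary: t t')
  case (Cons A \<Theta>)
  then show ?case using ctxt_eq_convert[OF assms(2)] by (auto simp: elems_eq_Cons)
qed simp

lemma elems_eq_left: "elems_eq S \<Gamma> \<Theta> t t' \<Longrightarrow> elems_eq S \<Gamma> \<Theta> t t"
proof (induction \<Theta> arbitrary: t t')
  case (Cons A \<Theta>)
  then show ?case by (auto simp: elems_eq_Cons dest: eq_term_left)
qed simp

lemma elems_eq_sym: "ctxt S (\<Theta> @ \<Gamma>) \<Longrightarrow> elems_eq S \<Gamma> \<Theta> t t' \<Longrightarrow> elems_eq S \<Gamma> \<Theta> t' t"
  using elems_eq_length[of S \<Gamma> \<Theta> t t'] by (simp add: elems_eq_iff_sub sub_eq_sym)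

lemma elems_eq_right: "ctxt S (\<Theta> @ \<Gamma>) \<Longrightarrow> elems_eq S \<Gamma> \<Theta> t t' \<Longrightarrow> elems_eq S \<Gamma> \<Theta> t' t'"
  using elems_eq_sym elems_eq_left by blast

lemma elems_eq_trans: "ctxt S (\<Theta> @ \<Gamma>) \<Longrightarrow> elems_eq S \<Gamma> \<Theta> t t' \<Longrightarrow> elems_eq S \<Gamma> \<Theta> t' t'' \<Longrightarrow> elems_eq S \<Gamma> \<Theta> t t''"
  using elems_eq_length[of S \<Gamma> \<Theta> t t'] elems_eq_length[of S \<Gamma> \<Theta> t' t''] by (auto simp add: elems_eq_iff_sub intro: sub_eq_trans)

lemma elems_vars: "ctxt S (\<Xi> @ \<Theta> @ \<Gamma>) \<Longrightarrow> length \<Xi> = m \<Longrightarrow> length \<Theta> = n \<Longrightarrow>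
  elems_eq S (\<Xi> @ \<Theta> @ \<Gamma>) (subst_tele (\<lambda>i. Var (i + (m + n))) \<Theta>) (map Var [m..<m + n]) (map Var [m..<m + n])"
  using sub_shift[of \<Xi> "\<Theta> @ \<Gamma>"] map_add_upt[of m n]
  by (auto simp: sub_eq_append_iff ac_simps) (metis (no_types, lifting) list.map_comp comp_def map_eq_conv)

lemma ctxt_eq_append:
  "ctxt_eq S (\<Theta> @ \<Gamma>) (\<Theta>' @ \<Gamma>) \<Longrightarrow> ctxt_eq S \<Gamma> \<Gamma>' \<Longrightarrow> length \<Theta> = length \<Theta>' \<Longrightarrow> ctxt_eq S (\<Theta> @ \<Gamma>) (\<Theta>' @ \<Gamma>')"
proof (induction \<Theta> arbitrary: \<Theta>')
  case (Cons A \<Theta>) then show ?case by (cases \<Theta>') auto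
qed simp

lemma ctxt_eq_appendD:
  "ctxt_eq S (\<Theta> @ \<Gamma>) (\<Theta>' @ \<Gamma>') \<Longrightarrow> length \<Theta> = length \<Theta>' \<Longrightarrow> ctxt_eq S \<Gamma> \<Gamma>'"
proof (induction \<Theta> arbitrary: \<Theta>')
  case (Cons A \<Theta>) then show ?case by (cases \<Theta>') auto
qed simp

lemma ctxt_eq_subst_eq:
  assumes "sub_eq S \<Gamma>' \<Gamma> \<sigma> \<tau>" "ctxt_eq S (\<Theta> @ \<Gamma>) (\<Theta>' @ \<Delta>)" "length \<Theta> = length \<Theta>'"
  shows "ctxt_eq S (subst_tele \<sigma> \<Theta> @ \<Gamma>') (subst_tele \<tau> \<Theta>' @ \<Gamma>')"
  using assms(2,3)
proof (induction \<Theta> arbitrary: \<Theta>')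
  case Nil
  then show ?case using assms(1) sub_eq_ctxt by (auto intro: ctxt_eq_refl)
next
  case (Cons A \<Theta>)
  then obtain A' \<Theta>'' where *: "\<Theta>' = A' # \<Theta>''" "length \<Theta> = length \<Theta>''" by (cases \<Theta>') auto
  with Cons.prems have c: "ctxt_eq S (\<Theta> @ \<Gamma>) (\<Theta>'' @ \<Delta>)" and A: "\<Theta> @ \<Gamma> \<turnstile>\<^bsub>S\<^esub> EqType A A'" by auto
  from eq_type_subst[OF sub_eq_lift[OF assms(1) ctxt_eq_ctxt1[OF c]] A] Cons.IH[OF c *(2)] * show ?case by simp
qed

lemma var_type: "ctxt S \<Gamma> \<Longrightarrow> i < length \<Gamma> \<Longrightarrow> \<Gamma> \<turnstile>\<^bsub>S\<^esub> HasType (Var i) (shift (Suc i) (\<Gamma> ! i))"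
proof (induction \<Gamma> arbitrary: i)
  case (Cons A \<Gamma>)
  show ?case
  proof (cases i)
    case 0 then show ?thesis using variable Cons by simp
  next
    case (Suc j)
    then have "\<Gamma> \<turnstile>\<^bsub>S\<^esub> HasType (Var j) (shift (Suc j) (\<Gamma> ! j))" using Cons by simp
    from weakening[of "[]" \<Gamma> _ A, simplified, OF this] Suc Cons.prems show ?thesis
      by (simp add: shift_eq_subst)
  qed
qed simp

lemma var_at: "ctxt S (\<Xi> @ A # \<Gamma>) \<Longrightarrow> length \<Xi> = m \<Longrightarrow> \<Xi> @ A # \<Gamma> \<turnstile>\<^bsub>S\<^esub> EqTerm (Var m) (Var m) (shift (Suc m) A)"
  using var_type[of "\<Xi> @ A # \<Gamma>" m] eq_term_refl by (auto simp: nth_append)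

end

section \<open>Elimination of identity contexts\<close>

declare lift_sub_lift_sub [simp del]

section \<open>Elimination of a single identity type into a telescope\<close>

context identity_types
begin

lemma id_tele_ctxt_eq:
  assumes "\<Gamma> \<turnstile>\<^bsub>S\<^esub> EqType A A'"
  shows "ctxt_eq S (id_tele A @ \<Gamma>) (id_tele A' @ \<Gamma>)"
proof -
  have A: "\<Gamma> \<turnstile>\<^bsub>S\<^esub> IsType A" and c: "ctxt S (A # \<Gamma>)" using assms eq_type_presup in_context by (blast, auto)
  have s: "sub S (A # \<Gamma>) \<Gamma> (\<lambda>i. Var (i + 1))" using sub_shift[of "[A]" \<Gamma>] c by simp
  have 1: "A # \<Gamma> \<turnstile>\<^bsub>S\<^esub> EqType (shift 1 A) (shift 1 A')"
    using eq_type_subst[OF s assms] by (simp add: shift_eq_subst)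
  have c1: "ctxt S (shift 1 A # A # \<Gamma>)" using 1 eq_type_presup c by auto
  have s2: "sub S (shift 1 A # A # \<Gamma>) \<Gamma> (\<lambda>i. Var (i + 2))" using sub_shift[of "[shift 1 A, A]" \<Gamma>] c1 by (simp add: numeral_2_eq_2)
  have 2: "shift 1 A # A # \<Gamma> \<turnstile>\<^bsub>S\<^esub> EqType (shift 2 A) (shift 2 A')"
    using eq_type_subst[OF s2 assms] by (simp add: shift_eq_subst)
  have v0: "shift 1 A # A # \<Gamma> \<turnstile>\<^bsub>S\<^esub> EqTerm (Var 0) (Var 0) (shift 2 A)"
    using var_at[of "[]" "shift 1 A" "A # \<Gamma>"] c1 by (simp add: numeral_2_eq_2)
  have v1: "shift 1 A # A # \<Gamma> \<turnstile>\<^bsub>S\<^esub> EqTerm (Var 1) (Var 1) (shift 2 A)"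
    using var_at[of "[shift 1 A]" "A" "\<Gamma>"] c1 by (simp add: numeral_2_eq_2)
  show ?thesis using Id_cong[OF 2 v1 v0] 1 assms c by (simp add: id_tele_def ctxt_eq_refl)
qed

lemma diag_sub_eq:
  assumes "\<Gamma> \<turnstile>\<^bsub>S\<^esub> EqType A A'"
  shows "sub_eq S (A # \<Gamma>) (id_tele A @ \<Gamma>) (diag A) (diag A')"
proof -
  have c: "ctxt S (id_tele A @ \<Gamma>)" using id_tele_ctxt_eq[OF assms] ctxt_eq_ctxt1 by blast
  then have c': "ctxt S (A # \<Gamma>)" by (simp add: id_tele_def)
  have s: "sub S (A # \<Gamma>) \<Gamma> (\<lambda>i. Var (i + 1))" using sub_shift[of "[A]" \<Gamma>] c' by simp
  have 1: "A # \<Gamma> \<turnstile>\<^bsub>S\<^esub> EqType (shift 1 A) (shift 1 A')"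
    using eq_type_subst[OF s assms] by (simp add: shift_eq_subst)
  have v: "A # \<Gamma> \<turnstile>\<^bsub>S\<^esub> EqTerm (Var 0) (Var 0) (shift 1 A)"
    using var_at[of "[]" A \<Gamma>] c' by simp
  show ?thesis using c s v Refl_cong[OF 1 v] by (simp add: id_tele_def diag_def shift_eq_subst inst_def)
qed

text \<open>Congruence and computation have to be proved together. The type of the head component
  has the earlier components substituted into it, so on the diagonal the datum is given over
  \<open>s\<close> while the rule wants it over the restricted eliminators of the tail; only the
  computation rule for the tail identifies the two.\<close>

lemma J_tele_cong:
  assumes "ctxt_eq S (\<Theta> @ \<Delta> @ id_tele A @ \<Gamma>) (\<Theta>' @ \<Delta>' @ id_tele A' @ \<Gamma>)"
    "length \<Theta> = length \<Theta>'" "length \<Delta> = length \<Delta>'"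
    "elems_eq S (subst_tele (diag A) \<Delta> @ A # \<Gamma>) (subst_tele (lift_sub (length \<Delta>) (diag A)) \<Theta>) d d'"
  shows "elems_eq S (\<Delta> @ id_tele A @ \<Gamma>) \<Theta> (J_tele A \<Delta> \<Theta> d) (J_tele A' \<Delta>' \<Theta>' d') \<and>
    elems_eq S (subst_tele (diag A) \<Delta> @ A # \<Gamma>) (subst_tele (lift_sub (length \<Delta>) (diag A)) \<Theta>)
      (map (subst (lift_sub (length \<Delta>) (diag A))) (J_tele A \<Delta> \<Theta> d)) d"
  using assms(1,2,4)
proof (induction \<Theta> arbitrary: \<Theta>' d d')
  case Nil
  then show ?case by simp
next
  case (Cons D \<Theta>)
  let ?K = "\<Delta> @ id_tele A @ \<Gamma>" and ?L = "subst_tele (diag A) \<Delta> @ A # \<Gamma>"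
  let ?\<sigma> = "lift_sub (length \<Delta>) (diag A)"
  from Cons.prems(1,2) obtain D' \<Theta>'' where \<Theta>': "\<Theta>' = D' # \<Theta>''" "length \<Theta> = length \<Theta>''" by (cases \<Theta>') auto
  with Cons.prems(1) have c: "ctxt_eq S (\<Theta> @ ?K) (\<Theta>'' @ \<Delta>' @ id_tele A' @ \<Gamma>)" and D: "\<Theta> @ ?K \<turnstile>\<^bsub>S\<^esub> EqType D D'" by auto
  from Cons.prems(3) obtain a a' s s' where d: "d = a # s" "d' = a' # s'"
    and s: "elems_eq S ?L (subst_tele ?\<sigma> \<Theta>) s s'"
    and a: "?L \<turnstile>\<^bsub>S\<^esub> EqTerm a a' (subst (ext s Var) (subst (lift_sub (length \<Theta>) ?\<sigma>) D))"
    by (auto simp: elems_eq_Cons)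
  let ?j = "J_tele A \<Delta> \<Theta> s" and ?j' = "J_tele A' \<Delta>' \<Theta>'' s'"
  from Cons.IH[OF c \<Theta>'(2) s] have j: "elems_eq S ?K \<Theta> ?j ?j'"
    and js: "elems_eq S ?L (subst_tele ?\<sigma> \<Theta>) (map (subst ?\<sigma>) ?j) s" by auto
  have c\<Theta>: "ctxt S (\<Theta> @ ?K)" using c ctxt_eq_ctxt1 by blast
  have cK: "ctxt_eq S ?K (\<Delta>' @ id_tele A' @ \<Gamma>)" using ctxt_eq_appendD[OF c \<Theta>'(2)] .
  have lens: "length s = length \<Theta>" "length ?j = length \<Theta>"
    using elems_eq_length[OF s] elems_eq_length[OF j] by auto
  have "ctxt S (id_tele A @ \<Gamma>)" by (rule ctxt_appendD[OF ctxt_appendD[OF c\<Theta>]])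
  then have A: "\<Gamma> \<turnstile>\<^bsub>S\<^esub> EqType A A" by (auto simp: id_tele_def intro: eq_type_refl)
  have \<sigma>: "sub S ?L ?K ?\<sigma>" by (rule sub_eq_lift[OF diag_sub_eq[OF A]]) (rule ctxt_appendD[OF c\<Theta>])
  have c0: "ctxt S (subst_tele ?\<sigma> \<Theta> @ ?L)" using ctxt_subst[OF \<sigma> c\<Theta>] .
  let ?C = "subst (ext ?j Var) D" and ?C' = "subst (ext ?j' Var) D'"
  have C: "?K \<turnstile>\<^bsub>S\<^esub> EqType ?C ?C'" by (rule eq_type_subst[OF elems_eq_sub[OF c\<Theta> j] D])
  have C\<sigma>: "subst ?\<sigma> ?C = subst (ext (map (subst ?\<sigma>) ?j) ?\<sigma>) D" by simp
  have C\<sigma>': "subst ?\<sigma> ?C = subst (ext (map (subst ?\<sigma>) ?j) Var) (subst (lift_sub (length \<Theta>) ?\<sigma>) D)"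
    using lens by simp
  \<comment> \<open>The computation rule of the tail, read backwards, converts the type of
    \<open>a\<close> from the values \<open>s\<close> to the restricted eliminators.\<close>
  have "sub_eq S ?L (\<Theta> @ ?K) (ext s ?\<sigma>) (ext (map (subst ?\<sigma>) ?j) ?\<sigma>)"
    by (rule sub_eq_ext[OF \<sigma> c\<Theta> elems_eq_sym[OF c0 js]])
  then have "?L \<turnstile>\<^bsub>S\<^esub> EqType (subst (ext s ?\<sigma>) D) (subst ?\<sigma> ?C)"
    unfolding C\<sigma> by (rule eq_type_subst) (use D eq_type_presup eq_type_refl in blast)
  moreover have "subst (ext s Var) (subst (lift_sub (length \<Theta>) ?\<sigma>) D) = subst (ext s ?\<sigma>) D"
    using lens by simp
  ultimately have a': "?L \<turnstile>\<^bsub>S\<^esub> EqTerm a a' (subst ?\<sigma> ?C)" using a eq_conversion by metis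
  have "?K \<turnstile>\<^bsub>S\<^esub> EqTerm (J_gen A \<Delta> ?C a) (J_gen A' \<Delta>' ?C' a') ?C"
    by (rule J_cong[OF cK assms(3) C a'])
  moreover have "?L \<turnstile>\<^bsub>S\<^esub> EqTerm (subst ?\<sigma> (J_gen A \<Delta> ?C a)) a (subst ?\<sigma> ?C)"
    by (rule Id_comp) (use C a' eq_type_presup eq_term_presup in blast)+
  then have "?L \<turnstile>\<^bsub>S\<^esub> EqTerm (subst ?\<sigma> (J_gen A \<Delta> ?C a)) a
      (subst (ext (map (subst ?\<sigma>) ?j) Var) (subst (lift_sub (length \<Theta>) ?\<sigma>) D))"
    unfolding C\<sigma>' .
  ultimately show ?case using j js
    by (simp add: Let_def elems_eq_Cons inst_eq_ext d \<Theta>'(1) del: subst_subst)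
qed

end

text \<open>
  \<open>gen_ctx \<Phi> \<Gamma>\<close> is the context \<open>x : \<Phi>, x' : \<Phi>, p : Id\<^sub>\<Phi>(x, x')\<close> over \<open>\<Gamma>\<close>, and \<open>diag_ctx \<Phi>\<close> substitutes
  \<open>x, x, r(x)\<close> in it.  The remaining definitions name the parts of the recursive step of \<open>J_ctx\<close>: the
  post-context \<open>y, y', q\<close> and the renamings \<open>\<pi>\<close> and \<open>\<pi>'\<close>.
\<close>

definition gen_ctx :: "'c ctx \<Rightarrow> 'c ctx \<Rightarrow> 'c ctx" where
  "gen_ctx \<Phi> \<Gamma> = Id_ctx \<Phi> @ shift_tele (length \<Phi>) \<Phi> @ \<Phi> @ \<Gamma>"

definition diag_ctx :: "'c ctx \<Rightarrow> nat \<Rightarrow> 'c expr" where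
  "diag_ctx \<Phi> = ext (refl_ctx \<Phi> @ vars (length \<Phi>)) Var"

definition transp :: "'c ctx \<Rightarrow> 'c expr \<Rightarrow> 'c expr" where
  "transp \<Lambda> D = hd (transport \<Lambda> [D])"

text \<open>The second copy x' as a morphism from \<open>gen_ctx \<Phi> \<Gamma>\<close> to
  \<open>\<Phi> @ \<Gamma>\<close>. Below x' in index lie the \<open>n\<close> paths, whence
  \<open>i + n\<close>; an ambient index has to clear p, x' and x, which gives
  \<open>(i - n) + 3 * n\<close>.\<close>

definition right_sub :: "nat \<Rightarrow> nat \<Rightarrow> 'c expr" where
  "right_sub n i = Var (if i < n then i + n else i + 2 * n)"

definition post_tele :: "'c ctx \<Rightarrow> 'c expr \<Rightarrow> 'c ctx" where
  "post_tele \<Lambda> D = (let n = length \<Lambda> in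
    [IdT (shift (2 * n + 2) D) (Var 1) (subst (\<lambda>i. Var (if i = 0 then 0 else i + 1)) (transp \<Lambda> D)),
     subst (\<lambda>i. Var (if i < n then i + n + 1 else i + 2 * n + 1)) D, shift (2 * n) D])"

definition swap :: "nat \<Rightarrow> nat \<Rightarrow> nat" where
  "swap n i = (if i = 0 then 0
                  else if i \<le> n then i + 2
                  else if i = n + 1 then 1
                  else if i \<le> 2 * n + 1 then i + 1
                  else if i = 2 * n + 2 then 2
                  else i)"

definition unswap :: "nat \<Rightarrow> nat \<Rightarrow> nat" where
  "unswap n i = (if i = 0 then 0
                   else if i = 1 then n + 1
                   else if i = 2 then 2 * n + 2
                   else if i \<le> n + 2 then i - 2
                   else if i \<le> 2 * n + 2 then i - 1
                   else i)"

lemma refl_ctx_length [simp]: "length (refl_ctx \<Phi>) = length \<Phi>"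
  by (induction \<Phi>) auto

lemma Id_ctx_length [simp]: "length (Id_ctx \<Phi>) = length \<Phi>"
  by (induction \<Phi>) (auto simp: Let_def)

lemma swap_unswap [simp]: "swap n (unswap n i) = i" "unswap n (swap n i) = i"
  by (auto simp: swap_def unswap_def)

lemma post_tele_length [simp]: "length (post_tele \<Lambda> D) = 3"
  by (simp add: post_tele_def Let_def)

lemma Id_ctx_Cons:
  "Id_ctx (D # \<Lambda>) = (let n = length \<Lambda> in
     IdT (shift (2 * n + 2) D) (Var (2 * n + 1))
       (subst (\<lambda>i. Var (if i = 0 then n else if i \<le> n then i - 1 else if i \<le> 2 * n then i else i + 1)) (transp \<Lambda> D))
     # subst_tele (\<lambda>i. Var (if i < n then i + 1 else i + 2)) (Id_ctx \<Lambda>))"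
  by (simp add: Let_def transp_def rename_eq_subst)

lemma lift_ren_eq: "(\<lambda>i. Var (lift_ren m \<rho> i)) = lift_sub m (\<lambda>i. Var (\<rho> i))"
  by (auto simp: lift_sub_def)

lemma rename_eq: "rename \<rho> = subst (\<lambda>i. Var (\<rho> i))"
  by (rule ext) (rule rename_eq_subst)

text \<open>The recursion restated with substitutions in place of renamings, the form in which it
  can be typed. The substitution called \<open>diag_y\<close> in the definition is a composite:
  reorder by \<open>swap\<close>, then take the diagonal of \<open>\<Lambda>\<close> under the three
  variables y, y', q.\<close>

lemma J_ctx_Cons:
  fixes \<Lambda> :: "'c ctx"
  defines "n \<equiv> length \<Lambda>"
  shows "J_ctx (D # \<Lambda>) \<Delta> \<Theta> d = map (subst (lift_sub (length \<Delta>) (\<lambda>i. Var (unswap n i))))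
    (J_ctx \<Lambda> (subst_tele (\<lambda>i. Var (swap n i)) \<Delta> @ post_tele \<Lambda> D)
      (subst_tele (lift_sub (length \<Delta>) (\<lambda>i. Var (swap n i))) \<Theta>)
      (J_tele D (subst_tele (\<lambda>i. lift_sub 3 (diag_ctx \<Lambda>) (swap n i)) \<Delta>)
        (subst_tele (lift_sub (length \<Delta>) (\<lambda>i. lift_sub 3 (diag_ctx \<Lambda>) (swap n i))) \<Theta>) d))"
proof -
  have *: "(\<lambda>i. if i = 0 then Var 0
                       else if i \<le> n then shift 3 (refl_ctx \<Lambda> ! (i - 1))
                       else if i = n + 1 then Var 1
                       else if i \<le> 2 * n + 1 then Var (i - n + 1)
                       else Var (i - 2 * n)) = (\<lambda>i. lift_sub 3 (diag_ctx \<Lambda>) (swap n i))"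
    by (auto simp: fun_eq_iff lift_sub_def diag_ctx_def swap_def ext_def n_def)
  show ?thesis
    unfolding J_ctx.simps Let_def *[unfolded n_def] n_def
    by (simp only: swap_def[abs_def] unswap_def[abs_def] post_tele_def Let_def transp_def rename_eq lift_ren_eq)
qed

lemma transport_eq: "transport \<Lambda> [D] = J_ctx \<Lambda> [subst (right_sub (length \<Lambda>)) D] [shift (2 * length \<Lambda> + 1) D] [Var 0]"
  by (simp add: Let_def shift_tele_def right_sub_def[abs_def] shift_eq_subst vars_def ac_simps)

declare J_ctx.simps(2) [simp del] transport.simps [simp del] Id_ctx.simps(2) [simp del]

lemma map_subst_Var [simp]: "map (subst Var) d = d"
  by (simp add: map_idI)

text \<open>
  The elimination, congruence and computation rules of \<open>J_ctx\<close> have to be proved together: the type of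
  the generic path of \<open>D # \<Lambda>\<close> contains a transport, that is, an instance of \<open>J_ctx \<Lambda>\<close>.
\<close>

definition J_ctx_ok :: "'c type_theory \<Rightarrow> 'c ctx \<Rightarrow> 'c ctx \<Rightarrow> 'c ctx \<Rightarrow> bool" where
  "J_ctx_ok S \<Gamma> \<Phi> \<Phi>' \<longleftrightarrow> ctxt_eq S (gen_ctx \<Phi> \<Gamma>) (gen_ctx \<Phi>' \<Gamma>) \<and>
    sub_eq S (\<Phi> @ \<Gamma>) (gen_ctx \<Phi> \<Gamma>) (diag_ctx \<Phi>) (diag_ctx \<Phi>') \<and>
    (\<forall>\<Delta> \<Delta>' \<Theta> \<Theta>' d d'. length \<Theta> = length \<Theta>' \<longrightarrow> length \<Delta> = length \<Delta>' \<longrightarrow>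
      ctxt_eq S (\<Theta> @ \<Delta> @ gen_ctx \<Phi> \<Gamma>) (\<Theta>' @ \<Delta>' @ gen_ctx \<Phi>' \<Gamma>) \<longrightarrow>
      elems_eq S (subst_tele (diag_ctx \<Phi>) \<Delta> @ \<Phi> @ \<Gamma>) (subst_tele (lift_sub (length \<Delta>) (diag_ctx \<Phi>)) \<Theta>) d d' \<longrightarrow>
      elems_eq S (\<Delta> @ gen_ctx \<Phi> \<Gamma>) \<Theta> (J_ctx \<Phi> \<Delta> \<Theta> d) (J_ctx \<Phi>' \<Delta>' \<Theta>' d') \<and>
      elems_eq S (subst_tele (diag_ctx \<Phi>) \<Delta> @ \<Phi> @ \<Gamma>) (subst_tele (lift_sub (length \<Delta>) (diag_ctx \<Phi>)) \<Theta>)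
        (map (subst (lift_sub (length \<Delta>) (diag_ctx \<Phi>))) (J_ctx \<Phi> \<Delta> \<Theta> d)) d)"

lemma diag_ctx_add [simp]: "length \<Phi> = n \<Longrightarrow> diag_ctx \<Phi> (i + n) = (if i < n then Var i else Var (i - n))"
  by (auto simp: diag_ctx_def ext_def)

lemma map_upt_shift: "map f [k..<k + n] = map (\<lambda>i. f (i + k)) [0..<n]"
  by (rule nth_equalityI) (auto simp: ac_simps)

context dependent_type_theory
begin

lemma sub_shift': "ctxt S (\<Xi> @ \<Gamma>) \<Longrightarrow> length \<Xi> = m \<Longrightarrow> sub S (\<Xi> @ \<Gamma>) \<Gamma> (\<lambda>i. Var (i + m))"
  using sub_shift by blast

lemma right_sub_typed:
  assumes "ctxt S (gen_ctx \<Phi> \<Gamma>)" "length \<Phi> = n"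
  shows "sub S (gen_ctx \<Phi> \<Gamma>) (\<Phi> @ \<Gamma>) (right_sub n)"
proof -
  have three: "3 * n = n + (n + n)" by simp
  have s: "sub S (gen_ctx \<Phi> \<Gamma>) \<Gamma> (\<lambda>i. Var (i + 3 * n))"
    using sub_shift'[of "Id_ctx \<Phi> @ shift_tele n \<Phi> @ \<Phi>" \<Gamma> "3 * n"] assms by (simp add: gen_ctx_def)
  have c: "ctxt S (\<Phi> @ \<Gamma>)"
    using assms ctxt_appendD[of S "Id_ctx \<Phi> @ shift_tele n \<Phi>" "\<Phi> @ \<Gamma>"] by (simp add: gen_ctx_def)
  have "elems_eq S (gen_ctx \<Phi> \<Gamma>) (subst_tele (\<lambda>i. Var (i + (n + n))) (shift_tele n \<Phi>)) (map Var [n..<n+n]) (map Var [n..<n+n])"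
    using elems_vars[of "Id_ctx \<Phi>" "shift_tele n \<Phi>" "\<Phi> @ \<Gamma>" n n] assms by (simp add: gen_ctx_def)
  then have "elems_eq S (gen_ctx \<Phi> \<Gamma>) (subst_tele (\<lambda>i. Var (i + 3 * n)) \<Phi>) (map Var [n..<n+n]) (map Var [n..<n+n])"
    unfolding three by (simp add: ac_simps)
  from sub_eq_ext[OF s c this] have "sub S (gen_ctx \<Phi> \<Gamma>) (\<Phi> @ \<Gamma>) (ext (map Var [n..<n+n]) (\<lambda>i. Var (i + 3 * n)))" .
  moreover have "ext (map Var [n..<n+n]) (\<lambda>i. Var (i + 3 * n)) = (right_sub n :: nat \<Rightarrow> 'c expr)"
    by (auto simp: ext_def right_sub_def fun_eq_iff)
  ultimately show ?thesis by (simp only:)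
qed

lemma left_sub_typed:
  assumes "ctxt S (gen_ctx \<Phi> \<Gamma>)" "length \<Phi> = n"
  shows "sub S (gen_ctx \<Phi> \<Gamma>) (\<Phi> @ \<Gamma>) (\<lambda>i. Var (i + 2 * n))"
  using sub_shift[of "Id_ctx \<Phi> @ shift_tele n \<Phi>" "\<Phi> @ \<Gamma>"] assms by (simp add: gen_ctx_def mult_2)

text \<open>The layout is that of \<open>gen_ctx (D # \<Lambda>) \<Gamma>\<close>, innermost first:
  the path q, the \<open>n\<close> paths p, then y', x', y and the rest \<open>B\<close>. Typing of
  a renaming is thereby reduced to one condition per block.\<close>

lemma sub_ren_blocks:
  assumes "ctxt S (Q # P @ Y # X @ D # B)" "length P = n" "length X = n"
    and B: "sub S K B (\<lambda>i. Var (\<rho> (i + (2 * n + 3))))"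
    and D: "K \<turnstile>\<^bsub>S\<^esub> EqTerm (Var (\<rho> (2 * n + 2))) (Var (\<rho> (2 * n + 2))) (subst (\<lambda>i. Var (\<rho> (i + (2 * n + 3)))) D)"
    and X: "elems_eq S K (subst_tele (\<lambda>i. Var (\<rho> (i + (2 * n + 2)))) X) (map (\<lambda>i. Var (\<rho> i)) [n + 2..<n + 2 + n]) (map (\<lambda>i. Var (\<rho> i)) [n + 2..<n + 2 + n])"
    and Y: "K \<turnstile>\<^bsub>S\<^esub> EqTerm (Var (\<rho> (n + 1))) (Var (\<rho> (n + 1))) (subst (\<lambda>i. Var (\<rho> (i + (n + 2)))) Y)"
    and P: "elems_eq S K (subst_tele (\<lambda>i. Var (\<rho> (i + (n + 1)))) P) (map (\<lambda>i. Var (\<rho> i)) [1..<1 + n]) (map (\<lambda>i. Var (\<rho> i)) [1..<1 + n])"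
    and Q: "K \<turnstile>\<^bsub>S\<^esub> EqTerm (Var (\<rho> 0)) (Var (\<rho> 0)) (subst (\<lambda>i. Var (\<rho> (i + 1))) Q)"
  shows "sub S K (Q # P @ Y # X @ D # B) (\<lambda>i. Var (\<rho> i))"
proof -
  have m: "map (\<lambda>i. Var (\<rho> i)) [k..<k + n] = map (\<lambda>i. Var (\<rho> (i + k))) [0..<n]" for k
    by (rule map_upt_shift)
  have c2: "ctxt S (P @ Y # X @ D # B)" using assms(1) by simp
  then have c: "ctxt S (X @ D # B)" "ctxt S (P @ Y # X @ D # B)"
    using ctxt_appendD[OF c2] by auto
  have "sub S K (D # B) (\<lambda>i. Var (\<rho> (i + (2 * n + 2))))"
    using B D ctxt_appendD[OF c(1)] by (simp add: numeral_3_eq_3)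
  with c X have "sub S K (X @ D # B) (\<lambda>i. Var (\<rho> (i + (n + 2))))"
    unfolding m mult_2 by (simp add: sub_eq_append_iff[OF assms(3)] ac_simps)
  with Y c ctxt_appendD[OF c(2)] have "sub S K (Y # X @ D # B) (\<lambda>i. Var (\<rho> (i + (n + 1))))"
    by simp
  with c P have "sub S K (P @ Y # X @ D # B) (\<lambda>i. Var (\<rho> (i + 1)))"
    unfolding m by (simp add: sub_eq_append_iff[OF assms(2)] ac_simps)
  with Q assms(1) show ?thesis by simp
qed

text \<open>The counterpart for the layout of
  \<open>post_tele \<Lambda> D @ gen_ctx \<Lambda> \<Gamma>\<close>, innermost first: q, y', y, then
  p, x' and the rest.\<close>

lemma sub_ren_blocks':
  assumes "ctxt S (Q # Y # D # P @ X @ B)" "length P = n" "length X = n"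
    and B: "sub S K B (\<lambda>i. Var (\<rho> (i + (2 * n + 3))))"
    and X: "elems_eq S K (subst_tele (\<lambda>i. Var (\<rho> (i + (2 * n + 3)))) X) (map (\<lambda>i. Var (\<rho> i)) [n + 3..<n + 3 + n]) (map (\<lambda>i. Var (\<rho> i)) [n + 3..<n + 3 + n])"
    and P: "elems_eq S K (subst_tele (\<lambda>i. Var (\<rho> (i + (n + 3)))) P) (map (\<lambda>i. Var (\<rho> i)) [3..<3 + n]) (map (\<lambda>i. Var (\<rho> i)) [3..<3 + n])"
    and D: "K \<turnstile>\<^bsub>S\<^esub> EqTerm (Var (\<rho> 2)) (Var (\<rho> 2)) (subst (\<lambda>i. Var (\<rho> (i + 3))) D)"
    and Y: "K \<turnstile>\<^bsub>S\<^esub> EqTerm (Var (\<rho> 1)) (Var (\<rho> 1)) (subst (\<lambda>i. Var (\<rho> (i + 2))) Y)"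
    and Q: "K \<turnstile>\<^bsub>S\<^esub> EqTerm (Var (\<rho> 0)) (Var (\<rho> 0)) (subst (\<lambda>i. Var (\<rho> (i + 1))) Q)"
  shows "sub S K (Q # Y # D # P @ X @ B) (\<lambda>i. Var (\<rho> i))"
proof -
  have m: "map (\<lambda>i. Var (\<rho> i)) [k..<k + n] = map (\<lambda>i. Var (\<rho> (i + k))) [0..<n]" for k
    by (rule map_upt_shift)
  have c: "ctxt S (P @ X @ B)" using assms(1) by simp
  have c': "ctxt S (X @ B)" by (rule ctxt_appendD[OF c])
  from B X c' have "sub S K (X @ B) (\<lambda>i. Var (\<rho> (i + (n + 3))))"
    unfolding m mult_2 by (simp add: sub_eq_append_iff[OF assms(3)] ac_simps)
  with c P have "sub S K (P @ X @ B) (\<lambda>i. Var (\<rho> (i + 3)))"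
    unfolding m by (simp add: sub_eq_append_iff[OF assms(2)] ac_simps)
  with D Y Q assms(1) show ?thesis by (simp add: numeral_3_eq_3 numeral_2_eq_2)
qed

end

section \<open>Identity contexts: the step from \<Lambda> to its extension by D\<close>

context identity_types
begin

context
  fixes \<Gamma> \<Lambda> \<Lambda>' :: "'c ctx" and D D' :: "'c expr" and n
  assumes ok: "J_ctx_ok S \<Gamma> \<Lambda> \<Lambda>'" and DD: "\<Lambda> @ \<Gamma> \<turnstile>\<^bsub>S\<^esub> EqType D D'"
    and n: "length \<Lambda> = n" "length \<Lambda>' = n" and \<Lambda>\<Lambda>: "ctxt_eq S (\<Lambda> @ \<Gamma>) (\<Lambda>' @ \<Gamma>)"
begin

lemma gen_eq: "ctxt_eq S (gen_ctx \<Lambda> \<Gamma>) (gen_ctx \<Lambda>' \<Gamma>)"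
  using ok by (simp add: J_ctx_ok_def)

lemma gen_step_ctxt: "ctxt S (gen_ctx \<Lambda> \<Gamma>)"
  using gen_eq ctxt_eq_ctxt1 by blast

lemma D_ctxt: "ctxt S (D # \<Lambda> @ \<Gamma>)"
  using DD eq_type_presup in_context by auto

lemma diag_eq: "sub_eq S (\<Lambda> @ \<Gamma>) (gen_ctx \<Lambda> \<Gamma>) (diag_ctx \<Lambda>) (diag_ctx \<Lambda>')"
  using ok by (simp add: J_ctx_ok_def)

lemma tr_dom_eq: "gen_ctx \<Lambda> \<Gamma> \<turnstile>\<^bsub>S\<^esub> EqType (subst (right_sub n) D) (subst (right_sub n) D')"
  using eq_type_subst[OF right_sub_typed[OF gen_step_ctxt n(1)] DD] .

lemma tr_dom_ctxt: "ctxt S (subst (right_sub n) D # gen_ctx \<Lambda> \<Gamma>)"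
  using tr_dom_eq eq_type_presup gen_step_ctxt by auto

lemma right_diag: "subst (diag_ctx \<Lambda>) (subst (right_sub n) D) = D"
  using n by (auto simp: right_sub_def[abs_def] mult_2 add.assoc[symmetric] intro!: subst_VarI)

text \<open>Transport is the elimination over \<open>\<Lambda>\<close> whose datum on the diagonal
  is the variable z itself, so congruence and computation are read off from the assumption on
  \<open>\<Lambda>\<close>. They are what is needed to form the type of the last generic
  path.\<close>

lemma transp_props:
  "subst (right_sub n) D # gen_ctx \<Lambda> \<Gamma> \<turnstile>\<^bsub>S\<^esub> EqTerm (transp \<Lambda> D) (transp \<Lambda>' D') (shift (2 * n + 1) D)"
  "D # \<Lambda> @ \<Gamma> \<turnstile>\<^bsub>S\<^esub> EqTerm (subst (lift_sub 1 (diag_ctx \<Lambda>)) (transp \<Lambda> D)) (Var 0) (shift 1 D)"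
proof -
  let ?Z = "subst (right_sub n) D" and ?Z' = "subst (right_sub n) D'"
  have "sub S (?Z # gen_ctx \<Lambda> \<Gamma>) (\<Lambda> @ \<Gamma>) (\<lambda>i. Var (i + (2 * n + 1)))"
    using sub_shift'[of "?Z # Id_ctx \<Lambda> @ shift_tele n \<Lambda>" "\<Lambda> @ \<Gamma>" "2 * n + 1"] tr_dom_ctxt n by (simp add: gen_ctx_def)
  from eq_type_subst[OF this DD] have "?Z # gen_ctx \<Lambda> \<Gamma> \<turnstile>\<^bsub>S\<^esub> EqType (shift (2 * n + 1) D) (shift (2 * n + 1) D')"
    by (simp add: shift_eq_subst)
  then have c: "ctxt_eq S ([shift (2 * n + 1) D] @ [?Z] @ gen_ctx \<Lambda> \<Gamma>) ([shift (2 * n + 1) D'] @ [?Z'] @ gen_ctx \<Lambda>' \<Gamma>)"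
    using tr_dom_eq gen_eq by simp
  have D: "subst (lift_sub 1 (diag_ctx \<Lambda>)) (shift (2 * n + 1) D) = shift 1 D"
  proof -
    have "subst (lift_sub 1 (diag_ctx \<Lambda>)) (shift (2 * n + 1) D) = subst (\<lambda>i. lift_sub 1 (diag_ctx \<Lambda>) (i + (2 * n + 1))) D" by simp
    also have "(\<lambda>i. lift_sub 1 (diag_ctx \<Lambda>) (i + (2 * n + 1))) = (\<lambda>i. Var (i + 1))"
      using n by (auto simp: lift_sub_def mult_2 add.assoc[symmetric])
    finally show ?thesis by (simp add: shift_eq_subst)
  qed
  have d: "elems_eq S (subst_tele (diag_ctx \<Lambda>) [?Z] @ \<Lambda> @ \<Gamma>) (subst_tele (lift_sub (length [?Z]) (diag_ctx \<Lambda>)) [shift (2 * n + 1) D]) [Var 0] [Var 0]"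
    using var_at[of "[]" D "\<Lambda> @ \<Gamma>" 0] D_ctxt D right_diag by (simp add: elems_eq_Cons shift_eq_subst)
  from ok have "elems_eq S ([?Z] @ gen_ctx \<Lambda> \<Gamma>) [shift (2 * n + 1) D] (transport \<Lambda> [D]) (transport \<Lambda>' [D']) \<and>
      elems_eq S (subst_tele (diag_ctx \<Lambda>) [?Z] @ \<Lambda> @ \<Gamma>) (subst_tele (lift_sub (length [?Z]) (diag_ctx \<Lambda>)) [shift (2 * n + 1) D])
        (map (subst (lift_sub (length [?Z]) (diag_ctx \<Lambda>))) (transport \<Lambda> [D])) [Var 0]"
    unfolding J_ctx_ok_def transport_eq n using c d by (metis length_Cons)
  then show "?Z # gen_ctx \<Lambda> \<Gamma> \<turnstile>\<^bsub>S\<^esub> EqTerm (transp \<Lambda> D) (transp \<Lambda>' D') (shift (2 * n + 1) D)"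
    "D # \<Lambda> @ \<Gamma> \<turnstile>\<^bsub>S\<^esub> EqTerm (subst (lift_sub 1 (diag_ctx \<Lambda>)) (transp \<Lambda> D)) (Var 0) (shift 1 D)"
    using D right_diag by (auto simp: transp_def elems_eq_Cons shift_eq_subst)
qed

lemma post_eq: "ctxt_eq S (post_tele \<Lambda> D @ gen_ctx \<Lambda> \<Gamma>) (post_tele \<Lambda>' D' @ gen_ctx \<Lambda>' \<Gamma>)"
proof -
  let ?G = "gen_ctx \<Lambda> \<Gamma>" and ?D1 = "shift (2 * n) D" and ?D1' = "shift (2 * n) D'"
  let ?y = "\<lambda>i. Var (if i < n then i + n + 1 else i + 2 * n + 1)"
  have 1: "?G \<turnstile>\<^bsub>S\<^esub> EqType ?D1 ?D1'"
    using eq_type_subst[OF left_sub_typed[OF gen_step_ctxt n(1)] DD] by (simp add: shift_eq_subst)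
  then have c1: "ctxt S (?D1 # ?G)" using eq_type_presup gen_step_ctxt by auto
  have W: "sub S (?D1 # ?G) ?G (\<lambda>i. Var (i + 1))" using sub_shift'[of "[?D1]" ?G 1] c1 by simp
  have y: "(\<lambda>i. subst (\<lambda>i. Var (i + 1)) (right_sub n i)) = ?y" by (auto simp: right_sub_def)
  have "sub S (?D1 # ?G) (\<Lambda> @ \<Gamma>) ?y"
    using sub_eq_comp[OF W right_sub_typed[OF gen_step_ctxt n(1)]] unfolding y .
  from eq_type_subst[OF this DD] have 2: "?D1 # ?G \<turnstile>\<^bsub>S\<^esub> EqType (subst ?y D) (subst ?y D')" .
  then have c2: "ctxt S (subst ?y D # ?D1 # ?G)" using eq_type_presup c1 by auto
  have z: "lift_sub 1 (\<lambda>i. Var (i + 1)) = (\<lambda>i. Var (if i = 0 then 0 else i + 1))"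
    by (auto simp: lift_sub_def fun_eq_iff)
  have W2: "sub S (subst ?y D # ?D1 # ?G) (subst (right_sub n) D # ?G) (\<lambda>i. Var (if i = 0 then 0 else i + 1))"
  proof -
    have e: "subst (\<lambda>i. Var (i + 1)) (subst (right_sub n) D) = subst ?y D" by (simp only: subst_subst y)
    have "ctxt S ([subst (right_sub n) D] @ ?G)" using tr_dom_ctxt by simp
    from sub_eq_lift[OF W this] show ?thesis
      by (simp only: subst_tele.simps list.size lift_sub_0 e append.simps add_0 z One_nat_def[symmetric])
  qed
  have sz: "subst (\<lambda>i. Var (if i = 0 then 0 else i + 1)) (shift (2 * n + 1) D) = shift (2 * n + 2) D"
    by (simp add: shift_eq_subst)
  have 3: "subst ?y D # ?D1 # ?G \<turnstile>\<^bsub>S\<^esub> EqTerm (subst (\<lambda>i. Var (if i = 0 then 0 else i + 1)) (transp \<Lambda> D))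
      (subst (\<lambda>i. Var (if i = 0 then 0 else i + 1)) (transp \<Lambda>' D')) (shift (2 * n + 2) D)"
    using eq_term_subst[OF W2 transp_props(1)] unfolding sz .
  have 4: "subst ?y D # ?D1 # ?G \<turnstile>\<^bsub>S\<^esub> EqTerm (Var 1) (Var 1) (shift (2 * n + 2) D)"
    using var_at[of "[subst ?y D]" ?D1 ?G 1] c2 by simp
  have "sub S (subst ?y D # ?D1 # ?G) (\<Lambda> @ \<Gamma>) (\<lambda>i. Var (i + (2 * n + 2)))"
    using sub_shift'[of "subst ?y D # ?D1 # Id_ctx \<Lambda> @ shift_tele n \<Lambda>" "\<Lambda> @ \<Gamma>" "2 * n + 2"] c2 n by (simp add: gen_ctx_def)
  from eq_type_subst[OF this DD]
  have 5: "subst ?y D # ?D1 # ?G \<turnstile>\<^bsub>S\<^esub> EqType (shift (2 * n + 2) D) (shift (2 * n + 2) D')" by (simp add: shift_eq_subst)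
  show ?thesis using Id_cong[OF 5 4 3] 1 2 gen_eq by (simp add: post_tele_def n)
qed

text \<open>On the diagonal of \<open>\<Lambda>\<close> the transport in the type of q is the
  identity only definitionally, not literally. The restricted post-context is therefore the generic
  context of the single type \<open>D\<close> up to conversion; at this point the two eliminations
  of the recursion fit together.\<close>

lemma diag_post: "ctxt_eq S (id_tele D @ \<Lambda> @ \<Gamma>) (subst_tele (diag_ctx \<Lambda>) (post_tele \<Lambda> D) @ \<Lambda> @ \<Gamma>)"
proof -
  have DD': "\<Lambda> @ \<Gamma> \<turnstile>\<^bsub>S\<^esub> EqType D D" using DD eq_type_presup eq_type_refl by blast
  have c: "ctxt S (shift 1 D # D # \<Lambda> @ \<Gamma>)"
    using id_tele_ctxt_eq[OF DD'] ctxt_eq_ctxt1 by (fastforce simp: id_tele_def)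
  have e1: "subst (diag_ctx \<Lambda>) (shift (2 * n) D) = D"
    using n by (auto simp: mult_2 add.assoc[symmetric] intro!: subst_VarI)
  have e2: "subst (lift_sub 1 (diag_ctx \<Lambda>)) (subst (\<lambda>i. Var (if i < n then i + n + 1 else i + 2 * n + 1)) D) = shift 1 D"
  proof -
    have "(\<lambda>i. lift_sub 1 (diag_ctx \<Lambda>) (if i < n then i + n + 1 else i + 2 * n + 1)) = (\<lambda>i. Var (i + 1))"
      using n by (auto simp: lift_sub_def mult_2 add.assoc[symmetric])
    then show ?thesis by (simp add: shift_eq_subst)
  qed
  have e3: "subst (lift_sub 2 (diag_ctx \<Lambda>)) (shift (2 * n + 2) D) = shift 2 D"
  proof -
    have "(\<lambda>i. lift_sub 2 (diag_ctx \<Lambda>) (i + (2 * n + 2))) = (\<lambda>i. Var (i + 2))"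
      using n by (auto simp: lift_sub_def mult_2 add.assoc[symmetric])
    then show ?thesis by (simp add: shift_eq_subst)
  qed
  let ?K = "shift 1 D # D # \<Lambda> @ \<Gamma>"
  have "sub S (D # \<Lambda> @ \<Gamma>) (\<Lambda> @ \<Gamma>) (\<lambda>i. Var (i + 1))" using sub_shift'[of "[D]" "\<Lambda> @ \<Gamma>" 1] D_ctxt by simp
  from sub_eq_lift[OF this, of "[D]"] D_ctxt
  have "sub S ?K (D # \<Lambda> @ \<Gamma>) (lift_sub 1 (\<lambda>i. Var (i + 1)))" by (simp add: shift_eq_subst)
  from eq_term_subst[OF this transp_props(2)]
  have 1: "?K \<turnstile>\<^bsub>S\<^esub> EqTerm (subst (lift_sub 1 (\<lambda>i. Var (i + 1))) (subst (lift_sub 1 (diag_ctx \<Lambda>)) (transp \<Lambda> D))) (Var 0) (shift 2 D)"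
    by (simp add: lift_sub_def shift_eq_subst)
  have e4: "(\<lambda>i. subst (lift_sub 1 (\<lambda>i. Var (i + 1))) (lift_sub 1 (diag_ctx \<Lambda>) i)) =
     (\<lambda>i. subst (lift_sub 2 (diag_ctx \<Lambda>)) (Var (if i = 0 then 0 else i + 1)))"
    by (auto simp: fun_eq_iff lift_sub_def shift_eq_subst)
  have "subst (lift_sub 2 (diag_ctx \<Lambda>)) (subst (\<lambda>i. Var (if i = 0 then 0 else i + 1)) (transp \<Lambda> D)) =
    subst (lift_sub 1 (\<lambda>i. Var (i + 1))) (subst (lift_sub 1 (diag_ctx \<Lambda>)) (transp \<Lambda> D))"
    unfolding subst_subst e4 ..
  with 1 have 2: "?K \<turnstile>\<^bsub>S\<^esub> EqTerm (Var 0) (subst (lift_sub 2 (diag_ctx \<Lambda>)) (subst (\<lambda>i. Var (if i = 0 then 0 else i + 1)) (transp \<Lambda> D))) (shift 2 D)"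
    using eq_term_sym by metis
  have 3: "?K \<turnstile>\<^bsub>S\<^esub> EqTerm (Var 1) (Var 1) (shift 2 D)"
    using var_at[of "[shift 1 D]" D "\<Lambda> @ \<Gamma>" 1] c by (simp add: numeral_2_eq_2)
  have 4: "?K \<turnstile>\<^bsub>S\<^esub> EqType (shift 2 D) (shift 2 D)"
    using 3 eq_term_presup has_type_presup eq_type_refl by blast
  have v: "subst (lift_sub 2 (diag_ctx \<Lambda>)) (Var 1) = Var 1" by (simp add: lift_sub_def)
  have "subst_tele (diag_ctx \<Lambda>) (post_tele \<Lambda> D) =
    [IdT (shift 2 D) (Var 1) (subst (lift_sub 2 (diag_ctx \<Lambda>)) (subst (\<lambda>i. Var (if i = 0 then 0 else i + 1)) (transp \<Lambda> D))), shift 1 D, D]"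
    unfolding post_tele_def Let_def n subst_tele.simps list.size
    using e1 e2 e3 v by (simp add: numeral_2_eq_2 del: subst_subst subst_shift)
  then show ?thesis using Id_cong[OF 4 3 2] c by (simp add: id_tele_def ctxt_eq_refl eq_type_refl del: subst_subst)
qed

lemma gen_Cons: "gen_ctx (D # \<Lambda>) \<Gamma> =
    IdT (shift (2 * n + 2) D) (Var (2 * n + 1))
       (subst (\<lambda>i. Var (if i = 0 then n else if i \<le> n then i - 1 else if i \<le> 2 * n then i else i + 1)) (transp \<Lambda> D))
     # subst_tele (\<lambda>i. Var (if i < n then i + 1 else i + 2)) (Id_ctx \<Lambda>) @
     subst (lift_sub n (\<lambda>i. Var (i + (n + 1)))) D # subst_tele (\<lambda>i. Var (i + (n + 1))) \<Lambda> @ D # \<Lambda> @ \<Gamma>"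
  by (simp add: gen_ctx_def Id_ctx_Cons Let_def n shift_tele_def)

lemma gen_Cons_eq: "ctxt_eq S (gen_ctx (D # \<Lambda>) \<Gamma>) (gen_ctx (D' # \<Lambda>') \<Gamma>)"
proof -
  let ?B = "D # \<Lambda> @ \<Gamma>"
  \<comment> \<open>In \<open>?a\<close>, which moves the data of \<open>\<Lambda>\<close> to the
    order x, y, x', y', a variable of x' has to step over y' only, every other one over both y' and
    y. The map \<open>?r\<close> weakens the ambient context past x and y.\<close>
  let ?r = "\<lambda>i. Var (i + (n + 1))" and ?a = "\<lambda>i. Var (if i < n then i + 1 else i + 2)"
  let ?Y = "subst (lift_sub n ?r) D" and ?X = "subst_tele ?r \<Lambda>" and ?P = "subst_tele ?a (Id_ctx \<Lambda>)"
  let ?Y' = "subst (lift_sub n ?r) D'" and ?X' = "subst_tele ?r \<Lambda>'" and ?P' = "subst_tele ?a (Id_ctx \<Lambda>')"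
  have cB: "ctxt_eq S ?B (D' # \<Lambda>' @ \<Gamma>)" using \<Lambda>\<Lambda> DD by simp
  have "sub S ?B \<Gamma> ?r" using sub_shift'[of "D # \<Lambda>" \<Gamma> "n + 1"] D_ctxt n by simp
  from ctxt_eq_subst_eq[OF this, of "D # \<Lambda>" "D' # \<Lambda>'" \<Gamma>] cB n
  have YX: "ctxt_eq S (?Y # ?X @ ?B) (?Y' # ?X' @ ?B)" by simp
  then have cYX: "ctxt S (?Y # ?X @ ?B)" by (rule ctxt_eq_ctxt1)
  have s: "sub S (?Y # ?X @ ?B) (\<Lambda> @ \<Gamma>) (\<lambda>i. Var (i + (n + 2)))"
    using sub_shift'[of "?Y # ?X @ [D]" "\<Lambda> @ \<Gamma>" "n + 2"] cYX n by simp
  have "elems_eq S (?Y # ?X @ ?B) (subst_tele (\<lambda>i. Var (i + (1 + n))) ?X) (map Var [1..<1 + n]) (map Var [1..<1 + n])"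
    using elems_vars[of "[?Y]" ?X ?B 1 n] cYX n by simp
  moreover have "subst_tele (\<lambda>i. Var (i + (1 + n))) ?X = subst_tele (\<lambda>i. Var (i + (n + 2))) (shift_tele n \<Lambda>)"
    by (simp add: ac_simps)
  ultimately have e: "elems_eq S (?Y # ?X @ ?B) (subst_tele (\<lambda>i. Var (i + (n + 2))) (shift_tele n \<Lambda>)) (map Var [1..<1 + n]) (map Var [1..<1 + n])"
    by (simp only:)
  have cg: "ctxt S (shift_tele n \<Lambda> @ \<Lambda> @ \<Gamma>)" using gen_step_ctxt ctxt_appendD by (auto simp: gen_ctx_def n)
  have "ext (map Var [1..<1 + n]) (\<lambda>i. Var (i + (n + 2))) = (?a :: nat \<Rightarrow> 'c expr)" by (auto simp: ext_def fun_eq_iff simp del: upt_Suc)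
  with sub_eq_ext[OF s cg e] have a: "sub S (?Y # ?X @ ?B) (shift_tele n \<Lambda> @ \<Lambda> @ \<Gamma>) ?a" by (simp only:)
  have g: "ctxt_eq S (Id_ctx \<Lambda> @ shift_tele n \<Lambda> @ \<Lambda> @ \<Gamma>) (Id_ctx \<Lambda>' @ shift_tele n \<Lambda>' @ \<Lambda>' @ \<Gamma>)"
    using gen_eq by (simp add: gen_ctx_def n)
  have P: "ctxt_eq S (?P @ ?Y # ?X @ ?B) (?P' @ ?Y # ?X @ ?B)"
    using ctxt_eq_subst_eq[OF a g] n by simp
  let ?K = "?P @ ?Y # ?X @ ?B"
  have cK: "ctxt S ?K" using P by (rule ctxt_eq_ctxt1)
  have la: "sub S ?K (gen_ctx \<Lambda> \<Gamma>) (lift_sub n ?a)"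
    using sub_eq_lift[OF a ctxt_eq_ctxt1[OF g]] n by (simp add: gen_ctx_def)
  have f: "(\<lambda>i. subst (lift_sub n ?a) (right_sub n i)) = (\<lambda>i. Var (if i < n then i + n + 1 else i + 2 * n + 2))"
    by (auto simp: right_sub_def lift_sub_def)
  have f': "(\<lambda>i. lift_sub n ?r (i)) = (\<lambda>i. Var (if i < n then i else i + n + 1))"
    by (auto simp: lift_sub_def)
  have "?K \<turnstile>\<^bsub>S\<^esub> EqTerm (Var n) (Var n) (shift (Suc n) ?Y)"
    using var_at[of ?P ?Y "?X @ ?B" n] cK n by simp
  moreover have "shift (Suc n) ?Y = subst (lift_sub n ?a) (subst (right_sub n) D)"
  proof -
    have "(\<lambda>i. shift (Suc n) (Var (if i < n then i else i + n + 1) :: 'c expr)) = (\<lambda>i. Var (if i < n then i + n + 1 else i + 2 * n + 2))" by auto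
    then show ?thesis unfolding subst_subst f shift_subst f' by (simp only:)
  qed
  ultimately have "?K \<turnstile>\<^bsub>S\<^esub> EqTerm (Var n) (Var n) (subst (lift_sub n ?a) (subst (right_sub n) D))" by (simp only:)
  then have "elems_eq S ?K (subst_tele (lift_sub n ?a) [subst (right_sub n) D]) [Var n] [Var n]"
    by (simp add: elems_eq_Cons)
  from sub_eq_ext[OF la _ this] tr_dom_ctxt
  have "sub S ?K (subst (right_sub n) D # gen_ctx \<Lambda> \<Gamma>) (ext [Var n] (lift_sub n ?a))" by simp
  moreover have "ext [Var n] (lift_sub n ?a) = (\<lambda>i. Var (if i = 0 then n else if i \<le> n then i - 1 else if i \<le> 2 * n then i else i + 1) :: 'c expr)" (is "_ = ?h")
    by (auto simp: ext_def lift_sub_def fun_eq_iff)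
  ultimately have h: "sub S ?K (subst (right_sub n) D # gen_ctx \<Lambda> \<Gamma>) ?h" by (simp only:)
  have sh: "subst ?h (shift (2 * n + 1) D) = shift (2 * n + 2) D" by (simp add: shift_eq_subst)
  have 1: "?K \<turnstile>\<^bsub>S\<^esub> EqTerm (subst ?h (transp \<Lambda> D)) (subst ?h (transp \<Lambda>' D')) (shift (2 * n + 2) D)"
    using eq_term_subst[OF h transp_props(1)] unfolding sh .
  have 2: "?K \<turnstile>\<^bsub>S\<^esub> EqTerm (Var (2 * n + 1)) (Var (2 * n + 1)) (shift (2 * n + 2) D)"
    using var_at[of "?P @ ?Y # ?X" D "\<Lambda> @ \<Gamma>" "2 * n + 1"] cK n by simp
  have "sub S ?K (\<Lambda> @ \<Gamma>) (\<lambda>i. Var (i + (2 * n + 2)))"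
    using sub_shift'[of "?P @ ?Y # ?X @ [D]" "\<Lambda> @ \<Gamma>" "2 * n + 2"] cK n by simp
  from eq_type_subst[OF this DD] have 3: "?K \<turnstile>\<^bsub>S\<^esub> EqType (shift (2 * n + 2) D) (shift (2 * n + 2) D')" by (simp add: shift_eq_subst)
  let ?Q = "IdT (shift (2 * n + 2) D) (Var (2 * n + 1)) (subst ?h (transp \<Lambda> D))"
  let ?Q' = "IdT (shift (2 * n + 2) D') (Var (2 * n + 1)) (subst ?h (transp \<Lambda>' D'))"
  have Q: "ctxt_eq S (?Q # ?K) (?Q' # ?P' @ ?Y # ?X @ ?B)" using Id_cong[OF 3 2 1] P by simp
  have "ctxt_eq S ((?Q # ?P @ ?Y # ?X) @ ?B) ((?Q' # ?P' @ ?Y' # ?X') @ D' # \<Lambda>' @ \<Gamma>)"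
  proof (rule ctxt_eq_append[OF _ cB])
    have "ctxt_eq S ((?Q # ?P) @ ?Y # ?X @ ?B) ((?Q' # ?P') @ ?Y' # ?X' @ ?B)"
      by (rule ctxt_eq_append[OF _ YX]) (use Q n in simp_all)
    then show "ctxt_eq S ((?Q # ?P @ ?Y # ?X) @ ?B) ((?Q' # ?P' @ ?Y' # ?X') @ ?B)" by simp
  qed (use n in simp)
  then show ?thesis using gen_Cons by (simp add: gen_ctx_def Id_ctx_Cons Let_def n shift_tele_def)
qed

text \<open>Goals 4 to 9 treat the ambient part, y, x', y', p and q in this order. For each block of
  variables, composing the renamings involved shows that the required type is a weakening of the
  declared one.\<close>

lemma swap_typed: "sub S (post_tele \<Lambda> D @ gen_ctx \<Lambda> \<Gamma>) (gen_ctx (D # \<Lambda>) \<Gamma>) (\<lambda>i. Var (swap n i))"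
proof -
  let ?K = "post_tele \<Lambda> D @ gen_ctx \<Lambda> \<Gamma>"
  have c: "ctxt S ?K" using post_eq by (rule ctxt_eq_ctxt1)
  have c': "ctxt S (post_tele \<Lambda> D @ Id_ctx \<Lambda> @ shift_tele n \<Lambda> @ \<Lambda> @ \<Gamma>)" using c by (simp add: gen_ctx_def n)
  have cg: "ctxt S (gen_ctx (D # \<Lambda>) \<Gamma>)" using gen_Cons_eq by (rule ctxt_eq_ctxt1)
  show ?thesis unfolding gen_Cons
  proof (rule sub_ren_blocks[where n = n], goal_cases)
    case 1 then show ?case using cg by (simp add: gen_Cons)
  next
    case 2 then show ?case using n by simp
  next
    case 3 then show ?case using n by simp
  next
    case 4
    have "(\<lambda>i. Var (swap n (i + (2 * n + 3))) :: 'c expr) = (\<lambda>i. Var (i + (2 * n + 3)))" by (auto simp: swap_def)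
    then show ?case using sub_shift'[of "post_tele \<Lambda> D @ Id_ctx \<Lambda> @ shift_tele n \<Lambda>" "\<Lambda> @ \<Gamma>" "2 * n + 3"] c' n
      by (simp add: gen_ctx_def)
  next
    case 5
    have "(\<lambda>i. Var (swap n (i + (2 * n + 3))) :: 'c expr) = (\<lambda>i. Var (i + (2 * n + 3)))" by (auto simp: swap_def)
    moreover have "swap n (2 * n + 2) = 2" by (simp add: swap_def)
    ultimately show ?case using var_at[of "take 2 (post_tele \<Lambda> D)" "shift (2 * n) D" "gen_ctx \<Lambda> \<Gamma>" 2] c
      by (simp add: post_tele_def Let_def n shift_eq_subst add.assoc)
  next
    case 6
    have "map (\<lambda>i. Var (swap n i) :: 'c expr) [n + 2..<n + 2 + n] = map Var [n + 3..<n + 3 + n]"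
      by (rule nth_equalityI) (auto simp: swap_def simp del: upt_Suc)
    moreover have "subst_tele (\<lambda>i. Var (swap n (i + (2 * n + 2)))) (subst_tele (\<lambda>i. Var (i + (n + 1))) \<Lambda>) =
       subst_tele (\<lambda>i. Var (i + (n + 3 + n))) (shift_tele n \<Lambda>)"
    proof -
      have "(\<lambda>i. Var (swap n (i + (n + 1) + (2 * n + 2))) :: 'c expr) = (\<lambda>i. Var (i + n + (n + 3 + n)))"
        by (auto simp: swap_def)
      then show ?thesis by (simp only: subst_tele_subst_tele subst_tele_shift_tele subst.simps)
    qed
    ultimately show ?case using elems_vars[of "post_tele \<Lambda> D @ Id_ctx \<Lambda>" "shift_tele n \<Lambda>" "\<Lambda> @ \<Gamma>" "n + 3" n] c' n
      by (simp add: gen_ctx_def del: subst_tele_subst_tele subst_tele_shift_tele)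
  next
    case 7
    let ?Y = "subst (\<lambda>i. Var (if i < n then i + n + 1 else i + 2 * n + 1)) D"
    have "subst (\<lambda>i. Var (swap n (i + (n + 2)))) (subst (lift_sub n (\<lambda>i. Var (i + (n + 1)))) D) = shift 2 ?Y"
    proof -
      have "(\<lambda>i. subst (\<lambda>i. Var (swap n (i + (n + 2)))) (lift_sub n (\<lambda>i. Var (i + (n + 1))) i) :: 'c expr) =
         (\<lambda>i. shift 2 (Var (if i < n then i + n + 1 else i + 2 * n + 1)))"
        by (auto simp: swap_def lift_sub_def)
      then show ?thesis by (simp only: subst_subst shift_subst)
    qed
    moreover have "swap n (n + 1) = 1" by (simp add: swap_def)
    moreover have "?K \<turnstile>\<^bsub>S\<^esub> EqTerm (Var 1) (Var 1) (shift 2 ?Y)"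
      using var_at[of "take 1 (post_tele \<Lambda> D)" ?Y "shift (2 * n) D # gen_ctx \<Lambda> \<Gamma>" 1] c
      by (simp add: post_tele_def Let_def n numeral_2_eq_2)
    ultimately show ?case by (simp only:)
  next
    case 8
    have "map (\<lambda>i. Var (swap n i) :: 'c expr) [1..<1 + n] = map Var [3..<3 + n]"
      by (rule nth_equalityI) (auto simp: swap_def simp del: upt_Suc)
    moreover have "subst_tele (\<lambda>i. Var (swap n (i + (n + 1)))) (subst_tele (\<lambda>i. Var (if i < n then i + 1 else i + 2)) (Id_ctx \<Lambda>)) =
       subst_tele (\<lambda>i. Var (i + (3 + n))) (Id_ctx \<Lambda>)"
    proof -
      have "(\<lambda>i. Var (swap n ((if i < n then i + 1 else i + 2) + (n + 1))) :: 'c expr) = (\<lambda>i. Var (i + (3 + n)))"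
        by (auto simp: swap_def)
      then show ?thesis by (simp only: subst_tele_subst_tele subst.simps)
    qed
    ultimately show ?case using elems_vars[of "post_tele \<Lambda> D" "Id_ctx \<Lambda>" "shift_tele n \<Lambda> @ \<Lambda> @ \<Gamma>" 3 n] c' n
      by (simp add: gen_ctx_def del: subst_tele_subst_tele)
  next
    case 9
    let ?Q = "IdT (shift (2 * n + 2) D) (Var 1) (subst (\<lambda>i. Var (if i = 0 then 0 else i + 1)) (transp \<Lambda> D))"
    have v: "?K \<turnstile>\<^bsub>S\<^esub> EqTerm (Var 0) (Var 0) (shift 1 ?Q)"
      using var_at[of "[]" ?Q "tl (post_tele \<Lambda> D) @ gen_ctx \<Lambda> \<Gamma>" 0] c
      by (simp add: post_tele_def Let_def n)
    have e1: "(\<lambda>i. Var (swap n (i + (2 * n + 2) + 1)) :: 'c expr) = (\<lambda>i. Var (i + (2 * n + 2) + 1))" by (auto simp: swap_def)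
    have e2: "(\<lambda>i. Var (swap n ((if i = 0 then n else if i \<le> n then i - 1 else if i \<le> 2 * n then i else i + 1) + 1)) :: 'c expr) =
      (\<lambda>i. Var ((if i = 0 then 0 else i + 1) + 1))"
      by (auto simp: swap_def fun_eq_iff)
    have e3: "swap n (2 * n + 1 + 1) = 1 + 1" by (simp add: swap_def)
    have "shift 1 ?Q = subst (\<lambda>i. Var (swap n (i + 1))) (IdT (shift (2 * n + 2) D) (Var (2 * n + 1))
       (subst (\<lambda>i. Var (if i = 0 then n else if i \<le> n then i - 1 else if i \<le> 2 * n then i else i + 1)) (transp \<Lambda> D)))"
      by (simp only: shift_eq_subst subst_IdT subst_subst subst.simps e1 e2 e3)
    moreover have "swap n 0 = 0" by (simp add: swap_def)
    ultimately show ?case using v by (simp only:)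
  qed
qed

text \<open>As for \<open>swap\<close>, by an equation of renamings for each block; here goals 4 to
  9 are the ambient part, x', p, y, y' and q.\<close>

lemma unswap_typed: "sub S (gen_ctx (D # \<Lambda>) \<Gamma>) (post_tele \<Lambda> D @ gen_ctx \<Lambda> \<Gamma>) (\<lambda>i. Var (unswap n i))"
proof -
  let ?Q = "IdT (shift (2 * n + 2) D) (Var (2 * n + 1))
       (subst (\<lambda>i. Var (if i = 0 then n else if i \<le> n then i - 1 else if i \<le> 2 * n then i else i + 1)) (transp \<Lambda> D))"
  let ?P = "subst_tele (\<lambda>i. Var (if i < n then i + 1 else i + 2)) (Id_ctx \<Lambda>)"
  let ?Y = "subst (lift_sub n (\<lambda>i. Var (i + (n + 1)))) D" and ?X = "subst_tele (\<lambda>i. Var (i + (n + 1))) \<Lambda>"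
  let ?K = "?Q # ?P @ ?Y # ?X @ D # \<Lambda> @ \<Gamma>"
  have "ctxt S (post_tele \<Lambda> D @ gen_ctx \<Lambda> \<Gamma>)" using post_eq by (rule ctxt_eq_ctxt1)
  have p: "post_tele \<Lambda> D @ gen_ctx \<Lambda> \<Gamma> =
    IdT (shift (2 * n + 2) D) (Var 1) (subst (\<lambda>i. Var (if i = 0 then 0 else i + 1)) (transp \<Lambda> D)) #
    subst (\<lambda>i. Var (if i < n then i + n + 1 else i + 2 * n + 1)) D # shift (2 * n) D # Id_ctx \<Lambda> @ shift_tele n \<Lambda> @ \<Lambda> @ \<Gamma>"
    by (simp add: post_tele_def gen_ctx_def Let_def n)
  have c': "ctxt S (post_tele \<Lambda> D @ gen_ctx \<Lambda> \<Gamma>)" using post_eq by (rule ctxt_eq_ctxt1)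
  have c: "ctxt S ?K" using gen_Cons_eq ctxt_eq_ctxt1 gen_Cons by metis
  show ?thesis unfolding p unfolding gen_Cons
  proof (rule sub_ren_blocks'[where n = n], goal_cases)
    case 1 then show ?case using c' by (simp only: p)
  next
    case 2 then show ?case using n by simp
  next
    case 3 then show ?case using n by simp
  next
    case 4
    have "(\<lambda>i. Var (unswap n (i + (2 * n + 3))) :: 'c expr) = (\<lambda>i. Var (i + (2 * n + 3)))" by (auto simp: unswap_def)
    then show ?case using sub_shift'[of "?Q # ?P @ ?Y # ?X @ [D]" "\<Lambda> @ \<Gamma>" "2 * n + 3"] c n by simp
  next
    case 5
    have "map (\<lambda>i. Var (unswap n i) :: 'c expr) [n + 3..<n + 3 + n] = map Var [n + 2..<n + 2 + n]"
      by (rule nth_equalityI) (auto simp: unswap_def simp del: upt_Suc)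
    moreover have "subst_tele (\<lambda>i. Var (unswap n (i + (2 * n + 3)))) (shift_tele n \<Lambda>) =
       subst_tele (\<lambda>i. Var (i + (n + 2 + n))) ?X"
    proof -
      have "(\<lambda>i. Var (unswap n (i + n + (2 * n + 3))) :: 'c expr) = (\<lambda>i. Var (i + (n + 1) + (n + 2 + n)))"
        by (auto simp: unswap_def)
      then show ?thesis by (simp only: subst_tele_subst_tele subst_tele_shift_tele subst.simps)
    qed
    ultimately show ?case using elems_vars[of "?Q # ?P @ [?Y]" ?X "D # \<Lambda> @ \<Gamma>" "n + 2" n] c n
      by (simp del: subst_tele_subst_tele subst_tele_shift_tele)
  next
    case 6
    have "map (\<lambda>i. Var (unswap n i) :: 'c expr) [3..<3 + n] = map Var [1..<1 + n]"
      by (rule nth_equalityI) (auto simp: unswap_def simp del: upt_Suc)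
    moreover have "subst_tele (\<lambda>i. Var (unswap n (i + (n + 3)))) (Id_ctx \<Lambda>) = subst_tele (\<lambda>i. Var (i + (1 + n))) ?P"
    proof -
      have "(\<lambda>i. Var (unswap n (i + (n + 3))) :: 'c expr) = (\<lambda>i. Var ((if i < n then i + 1 else i + 2) + (1 + n)))"
        by (auto simp: unswap_def)
      then show ?thesis by (simp only: subst_tele_subst_tele subst.simps)
    qed
    ultimately show ?case using elems_vars[of "[?Q]" ?P "?Y # ?X @ D # \<Lambda> @ \<Gamma>" 1 n] c n
      by (simp del: subst_tele_subst_tele)
  next
    case 7
    have "(\<lambda>i. Var (unswap n (i + (2 * n) + 3)) :: 'c expr) = (\<lambda>i. Var (i + (2 * n + 3)))" by (auto simp: unswap_def)
    then have "subst (\<lambda>i. Var (unswap n (i + 3))) (shift (2 * n) D) = shift (2 * n + 3) D"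
      by (simp only: shift_eq_subst subst_subst subst.simps)
    moreover have "unswap n 2 = 2 * n + 2" by (simp add: unswap_def)
    moreover have "?K \<turnstile>\<^bsub>S\<^esub> EqTerm (Var (2 * n + 2)) (Var (2 * n + 2)) (shift (2 * n + 3) D)"
      using var_at[of "?Q # ?P @ ?Y # ?X" D "\<Lambda> @ \<Gamma>" "2 * n + 2"] c n by (simp add: numeral_3_eq_3)
    ultimately show ?case by (simp only:)
  next
    case 8
    have "subst (\<lambda>i. Var (unswap n (i + 2))) (subst (\<lambda>i. Var (if i < n then i + n + 1 else i + 2 * n + 1)) D) = shift (n + 2) ?Y"
    proof -
      have "(\<lambda>i. Var (unswap n ((if i < n then i + n + 1 else i + 2 * n + 1) + 2)) :: 'c expr) =
         (\<lambda>i. shift (n + 2) (lift_sub n (\<lambda>i. Var (i + (n + 1))) i))"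
        by (auto simp: unswap_def lift_sub_def)
      then show ?thesis by (simp only: subst_subst shift_subst subst.simps)
    qed
    moreover have "unswap n 1 = n + 1" by (simp add: unswap_def)
    moreover have "?K \<turnstile>\<^bsub>S\<^esub> EqTerm (Var (n + 1)) (Var (n + 1)) (shift (n + 2) ?Y)"
      using var_at[of "?Q # ?P" ?Y "?X @ D # \<Lambda> @ \<Gamma>" "n + 1"] c n by (simp add: numeral_2_eq_2)
    ultimately show ?case by (simp only:)
  next
    case 9
    have v: "?K \<turnstile>\<^bsub>S\<^esub> EqTerm (Var 0) (Var 0) (shift 1 ?Q)"
      using var_at[of "[]" ?Q "?P @ ?Y # ?X @ D # \<Lambda> @ \<Gamma>" 0] c by simp
    have e1: "(\<lambda>i. Var (unswap n (i + (2 * n + 2) + 1)) :: 'c expr) = (\<lambda>i. Var (i + (2 * n + 2) + 1))" by (auto simp: unswap_def)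
    have e2: "(\<lambda>i. Var ((if i = 0 then n else if i \<le> n then i - 1 else if i \<le> 2 * n then i else i + 1) + 1) :: 'c expr) =
      (\<lambda>i. Var (unswap n ((if i = 0 then 0 else i + 1) + 1)))"
      by (auto simp: unswap_def fun_eq_iff)
    have e3: "unswap n (1 + 1) = 2 * n + 1 + 1" by (simp add: unswap_def)
    have "shift 1 ?Q = subst (\<lambda>i. Var (unswap n (i + 1))) (IdT (shift (2 * n + 2) D) (Var 1) (subst (\<lambda>i. Var (if i = 0 then 0 else i + 1)) (transp \<Lambda> D)))"
      by (simp only: shift_eq_subst subst_IdT subst_subst subst.simps e1 e2 e3)
    moreover have "unswap n 0 = 0" by (simp add: unswap_def)
    ultimately show ?case using v by (simp only:)
  qed
qed

text \<open>The diagonal of \<open>A # L\<close> is taken in two stages: over \<open>L\<close> while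
  the last three variables are kept, then in the last type. The computation rule of the recursive
  eliminator is the corresponding composite of two computation rules.\<close>

lemma diag_ctx_Cons: "length L = n \<Longrightarrow> diag_ctx (A # L) = (\<lambda>i. subst (diag A) (lift_sub 3 (diag_ctx L) (swap n i)))"
proof
  fix i
  assume L: "length L = n"
  have d: "(\<lambda>i. diag A (i + 3)) = (\<lambda>i. Var (i + 1))" by (auto simp: diag_def inst_def)
  have d': "diag A (Suc 0) = Var 0" "diag A 2 = Var 0" "diag A 0 = Refl (shift 1 A) (Var 0)" by (auto simp: diag_def inst_def)
  consider "i = 0" | "0 < i" "i \<le> n" | "i = n + 1" | "n + 1 < i" "i \<le> 2 * n + 1" | "i = 2 * n + 2" | "2 * n + 2 < i" by linarith
  then show "diag_ctx (A # L) i = subst (diag A) (lift_sub 3 (diag_ctx L) (swap n i))"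
  proof cases
    case 2
    then have "diag_ctx (A # L) i = shift 1 (refl_ctx L ! (i - 1))"
      using L by (auto simp: diag_ctx_def ext_def nth_append nth_Cons')
    moreover have "lift_sub 3 (diag_ctx L) (swap n i) = shift 3 (refl_ctx L ! (i - 1))"
      using 2 L by (auto simp: diag_ctx_def ext_def lift_sub_def swap_def)
    ultimately show ?thesis by (simp only: subst_shift d shift_eq_subst[of 1])
  qed (use L d' in \<open>auto simp: diag_ctx_def ext_def lift_sub_def swap_def nth_append nth_Cons' fun_cong[OF d, simplified]\<close>,
      (auto simp: diag_def inst_def)?)
qed

text \<open>Let \<open>j\<close> be the elimination in \<open>D\<close> and \<open>k\<close> the
  elimination over \<open>\<Lambda>\<close> applied to it. On the diagonal of
  \<open>\<Lambda>\<close> the term \<open>k\<close> restricts to \<open>j\<close>, and on that of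
  \<open>D\<close> the term \<open>j\<close> restricts to \<open>d\<close>. The result is
  \<open>k\<close> with its variables in the original order, and \<open>diag_ctx_Cons\<close> chains
  the two restrictions.\<close>

lemma J_ctx_step: "J_ctx_ok S \<Gamma> (D # \<Lambda>) (D' # \<Lambda>')"
proof -
  let ?B = "D # \<Lambda> @ \<Gamma>" and ?I = "id_tele D @ \<Lambda> @ \<Gamma>"
  let ?s = "lift_sub 3 (diag_ctx \<Lambda>)" and ?s' = "lift_sub 3 (diag_ctx \<Lambda>')"
  let ?y = "\<lambda>i. ?s (swap n i)" and ?y' = "\<lambda>i. ?s' (swap n i)"
  have cp: "ctxt S (post_tele \<Lambda> D @ gen_ctx \<Lambda> \<Gamma>)" using post_eq by (rule ctxt_eq_ctxt1)
  have "sub_eq S (subst_tele (diag_ctx \<Lambda>) (post_tele \<Lambda> D) @ \<Lambda> @ \<Gamma>) (post_tele \<Lambda> D @ gen_ctx \<Lambda> \<Gamma>) ?s ?s'"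
    using sub_eq_lift[OF diag_eq cp] by simp
  then have s: "sub_eq S ?I (post_tele \<Lambda> D @ gen_ctx \<Lambda> \<Gamma>) ?s ?s'"
    using sub_eq_convert_dom ctxt_eq_sym[OF diag_post] by blast
  have y: "sub_eq S ?I (gen_ctx (D # \<Lambda>) \<Gamma>) ?y ?y'"
    using sub_eq_comp[OF s swap_typed] by simp
  have dd: "sub_eq S ?B ?I (diag D) (diag D')" by (rule diag_sub_eq[OF DD])
  have \<delta>: "sub_eq S ?B (gen_ctx (D # \<Lambda>) \<Gamma>) (diag_ctx (D # \<Lambda>)) (diag_ctx (D' # \<Lambda>'))"
    using sub_eq_comp[OF dd y] by (simp add: diag_ctx_Cons n)
  have \<delta>': "(\<lambda>i. subst (diag D) (?y i)) = diag_ctx (D # \<Lambda>)" by (simp add: diag_ctx_Cons n)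
  have \<delta>u: "(\<lambda>i. diag_ctx (D # \<Lambda>) (unswap n i)) = (\<lambda>i. subst (diag D) (?s i))" by (simp add: diag_ctx_Cons n)
  have J: "elems_eq S (\<Delta> @ gen_ctx (D # \<Lambda>) \<Gamma>) \<Theta> (J_ctx (D # \<Lambda>) \<Delta> \<Theta> d) (J_ctx (D' # \<Lambda>') \<Delta>' \<Theta>' d') \<and>
      elems_eq S (subst_tele (diag_ctx (D # \<Lambda>)) \<Delta> @ ?B) (subst_tele (lift_sub m (diag_ctx (D # \<Lambda>))) \<Theta>)
        (map (subst (lift_sub m (diag_ctx (D # \<Lambda>)))) (J_ctx (D # \<Lambda>) \<Delta> \<Theta> d)) d"
    if l: "length \<Theta> = length \<Theta>'" "length \<Delta> = m" "length \<Delta>' = m"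
      and c: "ctxt_eq S (\<Theta> @ \<Delta> @ gen_ctx (D # \<Lambda>) \<Gamma>) (\<Theta>' @ \<Delta>' @ gen_ctx (D' # \<Lambda>') \<Gamma>)"
      and d: "elems_eq S (subst_tele (diag_ctx (D # \<Lambda>)) \<Delta> @ ?B) (subst_tele (lift_sub m (diag_ctx (D # \<Lambda>))) \<Theta>) d d'"
    for \<Theta> \<Theta>' \<Delta> \<Delta>' m d d'
  proof -
    let ?\<Delta>y = "subst_tele ?y \<Delta>" and ?\<Theta>y = "subst_tele (lift_sub m ?y) \<Theta>"
    let ?\<Delta>y' = "subst_tele ?y' \<Delta>'" and ?\<Theta>y' = "subst_tele (lift_sub m ?y') \<Theta>'"
    let ?w = "\<lambda>i. Var (swap n i)" and ?u = "\<lambda>i. Var (unswap n i)"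
    let ?\<Delta>w = "subst_tele ?w \<Delta>" and ?\<Theta>w = "subst_tele (lift_sub m ?w) \<Theta>"
    let ?\<Delta>w' = "subst_tele ?w \<Delta>'" and ?\<Theta>w' = "subst_tele (lift_sub m ?w) \<Theta>'"
    have lc: "lift_sub m (\<lambda>i. subst \<sigma> (\<tau> i)) = (\<lambda>i. subst (lift_sub m \<sigma>) (lift_sub m \<tau> i))" for \<sigma> \<tau> :: "nat \<Rightarrow> 'c expr"
      by (simp only: lift_sub_lift_comp)
    have \<Delta>d: "subst_tele (diag D) ?\<Delta>y = subst_tele (diag_ctx (D # \<Lambda>)) \<Delta>" by (simp only: subst_tele_subst_tele \<delta>')
    have \<Theta>d: "subst_tele (lift_sub m (diag D)) ?\<Theta>y = subst_tele (lift_sub m (diag_ctx (D # \<Lambda>))) \<Theta>"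
      by (simp only: subst_tele_subst_tele \<delta>'[symmetric] lc)
    have c0: "ctxt_eq S ((\<Theta> @ \<Delta>) @ gen_ctx (D # \<Lambda>) \<Gamma>) ((\<Theta>' @ \<Delta>') @ gen_ctx (D' # \<Lambda>') \<Gamma>)" using c by simp
    have c1: "ctxt_eq S ((?\<Theta>y @ ?\<Delta>y) @ ?I) ((?\<Theta>y' @ ?\<Delta>y') @ id_tele D' @ \<Lambda> @ \<Gamma>)"
      by (rule ctxt_eq_append[OF _ id_tele_ctxt_eq[OF DD]]) (use ctxt_eq_subst_eq[OF y c0] l in simp_all)
    define j where "j = J_tele D ?\<Delta>y ?\<Theta>y d"
    define j' where "j' = J_tele D' ?\<Delta>y' ?\<Theta>y' d'"
    have jj: "elems_eq S (?\<Delta>y @ ?I) ?\<Theta>y j j'" and jd: "elems_eq S (subst_tele (diag_ctx (D # \<Lambda>)) \<Delta> @ ?B)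
        (subst_tele (lift_sub m (diag_ctx (D # \<Lambda>))) \<Theta>) (map (subst (lift_sub m (diag D))) j) d"
      using J_tele_cong[of ?\<Theta>y ?\<Delta>y D "\<Lambda> @ \<Gamma>" ?\<Theta>y' ?\<Delta>y' D' d d'] c1 l d \<Delta>d \<Theta>d
      by (simp_all add: j_def j'_def del: subst_tele_subst_tele)
    have c2: "ctxt_eq S ((?\<Theta>w @ ?\<Delta>w) @ post_tele \<Lambda> D @ gen_ctx \<Lambda> \<Gamma>) ((?\<Theta>w' @ ?\<Delta>w') @ post_tele \<Lambda>' D' @ gen_ctx \<Lambda>' \<Gamma>)"
      by (rule ctxt_eq_append[OF _ post_eq]) (use ctxt_eq_subst_eq[OF swap_typed c0] l in simp_all)
    then have cw: "ctxt S (?\<Delta>w @ post_tele \<Lambda> D @ gen_ctx \<Lambda> \<Gamma>)" "ctxt S (?\<Theta>w @ ?\<Delta>w @ post_tele \<Lambda> D @ gen_ctx \<Lambda> \<Gamma>)"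
      using ctxt_eq_ctxt1[OF c2] ctxt_appendD[of S ?\<Theta>w] by simp_all
    have \<Delta>s: "subst_tele ?s ?\<Delta>w = ?\<Delta>y" by simp
    have ls: "lift_sub (m + 3) (diag_ctx \<Lambda>) = lift_sub m ?s" by (simp add: lift_sub_lift_sub)
    have \<Theta>s: "subst_tele (lift_sub m ?s) ?\<Theta>w = ?\<Theta>y" by (simp only: subst_tele_subst_tele lc[symmetric] subst.simps)
    have cy: "ctxt S (?\<Delta>y @ ?I)" "ctxt S (?\<Theta>y @ ?\<Delta>y @ ?I)" using ctxt_eq_ctxt1[OF c1] ctxt_appendD[of S ?\<Theta>y "?\<Delta>y @ ?I"] by simp_all
    \<comment> \<open>\<open>j\<close> was typed over the generic context of the single type
      \<open>D\<close>, while elimination over \<open>\<Lambda>\<close> expects its datum over the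
      restricted post-context.\<close>
    have cIp: "ctxt_eq S (?\<Delta>y @ ?I) (?\<Delta>y @ subst_tele (diag_ctx \<Lambda>) (post_tele \<Lambda> D) @ \<Lambda> @ \<Gamma>)"
      by (rule ctxt_eq_append[OF ctxt_eq_refl[OF cy(1)] diag_post]) simp
    have jj': "elems_eq S (subst_tele (diag_ctx \<Lambda>) (?\<Delta>w @ post_tele \<Lambda> D) @ \<Lambda> @ \<Gamma>)
       (subst_tele (lift_sub (length (?\<Delta>w @ post_tele \<Lambda> D)) (diag_ctx \<Lambda>)) ?\<Theta>w) j j'"
      using elems_eq_convert_dom[OF jj cIp] \<Delta>s \<Theta>s ls l by (simp del: subst_tele_subst_tele)
    define k where "k = J_ctx \<Lambda> (?\<Delta>w @ post_tele \<Lambda> D) ?\<Theta>w j"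
    define k' where "k' = J_ctx \<Lambda>' (?\<Delta>w' @ post_tele \<Lambda>' D') ?\<Theta>w' j'"
    have "length ?\<Theta>w = length ?\<Theta>w'" "length (?\<Delta>w @ post_tele \<Lambda> D) = length (?\<Delta>w' @ post_tele \<Lambda>' D')"
       "ctxt_eq S (?\<Theta>w @ (?\<Delta>w @ post_tele \<Lambda> D) @ gen_ctx \<Lambda> \<Gamma>) (?\<Theta>w' @ (?\<Delta>w' @ post_tele \<Lambda>' D') @ gen_ctx \<Lambda>' \<Gamma>)"
      using l c2 by simp_all
    with ok jj' have kk: "elems_eq S ((?\<Delta>w @ post_tele \<Lambda> D) @ gen_ctx \<Lambda> \<Gamma>) ?\<Theta>w k k'"
      and kj: "elems_eq S (subst_tele (diag_ctx \<Lambda>) (?\<Delta>w @ post_tele \<Lambda> D) @ \<Lambda> @ \<Gamma>)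
       (subst_tele (lift_sub (length (?\<Delta>w @ post_tele \<Lambda> D)) (diag_ctx \<Lambda>)) ?\<Theta>w)
       (map (subst (lift_sub (length (?\<Delta>w @ post_tele \<Lambda> D)) (diag_ctx \<Lambda>))) k) j"
      unfolding J_ctx_ok_def k_def k'_def by blast+
    have kj': "elems_eq S (?\<Delta>y @ ?I) ?\<Theta>y (map (subst (lift_sub m ?s)) k) j"
      using elems_eq_convert_dom[OF _ ctxt_eq_sym[OF cIp]] kj \<Delta>s \<Theta>s ls l by (simp del: subst_tele_subst_tele)
    have u\<Delta>: "subst_tele ?u ?\<Delta>w = \<Delta>" by simp
    have u\<Theta>: "subst_tele (lift_sub m ?u) ?\<Theta>w = \<Theta>"
      by (simp only: subst_tele_subst_tele lc[symmetric] subst.simps swap_unswap lift_sub_Var subst_tele_Var)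
    have su: "sub S (\<Delta> @ gen_ctx (D # \<Lambda>) \<Gamma>) (?\<Delta>w @ post_tele \<Lambda> D @ gen_ctx \<Lambda> \<Gamma>) (lift_sub m ?u)"
      using sub_eq_lift[OF unswap_typed cw(1)] l unfolding u\<Delta> by simp
    have "elems_eq S (\<Delta> @ gen_ctx (D # \<Lambda>) \<Gamma>) \<Theta> (map (subst (lift_sub m ?u)) k) (map (subst (lift_sub m ?u)) k')"
      using elems_eq_subst[OF su cw(2)] kk unfolding u\<Theta> by simp
    then have 1: "elems_eq S (\<Delta> @ gen_ctx (D # \<Lambda>) \<Gamma>) \<Theta> (J_ctx (D # \<Lambda>) \<Delta> \<Theta> d) (J_ctx (D' # \<Lambda>') \<Delta>' \<Theta>' d')"
      unfolding J_ctx_Cons k_def k'_def j_def j'_def n l .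
    have sd: "sub S (subst_tele (diag_ctx (D # \<Lambda>)) \<Delta> @ ?B) (?\<Delta>y @ ?I) (lift_sub m (diag D))"
      using sub_eq_lift[OF sub_eq_left[OF dd] cy(1)] l \<Delta>d by (simp del: subst_tele_subst_tele)
    \<comment> \<open>Undoing the reordering and then restricting to the diagonal of
      \<open>D # \<Lambda>\<close> amounts to the restriction in two stages.\<close>
    have e: "map (subst (lift_sub m (diag_ctx (D # \<Lambda>)))) (map (subst (lift_sub m ?u)) k) =
        map (subst (lift_sub m (diag D))) (map (subst (lift_sub m ?s)) k)"
      unfolding map_map comp_def subst_subst lc[symmetric] subst.simps \<delta>u ..
    have 2: "elems_eq S (subst_tele (diag_ctx (D # \<Lambda>)) \<Delta> @ ?B) (subst_tele (lift_sub m (diag_ctx (D # \<Lambda>))) \<Theta>)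
        (map (subst (lift_sub m (diag_ctx (D # \<Lambda>)))) (map (subst (lift_sub m ?u)) k)) (map (subst (lift_sub m (diag D))) j)"
      unfolding e using elems_eq_subst[OF sd cy(2) kj'] unfolding \<Theta>d .
    have "ctxt S (subst_tele (lift_sub m (diag_ctx (D # \<Lambda>))) \<Theta> @ subst_tele (diag_ctx (D # \<Lambda>)) \<Delta> @ ?B)"
      using ctxt_subst[OF sd cy(2)] unfolding \<Theta>d .
    from elems_eq_trans[OF this 2 jd] have
      "elems_eq S (subst_tele (diag_ctx (D # \<Lambda>)) \<Delta> @ ?B) (subst_tele (lift_sub m (diag_ctx (D # \<Lambda>))) \<Theta>)
        (map (subst (lift_sub m (diag_ctx (D # \<Lambda>)))) (J_ctx (D # \<Lambda>) \<Delta> \<Theta> d)) d"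
      unfolding J_ctx_Cons k_def j_def n l .
    with 1 show ?thesis by blast
  qed
  show ?thesis unfolding J_ctx_ok_def using gen_Cons_eq \<delta> J by simp
qed

end

lemma J_ctx_ok: "ctxt_eq S (\<Phi> @ \<Gamma>) (\<Phi>' @ \<Gamma>) \<Longrightarrow> length \<Phi> = length \<Phi>' \<Longrightarrow> J_ctx_ok S \<Gamma> \<Phi> \<Phi>'"
proof (induction \<Phi> arbitrary: \<Phi>')
  case Nil
  then have c: "ctxt S \<Gamma>" using ctxt_eq_ctxt1 by simp
  have "diag_ctx [] = (Var :: nat \<Rightarrow> 'c expr)" by (simp add: diag_ctx_def vars_def)
  with c show ?case using Nil by (auto simp: J_ctx_ok_def gen_ctx_def shift_tele_def ctxt_eq_refl sub_Var dest: elems_eq_left)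
next
  case (Cons D \<Lambda>)
  then obtain D' \<Lambda>' where *: "\<Phi>' = D' # \<Lambda>'" "length \<Lambda> = length \<Lambda>'" by (cases \<Phi>') auto
  with Cons.prems have c: "ctxt_eq S (\<Lambda> @ \<Gamma>) (\<Lambda>' @ \<Gamma>)" and D: "\<Lambda> @ \<Gamma> \<turnstile>\<^bsub>S\<^esub> EqType D D'" by auto
  show ?case unfolding * using J_ctx_step[OF Cons.IH[OF c *(2)] D _ _ c] * by simp
qed

end

section \<open>Paths and their uniqueness\<close>

abbreviation refl_at :: "'c ctx \<Rightarrow> 'c expr list \<Rightarrow> 'c expr list" where
  "refl_at \<Delta> f \<equiv> compose (refl_ctx \<Delta>) f"

lemma compose_eq: "compose g f = map (subst (ext f Var)) g"
  by (simp add: compose_def inst_eq_ext)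

lemma compose_length [simp]: "length (compose g f) = length g"
  by (simp add: compose_def)

lemma Id_at_eq: "Id_at \<Delta> f g = subst_tele (ext g (ext f Var)) (Id_ctx \<Delta>)"
  by (simp add: Id_at_def inst_eq_ext)

lemma Id_at_length [simp]: "length (Id_at \<Delta> f g) = length \<Delta>"
  by (simp add: Id_at_def)

text \<open>Discreteness reflects equalities only between elements of a type that is itself an
  identity type. Every type in an identity context has this syntactic form, and substitution
  preserves it.\<close>

definition idt_tele :: "'c ctx \<Rightarrow> bool" where
  "idt_tele \<Psi> \<longleftrightarrow> (\<forall>A \<in> set \<Psi>. \<exists>B a b. A = IdT B a b)"

lemma idt_tele_subst: "idt_tele \<Psi> \<Longrightarrow> idt_tele (subst_tele \<sigma> \<Psi>)"
  by (induction \<Psi>) (auto simp: idt_tele_def IdT_def)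

lemma idt_tele_Id_ctx: "idt_tele (Id_ctx \<Delta>)"
proof (induction \<Delta>)
  case (Cons D \<Lambda>)
  then show ?case using idt_tele_subst[of "Id_ctx \<Lambda>"] by (auto simp: Id_ctx_Cons Let_def idt_tele_def)
qed (simp add: idt_tele_def)

lemma idt_tele_Id_at: "idt_tele (Id_at \<Delta> f g)"
  by (simp add: Id_at_eq idt_tele_subst idt_tele_Id_ctx)

context dependent_type_theory
begin

lemma closed_subst_tele: "ctxt S \<Delta> \<Longrightarrow> subst_tele \<sigma> \<Delta> = \<Delta>"
  using ctxt_scoped_tele[of \<Delta> "[]"] by (simp add: subst_tele_closed)

lemma closed_append: "ctxt S \<Delta> \<Longrightarrow> ctxt S K \<Longrightarrow> ctxt S (\<Delta> @ K)"
  using ctxt_subst[of K "[]" Var \<Delta>] by simp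

lemma closed_shift_tele [simp]: "ctxt S \<Delta> \<Longrightarrow> shift_tele n \<Delta> = \<Delta>"
  by (simp add: shift_tele_def closed_subst_tele)

lemma elems_sub_closed:
  assumes "ctxt S \<Delta>" "ctxt S K" "elems_eq S K \<Delta> f f'"
  shows "sub_eq S K \<Delta> (ext f \<tau>) (ext f' \<tau>')"
  using sub_eq_ext[of K "[]" \<tau> \<tau>' \<Delta> f f'] assms by (simp add: closed_subst_tele)

lemma elems_eq_compose:
  assumes "ctxt S \<Delta>" "ctxt S K" "elems_eq S K \<Delta> f f'" "ctxt S (\<Theta> @ \<Delta>)" "elems_eq S \<Delta> \<Theta> g g'"
  shows "elems_eq S K (subst_tele (ext f Var) \<Theta>) (compose g f) (compose g' f')"
  using elems_eq_subst[OF elems_sub_closed[OF assms(1-3)] assms(4,5)] by (simp add: compose_eq)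

lemma elems_eq_scoped:
  assumes "elems_eq S K \<Theta> f f'" "a \<in> set f"
  shows "scoped (length K) a"
  using assms
proof (induction \<Theta> arbitrary: f f')
  case (Cons A \<Theta>)
  then show ?case using eq_term_presup has_type_scoped by (fastforce simp: elems_eq_Cons)
qed simp

text \<open>The components of \<open>g\<close> contain only variables of \<open>\<Delta>\<close>, so
  an outer substitution acts on the composite through \<open>f\<close> alone. Reflexivity,
  composition and images of paths are all composites of this kind, which is why they are literally
  stable under substitution.\<close>

lemma map_subst_compose:
  assumes "elems_eq S \<Delta> \<Theta> g g'" "length f = length \<Delta>"
  shows "map (subst \<sigma>) (compose g f) = compose g (map (subst \<sigma>) f)"
proof -
  have "subst (ext (map (subst \<sigma>) f) \<sigma>) a = subst (ext (map (subst \<sigma>) f) Var) a" if "a \<in> set g" for a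
    using elems_eq_scoped[OF assms(1) that] by (rule subst_cong_scoped) (simp add: ext_def assms)
  then show ?thesis by (simp add: compose_eq)
qed

end

context identity_types
begin

lemma gen_closed: "ctxt S \<Delta> \<Longrightarrow> gen_ctx \<Delta> K = Id_ctx \<Delta> @ \<Delta> @ \<Delta> @ K"
  by (simp add: gen_ctx_def)

lemma J_ctx_okD:
  assumes "ctxt_eq S (\<Phi> @ \<Gamma>) (\<Phi>' @ \<Gamma>)" "length \<Phi> = length \<Phi>'"
  shows "ctxt_eq S (gen_ctx \<Phi> \<Gamma>) (gen_ctx \<Phi>' \<Gamma>)"
    "sub_eq S (\<Phi> @ \<Gamma>) (gen_ctx \<Phi> \<Gamma>) (diag_ctx \<Phi>) (diag_ctx \<Phi>')"
    "\<lbrakk>length \<Theta> = length \<Theta>'; length \<Delta> = length \<Delta>';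
      ctxt_eq S (\<Theta> @ \<Delta> @ gen_ctx \<Phi> \<Gamma>) (\<Theta>' @ \<Delta>' @ gen_ctx \<Phi>' \<Gamma>);
      elems_eq S (subst_tele (diag_ctx \<Phi>) \<Delta> @ \<Phi> @ \<Gamma>) (subst_tele (lift_sub (length \<Delta>) (diag_ctx \<Phi>)) \<Theta>) d d'\<rbrakk> \<Longrightarrow>
      elems_eq S (\<Delta> @ gen_ctx \<Phi> \<Gamma>) \<Theta> (J_ctx \<Phi> \<Delta> \<Theta> d) (J_ctx \<Phi>' \<Delta>' \<Theta>' d')"
    "\<lbrakk>length \<Theta> = length \<Theta>'; length \<Delta> = length \<Delta>';
      ctxt_eq S (\<Theta> @ \<Delta> @ gen_ctx \<Phi> \<Gamma>) (\<Theta>' @ \<Delta>' @ gen_ctx \<Phi>' \<Gamma>);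
      elems_eq S (subst_tele (diag_ctx \<Phi>) \<Delta> @ \<Phi> @ \<Gamma>) (subst_tele (lift_sub (length \<Delta>) (diag_ctx \<Phi>)) \<Theta>) d d'\<rbrakk> \<Longrightarrow>
      elems_eq S (subst_tele (diag_ctx \<Phi>) \<Delta> @ \<Phi> @ \<Gamma>) (subst_tele (lift_sub (length \<Delta>) (diag_ctx \<Phi>)) \<Theta>)
        (map (subst (lift_sub (length \<Delta>) (diag_ctx \<Phi>))) (J_ctx \<Phi> \<Delta> \<Theta> d)) d"
  using J_ctx_ok[OF assms] by (simp_all add: J_ctx_ok_def)

lemma gen_ctxt: "ctxt S (\<Phi> @ \<Gamma>) \<Longrightarrow> ctxt S (gen_ctx \<Phi> \<Gamma>)"
  using J_ctx_okD(1)[OF ctxt_eq_refl] ctxt_eq_ctxt1 by blast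

lemma diag_ctx_typed: "ctxt S (\<Phi> @ \<Gamma>) \<Longrightarrow> sub S (\<Phi> @ \<Gamma>) (gen_ctx \<Phi> \<Gamma>) (diag_ctx \<Phi>)"
  using J_ctx_okD(2)[OF ctxt_eq_refl] by blast

lemma Id_ctx_ctxt: "ctxt S \<Delta> \<Longrightarrow> ctxt S (Id_ctx \<Delta> @ \<Delta> @ \<Delta>)"
  using gen_ctxt[of \<Delta> "[]"] by (simp add: gen_closed)

lemma Id_ctx_scoped: "ctxt S \<Delta> \<Longrightarrow> scoped_tele (2 * length \<Delta>) (Id_ctx \<Delta>)"
  using ctxt_scoped_tele[OF Id_ctx_ctxt] by (simp add: mult_2)

lemma Id_at_subst:
  assumes "ctxt S \<Delta>" "length f = length \<Delta>" "length g = length \<Delta>"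
  shows "subst_tele \<sigma> (Id_at \<Delta> f g) = Id_at \<Delta> (map (subst \<sigma>) f) (map (subst \<sigma>) g)"
proof -
  have "subst_tele \<sigma> (Id_at \<Delta> f g) = subst_tele (ext (map (subst \<sigma>) g) (ext (map (subst \<sigma>) f) \<sigma>)) (Id_ctx \<Delta>)"
    by (simp add: Id_at_eq)
  also have "\<dots> = Id_at \<Delta> (map (subst \<sigma>) f) (map (subst \<sigma>) g)"
    unfolding Id_at_eq by (rule subst_tele_cong_scoped[OF Id_ctx_scoped]) (use assms in \<open>auto simp: ext_def\<close>)
  finally show ?thesis .
qed

lemma Id_at_vars:
  assumes "ctxt S \<Delta>" "length \<Delta> = n" "\<And>i. i < 2 * n \<Longrightarrow> \<sigma> i = ext g (ext f Var) i"
  shows "subst_tele \<sigma> (Id_ctx \<Delta>) = Id_at \<Delta> f g"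
  unfolding Id_at_eq using assms by (intro subst_tele_cong_scoped[OF Id_ctx_scoped]) auto

lemma ends_sub_eq:
  assumes "ctxt S \<Delta>" "ctxt S K" "elems_eq S K \<Delta> f f'" "elems_eq S K \<Delta> g g'"
  shows "sub_eq S K (\<Delta> @ \<Delta> @ K) (ext g (ext f Var)) (ext g' (ext f' Var))"
    and "sub_eq S K (\<Delta> @ \<Delta>) (ext g (ext f Var)) (ext g' (ext f' Var))"
proof -
  have "sub_eq S K (\<Delta> @ K) (ext f Var) (ext f' Var)" "sub_eq S K (\<Delta> @ []) (ext f Var) (ext f' Var)"
    using elems_eq_sub[OF closed_append] elems_sub_closed assms by simp_all
  then show "sub_eq S K (\<Delta> @ \<Delta> @ K) (ext g (ext f Var)) (ext g' (ext f' Var))"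
    "sub_eq S K (\<Delta> @ \<Delta>) (ext g (ext f Var)) (ext g' (ext f' Var))"
    using sub_eq_ext[of K "\<Delta> @ K" "ext f Var" "ext f' Var" \<Delta> g g'] sub_eq_ext[of K "\<Delta>" "ext f Var" "ext f' Var" \<Delta> g g'] assms
    by (simp_all add: closed_subst_tele closed_append)
qed

lemma Id_at_ctxt_eq:
  assumes "ctxt_eq S \<Delta> \<Delta>'" "ctxt S K" "elems_eq S K \<Delta> f f'" "elems_eq S K \<Delta> g g'"
  shows "ctxt_eq S (Id_at \<Delta> f g @ K) (Id_at \<Delta>' f' g' @ K)"
proof -
  have c: "ctxt S \<Delta>" "ctxt S \<Delta>'" using assms ctxt_eq_ctxt1 ctxt_eq_ctxt2 by blast+
  have "ctxt_eq S (Id_ctx \<Delta> @ \<Delta> @ \<Delta>) (Id_ctx \<Delta>' @ \<Delta>' @ \<Delta>')"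
    using J_ctx_okD(1)[of \<Delta> "[]" \<Delta>'] assms(1) c ctxt_eq_lengthD[OF assms(1)] by (simp add: gen_closed)
  from ctxt_eq_subst_eq[OF ends_sub_eq(2)[OF c(1) assms(2-4)] this] ctxt_eq_lengthD[OF assms(1)]
  show ?thesis by (simp add: Id_at_eq)
qed

lemma Id_at_ctxt:
  assumes "ctxt S \<Delta>" "ctxt S K" "elems_eq S K \<Delta> f f" "elems_eq S K \<Delta> g g"
  shows "ctxt S (Id_at \<Delta> f g @ K)"
  using Id_at_ctxt_eq[OF ctxt_eq_refl] assms ctxt_eq_ctxt1 by blast

lemma gen_sub_eq:
  assumes "ctxt S \<Delta>" "ctxt S K" "elems_eq S K \<Delta> f f'" "elems_eq S K \<Delta> g g'" "elems_eq S K (Id_at \<Delta> f g) p p'"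
  shows "sub_eq S K (gen_ctx \<Delta> K) (ext p (ext g (ext f Var))) (ext p' (ext g' (ext f' Var)))"
  unfolding gen_closed[OF assms(1)]
  using sub_eq_ext[OF ends_sub_eq(1)[OF assms(1-4)], of "Id_ctx \<Delta>" p p'] gen_ctxt[OF closed_append[OF assms(1,2)]] assms
  by (simp add: Id_at_eq gen_closed)

text \<open>Reflexivity is the path part of the diagonal substitution, whose typing belongs to the
  induction over contexts.\<close>

lemma refl_ctx_typed:
  assumes "ctxt S \<Delta>" "ctxt_eq S \<Delta> \<Delta>'"
  shows "elems_eq S \<Delta> (Id_at \<Delta> (vars (length \<Delta>)) (vars (length \<Delta>))) (refl_ctx \<Delta>) (refl_ctx \<Delta>')"
proof -
  let ?n = "length \<Delta>"
  have l: "length \<Delta>' = ?n" using assms ctxt_eq_lengthD by metis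
  have "sub_eq S \<Delta> (Id_ctx \<Delta> @ \<Delta> @ \<Delta>) (ext (refl_ctx \<Delta>) (ext (vars ?n) Var)) (ext (refl_ctx \<Delta>') (ext (vars ?n) Var))"
    using J_ctx_okD(2)[of \<Delta> "[]" \<Delta>'] assms l by (simp add: gen_closed diag_ctx_def)
  from sub_eq_extD(2)[OF this] l have "elems_eq S \<Delta> (subst_tele (ext (vars ?n) Var) (Id_ctx \<Delta>)) (refl_ctx \<Delta>) (refl_ctx \<Delta>')" by simp
  moreover have "subst_tele (ext (vars ?n) Var) (Id_ctx \<Delta>) = Id_at \<Delta> (vars ?n) (vars ?n)"
    by (rule Id_at_vars[OF assms(1) refl]) (auto simp: ext_def)
  ultimately show ?thesis by simp
qed

lemma map_ext_vars [simp]: "length f = n \<Longrightarrow> map (subst (ext f \<sigma>)) (vars n) = f"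
  by (rule nth_equalityI) (auto simp: ext_def)

lemma refl_at_eq:
  assumes "ctxt_eq S \<Delta> \<Delta>'" "ctxt S K" "elems_eq S K \<Delta> f f'"
  shows "elems_eq S K (Id_at \<Delta> f f) (refl_at \<Delta> f) (refl_at \<Delta>' f')"
proof -
  let ?v = "vars (length \<Delta>)"
  have c: "ctxt S \<Delta>" using assms ctxt_eq_ctxt1 by blast
  have l: "length f = length \<Delta>" using elems_eq_length[OF assms(3)] by simp
  have v: "elems_eq S \<Delta> \<Delta> ?v ?v"
    using elems_vars[of "[]" \<Delta> "[]" 0 "length \<Delta>"] c by (simp add: vars_def closed_subst_tele)
  have "elems_eq S K (subst_tele (ext f Var) (Id_at \<Delta> ?v ?v)) (refl_at \<Delta> f) (refl_at \<Delta>' f')"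
    by (rule elems_eq_compose[OF c assms(2,3) _ refl_ctx_typed[OF c assms(1)]]) (rule Id_at_ctxt[OF c c v v])
  then show ?thesis by (simp add: Id_at_subst[OF c] l)
qed

lemma map_subst_refl_at:
  assumes "ctxt S \<Delta>" "length f = length \<Delta>"
  shows "map (subst \<sigma>) (refl_at \<Delta> f) = refl_at \<Delta> (map (subst \<sigma>) f)"
  using map_subst_compose[OF refl_ctx_typed[OF assms(1) ctxt_eq_refl[OF assms(1)]] assms(2)] .

end

context discrete_identity_types
begin

text \<open>
  The only use of discreteness.  The types in \<open>\<Psi>\<close> are identity types, so an element of \<open>Id(t, t')\<close>
  yields \<open>t = t'\<close>; such an element is obtained by elimination from the reflexivity on the diagonal.
\<close>

lemma eq_by_diag:
  assumes "ctxt S (\<Psi> @ \<Theta> @ gen_ctx \<Phi> \<Gamma>)" "idt_tele \<Psi>"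
    "elems_eq S (\<Theta> @ gen_ctx \<Phi> \<Gamma>) \<Psi> t t" "elems_eq S (\<Theta> @ gen_ctx \<Phi> \<Gamma>) \<Psi> t' t'"
    "elems_eq S (subst_tele (diag_ctx \<Phi>) \<Theta> @ \<Phi> @ \<Gamma>) (subst_tele (lift_sub (length \<Theta>) (diag_ctx \<Phi>)) \<Psi>)
       (map (subst (lift_sub (length \<Theta>) (diag_ctx \<Phi>))) t) (map (subst (lift_sub (length \<Theta>) (diag_ctx \<Phi>))) t')"
  shows "elems_eq S (\<Theta> @ gen_ctx \<Phi> \<Gamma>) \<Psi> t t'"
  using assms
proof (induction \<Psi> arbitrary: t t')
  case Nil
  then show ?case by simp
next
  case (Cons A \<Psi>)
  let ?K = "\<Theta> @ gen_ctx \<Phi> \<Gamma>" and ?L = "subst_tele (diag_ctx \<Phi>) \<Theta> @ \<Phi> @ \<Gamma>" and ?\<sigma> = "lift_sub (length \<Theta>) (diag_ctx \<Phi>)"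
  obtain a s where t: "t = a # s" and s: "elems_eq S ?K \<Psi> s s" and a: "?K \<turnstile>\<^bsub>S\<^esub> EqTerm a a (subst (ext s Var) A)"
    using Cons.prems(3) by (auto simp: elems_eq_Cons)
  obtain a' s' where t': "t' = a' # s'" and s': "elems_eq S ?K \<Psi> s' s'" and a': "?K \<turnstile>\<^bsub>S\<^esub> EqTerm a' a' (subst (ext s' Var) A)"
    using Cons.prems(4) by (auto simp: elems_eq_Cons)
  have ss': "elems_eq S ?L (subst_tele ?\<sigma> \<Psi>) (map (subst ?\<sigma>) s) (map (subst ?\<sigma>) s')"
    and aa': "?L \<turnstile>\<^bsub>S\<^esub> EqTerm (subst ?\<sigma> a) (subst ?\<sigma> a') (subst (ext (map (subst ?\<sigma>) s) Var) (subst (lift_sub (length \<Psi>) ?\<sigma>) A))"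
    using Cons.prems(5) by (auto simp: elems_eq_Cons t t' simp del: subst_subst)
  have c\<Psi>: "ctxt S (\<Psi> @ ?K)" and A: "\<Psi> @ ?K \<turnstile>\<^bsub>S\<^esub> IsType A" using Cons.prems(1) by auto
  have IH: "elems_eq S ?K \<Psi> s s'"
    by (rule Cons.IH[OF c\<Psi> _ s s' ss']) (use Cons.prems(2) in \<open>simp add: idt_tele_def\<close>)
  \<comment> \<open>The two heads are typed over different tails. Since the tails are now known to
    agree, \<open>a'\<close> can be converted to the type of \<open>a\<close>, and only then can the
    identity type of the two heads be formed.\<close>
  let ?A = "subst (ext s Var) A"
  have "?K \<turnstile>\<^bsub>S\<^esub> EqType ?A (subst (ext s' Var) A)" by (rule eq_type_subst[OF elems_eq_sub[OF c\<Psi> IH] eq_type_refl[OF A]])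
  then have a': "?K \<turnstile>\<^bsub>S\<^esub> HasType a' ?A" using a' eq_type_sym conversion eq_term_presup by blast
  have a: "?K \<turnstile>\<^bsub>S\<^esub> HasType a ?A" using a eq_term_presup by blast
  have ls: "length s = length \<Psi>" using elems_eq_length[OF s] by simp
  have A\<sigma>: "subst (ext (map (subst ?\<sigma>) s) Var) (subst (lift_sub (length \<Psi>) ?\<sigma>) A) = subst ?\<sigma> ?A"
    by (simp add: ls)
  have c: "ctxt S (\<Phi> @ \<Gamma>)"
    by (rule ctxt_appendD[of S "\<Psi> @ \<Theta> @ Id_ctx \<Phi> @ shift_tele (length \<Phi>) \<Phi>"]) (use c\<Psi> in \<open>simp add: gen_ctx_def\<close>)
  let ?C = "IdT ?A a a'"
  have C: "?K \<turnstile>\<^bsub>S\<^esub> IsType ?C" using Id_form[OF a a'] .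
  have AA: "?L \<turnstile>\<^bsub>S\<^esub> EqType (subst ?\<sigma> ?A) (subst ?\<sigma> ?A)"
    using aa' eq_term_presup has_type_presup eq_type_refl unfolding A\<sigma> by blast
  have la: "?L \<turnstile>\<^bsub>S\<^esub> HasType (subst ?\<sigma> a) (subst ?\<sigma> ?A)" using aa' eq_term_presup unfolding A\<sigma> by blast
  have "?L \<turnstile>\<^bsub>S\<^esub> EqType (IdT (subst ?\<sigma> ?A) (subst ?\<sigma> a) (subst ?\<sigma> a)) (subst ?\<sigma> ?C)"
    using Id_cong[OF AA eq_term_refl[OF la]] aa' unfolding A\<sigma> by simp
  then have r: "?L \<turnstile>\<^bsub>S\<^esub> HasType (Refl (subst ?\<sigma> ?A) (subst ?\<sigma> a)) (subst ?\<sigma> ?C)"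
    using Id_intro[OF la] conversion by blast
  have "elems_eq S ?K [?C] (J_ctx \<Phi> \<Theta> [?C] [Refl (subst ?\<sigma> ?A) (subst ?\<sigma> a)]) (J_ctx \<Phi> \<Theta> [?C] [Refl (subst ?\<sigma> ?A) (subst ?\<sigma> a)])"
  proof (rule J_ctx_okD(3)[OF ctxt_eq_refl[OF c] refl])
    show "ctxt_eq S ([?C] @ ?K) ([?C] @ ?K)" by (rule ctxt_eq_refl) (use C c\<Psi> in_context in auto)
    show "elems_eq S ?L (subst_tele ?\<sigma> [?C]) [Refl (subst ?\<sigma> ?A) (subst ?\<sigma> a)] [Refl (subst ?\<sigma> ?A) (subst ?\<sigma> a)]"
      using eq_term_refl[OF r] by (simp add: elems_eq_Cons comp_def)
  qed simp_all
  then obtain \<alpha> where \<alpha>: "?K \<turnstile>\<^bsub>S\<^esub> HasType \<alpha> ?C" by (auto simp: elems_eq_Cons simp flip: has_type_eq)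
  obtain B u v where "A = IdT B u v" using Cons.prems(2) by (auto simp: idt_tele_def)
  then have "?K \<turnstile>\<^bsub>S\<^esub> EqTerm a a' ?A" using reflection[of ?K a _ _ _ a' \<alpha>] a a' \<alpha> by simp
  then show ?case using IH t t' by (simp add: elems_eq_Cons)
qed

end

section \<open>Composition and functorial action of paths\<close>

context dependent_type_theory
begin

lemma elems_vars_closed:
  assumes "ctxt S \<Delta>" "ctxt S (\<Xi> @ \<Delta> @ \<Gamma>)" "length \<Xi> = m" "length \<Delta> = n"
  shows "elems_eq S (\<Xi> @ \<Delta> @ \<Gamma>) \<Delta> (map Var [m..<m + n]) (map Var [m..<m + n])"
  using elems_vars[OF assms(2-4)] by (simp add: closed_subst_tele[OF assms(1)])

lemma closed_ctxt_eq_append: "ctxt_eq S \<Delta> \<Delta>' \<Longrightarrow> ctxt S K \<Longrightarrow> ctxt_eq S (\<Delta> @ K) (\<Delta>' @ K)"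
  using ctxt_eq_subst_eq[of K "[]" Var Var \<Delta> \<Delta>' "[]"] ctxt_eq_lengthD[of S \<Delta> \<Delta>'] by simp

lemma map_subst_cong:
  assumes "elems_eq S \<Delta> \<Theta> g g'" "\<And>i. i < length \<Delta> \<Longrightarrow> \<sigma> i = \<tau> i"
  shows "map (subst \<sigma>) g = map (subst \<tau>) g"
  using elems_eq_scoped[OF assms(1)] subst_cong_scoped[where \<sigma> = \<sigma> and \<tau> = \<tau>, OF _ assms(2)] by auto

end

lemma map_subst_vars:
  assumes "\<And>i. i < n \<Longrightarrow> \<sigma> (i + k) = Var (i + l)"
  shows "map (subst \<sigma>) (map Var [k..<k + n]) = map Var [l..<l + n]"
  by (rule nth_equalityI) (use assms in \<open>auto simp: add.commute\<close>)

lemma map_subst_vars_ext: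
  assumes "\<And>i. i < n \<Longrightarrow> \<sigma> (i + k) = f ! i" "length f = n"
  shows "map (subst \<sigma>) (map Var [k..<k + n]) = f"
  by (rule nth_equalityI) (use assms in \<open>auto simp: add.commute\<close>)

context identity_types
begin

text \<open>The ambient context is x : \<Delta>, the post-context \<open>P\<close> is a path from x
  to y, and the target \<open>T\<close> is a path from x to z. On the diagonal y and z coincide,
  \<open>T\<close> becomes the weakening of the restricted \<open>P\<close>, and the datum of the
  elimination is the post-context variable itself.\<close>

lemma path_comp_gen_props:
  assumes \<Delta>: "ctxt_eq S \<Delta> \<Delta>'" and n: "length \<Delta> = n"
  defines "P \<equiv> subst_tele (\<lambda>i. Var (i + 2 * n)) (Id_ctx \<Delta>)"
    and "T \<equiv> subst_tele (\<lambda>i. Var (if i < n then i + 2 * n else i + 3 * n)) (Id_ctx \<Delta>)"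
  shows "ctxt S (T @ P @ gen_ctx \<Delta> \<Delta>)"
    "elems_eq S (P @ gen_ctx \<Delta> \<Delta>) T (path_comp_gen \<Delta>) (path_comp_gen \<Delta>')"
    "ctxt S (subst_tele (lift_sub n (diag_ctx \<Delta>)) T @ subst_tele (diag_ctx \<Delta>) P @ \<Delta> @ \<Delta>)"
    "elems_eq S (subst_tele (diag_ctx \<Delta>) P @ \<Delta> @ \<Delta>) (subst_tele (lift_sub n (diag_ctx \<Delta>)) T)
       (map (subst (lift_sub n (diag_ctx \<Delta>))) (path_comp_gen \<Delta>)) (vars n)"
    "subst_tele (diag_ctx \<Delta>) P = Id_at \<Delta> (map Var [n..<n + n]) (map Var [0..<n])"
proof -
  have c: "ctxt S \<Delta>" "ctxt S \<Delta>'" using \<Delta> ctxt_eq_ctxt1 ctxt_eq_ctxt2 by blast+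
  have n': "length \<Delta>' = n" using ctxt_eq_lengthD[OF \<Delta>] n by simp
  let ?L = "gen_ctx \<Delta> \<Delta>" and ?\<delta> = "diag_ctx \<Delta>"
  let ?P' = "subst_tele (\<lambda>i. Var (i + 2 * n)) (Id_ctx \<Delta>')"
  let ?T' = "subst_tele (\<lambda>i. Var (if i < n then i + 2 * n else i + 3 * n)) (Id_ctx \<Delta>')"
  have cd: "ctxt S (\<Delta> @ \<Delta>)" by (rule closed_append[OF c(1) c(1)])
  have ce: "ctxt_eq S (\<Delta> @ \<Delta>) (\<Delta>' @ \<Delta>)" by (rule closed_ctxt_eq_append[OF \<Delta> c(1)])
  have cL: "ctxt S ?L" by (rule gen_ctxt[OF cd])
  have L: "?L = Id_ctx \<Delta> @ \<Delta> @ \<Delta> @ \<Delta>" by (rule gen_closed[OF c(1)])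
  have cee: "ctxt_eq S ?L (gen_ctx \<Delta>' \<Delta>)" by (rule J_ctx_okD(1)[OF ce]) (simp add: n n')
  \<comment> \<open>Blocks of \<open>gen_ctx \<Delta> \<Delta>\<close>, innermost first: q at 0, z
    at \<open>n\<close>, y at \<open>2 * n\<close>, x at \<open>3 * n\<close>. The post-context adds
    \<open>n\<close> to each, so x and z are then found at \<open>4 * n\<close> and
    \<open>2 * n\<close>.\<close>
  let ?X = "map Var [3 * n..<3 * n + n]" and ?Y = "map Var [2 * n..<2 * n + n]"
  let ?X' = "map Var [4 * n..<4 * n + n]" and ?Z' = "map Var [2 * n..<2 * n + n]"
  have X: "elems_eq S ?L \<Delta> ?X ?X" using elems_vars_closed[of \<Delta> "Id_ctx \<Delta> @ \<Delta> @ \<Delta>" "[]" "3 * n" n] c cL n by (simp add: L)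
  have Y: "elems_eq S ?L \<Delta> ?Y ?Y" using elems_vars_closed[of \<Delta> "Id_ctx \<Delta> @ \<Delta>" \<Delta> "2 * n" n] c cL n by (simp add: L)
  have P: "P = Id_at \<Delta> ?X ?Y" unfolding P_def by (rule Id_at_vars[OF c(1) n]) (auto simp: ext_def)
  have P': "?P' = Id_at \<Delta>' ?X ?Y" by (rule Id_at_vars[OF c(2) n']) (auto simp: ext_def)
  have eP: "ctxt_eq S (P @ ?L) (?P' @ ?L)" unfolding P P' by (rule Id_at_ctxt_eq[OF \<Delta> cL X Y])
  have cP: "ctxt S (P @ ?L)" using eP by (rule ctxt_eq_ctxt1)
  have lP: "length P = n" by (simp add: P_def n)
  have X': "elems_eq S (P @ ?L) \<Delta> ?X' ?X'" using elems_vars_closed[of \<Delta> "P @ Id_ctx \<Delta> @ \<Delta> @ \<Delta>" "[]" "4 * n" n] c cP n lP by (simp add: L)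
  have Z': "elems_eq S (P @ ?L) \<Delta> ?Z' ?Z'" using elems_vars_closed[of \<Delta> "P @ Id_ctx \<Delta>" "\<Delta> @ \<Delta>" "2 * n" n] c cP n lP by (simp add: L)
  have T: "T = Id_at \<Delta> ?X' ?Z'" unfolding T_def by (rule Id_at_vars[OF c(1) n]) (auto simp: ext_def)
  have T': "?T' = Id_at \<Delta>' ?X' ?Z'" by (rule Id_at_vars[OF c(2) n']) (auto simp: ext_def)
  have eT: "ctxt_eq S (T @ P @ ?L) (?T' @ P @ ?L)" unfolding T T' by (rule Id_at_ctxt_eq[OF \<Delta> cP X' Z'])
  have lT: "length T = n" by (simp add: T_def n)
  have e1: "ctxt_eq S (P @ ?L) (?P' @ gen_ctx \<Delta>' \<Delta>)"
    by (rule ctxt_eq_append[OF eP cee]) (simp add: lP n')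
  have e2: "ctxt_eq S (T @ P @ ?L) (?T' @ ?P' @ gen_ctx \<Delta>' \<Delta>)"
    by (rule ctxt_eq_append[OF eT e1]) (simp add: lT n')
  show cT: "ctxt S (T @ P @ ?L)" using eT by (rule ctxt_eq_ctxt1)
  have \<delta>: "?\<delta> (i + 2 * n) = Var i" "i < n \<Longrightarrow> ?\<delta> (i + n) = Var i" for i
    using n by (auto simp: mult_2 add.assoc[symmetric])
  have d3: "map (subst ?\<delta>) ?X = map Var [n..<n + n]"
    by (rule map_subst_vars) (use \<delta>(1)[of "i + n" for i] in \<open>simp add: algebra_simps\<close>)
  have d2: "map (subst ?\<delta>) ?Y = map Var [0..<0 + n]"
    by (rule map_subst_vars) (use \<delta> in simp)
  show P\<delta>: "subst_tele ?\<delta> P = Id_at \<Delta> (map Var [n..<n + n]) (map Var [0..<n])"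
    unfolding P using Id_at_subst[OF c(1), of ?X ?Y ?\<delta>] n d3 d2 by simp
  let ?M = "subst_tele ?\<delta> P @ \<Delta> @ \<Delta>"
  have d4: "map (subst (lift_sub n ?\<delta>)) ?X' = map Var [2 * n..<2 * n + n]"
    by (rule map_subst_vars) (use \<delta>(1)[of "i + n" for i] in \<open>simp add: lift_sub_def algebra_simps\<close>)
  have d5: "map (subst (lift_sub n ?\<delta>)) ?Z' = map Var [n..<n + n]"
    by (rule map_subst_vars) (use \<delta>(2) in \<open>simp add: lift_sub_def mult_2 add.assoc[symmetric]\<close>)
  have T\<delta>: "subst_tele (lift_sub n ?\<delta>) T = Id_at \<Delta> (map Var [2 * n..<2 * n + n]) (map Var [n..<n + n])"
    unfolding T using Id_at_subst[OF c(1), of ?X' ?Z' "lift_sub n ?\<delta>"] n d4 d5 by simp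
  have s: "sub S (\<Delta> @ \<Delta>) ?L ?\<delta>" by (rule diag_ctx_typed[OF cd])
  have cM: "ctxt S ?M" using ctxt_subst[OF s cP] .
  have "elems_eq S ?M (subst_tele (\<lambda>i. Var (i + (0 + n))) (subst_tele ?\<delta> P)) (map Var [0..<0 + n]) (map Var [0..<0 + n])"
    by (rule elems_vars[of "[]", simplified]) (use cM lP in simp_all)
  moreover have "subst_tele (\<lambda>i. Var (i + (0 + n))) (subst_tele ?\<delta> P) = subst_tele (lift_sub n ?\<delta>) T"
    unfolding P\<delta> T\<delta> using map_subst_vars[of n "\<lambda>i. Var (i + n) :: 'c expr" n "2 * n"] map_subst_vars[of n "\<lambda>i. Var (i + n) :: 'c expr" 0 n]
    by (subst Id_at_subst[OF c(1)]) (simp_all add: n comp_def mult_2)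
  ultimately have v: "elems_eq S ?M (subst_tele (lift_sub n ?\<delta>) T) (vars n) (vars n)" by (simp only: vars_def add_0)
  have v': "elems_eq S ?M (subst_tele (lift_sub (length P) ?\<delta>) T) (vars n) (vars n)" using v lP by simp
  have g: "path_comp_gen \<Delta> = J_ctx \<Delta> P T (vars n)" "path_comp_gen \<Delta>' = J_ctx \<Delta>' ?P' ?T' (vars n)"
    using c n n' by (simp_all add: path_comp_gen_def Let_def P_def T_def shift_tele_def[of "2 * n"])
  have l: "length \<Delta> = length \<Delta>'" "length T = length ?T'" "length P = length ?P'" using n n' lT lP by simp_all
  show "elems_eq S (P @ ?L) T (path_comp_gen \<Delta>) (path_comp_gen \<Delta>')"
    unfolding g by (rule J_ctx_okD(3)[OF ce l e2 v'])
  show "ctxt S (subst_tele (lift_sub n ?\<delta>) T @ ?M)" using ctxt_subst[OF s, of "T @ P"] cT lP by simp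
  show "elems_eq S ?M (subst_tele (lift_sub n ?\<delta>) T) (map (subst (lift_sub n ?\<delta>)) (path_comp_gen \<Delta>)) (vars n)"
    unfolding g using J_ctx_okD(4)[OF ce l e2 v'] lP by simp
qed

lemma path_comp_eq: "path_comp \<Delta> f g h q p = map (subst (ext p (ext q (ext h (ext g (ext f Var)))))) (path_comp_gen \<Delta>)"
  by (simp add: path_comp_def compose_eq)

lemma path_comp_gen_length:
  assumes "ctxt S \<Delta>" shows "length (path_comp_gen \<Delta>) = length \<Delta>"
  using path_comp_gen_props(2)[OF ctxt_eq_refl[OF assms] refl] elems_eq_length by fastforce

lemma path_comp_cong:
  assumes \<Delta>: "ctxt_eq S \<Delta> \<Delta>'" and K: "ctxt S K"
    and f: "elems_eq S K \<Delta> f f'" and g: "elems_eq S K \<Delta> g g'" and h: "elems_eq S K \<Delta> h h'"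
    and q: "elems_eq S K (Id_at \<Delta> g h) q q'" and p: "elems_eq S K (Id_at \<Delta> f g) p p'"
  shows "elems_eq S K (Id_at \<Delta> f h) (path_comp \<Delta> f g h q p) (path_comp \<Delta>' f' g' h' q' p')"
proof -
  define n where "n = length \<Delta>"
  have c: "ctxt S \<Delta>" using \<Delta> ctxt_eq_ctxt1 by blast
  let ?P = "subst_tele (\<lambda>i. Var (i + 2 * n)) (Id_ctx \<Delta>)"
  let ?T = "subst_tele (\<lambda>i. Var (if i < n then i + 2 * n else i + 3 * n)) (Id_ctx \<Delta>)"
  note gp = path_comp_gen_props[OF \<Delta> n_def[symmetric]]
  have l: "length f = n" "length g = n" "length h = n" "length q = n" "length p = n"
    using elems_eq_length[OF f] elems_eq_length[OF g] elems_eq_length[OF h] elems_eq_length[OF q] elems_eq_length[OF p]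
    by (simp_all add: n_def)
  have c3: "ctxt S (\<Delta> @ \<Delta>)" "ctxt S (\<Delta> @ \<Delta> @ \<Delta>)" "ctxt S (Id_ctx \<Delta> @ \<Delta> @ \<Delta> @ \<Delta>)"
    using c gen_ctxt[of \<Delta> \<Delta>] by (simp_all add: closed_append gen_closed)
  have 1: "sub_eq S K \<Delta> (ext f Var) (ext f' Var)" by (rule elems_sub_closed[OF c K f])
  have 2: "sub_eq S K (\<Delta> @ \<Delta>) (ext g (ext f Var)) (ext g' (ext f' Var))"
    by (rule sub_eq_ext[OF 1 c3(1)]) (simp add: closed_subst_tele[OF c] g)
  have 3: "sub_eq S K (\<Delta> @ \<Delta> @ \<Delta>) (ext h (ext g (ext f Var))) (ext h' (ext g' (ext f' Var)))"
    by (rule sub_eq_ext[OF 2 c3(2)]) (simp add: closed_subst_tele[OF c] h)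
  have e4: "subst_tele (ext h (ext g (ext f Var))) (Id_ctx \<Delta>) = Id_at \<Delta> g h"
    by (rule Id_at_vars[OF c n_def[symmetric]]) (use l in \<open>auto simp: ext_def\<close>)
  have 4: "sub_eq S K (gen_ctx \<Delta> \<Delta>) (ext q (ext h (ext g (ext f Var)))) (ext q' (ext h' (ext g' (ext f' Var))))"
    unfolding gen_closed[OF c] by (rule sub_eq_ext[OF 3 c3(3)]) (simp add: e4 q)
  have "subst_tele (ext q (ext h (ext g (ext f Var)))) ?P = subst_tele (\<lambda>i. (ext q (ext h (ext g (ext f Var)))) (i + 2 * n)) (Id_ctx \<Delta>)"
    by simp
  also have "\<dots> = Id_at \<Delta> f g"
    by (rule Id_at_vars[OF c n_def[symmetric]]) (use l in \<open>auto simp: ext_def\<close>)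
  finally have e5: "subst_tele (ext q (ext h (ext g (ext f Var)))) ?P = Id_at \<Delta> f g" .
  have 5: "sub_eq S K (?P @ gen_ctx \<Delta> \<Delta>) (ext p (ext q (ext h (ext g (ext f Var))))) (ext p' (ext q' (ext h' (ext g' (ext f' Var)))))"
    by (rule sub_eq_ext[OF 4 ctxt_appendD[OF gp(1)]]) (simp only: e5 p)
  have "subst_tele (ext p (ext q (ext h (ext g (ext f Var))))) ?T =
      subst_tele (\<lambda>i. (ext p (ext q (ext h (ext g (ext f Var))))) (if i < n then i + 2 * n else i + 3 * n)) (Id_ctx \<Delta>)"
    by simp
  also have "\<dots> = Id_at \<Delta> f h"
    by (rule Id_at_vars[OF c n_def[symmetric]]) (use l in \<open>auto simp: ext_def\<close>)
  finally have e6: "subst_tele (ext p (ext q (ext h (ext g (ext f Var))))) ?T = Id_at \<Delta> f h" .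
  show ?thesis using elems_eq_subst[OF 5 gp(1,2)] unfolding e6 path_comp_eq .
qed

text \<open>An instance of the computation rule, since composition is defined by elimination on the
  factor that is reflexive here.\<close>

lemma path_comp_refl_left:
  assumes c: "ctxt S \<Delta>" and K: "ctxt S K"
    and f: "elems_eq S K \<Delta> f f" and g: "elems_eq S K \<Delta> g g" and p: "elems_eq S K (Id_at \<Delta> f g) p p"
  shows "elems_eq S K (Id_at \<Delta> f g) (path_comp \<Delta> f g g (refl_at \<Delta> g) p) p"
proof -
  define n where "n = length \<Delta>"
  let ?P = "subst_tele (\<lambda>i. Var (i + 2 * n)) (Id_ctx \<Delta>)" and ?\<delta> = "diag_ctx \<Delta>"
  let ?T = "subst_tele (\<lambda>i. Var (if i < n then i + 2 * n else i + 3 * n)) (Id_ctx \<Delta>)"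
  note gp = path_comp_gen_props[OF ctxt_eq_refl[OF c] n_def[symmetric]]
  have l: "length f = n" "length g = n" "length p = n"
    using elems_eq_length[OF f] elems_eq_length[OF g] elems_eq_length[OF p] by (simp_all add: n_def)
  let ?\<rho> = "ext p (ext g (ext f Var))"
  have 2: "sub_eq S K (\<Delta> @ \<Delta>) (ext g (ext f Var)) (ext g (ext f Var))"
    by (rule ends_sub_eq(2)[OF c K f g])
  have m: "map (subst (ext g (ext f Var))) (map Var [n..<n + n]) = f" "map (subst (ext g (ext f Var))) (map Var [0..<n]) = g"
    using map_subst_vars_ext[of n "ext g (ext f Var)" n f] map_subst_vars_ext[of n "ext g (ext f Var)" 0 g] l
    by (simp_all add: ext_def)
  have "subst_tele (ext g (ext f Var)) (subst_tele ?\<delta> ?P) = Id_at \<Delta> f g"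
    unfolding gp(5) using m by (subst Id_at_subst[OF c]) (simp_all add: n_def)
  then have 3: "sub S K (subst_tele ?\<delta> ?P @ \<Delta> @ \<Delta>) ?\<rho>"
    using sub_eq_ext[OF 2 ctxt_appendD[OF gp(3)]] p by (simp only:)
  \<comment> \<open>Restricting to the diagonal and then filling in the end points is the
    instantiation with y = z = g and q reflexive.\<close>
  have s: "(\<lambda>i. subst ?\<rho> (lift_sub n ?\<delta> i)) = ext p (ext (refl_at \<Delta> g) (ext g (ext g (ext f Var))))"
  proof -
    have "map (subst (ext g (ext f Var))) (refl_ctx \<Delta>) = refl_at \<Delta> g"
      unfolding compose_eq by (rule map_subst_cong[OF refl_ctx_typed[OF c ctxt_eq_refl[OF c]]]) (use l in \<open>auto simp: ext_def n_def\<close>)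
    then show ?thesis using l by (simp add: diag_ctx_def n_def[symmetric])
  qed
  have "elems_eq S K (subst_tele ?\<rho> (subst_tele (lift_sub n ?\<delta>) ?T))
     (map (subst ?\<rho>) (map (subst (lift_sub n ?\<delta>)) (path_comp_gen \<Delta>))) (map (subst ?\<rho>) (vars n))"
    by (rule elems_eq_subst[OF 3 gp(3,4)])
  moreover have "map (subst ?\<rho>) (map (subst (lift_sub n ?\<delta>)) (path_comp_gen \<Delta>)) = path_comp \<Delta> f g g (refl_at \<Delta> g) p"
    using s unfolding path_comp_eq map_map comp_def subst_subst by (simp only:)
  moreover have "subst_tele ?\<rho> (subst_tele (lift_sub n ?\<delta>) ?T) = Id_at \<Delta> f g"
  proof -
    have "subst_tele ?\<rho> (subst_tele (lift_sub n ?\<delta>) ?T) =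
      subst_tele (\<lambda>i. ext p (ext (refl_at \<Delta> g) (ext g (ext g (ext f Var)))) (if i < n then i + 2 * n else i + 3 * n)) (Id_ctx \<Delta>)"
      unfolding subst_tele_subst_tele s[symmetric] by simp
    also have "\<dots> = Id_at \<Delta> f g"
      by (rule Id_at_vars[OF c n_def[symmetric]]) (use l in \<open>auto simp: ext_def n_def\<close>)
    finally show ?thesis .
  qed
  ultimately show ?thesis using l by simp
qed

lemma map_subst_path_comp:
  assumes "ctxt S \<Delta>" "length f = length \<Delta>" "length g = length \<Delta>" "length h = length \<Delta>" "length q = length \<Delta>" "length p = length \<Delta>"
  shows "map (subst \<sigma>) (path_comp \<Delta> f g h q p) =
    path_comp \<Delta> (map (subst \<sigma>) f) (map (subst \<sigma>) g) (map (subst \<sigma>) h) (map (subst \<sigma>) q) (map (subst \<sigma>) p)"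
  unfolding path_comp_def
  by (subst map_subst_compose[OF path_comp_gen_props(2)[OF ctxt_eq_refl[OF assms(1)] refl]])
    (use assms in \<open>simp_all add: gen_closed\<close>)

section \<open>Images of paths under a morphism of contexts\<close>

lemma path_map_gen_props:
  assumes \<Delta>: "ctxt_eq S \<Delta> \<Delta>'" and \<Theta>: "ctxt_eq S \<Theta> \<Theta>'" and h: "elems_eq S \<Delta> \<Theta> h h'" and n: "length \<Delta> = n"
  defines "T \<equiv> Id_at \<Theta> (map (shift (2 * n)) h) (map (shift n) h)"
  shows "ctxt S (T @ gen_ctx \<Delta> [])"
    "elems_eq S (gen_ctx \<Delta> []) T (path_map_gen \<Delta> \<Theta> h) (path_map_gen \<Delta>' \<Theta>' h')"
    "ctxt S (subst_tele (diag_ctx \<Delta>) T @ \<Delta>)"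
    "elems_eq S \<Delta> (subst_tele (diag_ctx \<Delta>) T) (map (subst (diag_ctx \<Delta>)) (path_map_gen \<Delta> \<Theta> h)) (refl_at \<Theta> h)"
    "subst_tele (diag_ctx \<Delta>) T = Id_at \<Theta> h h"
proof -
  have c: "ctxt S \<Delta>" "ctxt S \<Delta>'" "ctxt S \<Theta>" "ctxt S \<Theta>'" using \<Delta> \<Theta> ctxt_eq_ctxt1 ctxt_eq_ctxt2 by blast+
  have n': "length \<Delta>' = n" using ctxt_eq_lengthD[OF \<Delta>] n by simp
  let ?L = "gen_ctx \<Delta> []" and ?\<delta> = "diag_ctx \<Delta>"
  have ce: "ctxt_eq S (\<Delta> @ []) (\<Delta>' @ [])" using \<Delta> by simp
  have cL: "ctxt S ?L" by (rule gen_ctxt) (simp add: c)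
  have L: "?L = Id_ctx \<Delta> @ \<Delta> @ \<Delta>" using gen_closed[OF c(1), of "[]"] by simp
  have cee: "ctxt_eq S ?L (gen_ctx \<Delta>' [])" by (rule J_ctx_okD(1)[OF ce]) (simp add: n n')
  have sx: "sub S ?L \<Delta> (\<lambda>i. Var (i + 2 * n))"
    using sub_shift'[of "Id_ctx \<Delta> @ \<Delta>" \<Delta> "2 * n"] cL n by (simp add: L)
  have "elems_eq S ?L \<Delta> (map Var [n..<n + n]) (map Var [n..<n + n])"
    using elems_vars_closed[of \<Delta> "Id_ctx \<Delta>" \<Delta> n n] c cL n by (simp add: L)
  from elems_sub_closed[OF c(1) cL this] have "sub S ?L \<Delta> (ext (map Var [n..<n + n]) Var)" .
  \<comment> \<open>The function \<open>\<lambda>i. Var (i + n)\<close> agrees with the second copy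
    of \<open>\<Delta>\<close> on the variables in scope, which is all that matters; in this form it
    is a shift.\<close>
  then have "sub_eq S ?L \<Delta> (ext (map Var [n..<n + n]) Var) (\<lambda>i. Var (i + n))"
    by (rule sub_eq_trivial[OF c(1)]) (auto simp: ext_def n)
  then have sy: "sub S ?L \<Delta> (\<lambda>i. Var (i + n))" by (rule sub_eq_right)
  have c\<Theta>: "ctxt S (\<Theta> @ \<Delta>)" by (rule closed_append[OF c(3,1)])
  have hx: "elems_eq S ?L \<Theta> (map (shift (2 * n)) h) (map (shift (2 * n)) h')"
    using elems_eq_subst[OF sx c\<Theta> h] by (simp add: closed_subst_tele[OF c(3)] shift_eq_subst[abs_def])
  have hy: "elems_eq S ?L \<Theta> (map (shift n) h) (map (shift n) h')"
    using elems_eq_subst[OF sy c\<Theta> h] by (simp add: closed_subst_tele[OF c(3)] shift_eq_subst[abs_def])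
  let ?T' = "Id_at \<Theta>' (map (shift (2 * n)) h') (map (shift n) h')"
  have eT: "ctxt_eq S (T @ ?L) (?T' @ ?L)" unfolding T_def by (rule Id_at_ctxt_eq[OF \<Theta> cL hx hy])
  have lT: "length T = length ?T'" using ctxt_eq_lengthD[OF \<Theta>] by (simp add: T_def)
  have e: "ctxt_eq S (T @ [] @ ?L) (?T' @ [] @ gen_ctx \<Delta>' [])" using ctxt_eq_append[OF eT cee lT] by simp
  show cT: "ctxt S (T @ ?L)" using eT by (rule ctxt_eq_ctxt1)
  have lh: "length h = length \<Theta>" using elems_eq_length[OF h] by simp
  have "map (subst ?\<delta>) (map (shift (2 * n)) h) = map (subst Var) h"
    unfolding map_map comp_def subst_shift using n by (simp add: mult_2 add.assoc[symmetric])
  moreover have "map (subst ?\<delta>) (map (shift n) h) = map (subst Var) h"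
    unfolding map_map comp_def subst_shift by (rule map_subst_cong[OF h]) (simp add: n)
  ultimately show T\<delta>: "subst_tele ?\<delta> T = Id_at \<Theta> h h"
    unfolding T_def by (subst Id_at_subst[OF c(3)]) (simp_all add: lh)
  have r: "elems_eq S \<Delta> (Id_at \<Theta> h h) (refl_at \<Theta> h) (refl_at \<Theta>' h')" by (rule refl_at_eq[OF \<Theta> c(1) h])
  then have r': "elems_eq S (subst_tele ?\<delta> [] @ \<Delta> @ []) (subst_tele (lift_sub (length []) ?\<delta>) T) (refl_at \<Theta> h) (refl_at \<Theta>' h')"
    by (simp add: T\<delta>)
  have g: "path_map_gen \<Delta> \<Theta> h = J_ctx \<Delta> [] T (refl_at \<Theta> h)" "path_map_gen \<Delta>' \<Theta>' h' = J_ctx \<Delta>' [] ?T' (refl_at \<Theta>' h')"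
    using n n' by (simp_all add: path_map_gen_def Let_def T_def)
  have l: "length \<Delta> = length \<Delta>'" using n n' by simp
  show "elems_eq S ?L T (path_map_gen \<Delta> \<Theta> h) (path_map_gen \<Delta>' \<Theta>' h')"
    unfolding g using J_ctx_okD(3)[OF ce l lT refl e r'] by simp
  show "ctxt S (subst_tele ?\<delta> T @ \<Delta>)" using ctxt_subst[OF diag_ctx_typed[of \<Delta> "[]"] cT] c by simp
  show "elems_eq S \<Delta> (subst_tele ?\<delta> T) (map (subst ?\<delta>) (path_map_gen \<Delta> \<Theta> h)) (refl_at \<Theta> h)"
    unfolding g using J_ctx_okD(4)[OF ce l lT refl e r'] by simp
qed

lemma path_map_eq: "path_map \<Delta> \<Theta> h f g p = map (subst (ext p (ext g (ext f Var)))) (path_map_gen \<Delta> \<Theta> h)"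
  by (simp add: path_map_def compose_eq)

lemma path_map_cong:
  assumes \<Delta>: "ctxt_eq S \<Delta> \<Delta>'" and \<Theta>: "ctxt_eq S \<Theta> \<Theta>'" and h: "elems_eq S \<Delta> \<Theta> h h'" and K: "ctxt S K"
    and f: "elems_eq S K \<Delta> f f'" and g: "elems_eq S K \<Delta> g g'" and p: "elems_eq S K (Id_at \<Delta> f g) p p'"
  shows "elems_eq S K (Id_at \<Theta> (compose h f) (compose h g)) (path_map \<Delta> \<Theta> h f g p) (path_map \<Delta>' \<Theta>' h' f' g' p')"
proof -
  define n where "n = length \<Delta>"
  have c: "ctxt S \<Delta>" "ctxt S \<Theta>" using \<Delta> \<Theta> ctxt_eq_ctxt1 by blast+
  let ?T = "Id_at \<Theta> (map (shift (2 * n)) h) (map (shift n) h)"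
  note gp = path_map_gen_props[OF \<Delta> \<Theta> h n_def[symmetric]]
  have l: "length f = n" "length g = n" "length p = n" "length h = length \<Theta>"
    using elems_eq_length[OF f] elems_eq_length[OF g] elems_eq_length[OF p] elems_eq_length[OF h] by (simp_all add: n_def)
  let ?\<rho> = "ext p (ext g (ext f Var))"
  have s: "sub_eq S K (gen_ctx \<Delta> []) ?\<rho> (ext p' (ext g' (ext f' Var)))"
    using sub_eq_ext[OF ends_sub_eq(2)[OF c(1) K f g], of "Id_ctx \<Delta>" p p'] p Id_ctx_ctxt[OF c(1)] gen_closed[OF c(1), of "[]"]
    by (simp add: Id_at_eq)
  have "map (subst ?\<rho>) (map (shift (2 * n)) h) = compose h f"
    unfolding map_map comp_def subst_shift compose_eq using l by (simp add: mult_2 add.assoc[symmetric])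
  moreover have "map (subst ?\<rho>) (map (shift n) h) = compose h g"
    unfolding map_map comp_def subst_shift compose_eq by (rule map_subst_cong[OF h]) (use l in \<open>simp add: ext_def n_def\<close>)
  ultimately have "subst_tele ?\<rho> ?T = Id_at \<Theta> (compose h f) (compose h g)"
    by (subst Id_at_subst[OF c(2)]) (simp_all add: l)
  then show ?thesis using elems_eq_subst[OF s gp(1,2)] by (simp add: path_map_eq)
qed

lemma path_map_refl:
  assumes c: "ctxt S \<Delta>" "ctxt S \<Theta>" and h: "elems_eq S \<Delta> \<Theta> h h" and K: "ctxt S K" and f: "elems_eq S K \<Delta> f f"
  shows "elems_eq S K (Id_at \<Theta> (compose h f) (compose h f)) (path_map \<Delta> \<Theta> h f f (refl_at \<Delta> f)) (refl_at \<Theta> (compose h f))"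
proof -
  define n where "n = length \<Delta>"
  let ?T = "Id_at \<Theta> (map (shift (2 * n)) h) (map (shift n) h)" and ?\<delta> = "diag_ctx \<Delta>"
  note gp = path_map_gen_props[OF ctxt_eq_refl[OF c(1)] ctxt_eq_refl[OF c(2)] h n_def[symmetric]]
  have l: "length f = n" "length h = length \<Theta>" using elems_eq_length[OF f] elems_eq_length[OF h] by (simp_all add: n_def)
  have s: "sub S K \<Delta> (ext f Var)" by (rule elems_sub_closed[OF c(1) K f])
  have \<rho>: "(\<lambda>i. subst (ext f Var) (?\<delta> i)) = ext (refl_at \<Delta> f) (ext f (ext f Var))"
    using l by (simp add: diag_ctx_def compose_eq n_def)
  have "elems_eq S K (subst_tele (ext f Var) (subst_tele ?\<delta> ?T))
      (map (subst (ext f Var)) (map (subst ?\<delta>) (path_map_gen \<Delta> \<Theta> h))) (map (subst (ext f Var)) (refl_at \<Theta> h))"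
    by (rule elems_eq_subst[OF s gp(3,4)])
  moreover have "subst_tele (ext f Var) (subst_tele ?\<delta> ?T) = Id_at \<Theta> (compose h f) (compose h f)"
    unfolding gp(5) by (subst Id_at_subst[OF c(2)]) (simp_all add: l compose_eq)
  moreover have "map (subst (ext f Var)) (map (subst ?\<delta>) (path_map_gen \<Delta> \<Theta> h)) = path_map \<Delta> \<Theta> h f f (refl_at \<Delta> f)"
    using \<rho> unfolding path_map_eq map_map comp_def subst_subst by (simp only:)
  moreover have "map (subst (ext f Var)) (refl_at \<Theta> h) = refl_at \<Theta> (compose h f)"
    using map_subst_refl_at[OF c(2) l(2), of "ext f Var"] by (simp only: compose_eq[of h])
  ultimately show ?thesis by (simp only:)
qed

lemma map_subst_path_map:
  assumes "ctxt S \<Delta>" "ctxt S \<Theta>" "elems_eq S \<Delta> \<Theta> h h" "length f = length \<Delta>" "length g = length \<Delta>" "length p = length \<Delta>"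
  shows "map (subst \<sigma>) (path_map \<Delta> \<Theta> h f g p) = path_map \<Delta> \<Theta> h (map (subst \<sigma>) f) (map (subst \<sigma>) g) (map (subst \<sigma>) p)"
  unfolding path_map_def
  by (subst map_subst_compose[OF path_map_gen_props(2)[OF ctxt_eq_refl[OF assms(1)] ctxt_eq_refl[OF assms(2)] assms(3) refl]])
    (use assms in \<open>simp_all add: gen_closed\<close>)

end

text \<open>
  The components of the generic \<open>(x, y, p)\<close>, and elements of the ambient context, seen from
  \<open>\<Psi> @ gen_ctx \<Delta> K\<close> with \<open>n = length \<Delta>\<close> and \<open>m = length \<Psi>\<close>.
\<close>

definition gX :: "nat \<Rightarrow> nat \<Rightarrow> 'c expr list" where "gX n m = map Var [m + 2 * n..<m + 2 * n + n]"
definition gY :: "nat \<Rightarrow> nat \<Rightarrow> 'c expr list" where "gY n m = map Var [m + n..<m + n + n]"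
definition gP :: "nat \<Rightarrow> nat \<Rightarrow> 'c expr list" where "gP n m = map Var [m..<m + n]"
definition gW :: "nat \<Rightarrow> nat \<Rightarrow> 'c expr list \<Rightarrow> 'c expr list" where "gW n m a = map (shift (m + 3 * n)) a"

lemma g_length [simp]: "length (gX n m) = n" "length (gY n m) = n" "length (gP n m) = n" "length (gW n m a) = length a"
  by (simp_all add: gX_def gY_def gP_def gW_def)

context dependent_type_theory
begin

lemma elems_shift_closed:
  assumes "ctxt S \<Theta>" "ctxt S (\<Xi> @ K)" "length \<Xi> = m" "elems_eq S K \<Theta> a a'"
  shows "elems_eq S (\<Xi> @ K) \<Theta> (map (shift m) a) (map (shift m) a')"
  using elems_eq_subst[OF sub_shift'[OF assms(2,3)] closed_append[OF assms(1) ctxt_appendD[OF assms(2)]] assms(4)]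
  by (simp add: closed_subst_tele[OF assms(1)] shift_eq_subst[abs_def])

end

lemma map_shift_compose: "map (shift m) (compose h f) = compose h (map (shift m) f)" if "\<forall>a \<in> set h. scoped (length f) a"
proof -
  have "subst (\<lambda>i. shift m (ext f Var i)) a = subst (ext (map (shift m) f) Var) a" if "a \<in> set h" for a
    using \<open>\<forall>a \<in> set h. scoped (length f) a\<close> that by (intro subst_cong_scoped[of "length f"]) (auto simp: ext_def)
  then show ?thesis by (simp add: compose_eq)
qed

section \<open>The generic path with a post-context: typing, restriction, instantiation\<close>

context identity_types
begin

context
  fixes \<Delta> K \<Psi> :: "'c ctx" and n m
  assumes c: "ctxt S \<Delta>" "ctxt S K" "ctxt S (\<Psi> @ gen_ctx \<Delta> K)" and n: "length \<Delta> = n" and m: "length \<Psi> = m"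
begin

lemma gen_split: "gen_ctx \<Delta> K = Id_ctx \<Delta> @ \<Delta> @ \<Delta> @ K"
  by (rule gen_closed[OF c(1)])

lemma gX_typed: "elems_eq S (\<Psi> @ gen_ctx \<Delta> K) \<Delta> (gX n m) (gX n m)"
  using elems_vars_closed[of \<Delta> "\<Psi> @ Id_ctx \<Delta> @ \<Delta>" K "m + 2 * n" n] c n m by (simp add: gen_split gX_def)

lemma gY_typed: "elems_eq S (\<Psi> @ gen_ctx \<Delta> K) \<Delta> (gY n m) (gY n m)"
  using elems_vars_closed[of \<Delta> "\<Psi> @ Id_ctx \<Delta>" "\<Delta> @ K" "m + n" n] c n m by (simp add: gen_split gY_def)

lemma gP_typed: "elems_eq S (\<Psi> @ gen_ctx \<Delta> K) (Id_at \<Delta> (gX n m) (gY n m)) (gP n m) (gP n m)"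
proof -
  have "elems_eq S (\<Psi> @ gen_ctx \<Delta> K) (subst_tele (\<lambda>i. Var (i + (m + n))) (Id_ctx \<Delta>)) (gP n m) (gP n m)"
    using elems_vars[of \<Psi> "Id_ctx \<Delta>" "\<Delta> @ \<Delta> @ K" m n] c n m by (simp add: gen_split gP_def)
  moreover have "subst_tele (\<lambda>i. Var (i + (m + n))) (Id_ctx \<Delta>) = Id_at \<Delta> (gX n m) (gY n m)"
    by (rule Id_at_vars[OF c(1) n]) (auto simp: ext_def gX_def gY_def)
  ultimately show ?thesis by simp
qed

lemma gW_typed: "ctxt S \<Theta> \<Longrightarrow> elems_eq S K \<Theta> a a' \<Longrightarrow> elems_eq S (\<Psi> @ gen_ctx \<Delta> K) \<Theta> (gW n m a) (gW n m a')"
  using elems_shift_closed[of \<Theta> "\<Psi> @ Id_ctx \<Delta> @ \<Delta> @ \<Delta>" K "m + 3 * n" a a'] c n m by (simp add: gen_split gW_def)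

lemma gW_path_typed:
  assumes "ctxt S \<Theta>" "elems_eq S K \<Theta> a a" "elems_eq S K \<Theta> b b" "elems_eq S K (Id_at \<Theta> a b) p p'"
  shows "elems_eq S (\<Psi> @ gen_ctx \<Delta> K) (Id_at \<Theta> (gW n m a) (gW n m b)) (gW n m p) (gW n m p')"
proof -
  have s: "sub S (\<Psi> @ gen_ctx \<Delta> K) K (\<lambda>i. Var (i + (m + 3 * n)))"
    using sub_shift'[of "\<Psi> @ Id_ctx \<Delta> @ \<Delta> @ \<Delta>" K "m + 3 * n"] c n m by (simp add: gen_split)
  have "length a = length \<Theta>" "length b = length \<Theta>" using elems_eq_length[OF assms(2)] elems_eq_length[OF assms(3)] by auto
  then show ?thesis
    using elems_eq_subst[OF s Id_at_ctxt[OF assms(1) c(2) assms(2,3)] assms(4)]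
    by (simp add: Id_at_subst[OF assms(1)] gW_def shift_eq_subst[abs_def])
qed

text \<open>As raw terms \<open>gP n m\<close> is just the block of variables starting at
  \<open>m\<close>. Over the generic context this block is the path; over the restricted context it
  is the point x of \<open>\<Delta>\<close>, the path and one copy of \<open>\<Delta>\<close> having
  disappeared. For this reason the same list appears as the common value of both end points.\<close>

lemma g_diag:
  defines "\<sigma> \<equiv> lift_sub m (diag_ctx \<Delta>)"
  shows "map (subst \<sigma>) (gX n m) = gP n m" "map (subst \<sigma>) (gY n m) = gP n m" "map (subst \<sigma>) (gP n m) = refl_at \<Delta> (gP n m)"
    "map (subst \<sigma>) (gW n m a) = map (shift (m + n)) a" "map (subst \<sigma>) (map Var [0..<m]) = map Var [0..<m]"
proof -
  have \<delta>: "diag_ctx \<Delta> (i + 2 * n) = Var i" "i < n \<Longrightarrow> diag_ctx \<Delta> (i + n) = Var i" "i < n \<Longrightarrow> diag_ctx \<Delta> i = refl_ctx \<Delta> ! i" for i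
    using n by (auto simp: mult_2 add.assoc[symmetric] diag_ctx_def ext_def)
  show "map (subst \<sigma>) (gX n m) = gP n m" unfolding gX_def gP_def
    by (rule map_subst_vars) (use \<delta>(1) in \<open>simp add: \<sigma>_def lift_sub_def add.assoc[symmetric] add.commute[of m]\<close>)
  show "map (subst \<sigma>) (gY n m) = gP n m" unfolding gY_def gP_def
    by (rule map_subst_vars) (use \<delta>(2) in \<open>simp add: \<sigma>_def lift_sub_def add.assoc[symmetric] add.commute[of m]\<close>)
  show "map (subst \<sigma>) (map Var [0..<m]) = map Var [0..<m]"
    by (rule nth_equalityI) (auto simp: \<sigma>_def lift_sub_def)
  show "map (subst \<sigma>) (gP n m) = refl_at \<Delta> (gP n m)"
  proof (rule nth_equalityI)
    fix i assume "i < length (map (subst \<sigma>) (gP n m) :: 'c expr list)"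
    then have i: "i < n" by simp
    have "subst \<sigma> (gP n m ! i) = shift m (refl_ctx \<Delta> ! i)"
      using i n by (simp add: gP_def \<sigma>_def lift_sub_def diag_ctx_def ext_def)
    also have "\<dots> = subst (ext (gP n m) Var) (refl_ctx \<Delta> ! i)"
      unfolding shift_eq_subst
      by (rule subst_cong_scoped[OF elems_eq_scoped[OF refl_ctx_typed[OF c(1) ctxt_eq_refl[OF c(1)]]]])
        (use i n in \<open>auto simp: ext_def gP_def add.commute\<close>)
    finally show "map (subst \<sigma>) (gP n m) ! i = refl_at \<Delta> (gP n m) ! i" using i n by (simp add: compose_eq)
  qed (simp add: n)
  have "(\<lambda>i. \<sigma> (i + (m + 3 * n))) = (\<lambda>i. Var (i + (m + n)) :: 'c expr)"
  proof
    fix i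
    have "\<sigma> (i + (m + 3 * n)) = shift m (diag_ctx \<Delta> ((i + n) + 2 * n))" by (simp add: \<sigma>_def lift_sub_def algebra_simps)
    then show "\<sigma> (i + (m + 3 * n)) = Var (i + (m + n))" unfolding \<delta> by simp
  qed
  then show "map (subst \<sigma>) (gW n m a) = map (shift (m + n)) a"
    unfolding gW_def map_map comp_def subst_shift by (simp add: shift_eq_subst[abs_def])
qed

lemma g_inst:
  assumes "length \<psi> = m" "length p = n" "length g = n" "length f = n"
  defines "\<tau> \<equiv> ext \<psi> (ext p (ext g (ext f Var)))"
  shows "map (subst \<tau>) (gX n m) = f" "map (subst \<tau>) (gY n m) = g" "map (subst \<tau>) (gP n m) = p"
    "map (subst \<tau>) (gW n m a) = a" "map (subst \<tau>) (map Var [0..<m]) = \<psi>"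
proof -
  show "map (subst \<tau>) (gX n m) = f" "map (subst \<tau>) (gY n m) = g" "map (subst \<tau>) (gP n m) = p"
    unfolding gX_def gY_def gP_def
    subgoal by (rule map_subst_vars_ext) (use assms in \<open>auto simp: ext_def\<close>)
    subgoal by (rule map_subst_vars_ext) (use assms in \<open>auto simp: ext_def\<close>)
    subgoal by (rule map_subst_vars_ext) (use assms in \<open>auto simp: ext_def\<close>)
    done
  show "map (subst \<tau>) (map Var [0..<m]) = \<psi>"
    by (rule nth_equalityI) (use assms in \<open>auto simp: ext_def\<close>)
  have "(\<lambda>i. \<tau> (i + (m + 3 * n))) = Var" using assms by (auto simp: ext_def fun_eq_iff)
  then show "map (subst \<tau>) (gW n m a) = a" unfolding gW_def map_map comp_def subst_shift by simp
qed

text \<open>Supplies the reflexive case of a path induction. Data from \<open>K\<close> are weakened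
  by \<open>m + n\<close> here, against \<open>m + 3 * n\<close> over the generic path.\<close>

lemma diag_typed:
  shows "ctxt S (subst_tele (diag_ctx \<Delta>) \<Psi> @ \<Delta> @ K)"
    "elems_eq S (subst_tele (diag_ctx \<Delta>) \<Psi> @ \<Delta> @ K) \<Delta> (gP n m) (gP n m)"
    "ctxt S \<Theta> \<Longrightarrow> elems_eq S K \<Theta> a a' \<Longrightarrow> elems_eq S (subst_tele (diag_ctx \<Delta>) \<Psi> @ \<Delta> @ K) \<Theta> (map (shift (m + n)) a) (map (shift (m + n)) a')"
    "ctxt S \<Theta> \<Longrightarrow> elems_eq S K \<Theta> a a \<Longrightarrow> elems_eq S K \<Theta> b b \<Longrightarrow> elems_eq S K (Id_at \<Theta> a b) p p' \<Longrightarrow>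
      elems_eq S (subst_tele (diag_ctx \<Delta>) \<Psi> @ \<Delta> @ K) (Id_at \<Theta> (map (shift (m + n)) a) (map (shift (m + n)) b))
       (map (shift (m + n)) p) (map (shift (m + n)) p')"
proof -
  let ?M = "subst_tele (diag_ctx \<Delta>) \<Psi> @ \<Delta> @ K"
  show cM: "ctxt S ?M" using ctxt_subst[OF diag_ctx_typed[OF closed_append[OF c(1,2)]] c(3)] .
  show "elems_eq S ?M \<Delta> (gP n m) (gP n m)"
    using elems_vars_closed[OF c(1) cM _ n, of m] m by (simp add: gP_def)
  show "elems_eq S ?M \<Theta> (map (shift (m + n)) a) (map (shift (m + n)) a')" if "ctxt S \<Theta>" "elems_eq S K \<Theta> a a'"
    using elems_shift_closed[of \<Theta> "subst_tele (diag_ctx \<Delta>) \<Psi> @ \<Delta>" K "m + n" a a'] cM n m that by simp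
  assume *: "ctxt S \<Theta>" "elems_eq S K \<Theta> a a" "elems_eq S K \<Theta> b b" "elems_eq S K (Id_at \<Theta> a b) p p'"
  have s: "sub S ?M K (\<lambda>i. Var (i + (m + n)))"
    using sub_shift'[of "subst_tele (diag_ctx \<Delta>) \<Psi> @ \<Delta>" K "m + n"] cM n m by simp
  have "length a = length \<Theta>" "length b = length \<Theta>" using elems_eq_length[OF *(2)] elems_eq_length[OF *(3)] by auto
  then show "elems_eq S ?M (Id_at \<Theta> (map (shift (m + n)) a) (map (shift (m + n)) b)) (map (shift (m + n)) p) (map (shift (m + n)) p')"
    using elems_eq_subst[OF s Id_at_ctxt[OF *(1) c(2) *(2,3)] *(4)]
    by (simp add: Id_at_subst[OF *(1)] shift_eq_subst[abs_def])
qed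

end

lemma compose_typed:
  assumes "ctxt S \<Delta>" "ctxt S \<Theta>" "ctxt S K" "elems_eq S \<Delta> \<Theta> g g'" "elems_eq S K \<Delta> f f'"
  shows "elems_eq S K \<Theta> (compose g f) (compose g' f')"
  using elems_eq_compose[OF assms(1,3,5) closed_append[OF assms(2,1)] assms(4)] by (simp add: closed_subst_tele[OF assms(2)])

lemma compose_path_typed:
  assumes c: "ctxt S \<Delta>" "ctxt S \<Theta>" "ctxt S K" and "elems_eq S \<Delta> \<Theta> g g" "elems_eq S \<Delta> \<Theta> g' g'"
    "elems_eq S \<Delta> (Id_at \<Theta> g g') \<beta> \<beta>'" "elems_eq S K \<Delta> f f'"
  shows "elems_eq S K (Id_at \<Theta> (compose g f) (compose g' f)) (compose \<beta> f) (compose \<beta>' f')"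
proof -
  have "length g = length \<Theta>" "length g' = length \<Theta>" using elems_eq_length[OF assms(4)] elems_eq_length[OF assms(5)] by auto
  then show ?thesis
    using elems_eq_compose[OF c(1,3) assms(7) Id_at_ctxt[OF c(2,1) assms(4,5)] assms(6)]
    by (simp add: Id_at_subst[OF c(2)] compose_eq)
qed

end

context discrete_identity_types
begin

text \<open>The equation is established once over a generic path, where elimination is available,
  and then instantiated at \<open>p\<close> and the actual value \<psi> of the post-context.\<close>

lemma path_uniq:
  assumes "ctxt S \<Delta>" "ctxt S K" "elems_eq S K \<Delta> f f" "elems_eq S K \<Delta> g g" "elems_eq S K (Id_at \<Delta> f g) p p"
    and m: "length \<Psi> = m"
    and \<psi>: "elems_eq S K (subst_tele (ext p (ext g (ext f Var))) \<Psi>) \<psi> \<psi>"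
    and \<Omega>: "ctxt S (\<Omega> @ \<Psi> @ gen_ctx \<Delta> K)" "idt_tele \<Omega>"
    "elems_eq S (\<Psi> @ gen_ctx \<Delta> K) \<Omega> t t" "elems_eq S (\<Psi> @ gen_ctx \<Delta> K) \<Omega> t' t'"
    "elems_eq S (subst_tele (diag_ctx \<Delta>) \<Psi> @ \<Delta> @ K) (subst_tele (lift_sub m (diag_ctx \<Delta>)) \<Omega>)
       (map (subst (lift_sub m (diag_ctx \<Delta>))) t) (map (subst (lift_sub m (diag_ctx \<Delta>))) t')"
  defines "\<tau> \<equiv> ext \<psi> (ext p (ext g (ext f Var)))"
  shows "elems_eq S K (subst_tele \<tau> \<Omega>) (map (subst \<tau>) t) (map (subst \<tau>) t')"
proof -
  have "sub S K (\<Psi> @ gen_ctx \<Delta> K) \<tau>"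
    unfolding \<tau>_def by (rule sub_eq_ext[OF gen_sub_eq[OF assms(1-5)] ctxt_appendD[OF \<Omega>(1)] \<psi>])
  then show ?thesis using \<Omega>(1) eq_by_diag[OF \<Omega>(1-4)] \<Omega>(5) m by (intro elems_eq_subst) simp_all
qed

text \<open>Not a computation rule, since composition eliminates the other factor. Induction on
  \<open>p\<close> reduces the claim to the composite of two reflexivities, which the left unit law
  evaluates.\<close>

lemma path_comp_refl_right:
  assumes c: "ctxt S \<Delta>" "ctxt S K" and f: "elems_eq S K \<Delta> f f" and g: "elems_eq S K \<Delta> g g" and p: "elems_eq S K (Id_at \<Delta> f g) p p"
  shows "elems_eq S K (Id_at \<Delta> f g) (path_comp \<Delta> f f g p (refl_at \<Delta> f)) p"
proof -
  define n where "n = length \<Delta>"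
  have l: "length f = n" "length g = n" "length p = n"
    using elems_eq_length[OF f] elems_eq_length[OF g] elems_eq_length[OF p] by (simp_all add: n_def)
  have cG: "ctxt S ([] @ gen_ctx \<Delta> K)" using gen_ctxt[OF closed_append[OF c]] by simp
  note G = c cG n_def[symmetric] list.size(3)
  note ty = gX_typed[OF G] gY_typed[OF G] gP_typed[OF G]
  note r = refl_at_eq[OF ctxt_eq_refl[OF c(1)]]
  let ?X = "gX n 0 :: 'c expr list" and ?Y = "gY n 0 :: 'c expr list" and ?P = "gP n 0 :: 'c expr list"
  let ?t = "path_comp \<Delta> ?X ?X ?Y ?P (refl_at \<Delta> ?X)"
  let ?\<delta> = "lift_sub 0 (diag_ctx \<Delta>)" and ?\<tau> = "ext [] (ext p (ext g (ext f Var)))"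
  have t: "elems_eq S ([] @ gen_ctx \<Delta> K) (Id_at \<Delta> ?X ?Y) ?t ?t"
    by (rule path_comp_cong[OF ctxt_eq_refl[OF c(1)] cG ty(1) ty(1) ty(2) ty(3) r[OF cG ty(1)]])
  note dg = g_diag[OF G] and di = g_inst[OF G list.size(3) l(3,2,1)]
  note D = diag_typed(1,2)[OF G]
  have t\<delta>: "map (subst ?\<delta>) ?t = path_comp \<Delta> ?P ?P ?P (refl_at \<Delta> ?P) (refl_at \<Delta> ?P)"
    using dg by (simp add: map_subst_path_comp[OF c(1)] map_subst_refl_at[OF c(1)] n_def)
  have t\<tau>: "map (subst ?\<tau>) ?t = path_comp \<Delta> f f g p (refl_at \<Delta> f)"
    using di by (simp add: map_subst_path_comp[OF c(1)] map_subst_refl_at[OF c(1)] n_def del: ext_simps)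
  have \<Omega>\<delta>: "subst_tele ?\<delta> (Id_at \<Delta> ?X ?Y) = Id_at \<Delta> ?P ?P"
    using dg by (simp add: Id_at_subst[OF c(1)] n_def)
  have \<Omega>\<tau>: "subst_tele ?\<tau> (Id_at \<Delta> ?X ?Y) = Id_at \<Delta> f g"
    using di by (simp add: Id_at_subst[OF c(1)] n_def del: ext_simps)
  have "elems_eq S K (subst_tele ?\<tau> (Id_at \<Delta> ?X ?Y)) (map (subst ?\<tau>) ?t) (map (subst ?\<tau>) ?P)"
  proof (rule path_uniq[OF c f g p list.size(3) _ Id_at_ctxt[OF c(1) cG ty(1,2)] idt_tele_Id_at t ty(3)])
    show "elems_eq S (subst_tele (diag_ctx \<Delta>) [] @ \<Delta> @ K) (subst_tele ?\<delta> (Id_at \<Delta> ?X ?Y)) (map (subst ?\<delta>) ?t) (map (subst ?\<delta>) ?P)"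
      unfolding t\<delta> \<Omega>\<delta> dg(3) by (rule path_comp_refl_left[OF c(1) D(1,2) D(2) r[OF D]])
  qed simp
  then show ?thesis unfolding t\<tau> \<Omega>\<tau> di(3) .
qed

end

context identity_types
begin

lemma path_comp_length: "ctxt S \<Delta> \<Longrightarrow> length (path_comp \<Delta> f g h q p) = length \<Delta>"
  by (simp add: path_comp_eq path_comp_gen_length)

lemma path_map_length:
  assumes "ctxt S \<Delta>" "ctxt S \<Theta>" "elems_eq S \<Delta> \<Theta> h h"
  shows "length (path_map \<Delta> \<Theta> h f g p) = length \<Theta>"
  using elems_eq_length[OF path_map_gen_props(2)[OF ctxt_eq_refl[OF assms(1)] ctxt_eq_refl[OF assms(2)] assms(3) refl]]
  by (simp add: path_map_eq)

end

context discrete_identity_types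
begin

text \<open>
  Path induction for equations: two paths built from \<open>p : Id\<^sub>\<Delta>(f, g)\<close> and \<open>\<psi>\<close> are equal if their generic
  versions agree where \<open>p\<close> is a reflexivity.  The endpoints and paths are given separately with their
  values on the diagonal (index 1) and at \<open>p\<close> (index 2).
\<close>

lemma contraction:
  assumes c: "ctxt S \<Delta>" "ctxt S K" and fgp: "elems_eq S K \<Delta> f f" "elems_eq S K \<Delta> g g" "elems_eq S K (Id_at \<Delta> f g) p p"
    and \<Psi>: "ctxt S (\<Psi> @ gen_ctx \<Delta> K)" "length \<Psi> = m" "elems_eq S K (subst_tele (ext p (ext g (ext f Var))) \<Psi>) \<psi> \<psi>"
    and \<Theta>: "ctxt S \<Theta>" and a: "elems_eq S (\<Psi> @ gen_ctx \<Delta> K) \<Theta> a a" and b: "elems_eq S (\<Psi> @ gen_ctx \<Delta> K) \<Theta> b b"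
    and t: "elems_eq S (\<Psi> @ gen_ctx \<Delta> K) (Id_at \<Theta> a b) t t" and t': "elems_eq S (\<Psi> @ gen_ctx \<Delta> K) (Id_at \<Theta> a b) t' t'"
    and \<delta>: "map (subst (lift_sub m (diag_ctx \<Delta>))) a = a1" "map (subst (lift_sub m (diag_ctx \<Delta>))) b = b1"
      "map (subst (lift_sub m (diag_ctx \<Delta>))) t = t1" "map (subst (lift_sub m (diag_ctx \<Delta>))) t' = t1'"
    and \<tau>: "map (subst (ext \<psi> (ext p (ext g (ext f Var))))) a = a2" "map (subst (ext \<psi> (ext p (ext g (ext f Var))))) b = b2"
      "map (subst (ext \<psi> (ext p (ext g (ext f Var))))) t = t2" "map (subst (ext \<psi> (ext p (ext g (ext f Var))))) t' = t2'"
    and eq: "elems_eq S (subst_tele (diag_ctx \<Delta>) \<Psi> @ \<Delta> @ K) (Id_at \<Theta> a1 b1) t1 t1'"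
  shows "elems_eq S K (Id_at \<Theta> a2 b2) t2 t2'"
proof -
  have l: "length a = length \<Theta>" "length b = length \<Theta>" using elems_eq_length[OF a] elems_eq_length[OF b] by auto
  note Is = Id_at_subst[OF \<Theta> l]
  have "elems_eq S K (subst_tele (ext \<psi> (ext p (ext g (ext f Var)))) (Id_at \<Theta> a b))
     (map (subst (ext \<psi> (ext p (ext g (ext f Var))))) t) (map (subst (ext \<psi> (ext p (ext g (ext f Var))))) t')"
    by (rule path_uniq[OF c fgp \<Psi>(2,3) Id_at_ctxt[OF \<Theta> \<Psi>(1) a b] idt_tele_Id_at t t'])
      (simp only: Is \<delta> eq)
  then show ?thesis by (simp only: Is \<tau>)
qed

text \<open>Prepares inductions on a path that starts where another one ends. The far end f stays
  fixed in the ambient context, but the meeting point becomes the generic x, so the first path has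
  to be abstracted as a post-context from f to x. The variables \<open>map Var [0..<n]\<close> stand
  for it both before and after restriction to the diagonal.\<close>

lemma post_path:
  assumes c: "ctxt S \<Delta>" "ctxt S K" and f: "elems_eq S K \<Delta> f f" and g: "elems_eq S K \<Delta> g g" and n: "length \<Delta> = n"
    and lp: "length p = n" "length h = n"
  defines "\<Psi> \<equiv> Id_at \<Delta> (gW n 0 f) (gX n 0)"
  shows "ctxt S (\<Psi> @ gen_ctx \<Delta> K)" "length \<Psi> = n"
    "elems_eq S (\<Psi> @ gen_ctx \<Delta> K) (Id_at \<Delta> (gW n n f) (gX n n)) (map Var [0..<n]) (map Var [0..<n])"
    "elems_eq S (subst_tele (diag_ctx \<Delta>) \<Psi> @ \<Delta> @ K) (Id_at \<Delta> (map (shift (n + n)) f) (gP n n)) (map Var [0..<n]) (map Var [0..<n])"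
    "subst_tele (ext p (ext h (ext g Var))) \<Psi> = Id_at \<Delta> f g"
proof -
  have l: "length f = n" "length g = n" using elems_eq_length[OF f] elems_eq_length[OF g] n by simp_all
  have cG: "ctxt S ([] @ gen_ctx \<Delta> K)" using gen_ctxt[OF closed_append[OF c]] by simp
  note G = c cG n list.size(3)
  have X: "elems_eq S (gen_ctx \<Delta> K) \<Delta> (gX n 0) (gX n 0)" and W: "elems_eq S (gen_ctx \<Delta> K) \<Delta> (gW n 0 f) (gW n 0 f)"
    using gX_typed[OF G] gW_typed[OF G c(1) f] by simp_all
  show cP: "ctxt S (\<Psi> @ gen_ctx \<Delta> K)" unfolding \<Psi>_def by (rule Id_at_ctxt[OF c(1) _ W X]) (use cG in simp)
  show lP: "length \<Psi> = n" by (simp add: \<Psi>_def n)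
  have sh: "map (subst (\<lambda>i. Var (i + n))) (gX n 0) = (gX n n :: 'c expr list)" unfolding gX_def by (rule map_subst_vars) simp
  have sh2: "map (subst (\<lambda>i. Var (i + n))) (gW n 0 f) = gW n n f" by (simp add: gW_def shift_eq_subst[abs_def] comp_def ac_simps)
  have v: "elems_eq S (\<Xi> @ \<Gamma>) (subst_tele (\<lambda>i. Var (i + n)) \<Xi>) (map Var [0..<n]) (map Var [0..<n])" if "ctxt S (\<Xi> @ \<Gamma>)" "length \<Xi> = n" for \<Xi> \<Gamma>
    using elems_vars[of "[]" \<Xi> \<Gamma> 0 n] that by simp
  have "subst_tele (\<lambda>i. Var (i + n)) \<Psi> = Id_at \<Delta> (gW n n f) (gX n n)"
    unfolding \<Psi>_def by (subst Id_at_subst[OF c(1)]) (simp_all add: l n sh sh2)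
  then show "elems_eq S (\<Psi> @ gen_ctx \<Delta> K) (Id_at \<Delta> (gW n n f) (gX n n)) (map Var [0..<n]) (map Var [0..<n])"
    using v[OF cP lP] by simp
  have P\<delta>: "subst_tele (diag_ctx \<Delta>) \<Psi> = Id_at \<Delta> (map (shift n) f) (gP n 0)"
    unfolding \<Psi>_def using g_diag(1,4)[OF G] by (subst Id_at_subst[OF c(1)]) (simp_all add: l n)
  have cM: "ctxt S (subst_tele (diag_ctx \<Delta>) \<Psi> @ \<Delta> @ K)" using ctxt_subst[OF diag_ctx_typed[OF closed_append[OF c]] cP] .
  have sh3: "map (subst (\<lambda>i. Var (i + n))) (gP n 0) = (gP n n :: 'c expr list)" unfolding gP_def by (rule map_subst_vars) simp
  have "subst_tele (\<lambda>i. Var (i + n)) (subst_tele (diag_ctx \<Delta>) \<Psi>) = Id_at \<Delta> (map (shift (n + n)) f) (gP n n)"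
    unfolding P\<delta> by (subst Id_at_subst[OF c(1)]) (simp_all add: l n sh3 shift_eq_subst[abs_def] comp_def ac_simps)
  then show "elems_eq S (subst_tele (diag_ctx \<Delta>) \<Psi> @ \<Delta> @ K) (Id_at \<Delta> (map (shift (n + n)) f) (gP n n)) (map Var [0..<n]) (map Var [0..<n])"
    using v[OF cM] lP by simp
  show "subst_tele (ext p (ext h (ext g Var))) \<Psi> = Id_at \<Delta> f g"
    unfolding \<Psi>_def using g_inst(1,4)[OF G list.size(3) lp l(2)] by (subst Id_at_subst[OF c(1)]) (simp_all add: l n)
qed

text \<open>Induction on \<gamma>, with \<beta> abstracted because it ends where \<gamma> starts,
  and \<alpha> left in the ambient context. For reflexive \<gamma> both sides become \<beta> after
  \<alpha> by the left unit law.\<close>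

lemma path_comp_assoc:
  assumes c: "ctxt S \<Delta>" "ctxt S K"
    and f: "elems_eq S K \<Delta> f f" and g: "elems_eq S K \<Delta> g g" and h: "elems_eq S K \<Delta> h h" and k: "elems_eq S K \<Delta> k k"
    and \<alpha>: "elems_eq S K (Id_at \<Delta> f g) \<alpha> \<alpha>" and \<beta>: "elems_eq S K (Id_at \<Delta> g h) \<beta> \<beta>" and \<gamma>: "elems_eq S K (Id_at \<Delta> h k) \<gamma> \<gamma>"
  shows "elems_eq S K (Id_at \<Delta> f k) (path_comp \<Delta> f g k (path_comp \<Delta> g h k \<gamma> \<beta>) \<alpha>) (path_comp \<Delta> f h k \<gamma> (path_comp \<Delta> f g h \<beta> \<alpha>))"
proof -
  define n where "n = length \<Delta>"
  note n = n_def[symmetric]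
  have l: "length f = n" "length g = n" "length h = n" "length k = n" "length \<alpha> = n" "length \<beta> = n" "length \<gamma> = n"
    using elems_eq_length[OF f] elems_eq_length[OF g] elems_eq_length[OF h] elems_eq_length[OF k]
      elems_eq_length[OF \<alpha>] elems_eq_length[OF \<beta>] elems_eq_length[OF \<gamma>] by (simp_all add: n_def)
  note P = post_path[OF c g h n l(7,4)]
  note G = c P(1) n P(2)
  note rc = ctxt_eq_refl[OF c(1)]
  note X = gX_typed[OF G] and Y = gY_typed[OF G] and PP = gP_typed[OF G] and W = gW_typed[OF G c(1)] and WP = gW_path_typed[OF G c(1)]
  note D = diag_typed[OF G]
  note dg = g_diag[OF G] and di = g_inst[OF G l(6,7,4,3)]
  let ?X = "gX n n :: 'c expr list" and ?Y = "gY n n :: 'c expr list" and ?P = "gP n n :: 'c expr list" and ?W = "gW n n" and ?q = "map Var [0..<n] :: 'c expr list"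
  let ?s = "map (shift (n + n)) :: 'c expr list \<Rightarrow> _"
  let ?t = "path_comp \<Delta> (?W f) (?W g) ?Y (path_comp \<Delta> (?W g) ?X ?Y ?P ?q) (?W \<alpha>)"
  let ?t' = "path_comp \<Delta> (?W f) ?X ?Y ?P (path_comp \<Delta> (?W f) (?W g) ?X ?q (?W \<alpha>))"
  note pc = path_comp_cong[OF rc P(1)] and pcD = path_comp_cong[OF rc D(1)]
  note simps = map_subst_path_comp[OF c(1)] path_comp_length[OF c(1)] dg di l n g_length length_map length_upt diff_zero
  show ?thesis
  proof (rule contraction[OF c h k \<gamma> P(1,2) _ c(1) W[OF f] Y])
    show "elems_eq S K (subst_tele (ext \<gamma> (ext k (ext h Var))) (Id_at \<Delta> (gW n 0 g) (gX n 0))) \<beta> \<beta>" using P(5) \<beta> by simp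
    show "elems_eq S (Id_at \<Delta> (gW n 0 g) (gX n 0) @ gen_ctx \<Delta> K) (Id_at \<Delta> (?W f) ?Y) ?t ?t"
      by (rule pc[OF W[OF f] W[OF g] Y pc[OF W[OF g] X Y PP P(3)] WP[OF f g \<alpha>]])
    show "elems_eq S (Id_at \<Delta> (gW n 0 g) (gX n 0) @ gen_ctx \<Delta> K) (Id_at \<Delta> (?W f) ?Y) ?t' ?t'"
      by (rule pc[OF W[OF f] X Y PP pc[OF W[OF f] W[OF g] X P(3) WP[OF f g \<alpha>]]])
    have q: "elems_eq S (subst_tele (diag_ctx \<Delta>) (Id_at \<Delta> (gW n 0 g) (gX n 0)) @ \<Delta> @ K) (Id_at \<Delta> (?s g) ?P) ?q ?q" by (rule P(4))
    note D\<alpha> = D(4)[OF c(1) f g \<alpha>] and Df = D(3)[OF c(1) f] and Dg = D(3)[OF c(1) g]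
    note inner = path_comp_refl_left[OF c(1) D(1) Dg D(2) q]
    have cfP: "ctxt S (Id_at \<Delta> (?s f) ?P @ subst_tele (diag_ctx \<Delta>) (Id_at \<Delta> (gW n 0 g) (gX n 0)) @ \<Delta> @ K)"
      by (rule Id_at_ctxt[OF c(1) D(1) Df D(2)])
    note t1 = pcD[OF Df Dg D(2) inner D\<alpha>] and t2 = path_comp_refl_left[OF c(1) D(1) Df D(2) pcD[OF Df Dg D(2) q D\<alpha>]]
    show "elems_eq S (subst_tele (diag_ctx \<Delta>) (Id_at \<Delta> (gW n 0 g) (gX n 0)) @ \<Delta> @ K) (Id_at \<Delta> (?s f) ?P)
      (path_comp \<Delta> (?s f) (?s g) ?P (path_comp \<Delta> (?s g) ?P ?P (refl_at \<Delta> ?P) ?q) (?s \<alpha>))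
      (path_comp \<Delta> (?s f) ?P ?P (refl_at \<Delta> ?P) (path_comp \<Delta> (?s f) (?s g) ?P ?q (?s \<alpha>)))"
      using elems_eq_trans[OF cfP t1 elems_eq_sym[OF cfP t2]] .
  qed (simp_all only: simps)
qed

text \<open>Induction on \<beta>, with \<alpha> abstracted. For reflexive \<beta> both sides reduce
  to the image of \<alpha>.\<close>

lemma path_map_comp:
  assumes c: "ctxt S \<Delta>" "ctxt S K" "ctxt S \<Theta>" and u: "elems_eq S \<Delta> \<Theta> u u"
    and f: "elems_eq S K \<Delta> f f" and g: "elems_eq S K \<Delta> g g" and h: "elems_eq S K \<Delta> h h"
    and \<alpha>: "elems_eq S K (Id_at \<Delta> f g) \<alpha> \<alpha>" and \<beta>: "elems_eq S K (Id_at \<Delta> g h) \<beta> \<beta>"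
  shows "elems_eq S K (Id_at \<Theta> (compose u f) (compose u h)) (path_map \<Delta> \<Theta> u f h (path_comp \<Delta> f g h \<beta> \<alpha>))
    (path_comp \<Theta> (compose u f) (compose u g) (compose u h) (path_map \<Delta> \<Theta> u g h \<beta>) (path_map \<Delta> \<Theta> u f g \<alpha>))"
proof -
  define n where "n = length \<Delta>"
  note n = n_def[symmetric]
  have l: "length f = n" "length g = n" "length h = n" "length \<alpha> = n" "length \<beta> = n" "length u = length \<Theta>"
    using elems_eq_length[OF f] elems_eq_length[OF g] elems_eq_length[OF h]
      elems_eq_length[OF \<alpha>] elems_eq_length[OF \<beta>] elems_eq_length[OF u] by (simp_all add: n_def)
  note P = post_path[OF c(1,2) f g n l(5,3)]
  note G = c(1,2) P(1) n P(2)
  note rc = ctxt_eq_refl[OF c(1)] and rc' = ctxt_eq_refl[OF c(3)]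
  note X = gX_typed[OF G] and Y = gY_typed[OF G] and PP = gP_typed[OF G] and W = gW_typed[OF G c(1)]
  note D = diag_typed[OF G]
  note dg = g_diag[OF G] and di = g_inst[OF G l(4,5,3,2)]
  let ?X = "gX n n :: 'c expr list" and ?Y = "gY n n :: 'c expr list" and ?P = "gP n n :: 'c expr list" and ?W = "gW n n" and ?q = "map Var [0..<n] :: 'c expr list"
  let ?s = "map (shift (n + n)) :: 'c expr list \<Rightarrow> _" and ?c = "compose u"
  let ?t = "path_map \<Delta> \<Theta> u (?W f) ?Y (path_comp \<Delta> (?W f) ?X ?Y ?P ?q)"
  let ?t' = "path_comp \<Theta> (?c (?W f)) (?c ?X) (?c ?Y) (path_map \<Delta> \<Theta> u ?X ?Y ?P) (path_map \<Delta> \<Theta> u (?W f) ?X ?q)"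
  note pc = path_comp_cong[OF rc P(1)] and pc' = path_comp_cong[OF rc' P(1)]
    and pm = path_map_cong[OF rc rc' u P(1)] and co = compose_typed[OF c(1,3) P(1) u]
  note pcD = path_comp_cong[OF rc' D(1)] and pmD = path_map_cong[OF rc rc' u D(1)] and coD = compose_typed[OF c(1,3) D(1) u]
  note simps = map_subst_path_comp[OF c(1)] map_subst_path_comp[OF c(3)] map_subst_path_map[OF c(1,3) u] map_subst_compose[OF u]
    path_comp_length[OF c(1)] path_comp_length[OF c(3)] path_map_length[OF c(1,3) u] compose_length dg di l n g_length length_map length_upt diff_zero
  show ?thesis
  proof (rule contraction[OF c(1,2) g h \<beta> P(1,2) _ c(3) co[OF W[OF f]] co[OF Y]])
    show "elems_eq S K (subst_tele (ext \<beta> (ext h (ext g Var))) (Id_at \<Delta> (gW n 0 f) (gX n 0))) \<alpha> \<alpha>" using P(5) \<alpha> by simp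
    show "elems_eq S (Id_at \<Delta> (gW n 0 f) (gX n 0) @ gen_ctx \<Delta> K) (Id_at \<Theta> (?c (?W f)) (?c ?Y)) ?t ?t"
      by (rule pm[OF W[OF f] Y pc[OF W[OF f] X Y PP P(3)]])
    show "elems_eq S (Id_at \<Delta> (gW n 0 f) (gX n 0) @ gen_ctx \<Delta> K) (Id_at \<Theta> (?c (?W f)) (?c ?Y)) ?t' ?t'"
      by (rule pc'[OF co[OF W[OF f]] co[OF X] co[OF Y] pm[OF X Y PP] pm[OF W[OF f] X P(3)]])
    have q: "elems_eq S (subst_tele (diag_ctx \<Delta>) (Id_at \<Delta> (gW n 0 f) (gX n 0)) @ \<Delta> @ K) (Id_at \<Delta> (?s f) ?P) ?q ?q" by (rule P(4))
    note Df = D(3)[OF c(1) f]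
    have cfP: "ctxt S (Id_at \<Theta> (?c (?s f)) (?c ?P) @ subst_tele (diag_ctx \<Delta>) (Id_at \<Delta> (gW n 0 f) (gX n 0)) @ \<Delta> @ K)"
      by (rule Id_at_ctxt[OF c(3) D(1) coD[OF Df] coD[OF D(2)]])
    note m = pmD[OF Df D(2) q]
    note t1 = pmD[OF Df D(2) path_comp_refl_left[OF c(1) D(1) Df D(2) q]]
    note t2 = pcD[OF coD[OF Df] coD[OF D(2)] coD[OF D(2)] path_map_refl[OF c(1,3) u D(1,2)] m]
    note t3 = path_comp_refl_left[OF c(3) D(1) coD[OF Df] coD[OF D(2)] m]
    show "elems_eq S (subst_tele (diag_ctx \<Delta>) (Id_at \<Delta> (gW n 0 f) (gX n 0)) @ \<Delta> @ K) (Id_at \<Theta> (?c (?s f)) (?c ?P))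
      (path_map \<Delta> \<Theta> u (?s f) ?P (path_comp \<Delta> (?s f) ?P ?P (refl_at \<Delta> ?P) ?q))
      (path_comp \<Theta> (?c (?s f)) (?c ?P) (?c ?P) (path_map \<Delta> \<Theta> u ?P ?P (refl_at \<Delta> ?P)) (path_map \<Delta> \<Theta> u (?s f) ?P ?q))"
      using elems_eq_trans[OF cfP t1 elems_eq_sym[OF cfP elems_eq_trans[OF cfP t2 t3]]] .
  qed (simp_all only: simps)
qed

lemma contraction0:
  assumes c: "ctxt S \<Delta>" "ctxt S K" and fgp: "elems_eq S K \<Delta> f f" "elems_eq S K \<Delta> g g" "elems_eq S K (Id_at \<Delta> f g) p p"
    and n: "length \<Delta> = n"
    and \<Theta>: "ctxt S \<Theta>" and a: "elems_eq S (gen_ctx \<Delta> K) \<Theta> a a" and b: "elems_eq S (gen_ctx \<Delta> K) \<Theta> b b"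
    and t: "elems_eq S (gen_ctx \<Delta> K) (Id_at \<Theta> a b) t t" and t': "elems_eq S (gen_ctx \<Delta> K) (Id_at \<Theta> a b) t' t'"
    and \<delta>: "map (subst (diag_ctx \<Delta>)) a = a1" "map (subst (diag_ctx \<Delta>)) b = b1"
      "map (subst (diag_ctx \<Delta>)) t = t1" "map (subst (diag_ctx \<Delta>)) t' = t1'"
    and \<tau>: "map (subst (ext p (ext g (ext f Var)))) a = a2" "map (subst (ext p (ext g (ext f Var)))) b = b2"
      "map (subst (ext p (ext g (ext f Var)))) t = t2" "map (subst (ext p (ext g (ext f Var)))) t' = t2'"
    and eq: "elems_eq S (\<Delta> @ K) (Id_at \<Theta> a1 b1) t1 t1'"
  shows "elems_eq S K (Id_at \<Theta> a2 b2) t2 t2'"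
  by (rule contraction[OF c fgp, of "[]" 0 "[]"])
    (use assms gen_ctxt[OF closed_append[OF c]] in \<open>simp_all add: \<Theta>\<close>)

text \<open>Collects what an induction without post-context needs, to be cited by number: 1 to 4
  concern the generic path, 5 and 6 the diagonal, 7 to 9 the restriction to it, and 10 to 12 the
  instantiation at a given path.\<close>

lemma gen0:
  assumes c: "ctxt S \<Delta>" "ctxt S K" and n: "length \<Delta> = n"
  shows "ctxt S (gen_ctx \<Delta> K)" "elems_eq S (gen_ctx \<Delta> K) \<Delta> (gX n 0) (gX n 0)" "elems_eq S (gen_ctx \<Delta> K) \<Delta> (gY n 0) (gY n 0)"
    "elems_eq S (gen_ctx \<Delta> K) (Id_at \<Delta> (gX n 0) (gY n 0)) (gP n 0) (gP n 0)"
    "ctxt S (\<Delta> @ K)" "elems_eq S (\<Delta> @ K) \<Delta> (gP n 0) (gP n 0)"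
    "map (subst (diag_ctx \<Delta>)) (gX n 0) = gP n 0" "map (subst (diag_ctx \<Delta>)) (gY n 0) = gP n 0"
    "map (subst (diag_ctx \<Delta>)) (gP n 0) = refl_at \<Delta> (gP n 0)"
    "\<lbrakk>length p = n; length g = n; length f = n\<rbrakk> \<Longrightarrow> map (subst (ext p (ext g (ext f Var)))) (gX n 0) = f"
    "\<lbrakk>length p = n; length g = n; length f = n\<rbrakk> \<Longrightarrow> map (subst (ext p (ext g (ext f Var)))) (gY n 0) = g"
    "\<lbrakk>length p = n; length g = n; length f = n\<rbrakk> \<Longrightarrow> map (subst (ext p (ext g (ext f Var)))) (gP n 0) = p"
proof -
  have cG: "ctxt S ([] @ gen_ctx \<Delta> K)" using gen_ctxt[OF closed_append[OF c]] by simp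
  note G = c cG n list.size(3)
  show "ctxt S (gen_ctx \<Delta> K)" "elems_eq S (gen_ctx \<Delta> K) \<Delta> (gX n 0) (gX n 0)" "elems_eq S (gen_ctx \<Delta> K) \<Delta> (gY n 0) (gY n 0)"
    "elems_eq S (gen_ctx \<Delta> K) (Id_at \<Delta> (gX n 0) (gY n 0)) (gP n 0) (gP n 0)"
    "ctxt S (\<Delta> @ K)" "elems_eq S (\<Delta> @ K) \<Delta> (gP n 0) (gP n 0)"
    "map (subst (diag_ctx \<Delta>)) (gX n 0) = gP n 0" "map (subst (diag_ctx \<Delta>)) (gY n 0) = gP n 0"
    "map (subst (diag_ctx \<Delta>)) (gP n 0) = refl_at \<Delta> (gP n 0)"
    using cG gX_typed[OF G] gY_typed[OF G] gP_typed[OF G] diag_typed(1,2)[OF G] g_diag(1-3)[OF G] by simp_all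
  show "\<lbrakk>length p = n; length g = n; length f = n\<rbrakk> \<Longrightarrow> map (subst (ext p (ext g (ext f Var)))) (gX n 0) = f"
    "\<lbrakk>length p = n; length g = n; length f = n\<rbrakk> \<Longrightarrow> map (subst (ext p (ext g (ext f Var)))) (gY n 0) = g"
    "\<lbrakk>length p = n; length g = n; length f = n\<rbrakk> \<Longrightarrow> map (subst (ext p (ext g (ext f Var)))) (gP n 0) = p"
    using g_inst(1-3)[OF G list.size(3), of p g f] by simp_all
qed

lemma compose_vars [simp]: "length f = n \<Longrightarrow> compose (vars n) f = f"
  by (simp add: compose_eq)

lemma vars_typed: "ctxt S \<Delta> \<Longrightarrow> elems_eq S \<Delta> \<Delta> (vars (length \<Delta>)) (vars (length \<Delta>))"
  using elems_vars_closed[of \<Delta> "[]" "[]" 0 "length \<Delta>"] by (simp add: vars_def)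

lemma path_map_vars:
  assumes c: "ctxt S \<Delta>" "ctxt S K" and f: "elems_eq S K \<Delta> f f" and g: "elems_eq S K \<Delta> g g" and p: "elems_eq S K (Id_at \<Delta> f g) p p"
  shows "elems_eq S K (Id_at \<Delta> f g) (path_map \<Delta> \<Delta> (vars (length \<Delta>)) f g p) p"
proof -
  define n where "n = length \<Delta>"
  note n = n_def[symmetric]
  have l: "length f = n" "length g = n" "length p = n"
    using elems_eq_length[OF f] elems_eq_length[OF g] elems_eq_length[OF p] by (simp_all add: n_def)
  note G = gen0[OF c n]
  note rc = ctxt_eq_refl[OF c(1)]
  have v: "elems_eq S \<Delta> \<Delta> (vars n) (vars n)" using vars_typed[OF c(1)] n by simp
  let ?t = "path_map \<Delta> \<Delta> (vars n) (gX n 0) (gY n 0) (gP n 0)"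
  have "elems_eq S K (Id_at \<Delta> f g) (path_map \<Delta> \<Delta> (vars n) f g p) p"
  proof (rule contraction0[OF c f g p n c(1) G(2,3) _ G(4) G(7,8)])
    show "elems_eq S (gen_ctx \<Delta> K) (Id_at \<Delta> (gX n 0) (gY n 0)) ?t ?t"
      using path_map_cong[OF rc rc v G(1-4)] by simp
    show "elems_eq S (\<Delta> @ K) (Id_at \<Delta> (gP n 0) (gP n 0)) (path_map \<Delta> \<Delta> (vars n) (gP n 0) (gP n 0) (refl_at \<Delta> (gP n 0))) (refl_at \<Delta> (gP n 0))"
      using path_map_refl[OF c(1,1) v G(5,6)] by simp
  qed (simp_all only: map_subst_path_map[OF c(1,1) v] G(7-12) l n g_length)
  then show ?thesis by (simp add: n)
qed

text \<open>The two sides are different eliminations, so neither computes to the other; at a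
  reflexivity the left side evaluates to a reflexivity in one step and the right side in
  two.\<close>

lemma path_map_path_map:
  assumes c: "ctxt S \<Delta>" "ctxt S K" "ctxt S \<Theta>" "ctxt S \<Lambda>" and u: "elems_eq S \<Delta> \<Theta> u u" and v: "elems_eq S \<Theta> \<Lambda> v v"
    and f: "elems_eq S K \<Delta> f f" and g: "elems_eq S K \<Delta> g g" and p: "elems_eq S K (Id_at \<Delta> f g) p p"
  shows "elems_eq S K (Id_at \<Lambda> (compose (compose v u) f) (compose (compose v u) g)) (path_map \<Delta> \<Lambda> (compose v u) f g p)
     (path_map \<Theta> \<Lambda> v (compose u f) (compose u g) (path_map \<Delta> \<Theta> u f g p))"
proof -
  define n where "n = length \<Delta>"
  note n = n_def[symmetric]
  have l: "length f = n" "length g = n" "length p = n" "length u = length \<Theta>" "length v = length \<Lambda>"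
    using elems_eq_length[OF f] elems_eq_length[OF g] elems_eq_length[OF p] elems_eq_length[OF u] elems_eq_length[OF v] by (simp_all add: n_def)
  note G = gen0[OF c(1,2) n]
  note r1 = ctxt_eq_refl[OF c(1)] and r3 = ctxt_eq_refl[OF c(3)] and r4 = ctxt_eq_refl[OF c(4)]
  have vu: "elems_eq S \<Delta> \<Lambda> (compose v u) (compose v u)" by (rule compose_typed[OF c(3,4,1) v u])
  have cc: "compose (compose v u) f = compose v (compose u f)" if "length f = n" for f
    using map_subst_compose[OF v l(4), of "ext f Var"] by (simp only: compose_eq)
  note co = compose_typed[OF c(1,3) G(1) u] and coD = compose_typed[OF c(1,3) G(5) u]
    and co' = compose_typed[OF c(3,4) G(1) v] and coD' = compose_typed[OF c(3,4) G(5) v]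
  note pm = path_map_cong[OF r1 r3 u G(1-4)] and pmr = path_map_refl[OF c(1,3) u G(5,6)]
  note simps = map_subst_path_map[OF c(1,3) u] map_subst_path_map[OF c(3,4) v] map_subst_path_map[OF c(1,4) vu]
    map_subst_compose[OF u] map_subst_compose[OF v] path_map_length[OF c(1,3) u] compose_length G(7-12) l n g_length
  have "elems_eq S K (Id_at \<Lambda> (compose v (compose u f)) (compose v (compose u g))) (path_map \<Delta> \<Lambda> (compose v u) f g p)
     (path_map \<Theta> \<Lambda> v (compose u f) (compose u g) (path_map \<Delta> \<Theta> u f g p))"
  proof (rule contraction0[OF c(1,2) f g p n c(4) co'[OF co[OF G(2)]] co'[OF co[OF G(3)]]])
    show "elems_eq S (gen_ctx \<Delta> K) (Id_at \<Lambda> (compose v (compose u (gX n 0))) (compose v (compose u (gY n 0))))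
      (path_map \<Delta> \<Lambda> (compose v u) (gX n 0) (gY n 0) (gP n 0)) (path_map \<Delta> \<Lambda> (compose v u) (gX n 0) (gY n 0) (gP n 0))"
      using path_map_cong[OF r1 r4 vu G(1-4)] by (simp add: cc)
    show "elems_eq S (gen_ctx \<Delta> K) (Id_at \<Lambda> (compose v (compose u (gX n 0))) (compose v (compose u (gY n 0))))
      (path_map \<Theta> \<Lambda> v (compose u (gX n 0)) (compose u (gY n 0)) (path_map \<Delta> \<Theta> u (gX n 0) (gY n 0) (gP n 0)))
      (path_map \<Theta> \<Lambda> v (compose u (gX n 0)) (compose u (gY n 0)) (path_map \<Delta> \<Theta> u (gX n 0) (gY n 0) (gP n 0)))"
      by (rule path_map_cong[OF r3 r4 v G(1) co[OF G(2)] co[OF G(3)] pm])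
    have cI: "ctxt S (Id_at \<Lambda> (compose v (compose u (gP n 0))) (compose v (compose u (gP n 0))) @ \<Delta> @ K)"
      by (rule Id_at_ctxt[OF c(4) G(5)]) (rule coD'[OF coD[OF G(6)]])+
    have 1: "elems_eq S (\<Delta> @ K) (Id_at \<Lambda> (compose v (compose u (gP n 0))) (compose v (compose u (gP n 0))))
      (path_map \<Delta> \<Lambda> (compose v u) (gP n 0) (gP n 0) (refl_at \<Delta> (gP n 0))) (refl_at \<Lambda> (compose v (compose u (gP n 0))))"
      using path_map_refl[OF c(1,4) vu G(5,6)] by (simp add: cc)
    have 2: "elems_eq S (\<Delta> @ K) (Id_at \<Lambda> (compose v (compose u (gP n 0))) (compose v (compose u (gP n 0))))
      (path_map \<Theta> \<Lambda> v (compose u (gP n 0)) (compose u (gP n 0)) (path_map \<Delta> \<Theta> u (gP n 0) (gP n 0) (refl_at \<Delta> (gP n 0))))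
      (path_map \<Theta> \<Lambda> v (compose u (gP n 0)) (compose u (gP n 0)) (refl_at \<Theta> (compose u (gP n 0))))"
      by (rule path_map_cong[OF r3 r4 v G(5) coD[OF G(6)] coD[OF G(6)] pmr])
    note 3 = path_map_refl[OF c(3,4) v G(5) coD[OF G(6)]]
    show "elems_eq S (\<Delta> @ K) (Id_at \<Lambda> (compose v (compose u (gP n 0))) (compose v (compose u (gP n 0))))
      (path_map \<Delta> \<Lambda> (compose v u) (gP n 0) (gP n 0) (refl_at \<Delta> (gP n 0)))
      (path_map \<Theta> \<Lambda> v (compose u (gP n 0)) (compose u (gP n 0)) (path_map \<Delta> \<Theta> u (gP n 0) (gP n 0) (refl_at \<Delta> (gP n 0))))"
      using elems_eq_trans[OF cI 1 elems_eq_sym[OF cI elems_eq_trans[OF cI 2 3]]] .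
  qed (simp_all only: simps)
  then show ?thesis by (simp add: cc l)
qed

text \<open>This is naturality of the family of paths \<beta> with respect to \<open>p\<close>. For
  reflexive \<open>p\<close> each composite reduces to \<beta> at the point, one by the left and the
  other by the right unit law.\<close>

lemma path_interchange:
  assumes c: "ctxt S \<Delta>" "ctxt S K" "ctxt S \<Theta>" and u: "elems_eq S \<Delta> \<Theta> u u" and v: "elems_eq S \<Delta> \<Theta> v v"
    and \<beta>: "elems_eq S \<Delta> (Id_at \<Theta> u v) \<beta> \<beta>"
    and f: "elems_eq S K \<Delta> f f" and g: "elems_eq S K \<Delta> g g" and p: "elems_eq S K (Id_at \<Delta> f g) p p"
  shows "elems_eq S K (Id_at \<Theta> (compose u f) (compose v g))
     (path_comp \<Theta> (compose u f) (compose v f) (compose v g) (path_map \<Delta> \<Theta> v f g p) (compose \<beta> f))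
     (path_comp \<Theta> (compose u f) (compose u g) (compose v g) (compose \<beta> g) (path_map \<Delta> \<Theta> u f g p))"
proof -
  define n where "n = length \<Delta>"
  note n = n_def[symmetric]
  have l: "length f = n" "length g = n" "length p = n" "length u = length \<Theta>" "length v = length \<Theta>" "length \<beta> = length \<Theta>"
    using elems_eq_length[OF f] elems_eq_length[OF g] elems_eq_length[OF p] elems_eq_length[OF u] elems_eq_length[OF v] elems_eq_length[OF \<beta>] by (simp_all add: n_def)
  note G = gen0[OF c(1,2) n]
  note r1 = ctxt_eq_refl[OF c(1)] and r3 = ctxt_eq_refl[OF c(3)]
  note cu = compose_typed[OF c(1,3) G(1) u] and cuD = compose_typed[OF c(1,3) G(5) u]
    and cv = compose_typed[OF c(1,3) G(1) v] and cvD = compose_typed[OF c(1,3) G(5) v]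
    and cb = compose_path_typed[OF c(1,3) G(1) u v \<beta>] and cbD = compose_path_typed[OF c(1,3) G(5) u v \<beta>]
  note simps = map_subst_path_map[OF c(1,3) u] map_subst_path_map[OF c(1,3) v] map_subst_path_comp[OF c(3)]
    map_subst_compose[OF u] map_subst_compose[OF v] map_subst_compose[OF \<beta>] path_map_length[OF c(1,3) u] path_map_length[OF c(1,3) v]
    compose_length G(7-12) l n g_length
  let ?X = "gX n 0 :: 'c expr list" and ?Y = "gY n 0 :: 'c expr list" and ?P = "gP n 0 :: 'c expr list"
  let ?t = "path_comp \<Theta> (compose u ?X) (compose v ?X) (compose v ?Y) (path_map \<Delta> \<Theta> v ?X ?Y ?P) (compose \<beta> ?X)"
  let ?t' = "path_comp \<Theta> (compose u ?X) (compose u ?Y) (compose v ?Y) (compose \<beta> ?Y) (path_map \<Delta> \<Theta> u ?X ?Y ?P)"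
  show ?thesis
  proof (rule contraction0[OF c(1,2) f g p n c(3) cu[OF G(2)] cv[OF G(3)]])
    show "elems_eq S (gen_ctx \<Delta> K) (Id_at \<Theta> (compose u ?X) (compose v ?Y)) ?t ?t"
      by (rule path_comp_cong[OF r3 G(1) cu[OF G(2)] cv[OF G(2)] cv[OF G(3)] path_map_cong[OF r1 r3 v G(1-4)] cb[OF G(2)]])
    show "elems_eq S (gen_ctx \<Delta> K) (Id_at \<Theta> (compose u ?X) (compose v ?Y)) ?t' ?t'"
      by (rule path_comp_cong[OF r3 G(1) cu[OF G(2)] cu[OF G(3)] cv[OF G(3)] cb[OF G(3)] path_map_cong[OF r1 r3 u G(1-4)]])
    note U = cuD[OF G(6)] and V = cvD[OF G(6)] and B = cbD[OF G(6)]
    have cI: "ctxt S (Id_at \<Theta> (compose u ?P) (compose v ?P) @ \<Delta> @ K)" by (rule Id_at_ctxt[OF c(3) G(5) U V])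
    note 1 = path_comp_cong[OF r3 G(5) U V V path_map_refl[OF c(1,3) v G(5,6)] B]
    note 2 = path_comp_refl_left[OF c(3) G(5) U V B]
    note 3 = path_comp_cong[OF r3 G(5) U U V B path_map_refl[OF c(1,3) u G(5,6)]]
    note 4 = path_comp_refl_right[OF c(3) G(5) U V B]
    show "elems_eq S (\<Delta> @ K) (Id_at \<Theta> (compose u ?P) (compose v ?P))
      (path_comp \<Theta> (compose u ?P) (compose v ?P) (compose v ?P) (path_map \<Delta> \<Theta> v ?P ?P (refl_at \<Delta> ?P)) (compose \<beta> ?P))
      (path_comp \<Theta> (compose u ?P) (compose u ?P) (compose v ?P) (compose \<beta> ?P) (path_map \<Delta> \<Theta> u ?P ?P (refl_at \<Delta> ?P)))"
      using elems_eq_trans[OF cI elems_eq_trans[OF cI 1 2] elems_eq_sym[OF cI elems_eq_trans[OF cI 3 4]]] .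
  qed (simp_all only: simps)
qed

text \<open>The inverse comes from eliminating \<open>p\<close> into the paths from y to x, with
  reflexivity as datum. On the diagonal both required equations say that reflexivity composed with
  itself is reflexivity.\<close>

lemma path_inverse:
  assumes c: "ctxt S \<Delta>" "ctxt S K" and f: "elems_eq S K \<Delta> f f" and g: "elems_eq S K \<Delta> g g" and p: "elems_eq S K (Id_at \<Delta> f g) p p"
  shows "\<exists>q. elems_eq S K (Id_at \<Delta> g f) q q \<and>
    elems_eq S K (Id_at \<Delta> f f) (path_comp \<Delta> f g f q p) (refl_at \<Delta> f) \<and>
    elems_eq S K (Id_at \<Delta> g g) (path_comp \<Delta> g f g p q) (refl_at \<Delta> g)"
proof -
  define n where "n = length \<Delta>"
  note n = n_def[symmetric]
  have l: "length f = n" "length g = n" "length p = n"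
    using elems_eq_length[OF f] elems_eq_length[OF g] elems_eq_length[OF p] by (simp_all add: n_def)
  note G = gen0[OF c n]
  note rc = ctxt_eq_refl[OF c(1)]
  let ?X = "gX n 0 :: 'c expr list" and ?Y = "gY n 0 :: 'c expr list" and ?P = "gP n 0 :: 'c expr list"
  have cI: "ctxt S (Id_at \<Delta> ?Y ?X @ [] @ gen_ctx \<Delta> K)" using Id_at_ctxt[OF c(1) G(1) G(3) G(2)] by simp
  have I\<delta>: "subst_tele (diag_ctx \<Delta>) (Id_at \<Delta> ?Y ?X) = Id_at \<Delta> ?P ?P"
    by (subst Id_at_subst[OF c(1)]) (simp_all only: G(7,8) n g_length)
  have r: "elems_eq S (\<Delta> @ K) (Id_at \<Delta> ?P ?P) (refl_at \<Delta> ?P) (refl_at \<Delta> ?P)" by (rule refl_at_eq[OF rc G(5,6)])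
  then have r': "elems_eq S (subst_tele (diag_ctx \<Delta>) [] @ \<Delta> @ K) (subst_tele (lift_sub (length []) (diag_ctx \<Delta>)) (Id_at \<Delta> ?Y ?X)) (refl_at \<Delta> ?P) (refl_at \<Delta> ?P)"
    by (simp add: I\<delta>)
  define t where "t = J_ctx \<Delta> [] (Id_at \<Delta> ?Y ?X) (refl_at \<Delta> ?P)"
  have t: "elems_eq S (gen_ctx \<Delta> K) (Id_at \<Delta> ?Y ?X) t t"
    using J_ctx_okD(3)[OF ctxt_eq_refl[OF G(5)] refl refl refl ctxt_eq_refl[OF cI] r'] by (simp add: t_def)
  have t\<delta>: "elems_eq S (\<Delta> @ K) (Id_at \<Delta> ?P ?P) (map (subst (diag_ctx \<Delta>)) t) (refl_at \<Delta> ?P)"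
    using J_ctx_okD(4)[OF ctxt_eq_refl[OF G(5)] refl refl refl ctxt_eq_refl[OF cI] r'] I\<delta> by (simp add: t_def)
  have lt: "length t = n" using elems_eq_length[OF t] n by simp
  let ?\<tau> = "ext p (ext g (ext f Var))"
  define q where "q = map (subst ?\<tau>) t"
  have cI': "ctxt S (Id_at \<Delta> ?P ?P @ \<Delta> @ K)" by (rule Id_at_ctxt[OF c(1) G(5,6,6)])
  note simps = map_subst_path_comp[OF c(1)] map_subst_refl_at[OF c(1)] G(7-12) l n g_length length_map lt q_def
  have cr: "elems_eq S (\<Delta> @ K) (Id_at \<Delta> ?P ?P) (path_comp \<Delta> ?P ?P ?P (refl_at \<Delta> ?P) (refl_at \<Delta> ?P)) (refl_at \<Delta> ?P)"
    by (rule path_comp_refl_left[OF c(1) G(5,6,6) r])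
  have "subst_tele ?\<tau> (Id_at \<Delta> ?Y ?X) = Id_at \<Delta> g f"
    by (subst Id_at_subst[OF c(1)]) (simp_all only: simps)
  then have 1: "elems_eq S K (Id_at \<Delta> g f) q q"
    using elems_eq_subst[OF gen_sub_eq[OF c f g p] _ t] cI by (simp add: q_def)
  have 2: "elems_eq S K (Id_at \<Delta> f f) (path_comp \<Delta> f g f q p) (refl_at \<Delta> f)"
  proof (rule contraction0[OF c f g p n c(1) G(2,2)])
    show "elems_eq S (gen_ctx \<Delta> K) (Id_at \<Delta> ?X ?X) (path_comp \<Delta> ?X ?Y ?X t ?P) (path_comp \<Delta> ?X ?Y ?X t ?P)"
      by (rule path_comp_cong[OF rc G(1,2,3,2) t G(4)])
    show "elems_eq S (gen_ctx \<Delta> K) (Id_at \<Delta> ?X ?X) (refl_at \<Delta> ?X) (refl_at \<Delta> ?X)" by (rule refl_at_eq[OF rc G(1,2)])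
    show "elems_eq S (\<Delta> @ K) (Id_at \<Delta> ?P ?P) (path_comp \<Delta> ?P ?P ?P (map (subst (diag_ctx \<Delta>)) t) (refl_at \<Delta> ?P)) (refl_at \<Delta> ?P)"
      by (rule elems_eq_trans[OF cI' path_comp_cong[OF rc G(5,6,6,6) t\<delta> r] cr])
  qed (simp_all only: simps)
  have 3: "elems_eq S K (Id_at \<Delta> g g) (path_comp \<Delta> g f g p q) (refl_at \<Delta> g)"
  proof (rule contraction0[OF c f g p n c(1) G(3,3)])
    show "elems_eq S (gen_ctx \<Delta> K) (Id_at \<Delta> ?Y ?Y) (path_comp \<Delta> ?Y ?X ?Y ?P t) (path_comp \<Delta> ?Y ?X ?Y ?P t)"
      by (rule path_comp_cong[OF rc G(1,3,2,3) G(4) t])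
    show "elems_eq S (gen_ctx \<Delta> K) (Id_at \<Delta> ?Y ?Y) (refl_at \<Delta> ?Y) (refl_at \<Delta> ?Y)" by (rule refl_at_eq[OF rc G(1,3)])
    show "elems_eq S (\<Delta> @ K) (Id_at \<Delta> ?P ?P) (path_comp \<Delta> ?P ?P ?P (refl_at \<Delta> ?P) (map (subst (diag_ctx \<Delta>)) t)) (refl_at \<Delta> ?P)"
      by (rule elems_eq_trans[OF cI' path_comp_cong[OF rc G(5,6,6,6) r t\<delta>] cr])
  qed (simp_all only: simps)
  show ?thesis using 1 2 3 by blast
qed

end

section \<open>The 2-category of contexts\<close>

text \<open>Operations on classes are defined as unions over representatives. Such a union evaluates
  at a single representative once all its members are known to coincide, and the evaluation lemmas
  below all proceed in this way.\<close>

lemma UN_const: "a \<in> A \<Longrightarrow> (\<And>x. x \<in> A \<Longrightarrow> F x = c) \<Longrightarrow> (\<Union>x \<in> A. F x) = c"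
  by auto

lemma UN_const2: "a \<in> A \<Longrightarrow> b \<in> B \<Longrightarrow> (\<And>x y. x \<in> A \<Longrightarrow> y \<in> B \<Longrightarrow> F x y = c) \<Longrightarrow> (\<Union>x \<in> A. \<Union>y \<in> B. F x y) = c"
  by auto

definition ob :: "'c type_theory \<Rightarrow> 'c ctx \<Rightarrow> 'c ctx set" where "ob S \<Gamma> = ctx_rel S `` {\<Gamma>}"
definition mor :: "'c type_theory \<Rightarrow> 'c ctx \<Rightarrow> 'c ctx \<Rightarrow> 'c expr list \<Rightarrow> 'c mor set" where
  "mor S \<Gamma> \<Delta> f = mor_rel S `` {(\<Gamma>, \<Delta>, f)}"
definition cell :: "'c type_theory \<Rightarrow> 'c ctx \<Rightarrow> 'c ctx \<Rightarrow> 'c expr list \<Rightarrow> 'c expr list \<Rightarrow> 'c expr list \<Rightarrow> 'c cell set" where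
  "cell S \<Gamma> \<Delta> f g \<alpha> = cell_rel S `` {(\<Gamma>, \<Delta>, f, g, \<alpha>)}"

definition is_mor :: "'c type_theory \<Rightarrow> 'c ctx \<Rightarrow> 'c ctx \<Rightarrow> 'c expr list \<Rightarrow> bool" where
  "is_mor S \<Gamma> \<Delta> f \<longleftrightarrow> ctxt S \<Gamma> \<and> ctxt S \<Delta> \<and> elems_eq S \<Gamma> \<Delta> f f"
definition is_cell :: "'c type_theory \<Rightarrow> 'c ctx \<Rightarrow> 'c ctx \<Rightarrow> 'c expr list \<Rightarrow> 'c expr list \<Rightarrow> 'c expr list \<Rightarrow> bool" where
  "is_cell S \<Gamma> \<Delta> f g \<alpha> \<longleftrightarrow> is_mor S \<Gamma> \<Delta> f \<and> is_mor S \<Gamma> \<Delta> g \<and> elems_eq S \<Gamma> (Id_at \<Delta> f g) \<alpha> \<alpha>"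

section \<open>Representatives of contexts, morphisms and cells\<close>

context discrete_identity_types
begin

lemma mors_iff: "(\<Gamma>, \<Delta>, f) \<in> mors S \<longleftrightarrow> is_mor S \<Gamma> \<Delta> f"
  by (simp add: mors_def is_mor_def elems_eq_refl_iff)

lemma cells_iff: "(\<Gamma>, \<Delta>, f, g, \<alpha>) \<in> cells S \<longleftrightarrow> is_cell S \<Gamma> \<Delta> f g \<alpha>"
  by (simp add: cells_def is_cell_def mors_iff elems_eq_refl_iff)

lemma elems_eq_convert2:
  assumes "ctxt_eq S \<Gamma> \<Gamma>'" "ctxt_eq S \<Delta> \<Delta>'" "elems_eq S \<Gamma> \<Delta> f f'"
  shows "elems_eq S \<Gamma>' \<Delta>' f f'"
  using elems_eq_convert_dom[OF elems_eq_convert[OF assms(3) closed_ctxt_eq_append[OF assms(2) ctxt_eq_ctxt1[OF assms(1)]]] assms(1)] .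

lemma path_convert:
  assumes "ctxt_eq S \<Gamma> \<Gamma>'" "ctxt_eq S \<Delta> \<Delta>'" "elems_eq S \<Gamma> \<Delta> f f'" "elems_eq S \<Gamma> \<Delta> g g'"
    "elems_eq S \<Gamma> (Id_at \<Delta> f g) p q"
  shows "elems_eq S \<Gamma>' (Id_at \<Delta>' f' g') p q"
  using elems_eq_convert_dom[OF elems_eq_convert[OF assms(5) Id_at_ctxt_eq[OF assms(2) ctxt_eq_ctxt1[OF assms(1)] assms(3,4)]] assms(1)] .

lemma closed_elems_eq_sym: "ctxt S \<Gamma> \<Longrightarrow> ctxt S \<Delta> \<Longrightarrow> elems_eq S \<Gamma> \<Delta> f g \<Longrightarrow> elems_eq S \<Gamma> \<Delta> g f"
  by (rule elems_eq_sym[OF closed_append])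

lemma closed_elems_eq_trans: "ctxt S \<Gamma> \<Longrightarrow> ctxt S \<Delta> \<Longrightarrow> elems_eq S \<Gamma> \<Delta> f g \<Longrightarrow> elems_eq S \<Gamma> \<Delta> g h \<Longrightarrow> elems_eq S \<Gamma> \<Delta> f h"
  by (rule elems_eq_trans[OF closed_append])

lemma mor_rel_iff: "((\<Gamma>, \<Delta>, f), (\<Gamma>', \<Delta>', f')) \<in> mor_rel S \<longleftrightarrow> ctxt_eq S \<Gamma> \<Gamma>' \<and> ctxt_eq S \<Delta> \<Delta>' \<and> elems_eq S \<Gamma> \<Delta> f f'"
  by (simp add: mor_rel_def)

lemma mor_relD:
  assumes "((\<Gamma>, \<Delta>, f), (\<Gamma>', \<Delta>', f')) \<in> mor_rel S"
  shows "is_mor S \<Gamma> \<Delta> f" "is_mor S \<Gamma>' \<Delta>' f'" "ctxt_eq S \<Gamma> \<Gamma>'" "ctxt_eq S \<Delta> \<Delta>'" "elems_eq S \<Gamma> \<Delta> f f'"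
proof -
  show a: "ctxt_eq S \<Gamma> \<Gamma>'" "ctxt_eq S \<Delta> \<Delta>'" "elems_eq S \<Gamma> \<Delta> f f'" using assms by (simp_all add: mor_rel_iff)
  have c: "ctxt S \<Gamma>" "ctxt S \<Delta>" "ctxt S \<Gamma>'" "ctxt S \<Delta>'" using a ctxt_eq_ctxt1 ctxt_eq_ctxt2 by blast+
  show "is_mor S \<Gamma> \<Delta> f" using c elems_eq_left[OF a(3)] by (simp add: is_mor_def)
  show "is_mor S \<Gamma>' \<Delta>' f'" using c elems_eq_convert2[OF a(1,2) elems_eq_right[OF closed_append[OF c(2,1)] a(3)]] by (simp add: is_mor_def)
qed

lemma equiv_ob: "equiv {\<Gamma>. ctxt S \<Gamma>} (ctx_rel S)"
  by (auto simp: equiv_def refl_on_def sym_def trans_def ctx_rel_def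
      intro: ctxt_eq_refl ctxt_eq_sym ctxt_eq_trans dest: ctxt_eq_ctxt1 ctxt_eq_ctxt2)

lemma mor_rel_sym: "(a, b) \<in> mor_rel S \<Longrightarrow> (b, a) \<in> mor_rel S"
proof -
  assume *: "(a, b) \<in> mor_rel S"
  obtain \<Gamma> \<Delta> f \<Gamma>' \<Delta>' f' where ab: "a = (\<Gamma>, \<Delta>, f)" "b = (\<Gamma>', \<Delta>', f')" by (metis surj_pair)
  note r = mor_relD[OF *[unfolded ab]]
  have "elems_eq S \<Gamma>' \<Delta>' f' f" by (rule elems_eq_convert2[OF r(3,4) closed_elems_eq_sym[OF _ _ r(5)]]) (use r(1) in \<open>simp_all add: is_mor_def\<close>)
  then show ?thesis using r by (simp add: ab mor_rel_iff ctxt_eq_sym)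
qed

lemma mor_rel_trans: "(a, b) \<in> mor_rel S \<Longrightarrow> (b, d) \<in> mor_rel S \<Longrightarrow> (a, d) \<in> mor_rel S"
proof -
  assume *: "(a, b) \<in> mor_rel S" "(b, d) \<in> mor_rel S"
  obtain \<Gamma> \<Delta> f \<Gamma>' \<Delta>' f' \<Gamma>'' \<Delta>'' f'' where ab: "a = (\<Gamma>, \<Delta>, f)" "b = (\<Gamma>', \<Delta>', f')" "d = (\<Gamma>'', \<Delta>'', f'')" by (metis surj_pair)
  note r = mor_relD[OF *(1)[unfolded ab]] and r' = mor_relD[OF *(2)[unfolded ab]]
  have "elems_eq S \<Gamma> \<Delta> f' f''" by (rule elems_eq_convert2[OF ctxt_eq_sym[OF r(3)] ctxt_eq_sym[OF r(4)] r'(5)])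
  from closed_elems_eq_trans[OF _ _ r(5) this] r(1) have "elems_eq S \<Gamma> \<Delta> f f''" by (simp add: is_mor_def)
  then show ?thesis using ctxt_eq_trans[OF r(3) r'(3)] ctxt_eq_trans[OF r(4) r'(4)] by (simp add: ab mor_rel_iff)
qed

lemma is_mor_rel: "is_mor S \<Gamma> \<Delta> f \<Longrightarrow> ((\<Gamma>, \<Delta>, f), (\<Gamma>, \<Delta>, f)) \<in> mor_rel S"
  by (simp add: mor_rel_iff is_mor_def ctxt_eq_refl)

lemma equiv_mor: "equiv (mors S) (mor_rel S)"
proof (rule equivI)
  show "mor_rel S \<subseteq> mors S \<times> mors S" using mor_relD(1,2) by (auto simp: mors_iff)
  show "refl_on (mors S) (mor_rel S)" by (auto simp: refl_on_def mors_iff is_mor_rel)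
  show "sym (mor_rel S)" using mor_rel_sym by (auto simp: sym_def)
  show "trans (mor_rel S)" using mor_rel_trans unfolding trans_def by blast
qed

lemma cell_relD:
  assumes "((\<Gamma>, \<Delta>, f, g, \<alpha>), (\<Gamma>', \<Delta>', f', g', \<alpha>')) \<in> cell_rel S"
  shows "((\<Gamma>, \<Delta>, f), (\<Gamma>', \<Delta>', f')) \<in> mor_rel S" "((\<Gamma>, \<Delta>, g), (\<Gamma>', \<Delta>', g')) \<in> mor_rel S" "elems_eq S \<Gamma> (Id_at \<Delta> f g) \<alpha> \<alpha>'"
    "is_cell S \<Gamma> \<Delta> f g \<alpha>" "is_cell S \<Gamma>' \<Delta>' f' g' \<alpha>'"
proof -
  show a: "((\<Gamma>, \<Delta>, f), (\<Gamma>', \<Delta>', f')) \<in> mor_rel S" "((\<Gamma>, \<Delta>, g), (\<Gamma>', \<Delta>', g')) \<in> mor_rel S" "elems_eq S \<Gamma> (Id_at \<Delta> f g) \<alpha> \<alpha>'"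
    using assms by (simp_all add: cell_rel_def)
  note f = mor_relD[OF a(1)] and g = mor_relD[OF a(2)]
  have c: "ctxt S (Id_at \<Delta> f g @ \<Gamma>)" using f(1) g(1) by (auto simp: is_mor_def intro: Id_at_ctxt)
  show "is_cell S \<Gamma> \<Delta> f g \<alpha>" using f g elems_eq_left[OF a(3)] by (simp add: is_cell_def)
  show "is_cell S \<Gamma>' \<Delta>' f' g' \<alpha>'"
    using f g path_convert[OF f(3,4,5) g(5) elems_eq_right[OF c a(3)]] by (simp add: is_cell_def)
qed

lemma is_cell_rel: "is_cell S \<Gamma> \<Delta> f g \<alpha> \<Longrightarrow> ((\<Gamma>, \<Delta>, f, g, \<alpha>), (\<Gamma>, \<Delta>, f, g, \<alpha>)) \<in> cell_rel S"
  by (simp add: cell_rel_def is_cell_def is_mor_rel)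

lemma is_cell_ctxt: "is_cell S \<Gamma> \<Delta> f g \<alpha> \<Longrightarrow> ctxt S (Id_at \<Delta> f g @ \<Gamma>)"
  by (auto simp: is_cell_def is_mor_def intro: Id_at_ctxt)

lemma equiv_cell: "equiv (cells S) (cell_rel S)"
proof (rule equivI)
  show "cell_rel S \<subseteq> cells S \<times> cells S" using cell_relD(4,5) by (auto simp: cells_iff)
  show "refl_on (cells S) (cell_rel S)" by (auto simp: refl_on_def cells_iff is_cell_rel)
  show "sym (cell_rel S)"
  proof (rule symI)
    fix a b assume *: "(a, b) \<in> cell_rel S"
    obtain \<Gamma> \<Delta> f g \<alpha> \<Gamma>' \<Delta>' f' g' \<alpha>' where ab: "a = (\<Gamma>, \<Delta>, f, g, \<alpha>)" "b = (\<Gamma>', \<Delta>', f', g', \<alpha>')" by (metis surj_pair)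
    note r = cell_relD[OF *[unfolded ab]]
    note f = mor_relD[OF r(1)] and g = mor_relD[OF r(2)]
    show "(b, a) \<in> cell_rel S"
      using path_convert[OF f(3,4,5) g(5) elems_eq_sym[OF is_cell_ctxt[OF r(4)] r(3)]] mor_rel_sym[OF r(1)] mor_rel_sym[OF r(2)]
      by (simp add: ab cell_rel_def)
  qed
  show "trans (cell_rel S)"
  proof (rule transI)
    fix a b d assume *: "(a, b) \<in> cell_rel S" "(b, d) \<in> cell_rel S"
    obtain \<Gamma> \<Delta> f g \<alpha> \<Gamma>' \<Delta>' f' g' \<alpha>' where ab: "a = (\<Gamma>, \<Delta>, f, g, \<alpha>)" "b = (\<Gamma>', \<Delta>', f', g', \<alpha>')" by (metis surj_pair)
    obtain \<Gamma>'' \<Delta>'' f'' g'' \<alpha>'' where d: "d = (\<Gamma>'', \<Delta>'', f'', g'', \<alpha>'')" by (metis surj_pair)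
    note r = cell_relD[OF *(1)[unfolded ab]] and r' = cell_relD[OF *(2)[unfolded ab d]]
    note f = mor_relD[OF mor_rel_sym[OF r(1)]] and g = mor_relD[OF mor_rel_sym[OF r(2)]]
    have "elems_eq S \<Gamma> (Id_at \<Delta> f g) \<alpha>' \<alpha>''" by (rule path_convert[OF f(3,4,5) g(5) r'(3)])
    from elems_eq_trans[OF is_cell_ctxt[OF r(4)] r(3) this] mor_rel_trans[OF r(1) r'(1)] mor_rel_trans[OF r(2) r'(2)]
    show "(a, d) \<in> cell_rel S" by (simp add: ab d cell_rel_def)
  qed
qed

lemma ob_eq_iff: "ctxt S \<Gamma> \<Longrightarrow> ctxt S \<Gamma>' \<Longrightarrow> ob S \<Gamma> = ob S \<Gamma>' \<longleftrightarrow> ctxt_eq S \<Gamma> \<Gamma>'"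
  unfolding ob_def by (subst eq_equiv_class_iff[OF equiv_ob]) (auto simp: ctx_rel_def)

lemma ob_eqI: "ctxt_eq S \<Gamma> \<Gamma>' \<Longrightarrow> ob S \<Gamma> = ob S \<Gamma>'"
  using ob_eq_iff ctxt_eq_ctxt1 ctxt_eq_ctxt2 by blast

lemma mor_eq_iff: "is_mor S \<Gamma> \<Delta> f \<Longrightarrow> is_mor S \<Gamma>' \<Delta>' f' \<Longrightarrow> mor S \<Gamma> \<Delta> f = mor S \<Gamma>' \<Delta>' f' \<longleftrightarrow> ((\<Gamma>, \<Delta>, f), (\<Gamma>', \<Delta>', f')) \<in> mor_rel S"
  unfolding mor_def by (subst eq_equiv_class_iff[OF equiv_mor]) (auto simp: mors_iff)

lemma mor_eqI: "((\<Gamma>, \<Delta>, f), (\<Gamma>', \<Delta>', f')) \<in> mor_rel S \<Longrightarrow> mor S \<Gamma> \<Delta> f = mor S \<Gamma>' \<Delta>' f'"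
  unfolding mor_def by (rule equiv_class_eq[OF equiv_mor])

lemma cell_eqI: "((\<Gamma>, \<Delta>, f, g, \<alpha>), (\<Gamma>', \<Delta>', f', g', \<alpha>')) \<in> cell_rel S \<Longrightarrow> cell S \<Gamma> \<Delta> f g \<alpha> = cell S \<Gamma>' \<Delta>' f' g' \<alpha>'"
  unfolding cell_def by (rule equiv_class_eq[OF equiv_cell])

lemma cell_eq_iff: "is_cell S \<Gamma> \<Delta> f g \<alpha> \<Longrightarrow> is_cell S \<Gamma>' \<Delta>' f' g' \<alpha>' \<Longrightarrow>
    cell S \<Gamma> \<Delta> f g \<alpha> = cell S \<Gamma>' \<Delta>' f' g' \<alpha>' \<longleftrightarrow> ((\<Gamma>, \<Delta>, f, g, \<alpha>), (\<Gamma>', \<Delta>', f', g', \<alpha>')) \<in> cell_rel S"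
  unfolding cell_def by (subst eq_equiv_class_iff[OF equiv_cell]) (auto simp: cells_iff)

lemma cell_eqI': "is_mor S \<Gamma> \<Delta> f \<Longrightarrow> is_mor S \<Gamma> \<Delta> g \<Longrightarrow> elems_eq S \<Gamma> (Id_at \<Delta> f g) \<alpha> \<alpha>' \<Longrightarrow> cell S \<Gamma> \<Delta> f g \<alpha> = cell S \<Gamma> \<Delta> f g \<alpha>'"
  by (rule cell_eqI) (simp add: cell_rel_def is_mor_rel)

lemma mem_ob: "\<Gamma>' \<in> ob S \<Gamma> \<longleftrightarrow> ctxt_eq S \<Gamma> \<Gamma>'"
  by (simp add: ob_def ctx_rel_def)

lemma Obj_Ctx: "X \<in> Obj (Ctx S) \<longleftrightarrow> (\<exists>\<Gamma>. ctxt S \<Gamma> \<and> X = ob S \<Gamma>)"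
  by (auto simp: Ctx_def quotient_def ob_def)

lemma Arr_Ctx: "F \<in> Arr (Ctx S) \<longleftrightarrow> (\<exists>\<Gamma> \<Delta> f. is_mor S \<Gamma> \<Delta> f \<and> F = mor S \<Gamma> \<Delta> f)"
  by (force simp: Ctx_def quotient_def mor_def simp flip: mors_iff)

lemma Cell_Ctx: "A \<in> Cell (Ctx S) \<longleftrightarrow> (\<exists>\<Gamma> \<Delta> f g \<alpha>. is_cell S \<Gamma> \<Delta> f g \<alpha> \<and> A = cell S \<Gamma> \<Delta> f g \<alpha>)"
  by (force simp: Ctx_def quotient_def cell_def simp flip: cells_iff)

lemma Dom_Ctx: "is_mor S \<Gamma> \<Delta> f \<Longrightarrow> Dom (Ctx S) (mor S \<Gamma> \<Delta> f) = ob S \<Gamma>"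
  unfolding Ctx_def cat.simps mor_def
  by (rule UN_const[of "(\<Gamma>, \<Delta>, f)"]) (auto simp: is_mor_rel ob_def[symmetric] dest!: mor_relD(3) ob_eqI)

lemma Cod_Ctx: "is_mor S \<Gamma> \<Delta> f \<Longrightarrow> Cod (Ctx S) (mor S \<Gamma> \<Delta> f) = ob S \<Delta>"
  unfolding Ctx_def cat.simps mor_def
  by (rule UN_const[of "(\<Gamma>, \<Delta>, f)"]) (auto simp: is_mor_rel ob_def[symmetric] dest!: mor_relD(4) ob_eqI)

lemma is_mor_vars: "ctxt S \<Gamma> \<Longrightarrow> is_mor S \<Gamma> \<Gamma> (vars (length \<Gamma>))"
  by (simp add: is_mor_def vars_typed)

lemma Ident_Ctx: "ctxt S \<Gamma> \<Longrightarrow> Ident (Ctx S) (ob S \<Gamma>) = mor S \<Gamma> \<Gamma> (vars (length \<Gamma>))"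
  unfolding Ctx_def cat.simps
  by (rule UN_const[of \<Gamma>])
    (auto simp: mem_ob ctxt_eq_refl mor_def[symmetric] vars_typed mor_rel_iff ctxt_eq_lengthD[symmetric] intro!: mor_eqI[symmetric])

lemma is_mor_compose: "is_mor S \<Delta> \<Theta> g \<Longrightarrow> is_mor S \<Gamma> \<Delta> f \<Longrightarrow> is_mor S \<Gamma> \<Theta> (compose g f)"
  using compose_typed unfolding is_mor_def by blast

lemma Comp_Ctx:
  assumes "is_mor S \<Delta> \<Theta> g" "is_mor S \<Gamma> \<Delta> f"
  shows "Comp (Ctx S) (mor S \<Delta> \<Theta> g) (mor S \<Gamma> \<Delta> f) = mor S \<Gamma> \<Theta> (compose g f)"
  unfolding Ctx_def cat.simps mor_def case_prod_unfold
proof (rule UN_const2[of "(\<Delta>, \<Theta>, g)" _ "(\<Gamma>, \<Delta>, f)"], goal_cases)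
  case (3 x y)
  obtain \<Delta>' \<Theta>' g' \<Gamma>' \<Delta>'' f' where xy: "x = (\<Delta>', \<Theta>', g')" "y = (\<Gamma>', \<Delta>'', f')" by (metis surj_pair)
  with 3 have "((\<Delta>, \<Theta>, g), (\<Delta>', \<Theta>', g')) \<in> mor_rel S" "((\<Gamma>, \<Delta>, f), (\<Gamma>', \<Delta>'', f')) \<in> mor_rel S" by auto
  note r = mor_relD[OF this(1)] mor_relD[OF this(2)]
  have "mor S \<Gamma> \<Theta> (compose g f) = mor S \<Gamma>' \<Theta>' (compose g' f')"
    using r compose_typed[of \<Delta> \<Theta> \<Gamma> g g' f f'] by (intro mor_eqI) (simp add: mor_rel_iff is_mor_def)
  then show ?case by (simp add: xy mor_def)
qed (use assms is_mor_rel in auto)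

lemma is_cellD: "is_cell S \<Gamma> \<Delta> f g \<alpha> \<Longrightarrow> is_mor S \<Gamma> \<Delta> f \<and> is_mor S \<Gamma> \<Delta> g"
  by (simp add: is_cell_def)

lemma Src_Ctx: "is_cell S \<Gamma> \<Delta> f g \<alpha> \<Longrightarrow> Src (Ctx S) (cell S \<Gamma> \<Delta> f g \<alpha>) = mor S \<Gamma> \<Delta> f"
  unfolding Ctx_def cat2.simps cell_def
  by (rule UN_const[of "(\<Gamma>, \<Delta>, f, g, \<alpha>)"]) (auto simp: is_cell_rel mor_def[symmetric] dest!: cell_relD(1) mor_eqI)

lemma Trg_Ctx: "is_cell S \<Gamma> \<Delta> f g \<alpha> \<Longrightarrow> Trg (Ctx S) (cell S \<Gamma> \<Delta> f g \<alpha>) = mor S \<Gamma> \<Delta> g"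
  unfolding Ctx_def cat2.simps cell_def
  by (rule UN_const[of "(\<Gamma>, \<Delta>, f, g, \<alpha>)"]) (auto simp: is_cell_rel mor_def[symmetric] dest!: cell_relD(2) mor_eqI)

lemma is_cell_refl: "is_mor S \<Gamma> \<Delta> f \<Longrightarrow> is_cell S \<Gamma> \<Delta> f f (refl_at \<Delta> f)"
  unfolding is_cell_def is_mor_def using refl_at_eq ctxt_eq_refl by blast

lemma VId_Ctx: "is_mor S \<Gamma> \<Delta> f \<Longrightarrow> VId (Ctx S) (mor S \<Gamma> \<Delta> f) = cell S \<Gamma> \<Delta> f f (refl_at \<Delta> f)"
  unfolding Ctx_def cat2.simps mor_def
proof (rule UN_const[of "(\<Gamma>, \<Delta>, f)"], goal_cases)
  case (2 x)
  obtain \<Gamma>' \<Delta>' f' where x: "x = (\<Gamma>', \<Delta>', f')" by (metis surj_pair)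
  with 2 have r0: "((\<Gamma>, \<Delta>, f), (\<Gamma>', \<Delta>', f')) \<in> mor_rel S" by auto
  note r = mor_relD[OF r0]
  have "elems_eq S \<Gamma> (Id_at \<Delta> f f) (refl_at \<Delta> f) (refl_at \<Delta>' f')" by (rule refl_at_eq[OF r(4) _ r(5)]) (use r(1) in \<open>simp add: is_mor_def\<close>)
  then have "cell S \<Gamma> \<Delta> f f (refl_at \<Delta> f) = cell S \<Gamma>' \<Delta>' f' f' (refl_at \<Delta>' f')"
    using r0 by (intro cell_eqI) (simp add: cell_rel_def)
  then show ?case by (simp add: x cell_def)
qed (use is_mor_rel in auto)

lemma is_cell_path_comp:
  "is_cell S \<Gamma> \<Delta> g h \<beta> \<Longrightarrow> is_cell S \<Gamma> \<Delta> f g \<alpha> \<Longrightarrow> is_cell S \<Gamma> \<Delta> f h (path_comp \<Delta> f g h \<beta> \<alpha>)"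
  unfolding is_cell_def is_mor_def by (intro conjI path_comp_cong ctxt_eq_refl) auto

lemma VComp_Ctx:
  assumes "is_cell S \<Gamma> \<Delta> g h \<beta>" "is_cell S \<Gamma> \<Delta> f g \<alpha>"
  shows "VComp (Ctx S) (cell S \<Gamma> \<Delta> g h \<beta>) (cell S \<Gamma> \<Delta> f g \<alpha>) = cell S \<Gamma> \<Delta> f h (path_comp \<Delta> f g h \<beta> \<alpha>)"
  unfolding Ctx_def cat2.simps cell_def case_prod_unfold
proof (rule UN_const2[of "(\<Gamma>, \<Delta>, g, h, \<beta>)" _ "(\<Gamma>, \<Delta>, f, g, \<alpha>)"], goal_cases)
  case (3 x y)
  obtain \<Gamma>1 \<Delta>1 g1 h' \<beta>' where x: "x = (\<Gamma>1, \<Delta>1, g1, h', \<beta>')" by (metis surj_pair)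
  obtain \<Gamma>' \<Delta>' f' g' \<alpha>' where y: "y = (\<Gamma>', \<Delta>', f', g', \<alpha>')" by (metis surj_pair)
  from 3 x y have X: "((\<Gamma>, \<Delta>, g, h, \<beta>), (\<Gamma>1, \<Delta>1, g1, h', \<beta>')) \<in> cell_rel S" and Y: "((\<Gamma>, \<Delta>, f, g, \<alpha>), (\<Gamma>', \<Delta>', f', g', \<alpha>')) \<in> cell_rel S" by auto
  note rx = cell_relD[OF X] and ry = cell_relD[OF Y]
  note f = mor_relD[OF ry(1)] and g = mor_relD[OF ry(2)] and h = mor_relD[OF rx(2)]
  have "elems_eq S \<Gamma> (Id_at \<Delta> f h) (path_comp \<Delta> f g h \<beta> \<alpha>) (path_comp \<Delta>' f' g' h' \<beta>' \<alpha>')"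
    by (rule path_comp_cong[OF f(4) _ f(5) g(5) h(5) rx(3) ry(3)]) (use f(1) in \<open>simp add: is_mor_def\<close>)
  then have "cell S \<Gamma> \<Delta> f h (path_comp \<Delta> f g h \<beta> \<alpha>) = cell S \<Gamma>' \<Delta>' f' h' (path_comp \<Delta>' f' g' h' \<beta>' \<alpha>')"
    using ry(1) h f by (intro cell_eqI) (simp add: cell_rel_def mor_rel_iff)
  then show ?case by (simp add: x y cell_def)
qed (use assms is_cell_rel in auto)

lemma is_cell_path_map:
  "is_mor S \<Delta> \<Theta> h \<Longrightarrow> is_cell S \<Gamma> \<Delta> f g \<alpha> \<Longrightarrow> is_cell S \<Gamma> \<Theta> (compose h f) (compose h g) (path_map \<Delta> \<Theta> h f g \<alpha>)"
  unfolding is_cell_def using path_map_cong[OF ctxt_eq_refl ctxt_eq_refl] is_mor_compose by (auto simp: is_mor_def)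

lemma WhL_Ctx:
  assumes "is_mor S \<Delta> \<Theta> h" "is_cell S \<Gamma> \<Delta> f g \<alpha>"
  shows "WhL (Ctx S) (mor S \<Delta> \<Theta> h) (cell S \<Gamma> \<Delta> f g \<alpha>) = cell S \<Gamma> \<Theta> (compose h f) (compose h g) (path_map \<Delta> \<Theta> h f g \<alpha>)"
  unfolding Ctx_def cat2.simps cell_def mor_def case_prod_unfold
proof (rule UN_const2[of "(\<Delta>, \<Theta>, h)" _ "(\<Gamma>, \<Delta>, f, g, \<alpha>)"], goal_cases)
  case (3 x y)
  obtain \<Delta>1 \<Theta>' h' where x: "x = (\<Delta>1, \<Theta>', h')" by (metis surj_pair)
  obtain \<Gamma>' \<Delta>' f' g' \<alpha>' where y: "y = (\<Gamma>', \<Delta>', f', g', \<alpha>')" by (metis surj_pair)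
  from 3 x y have X: "((\<Delta>, \<Theta>, h), (\<Delta>1, \<Theta>', h')) \<in> mor_rel S" and Y: "((\<Gamma>, \<Delta>, f, g, \<alpha>), (\<Gamma>', \<Delta>', f', g', \<alpha>')) \<in> cell_rel S" by auto
  note h = mor_relD[OF X] and ry = cell_relD[OF Y]
  note f = mor_relD[OF ry(1)] and g = mor_relD[OF ry(2)]
  have c: "ctxt S \<Gamma>" "ctxt S \<Delta>" "ctxt S \<Theta>" using f(1) h(1) by (simp_all add: is_mor_def)
  have "elems_eq S \<Gamma> (Id_at \<Theta> (compose h f) (compose h g)) (path_map \<Delta> \<Theta> h f g \<alpha>) (path_map \<Delta>' \<Theta>' h' f' g' \<alpha>')"
    by (rule path_map_cong[OF f(4) h(4,5) c(1) f(5) g(5) ry(3)])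
  then have "cell S \<Gamma> \<Theta> (compose h f) (compose h g) (path_map \<Delta> \<Theta> h f g \<alpha>) = cell S \<Gamma>' \<Theta>' (compose h' f') (compose h' g') (path_map \<Delta>' \<Theta>' h' f' g' \<alpha>')"
    using f(3) h(4) compose_typed[OF c(2,3,1) h(5) f(5)] compose_typed[OF c(2,3,1) h(5) g(5)] by (intro cell_eqI) (simp add: cell_rel_def mor_rel_iff)
  then show ?case by (simp add: x y cell_def)
qed (use assms is_cell_rel is_mor_rel in auto)

lemma is_cell_compose:
  "is_mor S \<Xi> \<Gamma> k \<Longrightarrow> is_cell S \<Gamma> \<Delta> f g \<alpha> \<Longrightarrow> is_cell S \<Xi> \<Delta> (compose f k) (compose g k) (compose \<alpha> k)"
  unfolding is_cell_def using compose_path_typed is_mor_compose by (auto simp: is_mor_def)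

lemma WhR_Ctx:
  assumes "is_mor S \<Xi> \<Gamma> k" "is_cell S \<Gamma> \<Delta> f g \<alpha>"
  shows "WhR (Ctx S) (cell S \<Gamma> \<Delta> f g \<alpha>) (mor S \<Xi> \<Gamma> k) = cell S \<Xi> \<Delta> (compose f k) (compose g k) (compose \<alpha> k)"
  unfolding Ctx_def cat2.simps cell_def mor_def case_prod_unfold
proof (rule UN_const2[of "(\<Gamma>, \<Delta>, f, g, \<alpha>)" _ "(\<Xi>, \<Gamma>, k)"], goal_cases)
  case (3 y x)
  obtain \<Xi>' \<Gamma>1 k' where x: "x = (\<Xi>', \<Gamma>1, k')" by (metis surj_pair)
  obtain \<Gamma>' \<Delta>' f' g' \<alpha>' where y: "y = (\<Gamma>', \<Delta>', f', g', \<alpha>')" by (metis surj_pair)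
  from 3 x y have X: "((\<Xi>, \<Gamma>, k), (\<Xi>', \<Gamma>1, k')) \<in> mor_rel S" and Y: "((\<Gamma>, \<Delta>, f, g, \<alpha>), (\<Gamma>', \<Delta>', f', g', \<alpha>')) \<in> cell_rel S" by auto
  note k = mor_relD[OF X] and ry = cell_relD[OF Y]
  note f = mor_relD[OF ry(1)] and g = mor_relD[OF ry(2)]
  have c: "ctxt S \<Gamma>" "ctxt S \<Delta>" "ctxt S \<Xi>" using f(1) k(1) by (simp_all add: is_mor_def)
  have ff: "elems_eq S \<Gamma> \<Delta> f f" "elems_eq S \<Gamma> \<Delta> g g" using f(1) g(1) by (simp_all add: is_mor_def)
  have "elems_eq S \<Xi> (Id_at \<Delta> (compose f k) (compose g k)) (compose \<alpha> k) (compose \<alpha>' k')"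
    by (rule compose_path_typed[OF c ff ry(3) k(5)])
  then have "cell S \<Xi> \<Delta> (compose f k) (compose g k) (compose \<alpha> k) = cell S \<Xi>' \<Delta>' (compose f' k') (compose g' k') (compose \<alpha>' k')"
    using k(3) f(4) compose_typed[OF c f(5) k(5)] compose_typed[OF c g(5) k(5)] by (intro cell_eqI) (simp add: cell_rel_def mor_rel_iff)
  then show ?case by (simp add: x y cell_def)
qed (use assms is_cell_rel is_mor_rel in auto)

lemma cell_mors: "is_cell S \<Gamma> \<Delta> f g \<alpha> \<Longrightarrow> is_mor S \<Gamma> \<Delta> f" "is_cell S \<Gamma> \<Delta> f g \<alpha> \<Longrightarrow> is_mor S \<Gamma> \<Delta> g"
  by (simp_all add: is_cell_def)

lemma Cell_CtxI: "is_cell S \<Gamma> \<Delta> f g \<alpha> \<Longrightarrow> cell S \<Gamma> \<Delta> f g \<alpha> \<in> Cell (Ctx S)"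
  and Arr_CtxI: "is_mor S \<Gamma> \<Delta> f \<Longrightarrow> mor S \<Gamma> \<Delta> f \<in> Arr (Ctx S)"
  and Obj_CtxI: "ctxt S \<Gamma> \<Longrightarrow> ob S \<Gamma> \<in> Obj (Ctx S)"
  unfolding Cell_Ctx Arr_Ctx Obj_Ctx by blast+

lemma Src_Arr_Ctx: "A \<in> Cell (Ctx S) \<Longrightarrow> Src (Ctx S) A \<in> Arr (Ctx S)"
  using cell_mors by (auto simp: Cell_Ctx Src_Ctx Arr_CtxI)

lemma mor_change:
  assumes "is_mor S \<Gamma> \<Delta> f" "ctxt_eq S \<Gamma> \<Gamma>'" "ctxt_eq S \<Delta> \<Delta>'"
  shows "is_mor S \<Gamma>' \<Delta>' f" "mor S \<Gamma> \<Delta> f = mor S \<Gamma>' \<Delta>' f"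
proof -
  have *: "((\<Gamma>, \<Delta>, f), (\<Gamma>', \<Delta>', f)) \<in> mor_rel S" using assms by (simp add: mor_rel_iff is_mor_def)
  show "is_mor S \<Gamma>' \<Delta>' f" by (rule mor_relD[OF *])
  show "mor S \<Gamma> \<Delta> f = mor S \<Gamma>' \<Delta>' f" by (rule mor_eqI[OF *])
qed

text \<open>Composability of classes only means that certain classes of contexts coincide. Rebasing
  a representative to prescribed raw contexts makes composable classes syntactically composable, as
  the evaluation lemmas require.\<close>

lemma arr_dom_cod:
  assumes "F \<in> Arr (Ctx S)" "Dom (Ctx S) F = ob S \<Gamma>" "Cod (Ctx S) F = ob S \<Delta>" "ctxt S \<Gamma>" "ctxt S \<Delta>"
  shows "\<exists>f. is_mor S \<Gamma> \<Delta> f \<and> F = mor S \<Gamma> \<Delta> f"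
proof -
  from assms(1) obtain \<Gamma>0 \<Delta>0 f where f: "is_mor S \<Gamma>0 \<Delta>0 f" "F = mor S \<Gamma>0 \<Delta>0 f" by (auto simp: Arr_Ctx)
  then have "ob S \<Gamma>0 = ob S \<Gamma>" "ob S \<Delta>0 = ob S \<Delta>" using assms by (simp_all add: Dom_Ctx Cod_Ctx)
  then have "ctxt_eq S \<Gamma>0 \<Gamma>" "ctxt_eq S \<Delta>0 \<Delta>" using f(1) assms(4,5) by (simp_all add: ob_eq_iff is_mor_def)
  from mor_change[OF f(1) this] f(2) show ?thesis by auto
qed

lemma arr_dom:
  assumes "F \<in> Arr (Ctx S)" "Dom (Ctx S) F = ob S \<Gamma>" "ctxt S \<Gamma>"
  shows "\<exists>\<Delta> f. is_mor S \<Gamma> \<Delta> f \<and> F = mor S \<Gamma> \<Delta> f"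
proof -
  from assms(1) obtain \<Gamma>0 \<Delta>0 f where f: "is_mor S \<Gamma>0 \<Delta>0 f" "F = mor S \<Gamma>0 \<Delta>0 f" by (auto simp: Arr_Ctx)
  then have "Cod (Ctx S) F = ob S \<Delta>0" "ctxt S \<Delta>0" by (simp_all add: Cod_Ctx is_mor_def)
  from arr_dom_cod[OF assms(1,2) this(1) assms(3) this(2)] show ?thesis by blast
qed

lemma arr_cod:
  assumes "F \<in> Arr (Ctx S)" "Cod (Ctx S) F = ob S \<Delta>" "ctxt S \<Delta>"
  shows "\<exists>\<Gamma> f. is_mor S \<Gamma> \<Delta> f \<and> F = mor S \<Gamma> \<Delta> f"
proof -
  from assms(1) obtain \<Gamma>0 \<Delta>0 f where f: "is_mor S \<Gamma>0 \<Delta>0 f" "F = mor S \<Gamma>0 \<Delta>0 f" by (auto simp: Arr_Ctx)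
  then have "Dom (Ctx S) F = ob S \<Gamma>0" "ctxt S \<Gamma>0" by (simp_all add: Dom_Ctx is_mor_def)
  from arr_dom_cod[OF assms(1) this(1) assms(2) this(2) assms(3)] show ?thesis by blast
qed

lemma cell_change:
  assumes "is_cell S \<Gamma> \<Delta> f g \<alpha>" "((\<Gamma>, \<Delta>, f), (\<Gamma>', \<Delta>', f')) \<in> mor_rel S" "((\<Gamma>, \<Delta>, g), (\<Gamma>', \<Delta>', g')) \<in> mor_rel S"
  shows "is_cell S \<Gamma>' \<Delta>' f' g' \<alpha>" "cell S \<Gamma> \<Delta> f g \<alpha> = cell S \<Gamma>' \<Delta>' f' g' \<alpha>"
proof -
  have *: "((\<Gamma>, \<Delta>, f, g, \<alpha>), (\<Gamma>', \<Delta>', f', g', \<alpha>)) \<in> cell_rel S" using assms by (simp add: cell_rel_def is_cell_def)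
  show "is_cell S \<Gamma>' \<Delta>' f' g' \<alpha>" by (rule cell_relD[OF *])
  show "cell S \<Gamma> \<Delta> f g \<alpha> = cell S \<Gamma>' \<Delta>' f' g' \<alpha>" by (rule cell_eqI[OF *])
qed

lemma cell_src_trg:
  assumes "A \<in> Cell (Ctx S)" "Src (Ctx S) A = mor S \<Gamma> \<Delta> f" "Trg (Ctx S) A = mor S \<Gamma> \<Delta> g" "is_mor S \<Gamma> \<Delta> f" "is_mor S \<Gamma> \<Delta> g"
  shows "\<exists>\<alpha>. is_cell S \<Gamma> \<Delta> f g \<alpha> \<and> A = cell S \<Gamma> \<Delta> f g \<alpha>"
proof -
  from assms(1) obtain \<Gamma>0 \<Delta>0 f0 g0 \<alpha> where a: "is_cell S \<Gamma>0 \<Delta>0 f0 g0 \<alpha>" "A = cell S \<Gamma>0 \<Delta>0 f0 g0 \<alpha>" by (auto simp: Cell_Ctx)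
  then have "mor S \<Gamma>0 \<Delta>0 f0 = mor S \<Gamma> \<Delta> f" "mor S \<Gamma>0 \<Delta>0 g0 = mor S \<Gamma> \<Delta> g" using assms by (simp_all add: Src_Ctx Trg_Ctx)
  then have "((\<Gamma>0, \<Delta>0, f0), (\<Gamma>, \<Delta>, f)) \<in> mor_rel S" "((\<Gamma>0, \<Delta>0, g0), (\<Gamma>, \<Delta>, g)) \<in> mor_rel S"
    using is_cellD[OF a(1)] assms(4,5) by (simp_all add: mor_eq_iff)
  from cell_change[OF a(1) this] a(2) show ?thesis by auto
qed

lemma cell_src:
  assumes "A \<in> Cell (Ctx S)" "Src (Ctx S) A = mor S \<Gamma> \<Delta> f" "is_mor S \<Gamma> \<Delta> f"
  shows "\<exists>g \<alpha>. is_cell S \<Gamma> \<Delta> f g \<alpha> \<and> A = cell S \<Gamma> \<Delta> f g \<alpha>"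
proof -
  from assms(1) obtain \<Gamma>0 \<Delta>0 f0 g0 \<alpha> where a: "is_cell S \<Gamma>0 \<Delta>0 f0 g0 \<alpha>" "A = cell S \<Gamma>0 \<Delta>0 f0 g0 \<alpha>" by (auto simp: Cell_Ctx)
  note m = is_cellD[OF a(1)]
  have "mor S \<Gamma>0 \<Delta>0 f0 = mor S \<Gamma> \<Delta> f" using a assms by (simp add: Src_Ctx)
  then have "((\<Gamma>0, \<Delta>0, f0), (\<Gamma>, \<Delta>, f)) \<in> mor_rel S" using m assms(3) by (simp add: mor_eq_iff)
  from mor_change[OF _ mor_relD(3,4)[OF this], of g0] m
  have "is_mor S \<Gamma> \<Delta> g0" "Trg (Ctx S) A = mor S \<Gamma> \<Delta> g0" using a by (simp_all add: Trg_Ctx)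
  from cell_src_trg[OF assms(1,2) this(2) assms(3) this(1)] show ?thesis by blast
qed

lemma cell_trg:
  assumes "A \<in> Cell (Ctx S)" "Trg (Ctx S) A = mor S \<Gamma> \<Delta> g" "is_mor S \<Gamma> \<Delta> g"
  shows "\<exists>f \<alpha>. is_cell S \<Gamma> \<Delta> f g \<alpha> \<and> A = cell S \<Gamma> \<Delta> f g \<alpha>"
proof -
  from assms(1) obtain \<Gamma>0 \<Delta>0 f0 g0 \<alpha> where a: "is_cell S \<Gamma>0 \<Delta>0 f0 g0 \<alpha>" "A = cell S \<Gamma>0 \<Delta>0 f0 g0 \<alpha>" by (auto simp: Cell_Ctx)
  note m = is_cellD[OF a(1)]
  have "mor S \<Gamma>0 \<Delta>0 g0 = mor S \<Gamma> \<Delta> g" using a assms by (simp add: Trg_Ctx)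
  then have "((\<Gamma>0, \<Delta>0, g0), (\<Gamma>, \<Delta>, g)) \<in> mor_rel S" using m assms(3) by (simp add: mor_eq_iff)
  from mor_change[OF _ mor_relD(3,4)[OF this], of f0] m
  have "is_mor S \<Gamma> \<Delta> f0" "Src (Ctx S) A = mor S \<Gamma> \<Delta> f0" using a by (simp_all add: Src_Ctx)
  from cell_src_trg[OF assms(1) this(2) assms(2) this(1) assms(3)] show ?thesis by blast
qed

lemma cell_dom_cod:
  assumes "A \<in> Cell (Ctx S)" "Dom (Ctx S) (Src (Ctx S) A) = ob S \<Gamma>" "Cod (Ctx S) (Src (Ctx S) A) = ob S \<Delta>" "ctxt S \<Gamma>" "ctxt S \<Delta>"
  shows "\<exists>f g \<alpha>. is_cell S \<Gamma> \<Delta> f g \<alpha> \<and> A = cell S \<Gamma> \<Delta> f g \<alpha>"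
proof -
  have "Src (Ctx S) A \<in> Arr (Ctx S)" by (rule Src_Arr_Ctx[OF assms(1)])
  from arr_dom_cod[OF this assms(2-5)] cell_src[OF assms(1)] show ?thesis by blast
qed

lemma cell_dom:
  assumes "A \<in> Cell (Ctx S)" "Dom (Ctx S) (Src (Ctx S) A) = ob S \<Gamma>" "ctxt S \<Gamma>"
  shows "\<exists>\<Delta> f g \<alpha>. is_cell S \<Gamma> \<Delta> f g \<alpha> \<and> A = cell S \<Gamma> \<Delta> f g \<alpha>"
proof -
  have "Src (Ctx S) A \<in> Arr (Ctx S)" by (rule Src_Arr_Ctx[OF assms(1)])
  from arr_dom[OF this assms(2,3)] cell_src[OF assms(1)] show ?thesis by blast
qed

section \<open>The axioms of a 2-category for contexts\<close>

lemmas Ctx_simps = Dom_Ctx Cod_Ctx Ident_Ctx Comp_Ctx Src_Ctx Trg_Ctx VId_Ctx VComp_Ctx WhL_Ctx WhR_Ctx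
lemmas is_intros = is_mor_vars is_mor_compose is_cell_refl is_cell_path_comp is_cell_path_map is_cell_compose

lemma is_morD: "is_mor S \<Gamma> \<Delta> f \<Longrightarrow> ctxt S \<Gamma> \<and> ctxt S \<Delta> \<and> elems_eq S \<Gamma> \<Delta> f f \<and> length f = length \<Delta>"
  using elems_eq_length[of S \<Gamma> \<Delta> f f] by (simp add: is_mor_def)

lemma compose_assoc:
  assumes "is_mor S \<Theta> \<Lambda> h" "is_mor S \<Delta> \<Theta> g"
  shows "compose (compose h g) f = compose h (compose g f)"
  using map_subst_compose[of \<Theta> \<Lambda> h h g "ext f Var"] assms[THEN is_morD] by (simp add: compose_eq del: map_map)

lemma compose_vars_right: "is_mor S \<Gamma> \<Delta> f \<Longrightarrow> compose f (vars (length \<Gamma>)) = f"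
proof -
  assume f: "is_mor S \<Gamma> \<Delta> f"
  have "map (subst (ext (vars (length \<Gamma>)) Var)) f = map (subst Var) f"
    by (rule map_subst_cong) (use is_morD[OF f] in \<open>auto simp: ext_def\<close>)
  then show ?thesis by (simp add: compose_eq)
qed

lemma Ctx_category: "category (Ctx S)"
proof
  fix F assume "F \<in> Arr (Ctx S)"
  then obtain \<Gamma> \<Delta> f where f: "is_mor S \<Gamma> \<Delta> f" "F = mor S \<Gamma> \<Delta> f" by (auto simp: Arr_Ctx)
  show "Dom (Ctx S) F \<in> Obj (Ctx S)" "Cod (Ctx S) F \<in> Obj (Ctx S)"
    using f is_morD by (auto simp: Obj_Ctx Ctx_simps)
  show "Comp (Ctx S) (Ident (Ctx S) (Cod (Ctx S) F)) F = F" "Comp (Ctx S) F (Ident (Ctx S) (Dom (Ctx S) F)) = F"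
    using f is_morD[OF f(1)] by (simp_all add: Ctx_simps is_intros compose_vars_right)
next
  fix X assume "X \<in> Obj (Ctx S)"
  then show "Ident (Ctx S) X \<in> Arr (Ctx S)" "Dom (Ctx S) (Ident (Ctx S) X) = X" "Cod (Ctx S) (Ident (Ctx S) X) = X"
    using is_mor_vars by (auto simp: Obj_Ctx Ctx_simps Arr_CtxI)
next
  fix G F assume *: "G \<in> Arr (Ctx S)" "F \<in> Arr (Ctx S)" "Dom (Ctx S) G = Cod (Ctx S) F"
  then obtain \<Gamma> \<Delta> f where f: "is_mor S \<Gamma> \<Delta> f" "F = mor S \<Gamma> \<Delta> f" by (auto simp: Arr_Ctx)
  with * is_morD obtain \<Theta> g where g: "is_mor S \<Delta> \<Theta> g" "G = mor S \<Delta> \<Theta> g" using arr_dom[of G \<Delta>] by (auto simp: Ctx_simps)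
  show "Comp (Ctx S) G F \<in> Arr (Ctx S)" "Dom (Ctx S) (Comp (Ctx S) G F) = Dom (Ctx S) F" "Cod (Ctx S) (Comp (Ctx S) G F) = Cod (Ctx S) G"
    using f g is_mor_compose[OF g(1) f(1)] by (auto simp: Ctx_simps Arr_CtxI)
next
  fix H G F assume *: "H \<in> Arr (Ctx S)" "G \<in> Arr (Ctx S)" "F \<in> Arr (Ctx S)" "Dom (Ctx S) H = Cod (Ctx S) G" "Dom (Ctx S) G = Cod (Ctx S) F"
  then obtain \<Gamma> \<Delta> f where f: "is_mor S \<Gamma> \<Delta> f" "F = mor S \<Gamma> \<Delta> f" by (auto simp: Arr_Ctx)
  with * is_morD obtain \<Theta> g where g: "is_mor S \<Delta> \<Theta> g" "G = mor S \<Delta> \<Theta> g" using arr_dom[of G \<Delta>] by (auto simp: Ctx_simps)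
  with * is_morD obtain \<Lambda> h where h: "is_mor S \<Theta> \<Lambda> h" "H = mor S \<Theta> \<Lambda> h" using arr_dom[of H \<Theta>] by (auto simp: Ctx_simps)
  show "Comp (Ctx S) (Comp (Ctx S) H G) F = Comp (Ctx S) H (Comp (Ctx S) G F)"
    using f g h by (simp add: Ctx_simps is_mor_compose compose_assoc[OF h(1) g(1)])
qed

lemma is_cell_elems: "is_cell S \<Gamma> \<Delta> f g \<alpha> \<Longrightarrow> elems_eq S \<Gamma> \<Delta> f f \<and> elems_eq S \<Gamma> \<Delta> g g \<and> elems_eq S \<Gamma> (Id_at \<Delta> f g) \<alpha> \<alpha> \<and> length \<alpha> = length \<Delta> \<and> ctxt S \<Gamma> \<and> ctxt S \<Delta>"
  using elems_eq_length[of S \<Gamma> "Id_at \<Delta> f g" \<alpha> \<alpha>] by (simp add: is_cell_def is_mor_def)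

lemma hom_simps: "Obj (hom_cat C x y) = {f \<in> Arr C. Dom C f = x \<and> Cod C f = y}"
  "Arr (hom_cat C x y) = {\<alpha> \<in> Cell C. Dom C (Src C \<alpha>) = x \<and> Cod C (Src C \<alpha>) = y}"
  "Dom (hom_cat C x y) = Src C" "Cod (hom_cat C x y) = Trg C" "Ident (hom_cat C x y) = VId C" "Comp (hom_cat C x y) = VComp C"
  by (simp_all add: hom_cat_def)

text \<open>The laws of vertical composition are the unit and associativity laws of paths. They
  become equations of classes because those path laws are definitional equalities.\<close>

lemma Ctx_hom_category: "ctxt S \<Gamma> \<Longrightarrow> ctxt S \<Delta> \<Longrightarrow> category (hom_cat (Ctx S) (ob S \<Gamma>) (ob S \<Delta>))"
proof (unfold_locales, goal_cases)
  case c: (1 A)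
  then obtain f g \<alpha> where "is_cell S \<Gamma> \<Delta> f g \<alpha>" "A = cell S \<Gamma> \<Delta> f g \<alpha>" using cell_dom_cod[of A \<Gamma> \<Delta>] by (auto simp: hom_simps)
  then show ?case using cell_mors by (auto simp: hom_simps Ctx_simps Arr_CtxI)
next
  case c: (2 A)
  then obtain f g \<alpha> where "is_cell S \<Gamma> \<Delta> f g \<alpha>" "A = cell S \<Gamma> \<Delta> f g \<alpha>" using cell_dom_cod[of A \<Gamma> \<Delta>] by (auto simp: hom_simps)
  then show ?case using cell_mors by (auto simp: hom_simps Ctx_simps Arr_CtxI)
next
  case c: (3 F)
  then obtain f where "is_mor S \<Gamma> \<Delta> f" "F = mor S \<Gamma> \<Delta> f" using arr_dom_cod[of F \<Gamma> \<Delta>] by (auto simp: hom_simps)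
  then show ?case by (simp add: hom_simps Ctx_simps Cell_CtxI is_intros)
next
  case c: (4 F)
  then obtain f where "is_mor S \<Gamma> \<Delta> f" "F = mor S \<Gamma> \<Delta> f" using arr_dom_cod[of F \<Gamma> \<Delta>] by (auto simp: hom_simps)
  then show ?case by (simp add: hom_simps Ctx_simps is_intros)
next
  case c: (5 F)
  then obtain f where "is_mor S \<Gamma> \<Delta> f" "F = mor S \<Gamma> \<Delta> f" using arr_dom_cod[of F \<Gamma> \<Delta>] by (auto simp: hom_simps)
  then show ?case by (simp add: hom_simps Ctx_simps is_intros)
next
  case c: (6 B A)
  then obtain f g \<alpha> where a: "is_cell S \<Gamma> \<Delta> f g \<alpha>" "A = cell S \<Gamma> \<Delta> f g \<alpha>" using cell_dom_cod[of A \<Gamma> \<Delta>] by (auto simp: hom_simps)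
  with c cell_mors obtain h \<beta> where b: "is_cell S \<Gamma> \<Delta> g h \<beta>" "B = cell S \<Gamma> \<Delta> g h \<beta>" using cell_src[of B \<Gamma> \<Delta> g] by (auto simp: hom_simps Ctx_simps)
  show ?case using a b cell_mors[OF a(1)] by (simp add: hom_simps Ctx_simps Cell_CtxI is_cell_path_comp)
next
  case c: (7 B A)
  then obtain f g \<alpha> where a: "is_cell S \<Gamma> \<Delta> f g \<alpha>" "A = cell S \<Gamma> \<Delta> f g \<alpha>" using cell_dom_cod[of A \<Gamma> \<Delta>] by (auto simp: hom_simps)
  with c cell_mors obtain h \<beta> where b: "is_cell S \<Gamma> \<Delta> g h \<beta>" "B = cell S \<Gamma> \<Delta> g h \<beta>" using cell_src[of B \<Gamma> \<Delta> g] by (auto simp: hom_simps Ctx_simps)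
  show ?case using a b by (simp add: hom_simps Ctx_simps is_cell_path_comp)
next
  case c: (8 B A)
  then obtain f g \<alpha> where a: "is_cell S \<Gamma> \<Delta> f g \<alpha>" "A = cell S \<Gamma> \<Delta> f g \<alpha>" using cell_dom_cod[of A \<Gamma> \<Delta>] by (auto simp: hom_simps)
  with c cell_mors obtain h \<beta> where b: "is_cell S \<Gamma> \<Delta> g h \<beta>" "B = cell S \<Gamma> \<Delta> g h \<beta>" using cell_src[of B \<Gamma> \<Delta> g] by (auto simp: hom_simps Ctx_simps)
  show ?case using a b by (simp add: hom_simps Ctx_simps is_cell_path_comp)
next
  case c: (9 A)
  then obtain f g \<alpha> where a: "is_cell S \<Gamma> \<Delta> f g \<alpha>" "A = cell S \<Gamma> \<Delta> f g \<alpha>" using cell_dom_cod[of A \<Gamma> \<Delta>] by (auto simp: hom_simps)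
  note e = is_cell_elems[OF a(1)]
  have "cell S \<Gamma> \<Delta> f g (path_comp \<Delta> f g g (refl_at \<Delta> g) \<alpha>) = cell S \<Gamma> \<Delta> f g \<alpha>"
    by (rule cell_eqI'[OF cell_mors[OF a(1)]]) (use e path_comp_refl_left in blast)
  then show ?case using a cell_mors[OF a(1)] by (simp add: hom_simps Ctx_simps is_cell_refl)
next
  case c: (10 A)
  then obtain f g \<alpha> where a: "is_cell S \<Gamma> \<Delta> f g \<alpha>" "A = cell S \<Gamma> \<Delta> f g \<alpha>" using cell_dom_cod[of A \<Gamma> \<Delta>] by (auto simp: hom_simps)
  note e = is_cell_elems[OF a(1)]
  have "cell S \<Gamma> \<Delta> f g (path_comp \<Delta> f f g \<alpha> (refl_at \<Delta> f)) = cell S \<Gamma> \<Delta> f g \<alpha>"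
    by (rule cell_eqI'[OF cell_mors[OF a(1)]]) (use e path_comp_refl_right in blast)
  then show ?case using a cell_mors[OF a(1)] by (simp add: hom_simps Ctx_simps is_cell_refl)
next
  case c: (11 B' B A)
  then obtain f g \<alpha> where a: "is_cell S \<Gamma> \<Delta> f g \<alpha>" "A = cell S \<Gamma> \<Delta> f g \<alpha>" using cell_dom_cod[of A \<Gamma> \<Delta>] by (auto simp: hom_simps)
  with c cell_mors obtain h \<beta> where b: "is_cell S \<Gamma> \<Delta> g h \<beta>" "B = cell S \<Gamma> \<Delta> g h \<beta>" using cell_src[of B \<Gamma> \<Delta> g] by (auto simp: hom_simps Ctx_simps)
  with c cell_mors obtain k \<gamma> where g: "is_cell S \<Gamma> \<Delta> h k \<gamma>" "B' = cell S \<Gamma> \<Delta> h k \<gamma>" using cell_src[of B' \<Gamma> \<Delta> h] by (auto simp: hom_simps Ctx_simps)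
  note e = is_cell_elems[OF a(1)] is_cell_elems[OF b(1)] is_cell_elems[OF g(1)]
  have "cell S \<Gamma> \<Delta> f k (path_comp \<Delta> f g k (path_comp \<Delta> g h k \<gamma> \<beta>) \<alpha>) = cell S \<Gamma> \<Delta> f k (path_comp \<Delta> f h k \<gamma> (path_comp \<Delta> f g h \<beta> \<alpha>))"
    by (rule cell_eqI'[OF cell_mors(1)[OF a(1)] cell_mors(2)[OF g(1)]]) (use e path_comp_assoc in blast)
  then show ?case using a b g by (simp add: hom_simps Ctx_simps is_cell_path_comp)
qed

lemma compose_refl_at: "ctxt S \<Delta> \<Longrightarrow> length f = length \<Delta> \<Longrightarrow> compose (refl_at \<Delta> f) k = refl_at \<Delta> (compose f k)"
  using map_subst_refl_at[of \<Delta> f "ext k Var"] by (simp only: compose_eq[of "compose (refl_ctx \<Delta>) f"] compose_eq[of f])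

text \<open>Whiskering on the right is substitution, so the axioms that relate it to identities,
  vertical composition, composition of 1-cells and left whiskering hold for raw terms. Whiskering on
  the left is an elimination; its remaining axioms, and interchange, rest on the path laws
  established before.\<close>

lemma Ctx_two_category: "two_category (Ctx S)"
proof (intro two_category.intro Ctx_category two_category_axioms.intro, goal_cases)
  case (1 A) then show ?case using cell_mors by (auto simp: Cell_Ctx Ctx_simps Arr_CtxI)
next
  case (2 A) then show ?case using cell_mors by (auto simp: Cell_Ctx Ctx_simps Arr_CtxI)
next
  case (3 A) then show ?case using cell_mors by (auto simp: Cell_Ctx Ctx_simps)
next
  case (4 A) then show ?case using cell_mors by (auto simp: Cell_Ctx Ctx_simps)
next
  case (5 x y) then show ?case using Ctx_hom_category by (auto simp: Obj_Ctx)
next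
  case c: (6 H A)
  then obtain \<Gamma> \<Delta> f g \<alpha> where a: "is_cell S \<Gamma> \<Delta> f g \<alpha>" "A = cell S \<Gamma> \<Delta> f g \<alpha>" by (auto simp: Cell_Ctx)
  note m = cell_mors[OF a(1)]
  from c a m obtain \<Theta> h where h: "is_mor S \<Delta> \<Theta> h" "H = mor S \<Delta> \<Theta> h" using arr_dom[of H \<Delta>] is_morD by (auto simp: Ctx_simps)
  show ?case using a h m by (simp add: Ctx_simps is_cell_path_map[OF h(1) a(1)] Cell_CtxI)
next
  case c: (7 K A)
  then obtain \<Gamma> \<Delta> f g \<alpha> where a: "is_cell S \<Gamma> \<Delta> f g \<alpha>" "A = cell S \<Gamma> \<Delta> f g \<alpha>" by (auto simp: Cell_Ctx)
  note m = cell_mors[OF a(1)]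
  from c a m obtain \<Xi> k where k: "is_mor S \<Xi> \<Gamma> k" "K = mor S \<Xi> \<Gamma> k" using arr_cod[of K \<Gamma>] is_morD by (auto simp: Ctx_simps)
  show ?case using a k m by (simp add: Ctx_simps is_cell_compose[OF k(1) a(1)] Cell_CtxI)
next
  case c: (8 H F)
  then obtain \<Gamma> \<Delta> f where f: "is_mor S \<Gamma> \<Delta> f" "F = mor S \<Gamma> \<Delta> f" by (auto simp: Arr_Ctx)
  with c is_morD obtain \<Theta> h where h: "is_mor S \<Delta> \<Theta> h" "H = mor S \<Delta> \<Theta> h" using arr_dom[of H \<Delta>] by (auto simp: Ctx_simps)
  have hf: "is_mor S \<Gamma> \<Theta> (compose h f)" by (rule is_mor_compose[OF h(1) f(1)])
  have "cell S \<Gamma> \<Theta> (compose h f) (compose h f) (path_map \<Delta> \<Theta> h f f (refl_at \<Delta> f)) = cell S \<Gamma> \<Theta> (compose h f) (compose h f) (refl_at \<Theta> (compose h f))"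
    by (rule cell_eqI'[OF hf hf]) (use is_morD[OF f(1)] is_morD[OF h(1)] path_map_refl in blast)
  then show ?case using f h hf by (simp add: Ctx_simps is_cell_refl)
next
  case c: (9 F K)
  then obtain \<Gamma> \<Delta> f where f: "is_mor S \<Gamma> \<Delta> f" "F = mor S \<Gamma> \<Delta> f" by (auto simp: Arr_Ctx)
  with c is_morD obtain \<Xi> k where k: "is_mor S \<Xi> \<Gamma> k" "K = mor S \<Xi> \<Gamma> k" using arr_cod[of K \<Gamma>] by (auto simp: Ctx_simps)
  show ?case using f k is_mor_compose[OF f(1) k(1)] is_morD[OF f(1)] by (simp add: Ctx_simps is_cell_refl compose_refl_at)
next
  case c: (10 H B A)
  then obtain \<Gamma> \<Delta> f g \<alpha> where a: "is_cell S \<Gamma> \<Delta> f g \<alpha>" "A = cell S \<Gamma> \<Delta> f g \<alpha>" by (auto simp: Cell_Ctx)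
  note m = cell_mors[OF a(1)]
  from c a m obtain k \<beta> where b: "is_cell S \<Gamma> \<Delta> g k \<beta>" "B = cell S \<Gamma> \<Delta> g k \<beta>" using cell_src[of B \<Gamma> \<Delta> g] by (auto simp: Ctx_simps)
  from c a m obtain \<Theta> h where h: "is_mor S \<Delta> \<Theta> h" "H = mor S \<Delta> \<Theta> h" using arr_dom[of H \<Delta>] is_morD by (auto simp: Ctx_simps)
  have "cell S \<Gamma> \<Theta> (compose h f) (compose h k) (path_map \<Delta> \<Theta> h f k (path_comp \<Delta> f g k \<beta> \<alpha>)) =
      cell S \<Gamma> \<Theta> (compose h f) (compose h k) (path_comp \<Theta> (compose h f) (compose h g) (compose h k) (path_map \<Delta> \<Theta> h g k \<beta>) (path_map \<Delta> \<Theta> h f g \<alpha>))"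
    by (rule cell_eqI'[OF is_mor_compose[OF h(1) m(1)] is_mor_compose[OF h(1) cell_mors(2)[OF b(1)]]])
      (use is_cell_elems[OF a(1)] is_cell_elems[OF b(1)] is_morD[OF h(1)] path_map_comp in blast)
  then show ?case using a b h is_cell_path_map[OF h(1) a(1)] is_cell_path_map[OF h(1) b(1)] by (simp add: Ctx_simps is_cell_path_comp[OF b(1) a(1)])
next
  case c: (11 K B A)
  then obtain \<Gamma> \<Delta> f g \<alpha> where a: "is_cell S \<Gamma> \<Delta> f g \<alpha>" "A = cell S \<Gamma> \<Delta> f g \<alpha>" by (auto simp: Cell_Ctx)
  note m = cell_mors[OF a(1)]
  from c a m obtain h \<beta> where b: "is_cell S \<Gamma> \<Delta> g h \<beta>" "B = cell S \<Gamma> \<Delta> g h \<beta>" using cell_src[of B \<Gamma> \<Delta> g] by (auto simp: Ctx_simps)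
  from c a m obtain \<Xi> k where k: "is_mor S \<Xi> \<Gamma> k" "K = mor S \<Xi> \<Gamma> k" using arr_cod[of K \<Gamma>] is_morD by (auto simp: Ctx_simps)
  have "compose (path_comp \<Delta> f g h \<beta> \<alpha>) k = path_comp \<Delta> (compose f k) (compose g k) (compose h k) (compose \<beta> k) (compose \<alpha> k)"
    unfolding compose_eq[of _ k] using is_cell_elems[OF a(1)] is_cell_elems[OF b(1)] is_morD m cell_mors(2)[OF b(1)]
    by (intro map_subst_path_comp) auto
  then show ?case using a b k is_cell_compose[OF k(1) a(1)] is_cell_compose[OF k(1) b(1)] by (simp add: Ctx_simps is_cell_path_comp[OF b(1) a(1)])
next
  case c: (12 A)
  then obtain \<Gamma> \<Delta> f g \<alpha> where a: "is_cell S \<Gamma> \<Delta> f g \<alpha>" "A = cell S \<Gamma> \<Delta> f g \<alpha>" by (auto simp: Cell_Ctx)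
  note m = cell_mors[OF a(1)] and e = is_cell_elems[OF a(1)]
  have "cell S \<Gamma> \<Delta> f g (path_map \<Delta> \<Delta> (vars (length \<Delta>)) f g \<alpha>) = cell S \<Gamma> \<Delta> f g \<alpha>"
    by (rule cell_eqI'[OF m]) (use e path_map_vars in blast)
  then show ?case using a m e is_morD[OF m(1)] is_morD[OF m(2)] by (simp add: Ctx_simps is_mor_vars)
next
  case c: (13 A)
  then obtain \<Gamma> \<Delta> f g \<alpha> where a: "is_cell S \<Gamma> \<Delta> f g \<alpha>" "A = cell S \<Gamma> \<Delta> f g \<alpha>" by (auto simp: Cell_Ctx)
  note m = cell_mors[OF a(1)] and e = is_cell_elems[OF a(1)]
  have "map (subst (ext (vars (length \<Gamma>)) Var)) \<alpha> = map (subst Var) \<alpha>"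
    by (rule map_subst_cong) (use e in \<open>auto simp: ext_def\<close>)
  then have "compose \<alpha> (vars (length \<Gamma>)) = \<alpha>" by (simp add: compose_eq)
  then show ?case using a m e by (simp add: Ctx_simps is_mor_vars compose_vars_right)
next
  case c: (14 H K A)
  then obtain \<Gamma> \<Delta> f g \<alpha> where a: "is_cell S \<Gamma> \<Delta> f g \<alpha>" "A = cell S \<Gamma> \<Delta> f g \<alpha>" by (auto simp: Cell_Ctx)
  note m = cell_mors[OF a(1)] and e = is_cell_elems[OF a(1)]
  from c a m obtain \<Theta> k where k: "is_mor S \<Delta> \<Theta> k" "K = mor S \<Delta> \<Theta> k" using arr_dom[of K \<Delta>] is_morD by (auto simp: Ctx_simps)
  with c obtain \<Lambda> h where h: "is_mor S \<Theta> \<Lambda> h" "H = mor S \<Theta> \<Lambda> h" using arr_dom[of H \<Theta>] is_morD by (auto simp: Ctx_simps)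
  note hk = is_mor_compose[OF h(1) k(1)]
  have "cell S \<Gamma> \<Lambda> (compose (compose h k) f) (compose (compose h k) g) (path_map \<Delta> \<Lambda> (compose h k) f g \<alpha>) =
      cell S \<Gamma> \<Lambda> (compose (compose h k) f) (compose (compose h k) g) (path_map \<Theta> \<Lambda> h (compose k f) (compose k g) (path_map \<Delta> \<Theta> k f g \<alpha>))"
    by (rule cell_eqI'[OF is_mor_compose[OF hk m(1)] is_mor_compose[OF hk m(2)]])
      (use e is_morD[OF h(1)] is_morD[OF k(1)] path_map_path_map in blast)
  then show ?case using a h k hk is_cell_path_map[OF k(1) a(1)] by (simp add: Ctx_simps compose_assoc[OF h(1) k(1)])
next
  case c: (15 H K A)
  then obtain \<Gamma> \<Delta> f g \<alpha> where a: "is_cell S \<Gamma> \<Delta> f g \<alpha>" "A = cell S \<Gamma> \<Delta> f g \<alpha>" by (auto simp: Cell_Ctx)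
  note m = cell_mors[OF a(1)] and e = is_cell_elems[OF a(1)]
  from c a m obtain \<Xi> h where h: "is_mor S \<Xi> \<Gamma> h" "H = mor S \<Xi> \<Gamma> h" using arr_cod[of H \<Gamma>] is_morD by (auto simp: Ctx_simps)
  with c obtain \<Xi>' k where k: "is_mor S \<Xi>' \<Xi> k" "K = mor S \<Xi>' \<Xi> k" using arr_cod[of K \<Xi>] is_morD by (auto simp: Ctx_simps)
  have "length h = length \<Gamma>" using is_morD[OF h(1)] by simp
  then have "compose \<alpha> (compose h k) = compose (compose \<alpha> h) k"
    using map_subst_compose[OF conjunct1[OF conjunct2[OF conjunct2[OF e]]], of h "ext k Var"] by (simp only: compose_eq[of "compose \<alpha> h"] compose_eq[of h])
  then show ?case using a h k is_mor_compose[OF h(1) k(1)] is_cell_compose[OF h(1) a(1)]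
    by (simp add: Ctx_simps compose_assoc[OF m(1) h(1)] compose_assoc[OF m(2) h(1)])
next
  case c: (16 H K A)
  then obtain \<Gamma> \<Delta> f g \<alpha> where a: "is_cell S \<Gamma> \<Delta> f g \<alpha>" "A = cell S \<Gamma> \<Delta> f g \<alpha>" by (auto simp: Cell_Ctx)
  note m = cell_mors[OF a(1)] and e = is_cell_elems[OF a(1)]
  from c a m obtain \<Xi> k where k: "is_mor S \<Xi> \<Gamma> k" "K = mor S \<Xi> \<Gamma> k" using arr_cod[of K \<Gamma>] is_morD by (auto simp: Ctx_simps)
  from c a m obtain \<Theta> h where h: "is_mor S \<Delta> \<Theta> h" "H = mor S \<Delta> \<Theta> h" using arr_dom[of H \<Delta>] is_morD by (auto simp: Ctx_simps)
  have "compose (path_map \<Delta> \<Theta> h f g \<alpha>) k = path_map \<Delta> \<Theta> h (compose f k) (compose g k) (compose \<alpha> k)"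
    unfolding compose_eq[of _ k] using e is_morD[OF h(1)] is_morD[OF m(1)] is_morD[OF m(2)] by (intro map_subst_path_map) auto
  then show ?case using a h k is_cell_compose[OF k(1) a(1)] is_cell_path_map[OF h(1) a(1)]
    by (simp add: Ctx_simps compose_assoc[OF h(1) m(1)] compose_assoc[OF h(1) m(2)])
next
  case c: (17 B A)
  then obtain \<Gamma> \<Delta> f g \<alpha> where a: "is_cell S \<Gamma> \<Delta> f g \<alpha>" "A = cell S \<Gamma> \<Delta> f g \<alpha>" by (auto simp: Cell_Ctx)
  note m = cell_mors[OF a(1)] and e = is_cell_elems[OF a(1)]
  from c a m obtain \<Theta> u v \<beta> where b: "is_cell S \<Delta> \<Theta> u v \<beta>" "B = cell S \<Delta> \<Theta> u v \<beta>" using cell_dom[of B \<Delta>] is_morD by (auto simp: Ctx_simps)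
  note m' = cell_mors[OF b(1)] and e' = is_cell_elems[OF b(1)]
  have "cell S \<Gamma> \<Theta> (compose u f) (compose v g) (path_comp \<Theta> (compose u f) (compose v f) (compose v g) (path_map \<Delta> \<Theta> v f g \<alpha>) (compose \<beta> f)) =
     cell S \<Gamma> \<Theta> (compose u f) (compose v g) (path_comp \<Theta> (compose u f) (compose u g) (compose v g) (compose \<beta> g) (path_map \<Delta> \<Theta> u f g \<alpha>))"
    by (rule cell_eqI'[OF is_mor_compose[OF m'(1) m(1)] is_mor_compose[OF m'(2) m(2)]]) (use e e' path_interchange in blast)
  then show ?case using a b m m' is_cell_path_map[OF m'(1) a(1)] is_cell_path_map[OF m'(2) a(1)] is_cell_compose[OF m(1) b(1)] is_cell_compose[OF m(2) b(1)]
    by (simp add: Ctx_simps)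
qed

lemma Ctx_inverse:
  assumes "A \<in> Cell (Ctx S)"
  shows "\<exists>B. B \<in> Cell (Ctx S) \<and> Src (Ctx S) B = Trg (Ctx S) A \<and> Trg (Ctx S) B = Src (Ctx S) A \<and>
    VComp (Ctx S) B A = VId (Ctx S) (Src (Ctx S) A) \<and> VComp (Ctx S) A B = VId (Ctx S) (Trg (Ctx S) A)"
proof -
  from assms obtain \<Gamma> \<Delta> f g \<alpha> where a: "is_cell S \<Gamma> \<Delta> f g \<alpha>" "A = cell S \<Gamma> \<Delta> f g \<alpha>" by (auto simp: Cell_Ctx)
  note m = cell_mors[OF a(1)] and e = is_cell_elems[OF a(1)]
  from e path_inverse[of \<Delta> \<Gamma> f g \<alpha>] obtain \<beta> where \<beta>: "elems_eq S \<Gamma> (Id_at \<Delta> g f) \<beta> \<beta>"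
    "elems_eq S \<Gamma> (Id_at \<Delta> f f) (path_comp \<Delta> f g f \<beta> \<alpha>) (refl_at \<Delta> f)"
    "elems_eq S \<Gamma> (Id_at \<Delta> g g) (path_comp \<Delta> g f g \<alpha> \<beta>) (refl_at \<Delta> g)" by blast
  have b: "is_cell S \<Gamma> \<Delta> g f \<beta>" using m \<beta>(1) by (simp add: is_cell_def)
  show ?thesis using a b m cell_eqI'[OF m(1) m(1) \<beta>(2)] cell_eqI'[OF m(2) m(2) \<beta>(3)] Cell_CtxI[OF b]
    by (intro exI[of _ "cell S \<Gamma> \<Delta> g f \<beta>"]) (simp add: Ctx_simps)
qed

end

section \<open>Fibrations of locally groupoidal 2-categories\<close>

context two_category
begin

lemma hom_cat_of: "\<alpha> \<in> Cell C \<Longrightarrow> category (hom_cat C (Dom C (Src C \<alpha>)) (Cod C (Src C \<alpha>)))"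
  by (intro hom_category dom_obj cod_obj src_arr)

lemma vcomp_cell:
  assumes "\<beta> \<in> Cell C" "\<alpha> \<in> Cell C" "Src C \<beta> = Trg C \<alpha>"
  shows "VComp C \<beta> \<alpha> \<in> Cell C" "Src C (VComp C \<beta> \<alpha>) = Src C \<alpha>" "Trg C (VComp C \<beta> \<alpha>) = Trg C \<beta>"
proof -
  interpret H: category "hom_cat C (Dom C (Src C \<alpha>)) (Cod C (Src C \<alpha>))" by (rule hom_cat_of[OF assms(2)])
  have "Dom C (Src C \<beta>) = Dom C (Src C \<alpha>)" "Cod C (Src C \<beta>) = Cod C (Src C \<alpha>)"
    using assms cell_dom cell_cod by metis+
  then show "VComp C \<beta> \<alpha> \<in> Cell C" "Src C (VComp C \<beta> \<alpha>) = Src C \<alpha>" "Trg C (VComp C \<beta> \<alpha>) = Trg C \<beta>"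
    using H.comp_arr[of \<beta> \<alpha>] H.dom_comp[of \<beta> \<alpha>] H.cod_comp[of \<beta> \<alpha>] assms by (simp_all add: hom_cat_def)
qed

lemma vid_cell:
  assumes "f \<in> Arr C"
  shows "VId C f \<in> Cell C" "Src C (VId C f) = f" "Trg C (VId C f) = f"
proof -
  interpret H: category "hom_cat C (Dom C f) (Cod C f)" by (intro hom_category dom_obj cod_obj assms)
  show "VId C f \<in> Cell C" "Src C (VId C f) = f" "Trg C (VId C f) = f"
    using H.ident_arr[of f] H.dom_ident[of f] H.cod_ident[of f] assms by (simp_all add: hom_cat_def)
qed

lemma vcomp_vid:
  assumes "\<alpha> \<in> Cell C"
  shows "VComp C (VId C (Trg C \<alpha>)) \<alpha> = \<alpha>" "VComp C \<alpha> (VId C (Src C \<alpha>)) = \<alpha>"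
proof -
  interpret H: category "hom_cat C (Dom C (Src C \<alpha>)) (Cod C (Src C \<alpha>))" by (rule hom_cat_of[OF assms])
  show "VComp C (VId C (Trg C \<alpha>)) \<alpha> = \<alpha>" "VComp C \<alpha> (VId C (Src C \<alpha>)) = \<alpha>"
    using H.comp_ident_left[of \<alpha>] H.comp_ident_right[of \<alpha>] assms by (simp_all add: hom_cat_def)
qed

lemma vcomp_assoc:
  assumes "\<gamma> \<in> Cell C" "\<beta> \<in> Cell C" "\<alpha> \<in> Cell C" "Src C \<gamma> = Trg C \<beta>" "Src C \<beta> = Trg C \<alpha>"
  shows "VComp C (VComp C \<gamma> \<beta>) \<alpha> = VComp C \<gamma> (VComp C \<beta> \<alpha>)"
proof -
  interpret H: category "hom_cat C (Dom C (Src C \<alpha>)) (Cod C (Src C \<alpha>))" by (rule hom_cat_of[OF assms(3)])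
  have "Dom C (Src C \<beta>) = Dom C (Src C \<alpha>)" "Cod C (Src C \<beta>) = Cod C (Src C \<alpha>)"
    "Dom C (Src C \<gamma>) = Dom C (Src C \<alpha>)" "Cod C (Src C \<gamma>) = Cod C (Src C \<alpha>)"
    using assms cell_dom cell_cod by metis+
  then show ?thesis using H.comp_assoc[of \<gamma> \<beta> \<alpha>] assms by (simp add: hom_cat_def)
qed

definition inverse_cells :: "'t \<Rightarrow> 't \<Rightarrow> bool" where
  "inverse_cells \<alpha> \<beta> \<longleftrightarrow> \<alpha> \<in> Cell C \<and> \<beta> \<in> Cell C \<and> Src C \<beta> = Trg C \<alpha> \<and> Trg C \<beta> = Src C \<alpha> \<and>
    VComp C \<beta> \<alpha> = VId C (Src C \<alpha>) \<and> VComp C \<alpha> \<beta> = VId C (Trg C \<alpha>)"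

lemma inverse_cancel:
  assumes "inverse_cells \<alpha> \<beta>" "\<gamma> \<in> Cell C"
  shows "Trg C \<gamma> = Src C \<alpha> \<Longrightarrow> VComp C \<beta> (VComp C \<alpha> \<gamma>) = \<gamma>"
    "Trg C \<gamma> = Trg C \<alpha> \<Longrightarrow> VComp C \<alpha> (VComp C \<beta> \<gamma>) = \<gamma>"
  using assms vcomp_assoc[of \<beta> \<alpha> \<gamma>] vcomp_assoc[of \<alpha> \<beta> \<gamma>] vcomp_vid(1)[of \<gamma>]
  by (auto simp: inverse_cells_def)

lemma inverse_unique:
  assumes "inverse_cells \<alpha> \<beta>" "inverse_cells \<alpha> \<beta>'"
  shows "\<beta> = \<beta>'"
proof -
  have "VComp C \<beta> (VComp C \<alpha> \<beta>') = \<beta>'" by (rule inverse_cancel[OF assms(1)]) (use assms in \<open>auto simp: inverse_cells_def\<close>)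
  then show ?thesis using assms vcomp_vid(2)[of \<beta>] by (auto simp: inverse_cells_def)
qed

lemma inverse_whl:
  assumes "inverse_cells \<alpha> \<beta>" "h \<in> Arr C" "Dom C h = Cod C (Src C \<alpha>)"
  shows "inverse_cells (WhL C h \<alpha>) (WhL C h \<beta>)"
proof -
  from assms have a: "\<alpha> \<in> Cell C" "\<beta> \<in> Cell C" "Src C \<beta> = Trg C \<alpha>" "Trg C \<beta> = Src C \<alpha>"
    "VComp C \<beta> \<alpha> = VId C (Src C \<alpha>)" "VComp C \<alpha> \<beta> = VId C (Trg C \<alpha>)" by (auto simp: inverse_cells_def)
  have d: "Dom C h = Cod C (Src C \<beta>)" using assms(3) cell_cod[OF a(1)] a(3) by simp
  show ?thesis unfolding inverse_cells_def
    using a d whl_cell[OF assms(2) a(1) assms(3)] whl_cell[OF assms(2) a(2) d] whl_vcomp[OF assms(2) a(2,1) a(3) assms(3)]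
      whl_vcomp[OF assms(2) a(1,2) a(4)[symmetric] d] whl_vid[OF assms(2)] src_arr[OF a(1)] trg_arr[OF a(1)] assms(3)
    by simp
qed

lemma inverse_whr:
  assumes "inverse_cells \<alpha> \<beta>" "k \<in> Arr C" "Dom C (Src C \<alpha>) = Cod C k"
  shows "inverse_cells (WhR C \<alpha> k) (WhR C \<beta> k)"
proof -
  from assms have a: "\<alpha> \<in> Cell C" "\<beta> \<in> Cell C" "Src C \<beta> = Trg C \<alpha>" "Trg C \<beta> = Src C \<alpha>"
    "VComp C \<beta> \<alpha> = VId C (Src C \<alpha>)" "VComp C \<alpha> \<beta> = VId C (Trg C \<alpha>)" by (auto simp: inverse_cells_def)
  have d: "Dom C (Src C \<beta>) = Cod C k" using assms(3) cell_dom[OF a(1)] a(3) by simp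
  show ?thesis unfolding inverse_cells_def
    using a d whr_cell[OF assms(2) a(1) assms(3)] whr_cell[OF assms(2) a(2) d] whr_vcomp[OF assms(2) a(2,1) a(3) assms(3)]
      whr_vcomp[OF assms(2) a(1,2) a(4)[symmetric] d] whr_vid[OF _ assms(2)] src_arr[OF a(1)] trg_arr[OF a(1)] assms(3)
    by simp
qed

end

text \<open>
  When all 2-cells are invertible, they are all cartesian, so the local conditions of a 2-fibration
  amount to \<open>cell_lift\<close>; and the property of cartesian 1-cells with respect to 2-cells follows from its
  special case \<open>vertical\<close> for chosen lifts and 2-cells over identities.
\<close>

locale groupoidal_fibration = two_functor E B P0 P1 P2
  for E :: "('o, 'm, 't, 'z) cat2_scheme" and B :: "('p, 'n, 's, 'y) cat2_scheme"
    and P0 :: "'o \<Rightarrow> 'p" and P1 :: "'m \<Rightarrow> 'n" and P2 :: "'t \<Rightarrow> 's" +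
  fixes lift :: "'n \<Rightarrow> 'o \<Rightarrow> 'm"
  assumes cloven: "cloven_fibration E B P0 P1 lift"
    and invertible: "\<alpha> \<in> Cell E \<Longrightarrow> \<exists>\<beta>. E.inverse_cells \<alpha> \<beta>"
    and cell_lift: "\<lbrakk>g \<in> Arr E; \<kappa> \<in> Cell B; Trg B \<kappa> = P1 g\<rbrakk> \<Longrightarrow> \<exists>\<gamma>. \<gamma> \<in> Cell E \<and> Trg E \<gamma> = g \<and> P2 \<gamma> = \<kappa>"
    and vertical: "\<lbrakk>z \<in> Obj E; u \<in> Arr B; Cod B u = P0 z; k \<in> Arr E; k' \<in> Arr E; Dom E k = Dom E k';
       Cod E k = Dom E (lift u z); Cod E k' = Dom E (lift u z); P1 k = P1 k'; \<theta> \<in> Cell E;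
       Src E \<theta> = Comp E (lift u z) k; Trg E \<theta> = Comp E (lift u z) k'; P2 \<theta> = VId B (Comp B u (P1 k))\<rbrakk> \<Longrightarrow>
       \<exists>!\<theta>'. \<theta>' \<in> Cell E \<and> Src E \<theta>' = k \<and> Trg E \<theta>' = k' \<and> P2 \<theta>' = VId B (P1 k) \<and> WhL E (lift u z) \<theta>' = \<theta>"
begin

lemma map_inverse:
  assumes "E.inverse_cells \<alpha> \<beta>"
  shows "B.inverse_cells (P2 \<alpha>) (P2 \<beta>)"
  using assms vcomp_map[of \<beta> \<alpha>] vcomp_map[of \<alpha> \<beta>] vid_map E.src_arr[of \<alpha>] E.trg_arr[of \<alpha>]
  by (auto simp: E.inverse_cells_def B.inverse_cells_def cell_map src_map trg_map)

lemma hom_functor: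
  assumes "x \<in> Obj E" "y \<in> Obj E"
  shows "cat_functor (hom_cat E x y) (hom_cat B (P0 x) (P0 y)) P1 P2"
proof (intro cat_functor.intro cat_functor_axioms.intro E.hom_category B.hom_category assms obj_map)
qed (use E.src_arr in \<open>auto simp: hom_cat_def arr_map dom_map cod_map cell_map src_map trg_map vid_map vcomp_map\<close>)

text \<open>The factor through an invertible cell is forced: it is the given cell followed by the
  inverse. It lies over \<kappa> because the functor preserves inverses.\<close>

lemma cell_cartesian:
  assumes "x \<in> Obj E" "y \<in> Obj E" "\<alpha> \<in> Arr (hom_cat E x y)"
  shows "cartesian (hom_cat E x y) (hom_cat B (P0 x) (P0 y)) P1 P2 \<alpha>"
  unfolding cartesian_def
proof (intro conjI ballI impI assms(3))
  fix \<gamma> \<kappa>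
  assume \<gamma>: "\<gamma> \<in> Arr (hom_cat E x y)" and \<kappa>: "\<kappa> \<in> Arr (hom_cat B (P0 x) (P0 y))"
    and e: "Cod (hom_cat E x y) \<gamma> = Cod (hom_cat E x y) \<alpha> \<and> Dom (hom_cat B (P0 x) (P0 y)) \<kappa> = P1 (Dom (hom_cat E x y) \<gamma>) \<and>
       Cod (hom_cat B (P0 x) (P0 y)) \<kappa> = P1 (Dom (hom_cat E x y) \<alpha>) \<and> P2 \<gamma> = Comp (hom_cat B (P0 x) (P0 y)) (P2 \<alpha>) \<kappa>"
  have a: "\<alpha> \<in> Cell E" "\<gamma> \<in> Cell E" "\<kappa> \<in> Cell B" "Trg E \<gamma> = Trg E \<alpha>" "Trg B \<kappa> = P1 (Src E \<alpha>)"
    "P2 \<gamma> = VComp B (P2 \<alpha>) \<kappa>" "Dom E (Src E \<gamma>) = x" "Cod E (Src E \<gamma>) = y"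
    using assms(3) \<gamma> \<kappa> e by (auto simp: hom_cat_def)
  obtain \<beta> where \<beta>: "E.inverse_cells \<alpha> \<beta>" using invertible[OF a(1)] by blast
  then have b: "\<beta> \<in> Cell E" "Src E \<beta> = Trg E \<alpha>" "Trg E \<beta> = Src E \<alpha>" by (auto simp: E.inverse_cells_def)
  let ?k = "VComp E \<beta> \<gamma>"
  note k = E.vcomp_cell[OF b(1) a(2)]
  have 1: "P2 ?k = \<kappa>"
    using vcomp_map[OF b(1) a(2)] b(2) a B.inverse_cancel(1)[OF map_inverse[OF \<beta>] a(3)] src_map[OF a(1)] by simp
  have 2: "VComp E \<alpha> ?k = \<gamma>" using E.inverse_cancel(2)[OF \<beta> a(2)] a(4) by simp
  have 3: "k' = ?k" if "k' \<in> Cell E" "Trg E k' = Src E \<alpha>" "VComp E \<alpha> k' = \<gamma>" for k'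
    using E.inverse_cancel(1)[OF \<beta> that(1,2)] that(3) by simp
  show "\<exists>!k'. k' \<in> Arr (hom_cat E x y) \<and> Dom (hom_cat E x y) k' = Dom (hom_cat E x y) \<gamma> \<and>
      Cod (hom_cat E x y) k' = Dom (hom_cat E x y) \<alpha> \<and> P2 k' = \<kappa> \<and> Comp (hom_cat E x y) \<alpha> k' = \<gamma>"
  proof (rule ex1I[of _ ?k], goal_cases)
    case 1
    then show ?case using k b a \<open>P2 ?k = \<kappa>\<close> 2 by (simp add: hom_cat_def)
  next
    case (2 k')
    then show ?case by (intro 3) (simp_all add: hom_cat_def)
  qed
qed

text \<open>The local fibrations have to be cloven but no law relates the chosen liftings, so an
  arbitrary choice suffices.\<close>

definition lift2 :: "'o \<Rightarrow> 'o \<Rightarrow> 's \<Rightarrow> 'm \<Rightarrow> 't" where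
  "lift2 x y \<alpha> g = (SOME \<gamma>. \<gamma> \<in> Cell E \<and> Trg E \<gamma> = g \<and> P2 \<gamma> = \<alpha>)"

lemma lift2:
  assumes "g \<in> Arr E" "\<alpha> \<in> Cell B" "Trg B \<alpha> = P1 g"
  shows "lift2 x y \<alpha> g \<in> Cell E" "Trg E (lift2 x y \<alpha> g) = g" "P2 (lift2 x y \<alpha> g) = \<alpha>"
  using someI_ex[OF cell_lift[OF assms]] by (simp_all add: lift2_def)

lemma hom_cloven:
  assumes "x \<in> Obj E" "y \<in> Obj E"
  shows "cloven_fibration (hom_cat E x y) (hom_cat B (P0 x) (P0 y)) P1 P2 (lift2 x y)"
proof (intro cloven_fibration.intro hom_functor assms cloven_fibration_axioms.intro)
  fix g \<alpha> assume "g \<in> Obj (hom_cat E x y)" "\<alpha> \<in> Arr (hom_cat B (P0 x) (P0 y))" "Cod (hom_cat B (P0 x) (P0 y)) \<alpha> = P1 g"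
  then have *: "g \<in> Arr E" "Dom E g = x" "Cod E g = y" "\<alpha> \<in> Cell B" "Trg B \<alpha> = P1 g" by (auto simp: hom_cat_def)
  note l = lift2[OF *(1,4,5), of x y]
  have "lift2 x y \<alpha> g \<in> Arr (hom_cat E x y)"
    using l * E.cell_dom[OF l(1)] E.cell_cod[OF l(1)] by (simp add: hom_cat_def)
  then show "cartesian (hom_cat E x y) (hom_cat B (P0 x) (P0 y)) P1 P2 (lift2 x y \<alpha> g)" by (rule cell_cartesian[OF assms])
  show "Cod (hom_cat E x y) (lift2 x y \<alpha> g) = g" "P2 (lift2 x y \<alpha> g) = \<alpha>" using l by (simp_all add: hom_cat_def)
qed

lemma cartesianD:
  assumes "cartesian E B P0 P1 f" "g \<in> Arr E" "k \<in> Arr B" "Cod E g = Cod E f" "Dom B k = P0 (Dom E g)" "Cod B k = P0 (Dom E f)"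
    "P1 g = Comp B (P1 f) k"
  shows "\<exists>!k'. k' \<in> Arr E \<and> Dom E k' = Dom E g \<and> Cod E k' = Dom E f \<and> P1 k' = k \<and> Comp E f k' = g"
  using assms unfolding cartesian_def by blast

text \<open>The cartesian property for 1-cells determines the ends \<open>k\<close> and
  \<open>m\<close> of the factor. A lifting \<kappa> of \<gamma> ending at \<open>m\<close> has the
  right image but possibly another source. Its whiskering differs from \<alpha> by a cell over an
  identity, which \<open>vertical\<close> lifts to a correction from \<open>k\<close> to that
  source.\<close>

lemma lift_cells:
  assumes z: "z \<in> Obj E" "u \<in> Arr B" "Cod B u = P0 z"
    and \<alpha>: "\<alpha> \<in> Cell E" "Cod E (Src E \<alpha>) = z"
    and \<gamma>: "\<gamma> \<in> Cell B" "Dom B (Src B \<gamma>) = P0 (Dom E (Src E \<alpha>))" "Cod B (Src B \<gamma>) = P0 (Dom E (lift u z))"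
    and e: "P2 \<alpha> = WhL B u \<gamma>"
  shows "\<exists>!\<gamma>'. \<gamma>' \<in> Cell E \<and> Dom E (Src E \<gamma>') = Dom E (Src E \<alpha>) \<and> Cod E (Src E \<gamma>') = Dom E (lift u z) \<and>
                P2 \<gamma>' = \<gamma> \<and> WhL E (lift u z) \<gamma>' = \<alpha>"
proof -
  interpret F: cloven_fibration E B P0 P1 lift by (rule cloven)
  let ?l = "lift u z" and ?x = "Dom E (Src E \<alpha>)"
  note l = F.lift_cartesian[OF z] F.cod_lift[OF z] F.lift_over[OF z]
  have lE: "?l \<in> Arr E" using l(1) by (simp add: cartesian_def)
  have du: "Dom B u = P0 (Dom E ?l)" using dom_map[OF lE] l(3) by simp
  have w: "WhL B u \<gamma> \<in> Cell B \<and> Src B (WhL B u \<gamma>) = Comp B u (Src B \<gamma>) \<and> Trg B (WhL B u \<gamma>) = Comp B u (Trg B \<gamma>)"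
    by (rule B.whl_cell[OF z(2) \<gamma>(1)]) (simp add: du \<gamma>(3))
  note \<alpha>dc = E.cell_dom[OF \<alpha>(1)] E.cell_cod[OF \<alpha>(1)] and \<gamma>dc = B.cell_dom[OF \<gamma>(1)] B.cell_cod[OF \<gamma>(1)]
  have G: "P1 (Src E \<alpha>) = Comp B u (Src B \<gamma>)" "P1 (Trg E \<alpha>) = Comp B u (Trg B \<gamma>)"
    using src_map[OF \<alpha>(1)] trg_map[OF \<alpha>(1)] e w by simp_all
  have uk: "\<exists>!k'. k' \<in> Arr E \<and> Dom E k' = ?x \<and> Cod E k' = Dom E ?l \<and> P1 k' = Src B \<gamma> \<and> Comp E ?l k' = Src E \<alpha>"
    by (rule cartesianD[OF l(1)]) (use \<alpha> \<gamma> G l E.src_arr B.src_arr in auto)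
  have ul: "\<exists>!k'. k' \<in> Arr E \<and> Dom E k' = Dom E (Trg E \<alpha>) \<and> Cod E k' = Dom E ?l \<and> P1 k' = Trg B \<gamma> \<and> Comp E ?l k' = Trg E \<alpha>"
    by (rule cartesianD[OF l(1)]) (use \<alpha> \<alpha>dc \<gamma> \<gamma>dc G l E.trg_arr B.trg_arr in auto)
  from uk obtain k where k: "k \<in> Arr E" "Dom E k = ?x" "Cod E k = Dom E ?l" "P1 k = Src B \<gamma>" "Comp E ?l k = Src E \<alpha>" by blast
  from ul obtain m where m: "m \<in> Arr E" "Dom E m = Dom E (Trg E \<alpha>)" "Cod E m = Dom E ?l" "P1 m = Trg B \<gamma>" "Comp E ?l m = Trg E \<alpha>" by blast
  have ex: "\<exists>\<gamma>'. \<gamma>' \<in> Cell E \<and> Dom E (Src E \<gamma>') = ?x \<and> Cod E (Src E \<gamma>') = Dom E ?l \<and> P2 \<gamma>' = \<gamma> \<and> WhL E ?l \<gamma>' = \<alpha>"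
  proof -
    obtain \<kappa> where \<kappa>: "\<kappa> \<in> Cell E" "Trg E \<kappa> = m" "P2 \<kappa> = \<gamma>" using cell_lift[OF m(1) \<gamma>(1)] m(4) by auto
    note \<kappa>dc = E.cell_dom[OF \<kappa>(1)] E.cell_cod[OF \<kappa>(1)]
    let ?n = "Src E \<kappa>"
    have n: "?n \<in> Arr E" "Dom E ?n = ?x" "Cod E ?n = Dom E ?l" "P1 ?n = Src B \<gamma>"
      using E.src_arr[OF \<kappa>(1)] \<kappa>dc \<kappa>(2) m \<alpha>dc src_map[OF \<kappa>(1)] \<kappa>(3) by auto
    have lk: "WhL E ?l \<kappa> \<in> Cell E \<and> Src E (WhL E ?l \<kappa>) = Comp E ?l ?n \<and> Trg E (WhL E ?l \<kappa>) = Comp E ?l (Trg E \<kappa>)"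
      by (rule E.whl_cell[OF lE \<kappa>(1)]) (simp add: n)
    obtain \<beta> where \<beta>: "E.inverse_cells (WhL E ?l \<kappa>) \<beta>" using invertible lk by blast
    then have b: "\<beta> \<in> Cell E" "Src E \<beta> = Trg E \<alpha>" "Trg E \<beta> = Comp E ?l ?n" using lk \<kappa>(2) m(5) by (auto simp: E.inverse_cells_def)
    \<comment> \<open>The discrepancy between \<alpha> and the whiskered lifting. Both lie over the
      same cell of the base, so it lies over an identity.\<close>
    let ?\<theta> = "VComp E \<beta> \<alpha>"
    note \<theta> = E.vcomp_cell[OF b(1) \<alpha>(1) b(2)]
    have P: "P2 (WhL E ?l \<kappa>) = P2 \<alpha>" using whl_map[OF lE \<kappa>(1)] n l(3) \<kappa>(3) e by simp
    have P\<theta>: "P2 ?\<theta> = VId B (Comp B u (P1 k))"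
      using vcomp_map[OF b(1) \<alpha>(1) b(2)] map_inverse[OF \<beta>] src_map[OF \<alpha>(1)] G k(4) unfolding P by (simp add: B.inverse_cells_def)
    have "\<exists>!\<theta>'. \<theta>' \<in> Cell E \<and> Src E \<theta>' = k \<and> Trg E \<theta>' = ?n \<and> P2 \<theta>' = VId B (P1 k) \<and> WhL E ?l \<theta>' = ?\<theta>"
      by (rule vertical[OF z k(1) n(1)]) (use k n \<theta> b P\<theta> in simp_all)
    then obtain \<theta>' where t: "\<theta>' \<in> Cell E" "Src E \<theta>' = k" "Trg E \<theta>' = ?n" "P2 \<theta>' = VId B (P1 k)" "WhL E ?l \<theta>' = ?\<theta>" by blast
    note c = E.vcomp_cell[OF \<kappa>(1) t(1) t(3)[symmetric]]
    have "P2 (VComp E \<kappa> \<theta>') = \<gamma>"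
      using vcomp_map[OF \<kappa>(1) t(1) t(3)[symmetric]] t(4) \<kappa>(3) k(4) B.vcomp_vid(2)[OF \<gamma>(1)] by simp
    moreover have "WhL E ?l (VComp E \<kappa> \<theta>') = \<alpha>"
      using E.whl_vcomp[OF lE \<kappa>(1) t(1) t(3)[symmetric]] k t E.inverse_cancel(2)[OF \<beta> \<alpha>(1)] lk \<kappa>(2) m(5) by simp
    ultimately show ?thesis using c t k by auto
  qed
  have uq: "\<gamma>1 = \<gamma>2" if
      1: "\<gamma>1 \<in> Cell E \<and> Dom E (Src E \<gamma>1) = ?x \<and> Cod E (Src E \<gamma>1) = Dom E ?l \<and> P2 \<gamma>1 = \<gamma> \<and> WhL E ?l \<gamma>1 = \<alpha>" and
      2: "\<gamma>2 \<in> Cell E \<and> Dom E (Src E \<gamma>2) = ?x \<and> Cod E (Src E \<gamma>2) = Dom E ?l \<and> P2 \<gamma>2 = \<gamma> \<and> WhL E ?l \<gamma>2 = \<alpha>" for \<gamma>1 \<gamma>2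
  proof -
    have st: "Src E \<gamma>' = k" "Trg E \<gamma>' = m" if g: "\<gamma>' \<in> Cell E \<and> Dom E (Src E \<gamma>') = ?x \<and> Cod E (Src E \<gamma>') = Dom E ?l \<and> P2 \<gamma>' = \<gamma> \<and> WhL E ?l \<gamma>' = \<alpha>" for \<gamma>'
    proof -
      have w: "WhL E ?l \<gamma>' \<in> Cell E \<and> Src E (WhL E ?l \<gamma>') = Comp E ?l (Src E \<gamma>') \<and> Trg E (WhL E ?l \<gamma>') = Comp E ?l (Trg E \<gamma>')"
        by (rule E.whl_cell[OF lE]) (use g in auto)
      show "Src E \<gamma>' = k" using uk k g w E.src_arr src_map by metis
      show "Trg E \<gamma>' = m" using ul m g w E.trg_arr trg_map E.cell_dom E.cell_cod \<alpha>(1) by metis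
    qed
    \<comment> \<open>One solution followed by the inverse of the other is an endocell of
      \<open>k\<close> over an identity whose whiskering is trivial; the uniqueness part of
      \<open>vertical\<close> makes it the identity.\<close>
    obtain \<beta> where \<beta>: "E.inverse_cells \<gamma>2 \<beta>" using invertible 2 by blast
    then have b: "\<beta> \<in> Cell E" "Src E \<beta> = m" "Trg E \<beta> = k" "VComp E \<beta> \<gamma>2 = VId E k" using st[OF 2] by (auto simp: E.inverse_cells_def)
    have b1: "Src E \<beta> = Trg E \<gamma>1" using b st[OF 1] by simp
    note c = E.vcomp_cell[OF b(1) conjunct1[OF 1] b1]
    have b2: "Src E \<beta> = Trg E \<gamma>2" using b st[OF 2] by simp
    note vk = E.vid_cell[OF k(1)]
    have P: "P2 (VComp E \<beta> \<gamma>1) = VId B (P1 k)"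
      using vcomp_map[OF b(1) conjunct1[OF 1] b1] vcomp_map[OF b(1) conjunct1[OF 2] b2] 1 2 b(4) vid_map[OF k(1)] by simp
    have W: "WhL E ?l (VComp E \<beta> \<gamma>1) = WhL E ?l (VId E k)"
      using E.whl_vcomp[OF lE b(1) conjunct1[OF 1] b1] E.whl_vcomp[OF lE b(1) conjunct1[OF 2] b2] 1 2 b(4) by simp
    have W': "WhL E ?l (VId E k) = VId E (Comp E ?l k)" by (rule E.whl_vid[OF lE k(1)]) (simp add: k)
    have lk: "Comp E ?l k \<in> Arr E" by (rule E.comp_arr[OF lE k(1)]) (simp add: k)
    note vlk = E.vid_cell[OF lk]
    have "\<exists>!\<theta>'. \<theta>' \<in> Cell E \<and> Src E \<theta>' = k \<and> Trg E \<theta>' = k \<and> P2 \<theta>' = VId B (P1 k) \<and> WhL E ?l \<theta>' = VId E (Comp E ?l k)"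
      by (rule vertical[OF z k(1) k(1)]) (use k vlk vid_map[OF lk] comp_map[OF lE k(1)] l(3) in simp_all)
    then have "VComp E \<beta> \<gamma>1 = VId E k" using c vk P W W' vid_map[OF k(1)] st[OF 1] b by metis
    then have "VComp E \<gamma>2 (VId E k) = VComp E \<gamma>2 (VComp E \<beta> \<gamma>1)" by simp
    then show ?thesis using E.vcomp_vid(2)[of \<gamma>2] E.inverse_cancel(2)[OF \<beta>, of \<gamma>1] 1 2 st[OF 1] st[OF 2] by simp
  qed
  show ?thesis using ex uq by blast
qed

text \<open>Comparison 1-cells \<open>u\<close> and \<open>v\<close> over an identity relate
  \<open>f\<close> and the chosen lift of its image in both directions. Whiskering with
  \<open>v\<close> turns a factor through the lift into one through \<open>f\<close>; uniqueness is
  pulled back along \<open>u\<close>, since \<open>v\<close> after \<open>u\<close> is an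
  identity.\<close>

lemma cartesian_cells:
  assumes f: "cartesian E B P0 P1 f" and \<alpha>: "\<alpha> \<in> Cell E" "Cod E (Src E \<alpha>) = Cod E f"
    and \<gamma>: "\<gamma> \<in> Cell B" "Dom B (Src B \<gamma>) = P0 (Dom E (Src E \<alpha>))" "Cod B (Src B \<gamma>) = P0 (Dom E f)"
    and e: "P2 \<alpha> = WhL B (P1 f) \<gamma>"
  shows "\<exists>!\<gamma>'. \<gamma>' \<in> Cell E \<and> Dom E (Src E \<gamma>') = Dom E (Src E \<alpha>) \<and> Cod E (Src E \<gamma>') = Dom E f \<and> P2 \<gamma>' = \<gamma> \<and> WhL E f \<gamma>' = \<alpha>"
proof -
  interpret F: cloven_fibration E B P0 P1 lift by (rule cloven)
  have fE: "f \<in> Arr E" using f by (simp add: cartesian_def)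
  define z where "z = Cod E f"
  have z: "z \<in> Obj E" "P1 f \<in> Arr B" "Cod B (P1 f) = P0 z" using fE by (simp_all add: z_def E.cod_obj arr_map cod_map)
  let ?l = "lift (P1 f) z"
  note l = F.lift_cartesian[OF z] F.cod_lift[OF z] F.lift_over[OF z]
  have lE: "?l \<in> Arr E" using l(1) by (simp add: cartesian_def)
  have d: "P0 (Dom E ?l) = P0 (Dom E f)" using dom_map[OF lE] dom_map[OF fE] l(3) by simp
  have o: "Dom E f \<in> Obj E" "Dom E ?l \<in> Obj E" using fE lE by (simp_all add: E.dom_obj)
  let ?i = "Ident B (P0 (Dom E f))"
  have i: "?i \<in> Arr B" "Dom B ?i = P0 (Dom E f)" "Cod B ?i = P0 (Dom E f)" "Comp B (P1 f) ?i = P1 f" "Comp B ?i ?i = ?i"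
    using obj_map[OF o(1)] B.comp_ident_right[OF z(2)] dom_map[OF fE] B.comp_ident_right[of ?i]
    by (simp_all add: B.ident_arr B.dom_ident B.cod_ident)
  have "\<exists>!k'. k' \<in> Arr E \<and> Dom E k' = Dom E f \<and> Cod E k' = Dom E ?l \<and> P1 k' = ?i \<and> Comp E ?l k' = f"
    by (rule cartesianD[OF l(1) fE i(1)]) (use l i d in \<open>simp_all add: z_def\<close>)
  then obtain u where u: "u \<in> Arr E" "Dom E u = Dom E f" "Cod E u = Dom E ?l" "P1 u = ?i" "Comp E ?l u = f" by blast
  have "\<exists>!k'. k' \<in> Arr E \<and> Dom E k' = Dom E ?l \<and> Cod E k' = Dom E f \<and> P1 k' = ?i \<and> Comp E f k' = ?l"
    by (rule cartesianD[OF f lE i(1)]) (use l i d in \<open>simp_all add: z_def\<close>)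
  then obtain v where v: "v \<in> Arr E" "Dom E v = Dom E ?l" "Cod E v = Dom E f" "P1 v = ?i" "Comp E f v = ?l" by blast
  have "\<exists>!k'. k' \<in> Arr E \<and> Dom E k' = Dom E f \<and> Cod E k' = Dom E f \<and> P1 k' = ?i \<and> Comp E f k' = f"
    by (rule cartesianD[OF f fE i(1)]) (use i in simp_all)
  moreover have "Comp E f (Comp E v u) = f" using E.comp_assoc[OF fE v(1) u(1)] u v by simp
  moreover have "Comp E v u \<in> Arr E" "Dom E (Comp E v u) = Dom E f" "Cod E (Comp E v u) = Dom E f" "P1 (Comp E v u) = ?i"
    using u v i by (simp_all add: E.comp_arr E.dom_comp E.cod_comp comp_map)
  moreover have "Ident E (Dom E f) \<in> Arr E" "Dom E (Ident E (Dom E f)) = Dom E f" "Cod E (Ident E (Dom E f)) = Dom E f"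
      "P1 (Ident E (Dom E f)) = ?i" "Comp E f (Ident E (Dom E f)) = f"
    using o fE by (simp_all add: E.ident_arr E.dom_ident E.cod_ident ident_map E.comp_ident_right)
  \<comment> \<open>Both arrows factor \<open>f\<close> through itself over the identity, so the
    cartesian property of \<open>f\<close> identifies them.\<close>
  ultimately have vu: "Comp E v u = Ident E (Dom E f)" by metis
  have A: "\<exists>!\<gamma>'. \<gamma>' \<in> Cell E \<and> Dom E (Src E \<gamma>') = Dom E (Src E \<alpha>) \<and> Cod E (Src E \<gamma>') = Dom E ?l \<and> P2 \<gamma>' = \<gamma> \<and> WhL E ?l \<gamma>' = \<alpha>"
    by (rule lift_cells[OF z \<alpha>(1)]) (use \<alpha> \<gamma> e d in \<open>simp_all add: z_def\<close>)
  have wi: "WhL B ?i \<gamma> = \<gamma>" using B.whl_ident[OF \<gamma>(1)] \<gamma>(3) by simp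
  from A obtain \<delta> where \<delta>: "\<delta> \<in> Cell E" "Dom E (Src E \<delta>) = Dom E (Src E \<alpha>)" "Cod E (Src E \<delta>) = Dom E ?l" "P2 \<delta> = \<gamma>" "WhL E ?l \<delta> = \<alpha>" by blast
  have w: "WhL E v \<delta> \<in> Cell E \<and> Src E (WhL E v \<delta>) = Comp E v (Src E \<delta>) \<and> Trg E (WhL E v \<delta>) = Comp E v (Trg E \<delta>)"
    by (rule E.whl_cell[OF v(1) \<delta>(1)]) (simp add: \<delta> v)
  have ex: "WhL E v \<delta> \<in> Cell E \<and> Dom E (Src E (WhL E v \<delta>)) = Dom E (Src E \<alpha>) \<and> Cod E (Src E (WhL E v \<delta>)) = Dom E f \<and>
      P2 (WhL E v \<delta>) = \<gamma> \<and> WhL E f (WhL E v \<delta>) = \<alpha>"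
    using w \<delta> v wi whl_map[OF v(1) \<delta>(1)] E.whl_comp[OF fE v(1) \<delta>(1)] E.dom_comp[OF v(1) E.src_arr[OF \<delta>(1)]] E.cod_comp[OF v(1) E.src_arr[OF \<delta>(1)]]
    by simp
  have uq: "\<gamma>' = WhL E v \<delta>" if g: "\<gamma>' \<in> Cell E \<and> Dom E (Src E \<gamma>') = Dom E (Src E \<alpha>) \<and> Cod E (Src E \<gamma>') = Dom E f \<and> P2 \<gamma>' = \<gamma> \<and> WhL E f \<gamma>' = \<alpha>" for \<gamma>'
  proof -
    have g': "\<gamma>' \<in> Cell E" "Cod E (Src E \<gamma>') = Dom E f" using g by auto
    have w: "WhL E u \<gamma>' \<in> Cell E \<and> Src E (WhL E u \<gamma>') = Comp E u (Src E \<gamma>') \<and> Trg E (WhL E u \<gamma>') = Comp E u (Trg E \<gamma>')"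
      by (rule E.whl_cell[OF u(1) g'(1)]) (simp add: g' u)
    have "WhL E u \<gamma>' \<in> Cell E \<and> Dom E (Src E (WhL E u \<gamma>')) = Dom E (Src E \<alpha>) \<and> Cod E (Src E (WhL E u \<gamma>')) = Dom E ?l \<and>
      P2 (WhL E u \<gamma>') = \<gamma> \<and> WhL E ?l (WhL E u \<gamma>') = \<alpha>"
      using w g u wi whl_map[OF u(1) g'(1)] E.whl_comp[OF lE u(1) g'(1)] E.dom_comp[OF u(1) E.src_arr[OF g'(1)]] E.cod_comp[OF u(1) E.src_arr[OF g'(1)]]
      by simp
    with A \<delta> have "WhL E u \<gamma>' = \<delta>" by blast
    then show ?thesis using E.whl_comp[OF v(1) u(1) g'(1)] u v g' vu E.whl_ident[OF g'(1)] by simp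
  qed
  show ?thesis using ex uq by blast
qed

lemma cloven_two_fibration: "cloven_two_fibration E B P0 P1 P2 lift lift2"
proof (intro cloven_two_fibration.intro cloven_two_fibration_axioms.intro cloven cartesian_cells hom_cloven)
  show "two_functor E B P0 P1 P2" ..
next
  fix f z \<alpha>
  assume f: "f \<in> Arr E" and z: "z \<in> Obj E" and "cartesian (hom_cat E (Cod E f) z) (hom_cat B (P0 (Cod E f)) (P0 z)) P1 P2 \<alpha>"
  then have \<alpha>: "\<alpha> \<in> Cell E" "Dom E (Src E \<alpha>) = Cod E f" "Cod E (Src E \<alpha>) = z" by (auto simp: cartesian_def hom_cat_def)
  have w: "WhR E \<alpha> f \<in> Cell E \<and> Src E (WhR E \<alpha> f) = Comp E (Src E \<alpha>) f \<and> Trg E (WhR E \<alpha> f) = Comp E (Trg E \<alpha>) f"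
    by (rule E.whr_cell[OF f \<alpha>(1,2)])
  show "cartesian (hom_cat E (Dom E f) z) (hom_cat B (P0 (Dom E f)) (P0 z)) P1 P2 (WhR E \<alpha> f)"
    by (rule cell_cartesian[OF E.dom_obj[OF f] z])
      (use w \<alpha> E.dom_comp[OF E.src_arr[OF \<alpha>(1)] f \<alpha>(2)] E.cod_comp[OF E.src_arr[OF \<alpha>(1)] f \<alpha>(2)] in \<open>simp add: hom_cat_def\<close>)
qed assumption+

end

section \<open>Paths in an extended context\<close>

text \<open>The transport of \<open>b : B(g)\<close> to \<open>B(f)\<close> along \<open>p : Id\<^sub>\<Delta>(f, g)\<close>.\<close>

definition tr :: "'c ctx \<Rightarrow> 'c expr \<Rightarrow> 'c expr list \<Rightarrow> 'c expr list \<Rightarrow> 'c expr list \<Rightarrow> 'c expr \<Rightarrow> 'c expr" where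
  "tr \<Delta> B f g p b = subst (ext (b # p) (ext g (ext f Var))) (transp \<Delta> B)"

lemma compose_Cons [simp]: "compose (g # map (shift 1) f) (b # k) = subst (ext (b # k) Var) g # compose f k"
  by (simp add: compose_eq comp_def)

lemma compose_weak [simp]: "compose (map (shift 1) f) (b # k) = compose f k"
  by (simp add: compose_eq comp_def)

lemmas compose_Suc_0 [simp] = compose_Cons[unfolded One_nat_def] compose_weak[unfolded One_nat_def]

lemma refl_at_Cons: "refl_at (B # \<Delta>) (b # f) = Refl (subst (ext f Var) B) b # refl_at \<Delta> f"
  by (simp add: compose_eq comp_def)

text \<open>Unwinds the indices of \<open>Id_ctx\<close> into the description by pairs: a path of
  the extended context consists of a path \<open>p\<close> of the base and a path from
  \<open>b\<close> to the transport of \<open>b'\<close> along \<open>p\<close>. The later arguments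
  in the fibres start from this form.\<close>

lemma elems_eq_Id_at_Cons:
  assumes "length \<Delta> = n" "length f = n" "length g = n"
  shows "elems_eq S K (Id_at (B # \<Delta>) (b # f) (b' # g)) (q # p) (q' # p') \<longleftrightarrow>
    elems_eq S K (Id_at \<Delta> f g) p p' \<and> K \<turnstile>\<^bsub>S\<^esub> EqTerm q q' (IdT (subst (ext f Var) B) b (tr \<Delta> B f g p b'))"
proof -
  let ?\<sigma> = "ext (b' # g) (ext (b # f) Var)"
  let ?a = "\<lambda>i. Var (if i < n then i + 1 else i + 2)"
  let ?h = "\<lambda>i. Var (if i = 0 then n else if i \<le> n then i - 1 else if i \<le> 2 * n then i else i + 1)"
  have a: "(\<lambda>i. subst ?\<sigma> (?a i)) = ext g (ext f Var)"
    using assms by (auto simp: ext_def fun_eq_iff nth_Cons')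
  have h: "(\<lambda>i. subst (ext p ?\<sigma>) (?h i)) = ext (b' # p) (ext g (ext f Var))" if "length p = n"
    using assms that by (auto simp: ext_def fun_eq_iff nth_Cons' simp del: length_0_conv length_greater_0_conv)
  have c: "(\<lambda>i. ext p ?\<sigma> (i + (2 * n + 2))) = ext f Var" "ext p ?\<sigma> (2 * n + 1) = b" if "length p = n"
    using assms that by (auto simp: ext_def fun_eq_iff nth_Cons')
  have I: "Id_at (B # \<Delta>) (b # f) (b' # g) =
      subst (lift_sub n ?\<sigma>) (IdT (shift (2 * n + 2) B) (Var (2 * n + 1)) (subst ?h (transp \<Delta> B))) # Id_at \<Delta> f g"
    using a by (simp add: Id_at_eq Id_ctx_Cons Let_def assms(1) del: subst_IdT)
  have "subst (ext p Var) (subst (lift_sub n ?\<sigma>) (IdT (shift (2 * n + 2) B) (Var (2 * n + 1)) (subst ?h (transp \<Delta> B)))) =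
      IdT (subst (ext f Var) B) b (tr \<Delta> B f g p b')" if l: "length p = n"
  proof -
    have "subst (ext p Var) (subst (lift_sub n ?\<sigma>) e) = subst (ext p ?\<sigma>) e" for e
      using l by simp
    moreover have "subst (ext p ?\<sigma>) (IdT (shift (2 * n + 2) B) (Var (2 * n + 1)) (subst ?h (transp \<Delta> B))) =
      IdT (subst (ext f Var) B) b (tr \<Delta> B f g p b')"
      using h[OF l] c[OF l] by (simp only: subst_IdT subst_shift subst_subst subst.simps tr_def)
    ultimately show ?thesis by metis
  qed
  moreover have "length p = n" if "elems_eq S K (Id_at \<Delta> f g) p p'" using elems_eq_length[OF that] assms(1) by simp
  ultimately show ?thesis unfolding I elems_eq_Cons by (auto simp del: subst_IdT subst_subst)
qed

section \<open>Transport and paths over reflexivities\<close>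

context identity_types
begin

text \<open>Variant of \<open>gen_sub_eq\<close> whose target is the generic context over the empty
  one, where the transport of a type over a closed context lives.\<close>

lemma closed_gen_sub_eq:
  assumes "ctxt S \<Delta>" "ctxt S K" "elems_eq S K \<Delta> f f'" "elems_eq S K \<Delta> g g'" "elems_eq S K (Id_at \<Delta> f g) p p'"
  shows "sub_eq S K (gen_ctx \<Delta> []) (ext p (ext g (ext f Var))) (ext p' (ext g' (ext f' Var)))"
  using sub_eq_ext[OF ends_sub_eq(2)[OF assms(1-4)], of "Id_ctx \<Delta>" p p'] assms(5) Id_ctx_ctxt[OF assms(1)] gen_closed[OF assms(1), of "[]"]
  by (simp add: Id_at_eq)

lemma closed_transp:
  assumes "\<Delta> \<turnstile>\<^bsub>S\<^esub> IsType B"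
  shows "subst (right_sub (length \<Delta>)) B # gen_ctx \<Delta> [] \<turnstile>\<^bsub>S\<^esub> EqTerm (transp \<Delta> B) (transp \<Delta> B) (shift (2 * length \<Delta> + 1) B)"
    "B # \<Delta> \<turnstile>\<^bsub>S\<^esub> EqTerm (subst (lift_sub 1 (diag_ctx \<Delta>)) (transp \<Delta> B)) (Var 0) (shift 1 B)"
proof -
  have c: "ctxt_eq S (\<Delta> @ []) (\<Delta> @ [])" using in_context[OF assms] by (simp add: ctxt_eq_refl)
  have B: "\<Delta> @ [] \<turnstile>\<^bsub>S\<^esub> EqType B B" using assms by (simp add: eq_type_refl)
  show "subst (right_sub (length \<Delta>)) B # gen_ctx \<Delta> [] \<turnstile>\<^bsub>S\<^esub> EqTerm (transp \<Delta> B) (transp \<Delta> B) (shift (2 * length \<Delta> + 1) B)"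
    "B # \<Delta> \<turnstile>\<^bsub>S\<^esub> EqTerm (subst (lift_sub 1 (diag_ctx \<Delta>)) (transp \<Delta> B)) (Var 0) (shift 1 B)"
    using transp_props[OF J_ctx_ok[OF c refl] B refl refl c] by simp_all
qed

lemma tr_cong:
  assumes B: "\<Delta> \<turnstile>\<^bsub>S\<^esub> IsType B" and K: "ctxt S K"
    and f: "elems_eq S K \<Delta> f f'" and g: "elems_eq S K \<Delta> g g'" and p: "elems_eq S K (Id_at \<Delta> f g) p p'"
    and b: "K \<turnstile>\<^bsub>S\<^esub> EqTerm b b' (subst (ext g Var) B)"
  shows "K \<turnstile>\<^bsub>S\<^esub> EqTerm (tr \<Delta> B f g p b) (tr \<Delta> B f' g' p' b') (subst (ext f Var) B)"
proof -
  define n where "n = length \<Delta>"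
  have c: "ctxt S \<Delta>" using in_context[OF B] .
  have l: "length f = n" "length g = n" "length p = n"
    using elems_eq_length[OF f] elems_eq_length[OF g] elems_eq_length[OF p] by (simp_all add: n_def)
  let ?\<rho> = "ext p (ext g (ext f Var))"
  note s = closed_gen_sub_eq[OF c K f g p]
  note T = closed_transp(1)[OF B, folded n_def]
  have "subst ?\<rho> (subst (right_sub n) B) = subst (ext g Var) B"
    unfolding subst_subst by (rule subst_cong_scoped[OF is_type_scoped[OF B]]) (use l in \<open>auto simp: right_sub_def ext_def n_def[symmetric]\<close>)
  then have "sub_eq S K (subst (right_sub n) B # gen_ctx \<Delta> []) (ext (b # p) (ext g (ext f Var))) (ext (b' # p') (ext g' (ext f' Var)))"
    using s b in_context[OF T] by simp
  from eq_term_subst[OF this T]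
  have "K \<turnstile>\<^bsub>S\<^esub> EqTerm (tr \<Delta> B f g p b) (tr \<Delta> B f' g' p' b') (subst (ext (b # p) (ext g (ext f Var))) (shift (2 * n + 1) B))"
    by (simp only: tr_def)
  moreover have "subst (ext (b # p) (ext g (ext f Var))) (shift (2 * n + 1) B) = subst (ext f Var) B"
  proof -
    have "(\<lambda>i. ext (b # p) (ext g (ext f Var)) (i + (2 * n + 1))) = ext f Var" using l by (auto simp: ext_def fun_eq_iff)
    then show ?thesis by (simp only: subst_shift)
  qed
  ultimately show ?thesis by simp
qed

lemma tr_refl:
  assumes B: "\<Delta> \<turnstile>\<^bsub>S\<^esub> IsType B" and K: "ctxt S K" and f: "elems_eq S K \<Delta> f f" and b: "K \<turnstile>\<^bsub>S\<^esub> EqTerm b b (subst (ext f Var) B)"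
  shows "K \<turnstile>\<^bsub>S\<^esub> EqTerm (tr \<Delta> B f f (refl_at \<Delta> f) b) b (subst (ext f Var) B)"
proof -
  have c: "ctxt S \<Delta>" using in_context[OF B] .
  have l: "length f = length \<Delta>" using elems_eq_length[OF f] by simp
  have s: "sub S K (B # \<Delta>) (ext (b # f) Var)" using elems_sub_closed[OF c K f] b B by simp
  have "(\<lambda>i. subst (ext (b # f) Var) (lift_sub 1 (diag_ctx \<Delta>) i)) = ext (b # refl_at \<Delta> f) (ext f (ext f Var))"
  proof
    fix i
    show "subst (ext (b # f) Var) (lift_sub 1 (diag_ctx \<Delta>) i) = ext (b # refl_at \<Delta> f) (ext f (ext f Var)) i"
      using l by (cases i) (simp_all add: lift_sub_def diag_ctx_def compose_eq)
  qed
  then show ?thesis using eq_term_subst[OF s closed_transp(2)[OF B]] by (simp add: tr_def)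
qed

text \<open>Over a reflexivity the transport disappears, though only definitionally. Conversion
  along that equation turns paths of the extended context with reflexive base into elements of a
  single identity type of the fibre.\<close>

lemma Id_at_refl:
  assumes B: "\<Delta> \<turnstile>\<^bsub>S\<^esub> IsType B" and K: "ctxt S K" and f: "elems_eq S K \<Delta> f f"
    and b: "K \<turnstile>\<^bsub>S\<^esub> EqTerm b b (subst (ext f Var) B)" and b': "K \<turnstile>\<^bsub>S\<^esub> EqTerm b' b' (subst (ext f Var) B)"
  shows "elems_eq S K (Id_at (B # \<Delta>) (b # f) (b' # f)) (q # refl_at \<Delta> f) (q' # refl_at \<Delta> f) \<longleftrightarrow>
    K \<turnstile>\<^bsub>S\<^esub> EqTerm q q' (IdT (subst (ext f Var) B) b b')"
proof -
  have c: "ctxt S \<Delta>" using in_context[OF B] .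
  have l: "length f = length \<Delta>" using elems_eq_length[OF f] by simp
  have "K \<turnstile>\<^bsub>S\<^esub> EqType (subst (ext f Var) B) (subst (ext f Var) B)"
    using b eq_term_presup has_type_presup eq_type_refl by blast
  from Id_cong[OF this b tr_refl[OF B K f b']]
  have e: "K \<turnstile>\<^bsub>S\<^esub> EqType (IdT (subst (ext f Var) B) b (tr \<Delta> B f f (refl_at \<Delta> f) b')) (IdT (subst (ext f Var) B) b b')" .
  show ?thesis
    unfolding elems_eq_Id_at_Cons[OF refl l l] using e refl_at_eq[OF ctxt_eq_refl[OF c] K f] eq_conversion eq_type_sym by blast
qed

end

context discrete_identity_types
begin

text \<open>Induction over the whole path of \<open>B # \<Delta>\<close>: on the diagonal both sides
  are the reflexivity of the base point. The lemma turns the compatibility condition on 2-cells of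
  types-in-context into an equation between base parts of paths.\<close>

lemma path_map_proj:
  assumes B: "\<Delta> \<turnstile>\<^bsub>S\<^esub> IsType B" and K: "ctxt S K"
    and f: "elems_eq S K (B # \<Delta>) (b # f) (b # f)" and g: "elems_eq S K (B # \<Delta>) (b' # g) (b' # g)"
    and p: "elems_eq S K (Id_at (B # \<Delta>) (b # f) (b' # g)) (q # p) (q # p)"
  shows "elems_eq S K (Id_at \<Delta> f g) (path_map (B # \<Delta>) \<Delta> (map (shift 1) (vars (length \<Delta>))) (b # f) (b' # g) (q # p)) p"
proof -
  define n where "n = length \<Delta>"
  have c: "ctxt S \<Delta>" "ctxt S (B # \<Delta>)" using in_context[OF B] B by simp_all
  have l: "length f = n" "length g = n" "length p = n"
    using elems_eq_length[OF f] elems_eq_length[OF g] elems_eq_length[OF p] by (simp_all add: n_def)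
  let ?\<pi> = "map (shift 1) (vars n) :: 'c expr list"
  have \<pi>: "elems_eq S (B # \<Delta>) \<Delta> ?\<pi> ?\<pi>"
    using elems_shift_closed[of \<Delta> "[B]" \<Delta> 1] c vars_typed[OF c(1)] by (simp add: n_def)
  have n1: "length (B # \<Delta>) = Suc n" by (simp add: n_def)
  note G = gen0[OF c(2) K n1]
  let ?X = "gX (Suc n) 0 :: 'c expr list" and ?Y = "gY (Suc n) 0 :: 'c expr list" and ?P = "gP (Suc n) 0 :: 'c expr list"
  \<comment> \<open>The generic blocks of \<open>B # \<Delta>\<close> are split at their heads, so
    that their base parts can be named and typed separately.\<close>
  obtain x xs where X: "?X = x # xs" "length xs = n" by (metis g_length(1) length_Suc_conv)
  obtain y ys where Y: "?Y = y # ys" "length ys = n" by (metis g_length(2) length_Suc_conv)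
  obtain z zs where P: "?P = z # zs" "length zs = n" by (metis g_length(3) length_Suc_conv)
  have co: "compose ?\<pi> (a # s) = s" if "length s = n" for a and s :: "'c expr list"
    using compose_weak[of "vars n" a s] that by simp
  note r1 = ctxt_eq_refl[OF c(1)] and r2 = ctxt_eq_refl[OF c(2)]
  have tX: "elems_eq S (gen_ctx (B # \<Delta>) K) \<Delta> xs xs" and tY: "elems_eq S (gen_ctx (B # \<Delta>) K) \<Delta> ys ys"
    and tz: "elems_eq S ((B # \<Delta>) @ K) \<Delta> zs zs" using G(2,3,6) unfolding X Y P by simp_all
  have tP: "elems_eq S (gen_ctx (B # \<Delta>) K) (Id_at \<Delta> xs ys) zs zs"
    using G(4) unfolding X Y P elems_eq_Id_at_Cons[OF n_def[symmetric] X(2) Y(2)] by simp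
  have dX: "map (subst (diag_ctx (B # \<Delta>))) xs = zs" using G(7) unfolding X P by simp
  have dY: "map (subst (diag_ctx (B # \<Delta>))) ys = zs" using G(8) unfolding Y P by simp
  have dP: "map (subst (diag_ctx (B # \<Delta>))) zs = refl_at \<Delta> zs" using G(9) unfolding P refl_at_Cons by simp
  have l': "length (q # p) = Suc n" "length (b' # g) = Suc n" "length (b # f) = Suc n" using l by simp_all
  let ?\<tau> = "ext (q # p) (ext (b' # g) (ext (b # f) Var))"
  have \<tau>X: "map (subst ?\<tau>) xs = f" using G(10)[OF l'] unfolding X by simp
  have \<tau>Y: "map (subst ?\<tau>) ys = g" using G(11)[OF l'] unfolding Y by simp
  have \<tau>P: "map (subst ?\<tau>) zs = p" using G(12)[OF l'] unfolding P by simp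
  have "elems_eq S K (Id_at \<Delta> f g) (path_map (B # \<Delta>) \<Delta> ?\<pi> (b # f) (b' # g) (q # p)) p"
  proof (rule contraction0[OF c(2) K f g p n1 c(1) tX tY _ tP dX dY _ dP \<tau>X \<tau>Y _ \<tau>P])
    show "elems_eq S (gen_ctx (B # \<Delta>) K) (Id_at \<Delta> xs ys) (path_map (B # \<Delta>) \<Delta> ?\<pi> ?X ?Y ?P) (path_map (B # \<Delta>) \<Delta> ?\<pi> ?X ?Y ?P)"
      using path_map_cong[OF r2 r1 \<pi> G(1-4)] by (simp only: X Y co)
    show "elems_eq S ((B # \<Delta>) @ K) (Id_at \<Delta> zs zs) (path_map (B # \<Delta>) \<Delta> ?\<pi> ?P ?P (refl_at (B # \<Delta>) ?P)) (refl_at \<Delta> zs)"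
      using path_map_refl[OF c(2,1) \<pi> G(5,6)] by (simp only: P co)
  qed (simp_all only: map_subst_path_map[OF c(2,1) \<pi>] G(7-12) l' n1 g_length)
  then show ?thesis by (simp only: n_def)
qed

text \<open>For a context of one type the generic context is literally that of the elimination rule,
  so that uniqueness of paths can be applied within a single fibre.\<close>

lemma gen_ctx_single: "gen_ctx [C] K = id_tele C @ K"
  by (simp add: gen_ctx_def id_tele_def Id_ctx_Cons Let_def transp_def transport_eq shift_tele_def shift_eq_subst)

lemma diag_ctx_single: "diag_ctx [C] = diag C"
  by (auto simp: diag_ctx_def diag_def inst_def ext_def fun_eq_iff nth_Cons' vars_def)

text \<open>The tails \<sigma> and \<tau> may be chosen freely because scoping keeps them out of
  reach; callers thus need not match them.\<close>

lemma subst_compose_type: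
  assumes "scoped (length f) B" "\<forall>a \<in> set f. scoped (length k) a"
  shows "subst (ext k \<sigma>) (subst (ext f Var) B) = subst (ext (compose f k) \<tau>) B"
  unfolding subst_subst
proof (rule subst_cong_scoped[OF assms(1)])
  fix i assume i: "i < length f"
  then have "subst (ext k \<sigma>) (f ! i) = subst (ext k Var) (f ! i)"
    using assms(2) by (intro subst_cong_scoped[of "length k"]) (auto simp: ext_def)
  then show "subst (ext k \<sigma>) (ext f Var i) = ext (compose f k) \<tau> i" using i by (simp add: ext_def compose_eq)
qed

text \<open>The induction runs over \<open>q\<close> alone, a path in the type B(f k) over
  \<open>K\<close>, and not over a path of the extended context: the base part has to remain
  reflexive. When \<open>q\<close> is reflexive as well, the computation rule for images of paths
  applies.\<close>

lemma path_map_vertical: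
  assumes f: "elems_eq S \<Gamma> \<Delta> f f" and \<Gamma>: "ctxt S \<Gamma>" and B: "\<Delta> \<turnstile>\<^bsub>S\<^esub> IsType B" and K: "ctxt S K"
    and k: "elems_eq S K \<Gamma> k k"
    and b: "K \<turnstile>\<^bsub>S\<^esub> EqTerm b b (subst (ext (compose f k) Var) B)" and b': "K \<turnstile>\<^bsub>S\<^esub> EqTerm b' b' (subst (ext (compose f k) Var) B)"
    and q: "K \<turnstile>\<^bsub>S\<^esub> EqTerm q q (IdT (subst (ext (compose f k) Var) B) b b')"
  shows "elems_eq S K (Id_at (B # \<Delta>) (b # compose f k) (b' # compose f k))
    (path_map (subst (ext f Var) B # \<Gamma>) (B # \<Delta>) (Var 0 # map (shift 1) f) (b # k) (b' # k) (q # refl_at \<Gamma> k)) (q # refl_at \<Delta> (compose f k))"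
proof -
  have \<Delta>: "ctxt S \<Delta>" using in_context[OF B] .
  have lf: "length f = length \<Delta>" and lk: "length k = length \<Gamma>" using elems_eq_length[OF f] elems_eq_length[OF k] by simp_all
  let ?A = "subst (ext f Var) B" and ?C = "subst (ext (compose f k) Var) B"
  let ?F = "Var 0 # map (shift 1) f"
  have sf: "\<forall>a \<in> set f. scoped (length \<Gamma>) a" using elems_eq_scoped[OF f] by blast
  have sB: "scoped (length \<Delta>) B" by (rule is_type_scoped[OF B])
  have AC: "subst (ext k' Var) ?A = subst (ext (compose f k') Var) B" if "length k' = length \<Gamma>" for k'
    by (rule subst_compose_type) (use sB sf lf that in auto)
  have \<Gamma>s: "sub S \<Gamma> \<Delta> (ext f Var)" by (rule elems_sub_closed[OF \<Delta> \<Gamma> f])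
  have A: "\<Gamma> \<turnstile>\<^bsub>S\<^esub> IsType ?A" using subst_sub[OF \<Gamma>s B] by simp
  have cA: "ctxt S (?A # \<Gamma>)" and cB: "ctxt S (B # \<Delta>)" using A B \<Gamma> \<Delta> by simp_all
  note rA = ctxt_eq_refl[OF cA] and rB = ctxt_eq_refl[OF cB]
  have F: "elems_eq S (?A # \<Gamma>) (B # \<Delta>) ?F ?F"
  proof -
    have "elems_eq S (?A # \<Gamma>) \<Delta> (map (shift 1) f) (map (shift 1) f)"
      using elems_shift_closed[of \<Delta> "[?A]" \<Gamma> 1 f f] \<Delta> cA f by simp
    moreover have "?A # \<Gamma> \<turnstile>\<^bsub>S\<^esub> EqTerm (Var 0) (Var 0) (shift 1 ?A)" using var_at[of "[]" ?A \<Gamma> 0] cA by simp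
    moreover have "shift 1 ?A = subst (ext (map (shift 1) f) Var) B"
      unfolding shift_subst by (rule subst_cong_scoped[OF sB]) (use lf in \<open>auto simp: ext_def\<close>)
    ultimately show ?thesis by (simp add: elems_eq_Cons)
  qed
  have "K \<turnstile>\<^bsub>S\<^esub> IsType ?C" using b eq_term_presup has_type_presup by blast
  with K have cC: "ctxt S ([?C] @ K)" by simp
  let ?L = "id_tele ?C @ K"
  have cL: "ctxt S ?L" using gen_ctxt[OF cC] by (simp only: gen_ctx_single)
  let ?W = "map (shift 3) :: 'c expr list \<Rightarrow> _" and ?V = "map (shift 1) :: 'c expr list \<Rightarrow> _"
  have l3: "length (id_tele ?C) = 3" by (simp add: id_tele_def)
  have Wk: "elems_eq S ?L \<Gamma> (?W k) (?W k)" by (rule elems_shift_closed[OF \<Gamma> cL l3 k])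
  have Vk: "elems_eq S (?C # K) \<Gamma> (?V k) (?V k)" using elems_shift_closed[OF \<Gamma> cC _ k, of 1] by simp
  have lW: "length (?W k) = length \<Gamma>" "length (?V k) = length \<Gamma>" using lk by simp_all
  have sh: "shift j ?C = subst (ext (compose f (map (shift j) k)) Var) B" for j
  proof -
    have "shift j ?C = subst (\<lambda>i. shift j (ext (compose f k) Var i)) B" by simp
    also have "\<dots> = subst (ext (map (shift j) (compose f k)) Var) B"
      by (rule subst_cong_scoped[OF sB]) (use lf in \<open>auto simp: ext_def\<close>)
    also have "map (shift j) (compose f k) = compose f (map (shift j) k)"
      by (rule map_shift_compose) (use sf lk in auto)
    finally show ?thesis .
  qed
  have L: "?L = [IdT (shift 2 ?C) (Var 1) (Var 0), shift 1 ?C, ?C] @ K" by (simp add: id_tele_def)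
  have v2: "?L \<turnstile>\<^bsub>S\<^esub> EqTerm (Var 2) (Var 2) (shift 3 ?C)"
    using var_at[of "[IdT (shift 2 ?C) (Var 1) (Var 0), shift 1 ?C]" ?C K 2] cL unfolding L by (simp add: numeral_3_eq_3 numeral_2_eq_2)
  have v1: "?L \<turnstile>\<^bsub>S\<^esub> EqTerm (Var 1) (Var 1) (shift 3 ?C)"
    using var_at[of "[IdT (shift 2 ?C) (Var 1) (Var 0)]" "shift 1 ?C" "?C # K" 1] cL unfolding L by (simp add: numeral_3_eq_3 numeral_2_eq_2)
  have v0: "?L \<turnstile>\<^bsub>S\<^esub> EqTerm (Var 0) (Var 0) (IdT (shift 3 ?C) (Var 2) (Var 1))"
    using var_at[of "[]" "IdT (shift 2 ?C) (Var 1) (Var 0)" "shift 1 ?C # ?C # K" 0] cL unfolding L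
    by (simp add: shift_eq_subst numeral_3_eq_3 numeral_2_eq_2 comp_def)
  have fW: "elems_eq S ?L \<Delta> (compose f (?W k)) (compose f (?W k))" by (rule compose_typed[OF \<Gamma> \<Delta> cL f Wk])
  have fV: "elems_eq S (?C # K) \<Delta> (compose f (?V k)) (compose f (?V k))" by (rule compose_typed[OF \<Gamma> \<Delta> _ f Vk]) (use cC in simp)
  have fk: "elems_eq S K \<Delta> (compose f k) (compose f k)" by (rule compose_typed[OF \<Gamma> \<Delta> K f k])
  \<comment> \<open>The generic version over \<open>id_tele ?C\<close>, where \<open>Var 2\<close>,
    \<open>Var 1\<close> and \<open>Var 0\<close> are the two end points and the path; data from
    \<open>K\<close> are weakened past these three variables.\<close>
  let ?t = "path_map (?A # \<Gamma>) (B # \<Delta>) ?F (Var 2 # ?W k) (Var 1 # ?W k) (Var 0 # refl_at \<Gamma> (?W k))"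
  let ?t' = "Var 0 # refl_at \<Delta> (compose f (?W k))"
  let ?I = "Id_at (B # \<Delta>) (Var 2 # compose f (?W k)) (Var 1 # compose f (?W k))"
  have t': "elems_eq S ?L ?I ?t' ?t'"
    using v0 by (subst Id_at_refl[OF B cL fW]) (simp_all only: sh[of 3, symmetric] v1 v2)
  have w: "elems_eq S ?L (?A # \<Gamma>) (Var 2 # ?W k) (Var 2 # ?W k)" "elems_eq S ?L (?A # \<Gamma>) (Var 1 # ?W k) (Var 1 # ?W k)"
    using v1 v2 Wk by (auto simp: elems_eq_Cons AC[OF lW(1)] sh[of 3, symmetric] simp del: subst_subst shift_subst)
  have wp: "elems_eq S ?L (Id_at (?A # \<Gamma>) (Var 2 # ?W k) (Var 1 # ?W k)) (Var 0 # refl_at \<Gamma> (?W k)) (Var 0 # refl_at \<Gamma> (?W k))"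
    using v0 by (subst Id_at_refl[OF A cL Wk]) (simp_all only: AC[OF lW(1)] sh[of 3, symmetric] v1 v2)
  have t: "elems_eq S ?L ?I ?t ?t"
    using path_map_cong[OF rA rB F cL w wp] by (simp del: shift_subst)
  have Il: "length (Var 2 # compose f (?W k)) = length (B # \<Delta>)" "length (Var 1 # compose f (?W k)) = length (B # \<Delta>)" using lf by simp_all
  have dW: "map (subst (diag ?C)) (?W a) = ?V a" for a
  proof -
    have "(\<lambda>i. diag ?C (i + 3)) = (\<lambda>i. Var (i + 1))" by (auto simp: diag_def inst_def)
    then show ?thesis unfolding map_map comp_def subst_shift by (simp add: shift_eq_subst[abs_def])
  qed
  have dfW: "map (subst (diag ?C)) (compose f (?W k)) = compose f (?V k)"
    using map_subst_compose[OF f lW(1), of "diag ?C"] by (simp only: dW)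
  have d: "diag ?C 2 = Var 0" "diag ?C 1 = Var 0" "diag ?C 0 = Refl (shift 1 ?C) (Var 0)" by (simp_all add: diag_def inst_def)
  have I\<delta>: "subst_tele (diag ?C) ?I = Id_at (B # \<Delta>) (Var 0 # compose f (?V k)) (Var 0 # compose f (?V k))"
    by (subst Id_at_subst[OF cB Il]) (simp only: list.simps dfW subst.simps d)
  have V0: "elems_eq S (?C # K) (?A # \<Gamma>) (Var 0 # ?V k) (Var 0 # ?V k)"
  proof -
    have "?C # K \<turnstile>\<^bsub>S\<^esub> EqTerm (Var 0) (Var 0) (subst (ext (?V k) Var) ?A)"
      unfolding AC[OF lW(2)] sh[of 1, symmetric] using var_at[of "[]" ?C K 0] cC by (simp del: shift_subst)
    with Vk show ?thesis by (simp add: elems_eq_Cons del: subst_subst shift_subst subst_ext)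
  qed
  have r1: "refl_at (?A # \<Gamma>) (Var 0 # ?V k) = map (subst (diag ?C)) (Var 0 # refl_at \<Gamma> (?W k))"
    unfolding refl_at_Cons AC[OF lW(2)] sh[of 1, symmetric] using map_subst_refl_at[OF \<Gamma> lW(1), of "diag ?C"] by (simp only: list.simps dW subst.simps d)
  have r2: "refl_at (B # \<Delta>) (Var 0 # compose f (?V k)) = map (subst (diag ?C)) ?t'"
    unfolding refl_at_Cons sh[of 1, symmetric] using map_subst_refl_at[OF \<Delta>, of "compose f (?W k)" "diag ?C"] lf by (simp add: dfW d del: map_map)
  have td: "map (subst (diag ?C)) ?t = path_map (?A # \<Gamma>) (B # \<Delta>) ?F (Var 0 # ?V k) (Var 0 # ?V k) (refl_at (?A # \<Gamma>) (Var 0 # ?V k))"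
    unfolding r1 by (subst map_subst_path_map[OF cA cB F]) (simp_all add: lk dW d d(2)[unfolded One_nat_def] del: map_map)
  have cVK: "ctxt S (?C # K)" using cC by simp
  have D: "elems_eq S (?C # K) (subst_tele (diag ?C) ?I) (map (subst (diag ?C)) ?t) (map (subst (diag ?C)) ?t')"
    using path_map_refl[OF cA cB F cVK V0] unfolding I\<delta> td r2[symmetric] by simp
  have cI: "ctxt S (?I @ ?L)"
    by (rule Id_at_ctxt[OF cB cL]) (use fW v1 v2 in \<open>simp_all only: elems_eq.simps inst_eq_ext sh[of 3, symmetric] simp_thms\<close>)
  have E: "elems_eq S ?L ?I ?t ?t'"
    using eq_by_diag[of ?I "[]" "[?C]" K ?t ?t'] cI t t' D by (simp add: gen_ctx_single diag_ctx_single idt_tele_Id_at)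
  let ?\<tau> = "ext [q, b', b] Var"
  have s: "sub S K ?L ?\<tau>"
  proof -
    have "sub S K (id_tele ?C @ K) (ext [q, b', b] Var)"
    proof (rule sub_eq_ext[OF sub_Var[OF K] cL])
      show "elems_eq S K (subst_tele Var (id_tele ?C)) [q, b', b] [q, b', b]"
        using q b b' by (auto simp: id_tele_def elems_eq_Cons shift_eq_subst comp_def)
    qed
    then show ?thesis .
  qed
  have \<tau>W: "map (subst ?\<tau>) (?W a) = a" for a
  proof -
    have "(\<lambda>i. ?\<tau> (i + 3)) = Var" by (auto simp: ext_def)
    then show ?thesis unfolding map_map comp_def subst_shift by simp
  qed
  have \<tau>fW: "map (subst ?\<tau>) (compose f (?W k)) = compose f k"
    using map_subst_compose[OF f lW(1), of ?\<tau>] \<tau>W by simp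
  have \<tau>v: "?\<tau> 2 = b" "?\<tau> 1 = b'" "?\<tau> (Suc 0) = b'" "?\<tau> 0 = q" by (simp_all add: ext_def)
  have "elems_eq S K (subst_tele ?\<tau> ?I) (map (subst ?\<tau>) ?t) (map (subst ?\<tau>) ?t')" by (rule elems_eq_subst[OF s cI E])
  moreover have "subst_tele ?\<tau> ?I = Id_at (B # \<Delta>) (b # compose f k) (b' # compose f k)"
    using \<tau>fW by (subst Id_at_subst[OF cB Il]) (simp only: list.map subst.simps \<tau>v)
  moreover have "map (subst ?\<tau>) ?t = path_map (?A # \<Gamma>) (B # \<Delta>) ?F (b # k) (b' # k) (q # refl_at \<Gamma> k)"
    by (subst map_subst_path_map[OF cA cB F]) (simp_all only: list.map list.size length_map lk subst.simps \<tau>v \<tau>W map_subst_refl_at[OF \<Gamma> lW(1)] compose_length refl_ctx_length)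
  moreover have "map (subst ?\<tau>) ?t' = q # refl_at \<Delta> (compose f k)"
    using map_subst_refl_at[OF \<Delta>, of "compose f (?W k)" ?\<tau>] lf by (simp only: list.map subst.simps \<tau>v \<tau>fW compose_length)
  ultimately show ?thesis by simp
qed

end

section \<open>The 2-category of types-in-context\<close>

definition tob :: "'c type_theory \<Rightarrow> 'c ctx \<Rightarrow> 'c expr \<Rightarrow> 'c tobj set" where
  "tob S \<Gamma> A = tobj_rel S `` {(\<Gamma>, A)}"
definition tmor :: "'c type_theory \<Rightarrow> 'c ctx \<Rightarrow> 'c expr \<Rightarrow> 'c ctx \<Rightarrow> 'c expr \<Rightarrow> 'c expr list \<Rightarrow> 'c expr \<Rightarrow> 'c tmor set" where
  "tmor S \<Gamma> A \<Delta> B f g = tmor_rel S `` {((\<Gamma>, A), (\<Delta>, B), f, g)}"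

text \<open>A 1-cell is described through the context morphisms that it induces on bases and on
  extended contexts, so that facts about 1-cells reduce to facts about
  \<open>is_mor\<close>.\<close>

definition is_tmor :: "'c type_theory \<Rightarrow> 'c ctx \<Rightarrow> 'c expr \<Rightarrow> 'c ctx \<Rightarrow> 'c expr \<Rightarrow> 'c expr list \<Rightarrow> 'c expr \<Rightarrow> bool" where
  "is_tmor S \<Gamma> A \<Delta> B f g \<longleftrightarrow> is_mor S \<Gamma> \<Delta> f \<and> is_mor S (A # \<Gamma>) (B # \<Delta>) (g # map (shift 1) f)"

section \<open>Representatives of types-in-context and of their 1-cells\<close>

context discrete_identity_types
begin

lemma shift_subst_closed:
  assumes "\<Delta> \<turnstile>\<^bsub>S\<^esub> IsType B" "length f = length \<Delta>"
  shows "shift 1 (subst (ext f Var) B) = subst (ext (map (shift 1) f) Var) B"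
  unfolding shift_subst by (rule subst_cong_scoped[OF is_type_scoped[OF assms(1)]]) (use assms(2) in \<open>auto simp: ext_def\<close>)

lemma elems_shift1: "ctxt S \<Delta> \<Longrightarrow> ctxt S (A # \<Gamma>) \<Longrightarrow> elems_eq S \<Gamma> \<Delta> f f' \<Longrightarrow> elems_eq S (A # \<Gamma>) \<Delta> (map (shift 1) f) (map (shift 1) f')"
  using elems_shift_closed[of \<Delta> "[A]" \<Gamma> 1 f f'] by simp

lemma tobj_rel_iff: "((\<Gamma>, A), (\<Gamma>', A')) \<in> tobj_rel S \<longleftrightarrow> ctxt_eq S (A # \<Gamma>) (A' # \<Gamma>')"
  by (simp add: tobj_rel_def)

lemma tmor_relI:
  assumes "ctxt_eq S (A # \<Gamma>) (A' # \<Gamma>')" "ctxt_eq S (B # \<Delta>) (B' # \<Delta>')" "elems_eq S \<Gamma> \<Delta> f f'"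
    "A # \<Gamma> \<turnstile>\<^bsub>S\<^esub> EqTerm g g' (shift 1 (subst (ext f Var) B))"
  shows "(((\<Gamma>, A), (\<Delta>, B), f, g), ((\<Gamma>', A'), (\<Delta>', B'), f', g')) \<in> tmor_rel S"
  using assms by (simp add: tmor_rel_def tobj_rel_iff inst_eq_ext del: shift_subst)

text \<open>By this reduction to context morphisms, symmetry, transitivity and compatibility with
  composition are inherited instead of being proved again.\<close>

lemma tmor_rel_iff:
  "(((\<Gamma>, A), (\<Delta>, B), f, g), ((\<Gamma>', A'), (\<Delta>', B'), f', g')) \<in> tmor_rel S \<longleftrightarrow>
    ((\<Gamma>, \<Delta>, f), (\<Gamma>', \<Delta>', f')) \<in> mor_rel S \<and>
    ((A # \<Gamma>, B # \<Delta>, g # map (shift 1) f), (A' # \<Gamma>', B' # \<Delta>', g' # map (shift 1) f')) \<in> mor_rel S"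
    (is "?l \<longleftrightarrow> ?r")
proof
  assume ?l
  then have a: "ctxt_eq S (A # \<Gamma>) (A' # \<Gamma>')" "ctxt_eq S (B # \<Delta>) (B' # \<Delta>')" "elems_eq S \<Gamma> \<Delta> f f'"
    "A # \<Gamma> \<turnstile>\<^bsub>S\<^esub> EqTerm g g' (shift 1 (subst (ext f Var) B))"
    by (simp_all add: tmor_rel_def tobj_rel_iff inst_eq_ext del: shift_subst)
  have c: "ctxt S (A # \<Gamma>)" "ctxt S (B # \<Delta>)" using a(1,2) ctxt_eq_ctxt1 by blast+
  have "elems_eq S (A # \<Gamma>) \<Delta> (map (shift 1) f) (map (shift 1) f')" by (rule elems_shift1) (use c a in auto)
  moreover have "shift 1 (subst (ext f Var) B) = subst (ext (map (shift 1) f) Var) B"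
    by (rule shift_subst_closed) (use c elems_eq_length[OF a(3)] in auto)
  ultimately show ?r using a by (simp add: mor_rel_iff elems_eq_Cons del: subst_subst shift_subst)
next
  assume r: ?r
  then have a: "ctxt_eq S (A # \<Gamma>) (A' # \<Gamma>')" "ctxt_eq S (B # \<Delta>) (B' # \<Delta>')" "elems_eq S \<Gamma> \<Delta> f f'"
    "A # \<Gamma> \<turnstile>\<^bsub>S\<^esub> EqTerm g g' (subst (ext (map (shift 1) f) Var) B)"
    by (auto simp add: mor_rel_iff elems_eq_Cons simp del: subst_subst shift_subst)
  have c: "ctxt S (B # \<Delta>)" using a(2) ctxt_eq_ctxt1 by blast
  have "shift 1 (subst (ext f Var) B) = subst (ext (map (shift 1) f) Var) B"
    by (rule shift_subst_closed) (use c elems_eq_length[OF a(3)] in auto)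
  then show ?l by (intro tmor_relI) (use a in \<open>simp_all del: subst_subst shift_subst\<close>)
qed

lemma is_tmor_rel: "is_tmor S \<Gamma> A \<Delta> B f g \<longleftrightarrow> (((\<Gamma>, A), (\<Delta>, B), f, g), ((\<Gamma>, A), (\<Delta>, B), f, g)) \<in> tmor_rel S"
  unfolding tmor_rel_iff is_tmor_def using is_mor_rel mor_relD(1) by blast

lemma ctxt_eq_same: "ctxt_eq S \<Gamma> \<Gamma> \<longleftrightarrow> ctxt S \<Gamma>"
  using ctxt_eq_refl ctxt_eq_ctxt1 by blast

lemma tmors_iff: "((\<Gamma>, A), (\<Delta>, B), f, g) \<in> tmors S \<longleftrightarrow> is_tmor S \<Gamma> A \<Delta> B f g"
proof -
  have "((\<Gamma>, A), (\<Delta>, B), f, g) \<in> tmors S \<longleftrightarrow> (((\<Gamma>, A), (\<Delta>, B), f, g), ((\<Gamma>, A), (\<Delta>, B), f, g)) \<in> tmor_rel S"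
    unfolding tmors_def tmor_rel_def tobjs_def
    by (simp add: tobj_rel_iff ctxt_eq_same elems_eq_refl_iff has_type_eq del: shift_subst ctxt_eq.simps)
  then show ?thesis by (simp add: is_tmor_rel)
qed

lemma tmor_relD:
  assumes "(((\<Gamma>, A), (\<Delta>, B), f, g), ((\<Gamma>', A'), (\<Delta>', B'), f', g')) \<in> tmor_rel S"
  shows "is_tmor S \<Gamma> A \<Delta> B f g" "is_tmor S \<Gamma>' A' \<Delta>' B' f' g'"
    "ctxt_eq S (A # \<Gamma>) (A' # \<Gamma>')" "ctxt_eq S (B # \<Delta>) (B' # \<Delta>')"
proof -
  note r = assms[unfolded tmor_rel_iff]
  note m = mor_relD[OF r[THEN conjunct1]] and e = mor_relD[OF r[THEN conjunct2]]
  show "is_tmor S \<Gamma> A \<Delta> B f g" "is_tmor S \<Gamma>' A' \<Delta>' B' f' g'"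
    unfolding is_tmor_def by (intro conjI m(1) e(1) m(2) e(2))+
  show "ctxt_eq S (A # \<Gamma>) (A' # \<Gamma>')" "ctxt_eq S (B # \<Delta>) (B' # \<Delta>')" by (fact e(3) e(4))+
qed

lemma tmor_cases: obtains \<Gamma> A \<Delta> B f g where "x = ((\<Gamma>, A), (\<Delta>, B), f, g)"
  by (metis surj_pair)

lemma equiv_tmor: "equiv (tmors S) (tmor_rel S)"
proof (rule equivI)
  show "tmor_rel S \<subseteq> tmors S \<times> tmors S"
  proof
    fix z assume z: "z \<in> tmor_rel S"
    obtain x y where xy: "z = (x, y)" by (cases z)
    obtain \<Gamma> A \<Delta> B f g where x: "x = ((\<Gamma>, A), (\<Delta>, B), f, g)" by (rule tmor_cases)
    obtain \<Gamma>' A' \<Delta>' B' f' g' where y: "y = ((\<Gamma>', A'), (\<Delta>', B'), f', g')" by (rule tmor_cases)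
    from z show "z \<in> tmors S \<times> tmors S" unfolding xy x y by (simp add: tmors_iff tmor_relD(1,2))
  qed
  show "refl_on (tmors S) (tmor_rel S)"
  proof (rule refl_onI)
    fix x assume x: "x \<in> tmors S"
    obtain \<Gamma> A \<Delta> B f g where "x = ((\<Gamma>, A), (\<Delta>, B), f, g)" by (rule tmor_cases)
    with x show "(x, x) \<in> tmor_rel S" by (simp add: tmors_iff is_tmor_rel)
  qed
  show "sym (tmor_rel S)"
  proof (rule symI)
    fix x y assume *: "(x, y) \<in> tmor_rel S"
    obtain \<Gamma> A \<Delta> B f g where x: "x = ((\<Gamma>, A), (\<Delta>, B), f, g)" by (rule tmor_cases)
    obtain \<Gamma>' A' \<Delta>' B' f' g' where y: "y = ((\<Gamma>', A'), (\<Delta>', B'), f', g')" by (rule tmor_cases)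
    from * show "(y, x) \<in> tmor_rel S" unfolding x y tmor_rel_iff using mor_rel_sym by blast
  qed
  show "trans (tmor_rel S)"
  proof (rule transI)
    fix x y z assume *: "(x, y) \<in> tmor_rel S" "(y, z) \<in> tmor_rel S"
    obtain \<Gamma> A \<Delta> B f g where x: "x = ((\<Gamma>, A), (\<Delta>, B), f, g)" by (rule tmor_cases)
    obtain \<Gamma>' A' \<Delta>' B' f' g' where y: "y = ((\<Gamma>', A'), (\<Delta>', B'), f', g')" by (rule tmor_cases)
    obtain \<Gamma>'' A'' \<Delta>'' B'' f'' g'' where z: "z = ((\<Gamma>'', A''), (\<Delta>'', B''), f'', g'')" by (rule tmor_cases)
    from * show "(x, z) \<in> tmor_rel S" unfolding x y z tmor_rel_iff using mor_rel_trans by blast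
  qed
qed

lemma equiv_tob: "equiv (tobjs S) (tobj_rel S)"
proof -
  have 1: "tobjs S = {X. ctxt S (snd X # fst X)}" by (auto simp: tobjs_def)
  have 2: "tobj_rel S = {(X, Y). ctxt_eq S (snd X # fst X) (snd Y # fst Y)}" by (auto simp: tobj_rel_def)
  show ?thesis
  proof (rule equivI)
    show "tobj_rel S \<subseteq> tobjs S \<times> tobjs S" unfolding 1 2 using ctxt_eq_ctxt1 ctxt_eq_ctxt2 by blast
    show "refl_on (tobjs S) (tobj_rel S)" unfolding 1 2 refl_on_def using ctxt_eq_same by blast
    show "sym (tobj_rel S)" unfolding 2 sym_def using ctxt_eq_sym by blast
    show "trans (tobj_rel S)" unfolding 2 trans_def using ctxt_eq_trans by blast
  qed
qed

lemma tob_eq_iff: "ctxt S (A # \<Gamma>) \<Longrightarrow> ctxt S (A' # \<Gamma>') \<Longrightarrow> tob S \<Gamma> A = tob S \<Gamma>' A' \<longleftrightarrow> ctxt_eq S (A # \<Gamma>) (A' # \<Gamma>')"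
  unfolding tob_def by (subst eq_equiv_class_iff[OF equiv_tob]) (simp_all add: tobj_rel_iff tobjs_def)

lemma tob_eqI: "ctxt_eq S (A # \<Gamma>) (A' # \<Gamma>') \<Longrightarrow> tob S \<Gamma> A = tob S \<Gamma>' A'"
  using tob_eq_iff ctxt_eq_ctxt1 ctxt_eq_ctxt2 by blast

lemma tmor_eqI: "(((\<Gamma>, A), (\<Delta>, B), f, g), ((\<Gamma>', A'), (\<Delta>', B'), f', g')) \<in> tmor_rel S \<Longrightarrow> tmor S \<Gamma> A \<Delta> B f g = tmor S \<Gamma>' A' \<Delta>' B' f' g'"
  unfolding tmor_def by (rule equiv_class_eq[OF equiv_tmor])

lemma tmor_eq_iff:
  assumes "is_tmor S \<Gamma> A \<Delta> B f g" "is_tmor S \<Gamma>' A' \<Delta>' B' f' g'"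
  shows "tmor S \<Gamma> A \<Delta> B f g = tmor S \<Gamma>' A' \<Delta>' B' f' g' \<longleftrightarrow>
    mor S \<Gamma> \<Delta> f = mor S \<Gamma>' \<Delta>' f' \<and> mor S (A # \<Gamma>) (B # \<Delta>) (g # map (shift 1) f) = mor S (A' # \<Gamma>') (B' # \<Delta>') (g' # map (shift 1) f')"
  unfolding tmor_def using assms
  by (subst eq_equiv_class_iff[OF equiv_tmor]) (simp_all add: tmors_iff tmor_rel_iff is_tmor_def mor_eq_iff)

lemma mem_tob: "(\<Gamma>', A') \<in> tob S \<Gamma> A \<longleftrightarrow> ctxt_eq S (A # \<Gamma>) (A' # \<Gamma>')"
  by (simp add: tob_def tobj_rel_def)

lemma Obj_Typ: "X \<in> Obj (Typ S) \<longleftrightarrow> (\<exists>\<Gamma> A. ctxt S (A # \<Gamma>) \<and> X = tob S \<Gamma> A)"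
  by (auto simp: Typ_def quotient_def tob_def tobjs_def)

lemma Arr_Typ: "F \<in> Arr (Typ S) \<longleftrightarrow> (\<exists>\<Gamma> A \<Delta> B f g. is_tmor S \<Gamma> A \<Delta> B f g \<and> F = tmor S \<Gamma> A \<Delta> B f g)"
proof -
  have "F \<in> Arr (Typ S) \<longleftrightarrow> (\<exists>x \<in> tmors S. F = tmor_rel S `` {x})" by (auto simp: Typ_def quotient_def)
  also have "\<dots> \<longleftrightarrow> (\<exists>\<Gamma> A \<Delta> B f g. is_tmor S \<Gamma> A \<Delta> B f g \<and> F = tmor S \<Gamma> A \<Delta> B f g)"
    unfolding tmor_def tmors_iff[symmetric] by (metis surj_pair)
  finally show ?thesis .
qed

lemma is_tmorD: "is_tmor S \<Gamma> A \<Delta> B f g \<Longrightarrow> is_mor S \<Gamma> \<Delta> f \<and> is_mor S (A # \<Gamma>) (B # \<Delta>) (g # map (shift 1) f) \<and>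
    ctxt S (A # \<Gamma>) \<and> ctxt S (B # \<Delta>) \<and> length f = length \<Delta>"
  unfolding is_tmor_def using is_morD by blast

lemma tmor_UN:
  assumes "is_tmor S \<Gamma> A \<Delta> B f g"
    "\<And>\<Gamma>' A' \<Delta>' B' f' g'. (((\<Gamma>, A), (\<Delta>, B), f, g), ((\<Gamma>', A'), (\<Delta>', B'), f', g')) \<in> tmor_rel S \<Longrightarrow> F ((\<Gamma>', A'), (\<Delta>', B'), f', g') = c"
  shows "(\<Union>x \<in> tmor S \<Gamma> A \<Delta> B f g. F x) = c"
proof (rule UN_const)
  show "((\<Gamma>, A), (\<Delta>, B), f, g) \<in> tmor S \<Gamma> A \<Delta> B f g" using assms(1) by (simp add: tmor_def is_tmor_rel)
  fix x assume x: "x \<in> tmor S \<Gamma> A \<Delta> B f g"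
  obtain \<Gamma>' A' \<Delta>' B' f' g' where "x = ((\<Gamma>', A'), (\<Delta>', B'), f', g')" by (rule tmor_cases)
  with x show "F x = c" using assms(2) by (simp add: tmor_def)
qed

lemma tob_UN:
  assumes "ctxt S (A # \<Gamma>)" "\<And>\<Gamma>' A'. ctxt_eq S (A # \<Gamma>) (A' # \<Gamma>') \<Longrightarrow> F (\<Gamma>', A') = c"
  shows "(\<Union>x \<in> tob S \<Gamma> A. F x) = c"
proof (rule UN_const)
  show "(\<Gamma>, A) \<in> tob S \<Gamma> A" unfolding mem_tob by (rule ctxt_eq_refl[OF assms(1)])
  fix x assume "x \<in> tob S \<Gamma> A" then show "F x = c" using assms(2) by (cases x) (simp only: mem_tob)
qed

lemma Dom_Typ: "is_tmor S \<Gamma> A \<Delta> B f g \<Longrightarrow> tdom S (tmor S \<Gamma> A \<Delta> B f g) = tob S \<Gamma> A"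
  and Cod_Typ: "is_tmor S \<Gamma> A \<Delta> B f g \<Longrightarrow> tcod S (tmor S \<Gamma> A \<Delta> B f g) = tob S \<Delta> B"
  and base_mor_tmor: "is_tmor S \<Gamma> A \<Delta> B f g \<Longrightarrow> base_mor S (tmor S \<Gamma> A \<Delta> B f g) = mor S \<Gamma> \<Delta> f"
  and ext_mor_tmor: "is_tmor S \<Gamma> A \<Delta> B f g \<Longrightarrow> ext_mor S (tmor S \<Gamma> A \<Delta> B f g) = mor S (A # \<Gamma>) (B # \<Delta>) (g # map (shift 1) f)"
proof -
  assume *: "is_tmor S \<Gamma> A \<Delta> B f g"
  show "tdom S (tmor S \<Gamma> A \<Delta> B f g) = tob S \<Gamma> A" unfolding tdom_def
    by (rule tmor_UN[OF *], drule tmor_relD(3), drule tob_eqI, simp add: tob_def)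
  show "tcod S (tmor S \<Gamma> A \<Delta> B f g) = tob S \<Delta> B" unfolding tcod_def
    by (rule tmor_UN[OF *], drule tmor_relD(4), drule tob_eqI, simp add: tob_def)
  show "base_mor S (tmor S \<Gamma> A \<Delta> B f g) = mor S \<Gamma> \<Delta> f" unfolding base_mor_def
    by (rule tmor_UN[OF *], drule tmor_rel_iff[THEN iffD1, THEN conjunct1], drule mor_eqI, simp add: mor_def)
  show "ext_mor S (tmor S \<Gamma> A \<Delta> B f g) = mor S (A # \<Gamma>) (B # \<Delta>) (g # map (shift 1) f)" unfolding ext_mor_def
    by (rule tmor_UN[OF *], drule tmor_rel_iff[THEN iffD1, THEN conjunct2], drule mor_eqI, simp add: mor_def)
qed

lemma is_mor_proj: "ctxt S (A # \<Gamma>) \<Longrightarrow> is_mor S (A # \<Gamma>) \<Gamma> (map (shift 1) (vars (length \<Gamma>)))"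
  using elems_shift1[of \<Gamma> A \<Gamma> "vars (length \<Gamma>)" "vars (length \<Gamma>)"] vars_typed[of \<Gamma>] by (simp add: is_mor_def)

lemma base_obj_tob: "ctxt S (A # \<Gamma>) \<Longrightarrow> base_obj S (tob S \<Gamma> A) = ob S \<Gamma>"
  and proj_tob: "ctxt S (A # \<Gamma>) \<Longrightarrow> proj S (tob S \<Gamma> A) = mor S (A # \<Gamma>) \<Gamma> (map (shift 1) (vars (length \<Gamma>)))"
proof -
  assume *: "ctxt S (A # \<Gamma>)"
  show "base_obj S (tob S \<Gamma> A) = ob S \<Gamma>" unfolding base_obj_def
    by (rule tob_UN[OF *]) (auto simp: ob_def[symmetric] dest: ob_eqI)
  show "proj S (tob S \<Gamma> A) = mor S (A # \<Gamma>) \<Gamma> (map (shift 1) (vars (length \<Gamma>)))" unfolding proj_def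
  proof (rule tob_UN[OF *])
    fix \<Gamma>' A' assume e: "ctxt_eq S (A # \<Gamma>) (A' # \<Gamma>')"
    then have "ctxt_eq S \<Gamma> \<Gamma>'" by simp
    from mor_change(2)[OF is_mor_proj[OF *] e this] ctxt_eq_lengthD[OF this]
    show "(case (\<Gamma>', A') of (\<Gamma>, A) \<Rightarrow> mor_rel S `` {(A # \<Gamma>, \<Gamma>, map (shift 1) (vars (length \<Gamma>)))}) = mor S (A # \<Gamma>) \<Gamma> (map (shift 1) (vars (length \<Gamma>)))"
      by (simp add: mor_def)
  qed
qed

lemma vars_ext: "vars (Suc n) = Var 0 # map (shift 1) (vars n)"
  by (simp add: vars_def upt_conv_Cons map_Suc_upt[symmetric] comp_def shift_eq_subst del: upt_Suc)

lemma is_tmor_ident: "ctxt S (A # \<Gamma>) \<Longrightarrow> is_tmor S \<Gamma> A \<Gamma> A (vars (length \<Gamma>)) (Var 0)"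
  using is_mor_vars[of \<Gamma>] is_mor_vars[of "A # \<Gamma>"] by (simp add: is_tmor_def vars_ext)

lemma tident_tob: "ctxt S (A # \<Gamma>) \<Longrightarrow> tident S (tob S \<Gamma> A) = tmor S \<Gamma> A \<Gamma> A (vars (length \<Gamma>)) (Var 0)"
  unfolding tident_def
proof (erule tob_UN)
  fix \<Gamma>' A' assume e: "ctxt_eq S (A # \<Gamma>) (A' # \<Gamma>')"
  have c: "ctxt S (A # \<Gamma>)" by (rule ctxt_eq_ctxt1[OF e])
  have g: "ctxt_eq S \<Gamma> \<Gamma>'" using e by simp
  note i = is_tmor_ident[OF c, unfolded is_tmor_def]
  have "tmor S \<Gamma> A \<Gamma> A (vars (length \<Gamma>)) (Var 0) = tmor S \<Gamma>' A' \<Gamma>' A' (vars (length \<Gamma>')) (Var 0)"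
    using i e g ctxt_eq_lengthD[OF g] by (intro tmor_eqI) (simp add: tmor_rel_iff mor_rel_iff is_mor_def)
  then show "(case (\<Gamma>', A') of (\<Gamma>, A) \<Rightarrow> tmor_rel S `` {((\<Gamma>, A), (\<Gamma>, A), vars (length \<Gamma>), Var 0)}) = tmor S \<Gamma> A \<Gamma> A (vars (length \<Gamma>)) (Var 0)"
    by (simp add: tmor_def)
qed

text \<open>Passing from (f, g) to f.g commutes with composition already for raw terms, since the
  components of \<open>f'\<close> mention only base variables.\<close>

lemma ext_compose: "is_mor S \<Delta> \<Theta> f' \<Longrightarrow> length f = length \<Delta> \<Longrightarrow>
    subst (ext (g # map (shift 1) f) Var) g' # map (shift 1) (compose f' f) = compose (g' # map (shift 1) f') (g # map (shift 1) f)"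
  using elems_eq_scoped[of \<Delta> \<Theta> f' f'] map_shift_compose[of f' f 1] by (auto simp: is_mor_def)

lemma mor_rel_compose:
  assumes "((\<Delta>, \<Theta>, g), (\<Delta>', \<Theta>', g')) \<in> mor_rel S" "((\<Gamma>, \<Delta>, f), (\<Gamma>', \<Delta>'', f')) \<in> mor_rel S"
  shows "((\<Gamma>, \<Theta>, compose g f), (\<Gamma>', \<Theta>', compose g' f')) \<in> mor_rel S"
  using mor_relD[OF assms(1)] mor_relD[OF assms(2)] compose_typed[of \<Delta> \<Theta> \<Gamma> g g' f f'] by (simp add: mor_rel_iff is_mor_def)

lemma is_tmor_comp:
  assumes "is_tmor S \<Delta> B \<Theta> C f' g'" "is_tmor S \<Gamma> A \<Delta> B f g"
  shows "is_tmor S \<Gamma> A \<Theta> C (compose f' f) (subst (ext (g # map (shift 1) f) Var) g')"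
proof -
  note i = is_tmorD[OF assms(1)] is_tmorD[OF assms(2)]
  have m: "is_mor S \<Delta> \<Theta> f'" "length f = length \<Delta>" using i by blast+
  show ?thesis unfolding is_tmor_def ext_compose[OF m] using i is_mor_compose by blast
qed

lemma tcomp_tmor:
  assumes "is_tmor S \<Delta> B \<Theta> C f' g'" "is_tmor S \<Gamma> A \<Delta> B f g"
  shows "tcomp S (tmor S \<Delta> B \<Theta> C f' g') (tmor S \<Gamma> A \<Delta> B f g) = tmor S \<Gamma> A \<Theta> C (compose f' f) (subst (ext (g # map (shift 1) f) Var) g')"
  unfolding tcomp_def case_prod_unfold
proof (rule tmor_UN[OF assms(1)], rule tmor_UN[OF assms(2)], goal_cases)
  case (1 \<Delta>1 B1 \<Theta>1 C1 f1' g1' \<Gamma>1 A1 \<Delta>2 B2 f1 g1)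
  note r = tmor_relD[OF 1(1)] and r' = tmor_relD[OF 1(2)]
  have d: "ctxt_eq S \<Delta>1 \<Delta>2" using ctxt_eq_trans[OF ctxt_eq_sym[OF r(3)] r'(4)] by simp
  have l: "length f = length \<Delta>" "length f1 = length \<Delta>1" using is_tmorD[OF r'(1)] is_tmorD[OF r'(2)] ctxt_eq_lengthD[OF d] by simp_all
  have m: "is_mor S \<Delta> \<Theta> f'" "is_mor S \<Delta>1 \<Theta>1 f1'" using is_tmorD[OF r(1)] is_tmorD[OF r(2)] by blast+
  have "tmor S \<Gamma> A \<Theta> C (compose f' f) (subst (ext (g # map (shift 1) f) Var) g') = tmor S \<Gamma>1 A1 \<Theta>1 C1 (compose f1' f1) (subst (ext (g1 # map (shift 1) f1) Var) g1')"
    by (rule tmor_eqI, unfold tmor_rel_iff ext_compose[OF m(1) l(1)] ext_compose[OF m(2) l(2)])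
      (intro conjI mor_rel_compose; rule 1[unfolded tmor_rel_iff, THEN conjunct1] 1[unfolded tmor_rel_iff, THEN conjunct2])
  then show ?case by (simp add: tmor_def inst_eq_ext)
qed

text \<open>Independence of the representatives, which makes \<open>chosen_lift\<close> a single
  class.\<close>

lemma is_tmor_base_lift:
  assumes "((\<Gamma>, \<Delta>, f), (\<Gamma>', \<Delta>1, f')) \<in> mor_rel S" "ctxt_eq S (B # \<Delta>) (B' # \<Delta>')"
  shows "(((\<Gamma>, subst (ext f Var) B), (\<Delta>, B), f, Var 0), ((\<Gamma>', subst (ext f' Var) B'), (\<Delta>', B'), f', Var 0)) \<in> tmor_rel S"
proof -
  note r = mor_relD[OF assms(1)]
  have c: "ctxt S \<Gamma>" "ctxt S \<Delta>" using r(1) by (simp_all add: is_mor_def)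
  have "sub_eq S \<Gamma> \<Delta> (ext f Var) (ext f' Var)" by (rule elems_sub_closed[OF c(2,1) r(5)])
  from eq_type_subst[OF this] assms(2) have t: "\<Gamma> \<turnstile>\<^bsub>S\<^esub> EqType (subst (ext f Var) B) (subst (ext f' Var) B')" by simp
  from t have "\<Gamma> \<turnstile>\<^bsub>S\<^esub> IsType (subst (ext f Var) B)" using eq_type_presup by blast
  with c have "ctxt S (subst (ext f Var) B # \<Gamma>)" by simp
  with var_at[of "[]" "subst (ext f Var) B" \<Gamma> 0]
  have "subst (ext f Var) B # \<Gamma> \<turnstile>\<^bsub>S\<^esub> EqTerm (Var 0) (Var 0) (shift 1 (subst (ext f Var) B))" by (simp del: shift_subst)
  then show ?thesis by (intro tmor_relI assms(2) r(5)) (use r(3) t in simp_all)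
qed

lemma is_tmor_lift: "is_mor S \<Gamma> \<Delta> f \<Longrightarrow> ctxt S (B # \<Delta>) \<Longrightarrow> is_tmor S \<Gamma> (subst (ext f Var) B) \<Delta> B f (Var 0)"
  by (rule tmor_relD(1)[OF is_tmor_base_lift[OF is_mor_rel ctxt_eq_refl]])

lemma chosen_lift_mor:
  assumes "is_mor S \<Gamma> \<Delta> f" "ctxt S (B # \<Delta>)"
  shows "chosen_lift S (mor S \<Gamma> \<Delta> f) (tob S \<Delta> B) = tmor S \<Gamma> (subst (ext f Var) B) \<Delta> B f (Var 0)"
  unfolding chosen_lift_def
proof (rule UN_const)
  show "(\<Gamma>, \<Delta>, f) \<in> mor S \<Gamma> \<Delta> f" using is_mor_rel[OF assms(1)] by (simp add: mor_def)
  fix x assume *: "x \<in> mor S \<Gamma> \<Delta> f"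
  obtain \<Gamma>' \<Delta>1 f' where x: "x = (\<Gamma>', \<Delta>1, f')" by (rule prod_cases3)
  with * have r: "((\<Gamma>, \<Delta>, f), (\<Gamma>', \<Delta>1, f')) \<in> mor_rel S" by (simp add: mor_def)
  show "(case x of (\<Gamma>, \<Delta>', f) \<Rightarrow> \<Union>(\<Delta>, B) \<in> tob S \<Delta> B. tmor_rel S `` {((\<Gamma>, subst (inst 0 f) B), (\<Delta>, B), f, Var 0)}) =
      tmor S \<Gamma> (subst (ext f Var) B) \<Delta> B f (Var 0)"
    unfolding x prod.case
  proof (rule tob_UN[OF assms(2)])
    fix \<Delta>' B' assume "ctxt_eq S (B # \<Delta>) (B' # \<Delta>')"
    from tmor_eqI[OF is_tmor_base_lift[OF r this]]
    show "(case (\<Delta>', B') of (\<Delta>, B) \<Rightarrow> tmor_rel S `` {((\<Gamma>', subst (inst 0 f') B), (\<Delta>, B), f', Var 0)}) =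
        tmor S \<Gamma> (subst (ext f Var) B) \<Delta> B f (Var 0)" by (simp add: tmor_def inst_eq_ext)
  qed
qed

lemma tmor_change:
  assumes "is_tmor S \<Gamma> A \<Delta> B f g" "ctxt_eq S (A # \<Gamma>) (A' # \<Gamma>')" "ctxt_eq S (B # \<Delta>) (B' # \<Delta>')" "((\<Gamma>, \<Delta>, f), (\<Gamma>', \<Delta>', f')) \<in> mor_rel S"
  shows "is_tmor S \<Gamma>' A' \<Delta>' B' f' g" "tmor S \<Gamma> A \<Delta> B f g = tmor S \<Gamma>' A' \<Delta>' B' f' g"
proof -
  note i = is_tmorD[OF assms(1)]
  have e: "elems_eq S (A # \<Gamma>) \<Delta> (map (shift 1) f) (map (shift 1) f')"
    by (rule elems_shift1[OF _ _ mor_relD(5)[OF assms(4)]]) (use i in simp_all)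
  have "elems_eq S (A # \<Gamma>) (B # \<Delta>) (g # map (shift 1) f) (g # map (shift 1) f)" using i by (simp add: is_mor_def)
  with e have "elems_eq S (A # \<Gamma>) (B # \<Delta>) (g # map (shift 1) f) (g # map (shift 1) f')"
    by (simp add: elems_eq_Cons del: subst_subst shift_subst)
  then have r: "(((\<Gamma>, A), (\<Delta>, B), f, g), ((\<Gamma>', A'), (\<Delta>', B'), f', g)) \<in> tmor_rel S"
    using assms unfolding tmor_rel_iff by (simp add: mor_rel_iff)
  show "is_tmor S \<Gamma>' A' \<Delta>' B' f' g" by (rule tmor_relD(2)[OF r])
  show "tmor S \<Gamma> A \<Delta> B f g = tmor S \<Gamma>' A' \<Delta>' B' f' g" by (rule tmor_eqI[OF r])
qed

text \<open>The analogue of \<open>arr_dom_cod\<close>: a class of 1-cells is rebased to prescribed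
  raw contexts and types, as needed to evaluate composites.\<close>

lemma tarr_dom_cod:
  assumes "F \<in> Arr (Typ S)" "tdom S F = tob S \<Gamma> A" "tcod S F = tob S \<Delta> B" "ctxt S (A # \<Gamma>)" "ctxt S (B # \<Delta>)"
  shows "\<exists>f g. is_tmor S \<Gamma> A \<Delta> B f g \<and> F = tmor S \<Gamma> A \<Delta> B f g"
proof -
  from assms(1) obtain \<Gamma>0 A0 \<Delta>0 B0 f g where f: "is_tmor S \<Gamma>0 A0 \<Delta>0 B0 f g" "F = tmor S \<Gamma>0 A0 \<Delta>0 B0 f g" unfolding Arr_Typ by blast
  note i = is_tmorD[OF f(1)]
  have e: "ctxt_eq S (A0 # \<Gamma>0) (A # \<Gamma>)" "ctxt_eq S (B0 # \<Delta>0) (B # \<Delta>)"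
    using assms f i by (simp_all only: Dom_Typ Cod_Typ tob_eq_iff)
  have "((\<Gamma>0, \<Delta>0, f), (\<Gamma>, \<Delta>, f)) \<in> mor_rel S" using e i by (simp add: mor_rel_iff is_mor_def)
  from tmor_change[OF f(1) e this] f(2) show ?thesis by blast
qed

lemma tarr_dom_cod_base:
  assumes "F \<in> Arr (Typ S)" "tdom S F = tob S \<Gamma> A" "tcod S F = tob S \<Delta> B" "ctxt S (A # \<Gamma>)" "ctxt S (B # \<Delta>)"
    "base_mor S F = mor S \<Gamma> \<Delta> f" "is_mor S \<Gamma> \<Delta> f"
  shows "\<exists>g. is_tmor S \<Gamma> A \<Delta> B f g \<and> F = tmor S \<Gamma> A \<Delta> B f g"
proof -
  from tarr_dom_cod[OF assms(1-5)] obtain f' g where f: "is_tmor S \<Gamma> A \<Delta> B f' g" "F = tmor S \<Gamma> A \<Delta> B f' g" by blast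
  then have "((\<Gamma>, \<Delta>, f'), (\<Gamma>, \<Delta>, f)) \<in> mor_rel S" using assms(6,7) is_tmorD[OF f(1)] by (simp add: base_mor_tmor mor_eq_iff)
  from tmor_change[OF f(1) ctxt_eq_refl[OF assms(4)] ctxt_eq_refl[OF assms(5)] this] f(2) show ?thesis by blast
qed

section \<open>Types-in-context as squares in the 2-category of contexts\<close>

interpretation C: two_category "Ctx S" by (rule Ctx_two_category)

definition ext_obj :: "'c tobj set \<Rightarrow> 'c ctx set" where "ext_obj X = Dom (Ctx S) (proj S X)"

lemma Typ_simps: "Dom (Typ S) = tdom S" "Cod (Typ S) = tcod S" "Ident (Typ S) = tident S" "Comp (Typ S) = tcomp S"
  "Src (Typ S) (F, F', \<gamma>, \<alpha>) = F" "Trg (Typ S) (F, F', \<gamma>, \<alpha>) = F'"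
  "VId (Typ S) F = (F, F, VId (Ctx S) (ext_mor S F), VId (Ctx S) (base_mor S F))"
  "VComp (Typ S) (G, G', \<delta>, \<beta>) (F, F', \<gamma>, \<alpha>) = (F, G', VComp (Ctx S) \<delta> \<gamma>, VComp (Ctx S) \<beta> \<alpha>)"
  "WhL (Typ S) H (F, F', \<gamma>, \<alpha>) = (tcomp S H F, tcomp S H F', WhL (Ctx S) (ext_mor S H) \<gamma>, WhL (Ctx S) (base_mor S H) \<alpha>)"
  "WhR (Typ S) (F, F', \<gamma>, \<alpha>) K = (tcomp S F K, tcomp S F' K, WhR (Ctx S) \<gamma> (ext_mor S K), WhR (Ctx S) \<alpha> (base_mor S K))"
  by (simp_all add: Typ_def)

lemma Cell_Typ: "(F, F', \<gamma>, \<alpha>) \<in> Cell (Typ S) \<longleftrightarrow>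
     F \<in> Arr (Typ S) \<and> F' \<in> Arr (Typ S) \<and> tdom S F' = tdom S F \<and> tcod S F' = tcod S F \<and>
     \<gamma> \<in> Cell (Ctx S) \<and> Src (Ctx S) \<gamma> = ext_mor S F \<and> Trg (Ctx S) \<gamma> = ext_mor S F' \<and>
     \<alpha> \<in> Cell (Ctx S) \<and> Src (Ctx S) \<alpha> = base_mor S F \<and> Trg (Ctx S) \<alpha> = base_mor S F' \<and>
     WhL (Ctx S) (proj S (tcod S F)) \<gamma> = WhR (Ctx S) \<alpha> (proj S (tdom S F))"
  by (auto simp add: Typ_def tcells_def)

lemma ob_Typ:
  assumes "X \<in> Obj (Typ S)"
  shows "proj S X \<in> Arr (Ctx S)" "Dom (Ctx S) (proj S X) = ext_obj X" "Cod (Ctx S) (proj S X) = base_obj S X"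
    "ext_obj X \<in> Obj (Ctx S)" "base_obj S X \<in> Obj (Ctx S)"
    "tident S X \<in> Arr (Typ S)" "tdom S (tident S X) = X" "tcod S (tident S X) = X"
    "base_mor S (tident S X) = Ident (Ctx S) (base_obj S X)" "ext_mor S (tident S X) = Ident (Ctx S) (ext_obj X)"
proof -
  obtain \<Gamma> A where X: "ctxt S (A # \<Gamma>)" "X = tob S \<Gamma> A" using assms unfolding Obj_Typ by blast
  then have c: "ctxt S \<Gamma>" by simp
  note p = is_mor_proj[OF X(1)] and i = is_tmor_ident[OF X(1)]
  have e: "ext_obj X = ob S (A # \<Gamma>)" unfolding ext_obj_def X(2) proj_tob[OF X(1)] Dom_Ctx[OF p] ..
  show "proj S X \<in> Arr (Ctx S)" unfolding X(2) proj_tob[OF X(1)] by (rule Arr_CtxI[OF p])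
  show "Dom (Ctx S) (proj S X) = ext_obj X" by (simp add: ext_obj_def)
  show "Cod (Ctx S) (proj S X) = base_obj S X" unfolding X(2) proj_tob[OF X(1)] base_obj_tob[OF X(1)] by (rule Cod_Ctx[OF p])
  show "ext_obj X \<in> Obj (Ctx S)" unfolding e by (rule Obj_CtxI[OF X(1)])
  show "base_obj S X \<in> Obj (Ctx S)" unfolding X(2) base_obj_tob[OF X(1)] by (rule Obj_CtxI[OF c])
  show "tident S X \<in> Arr (Typ S)" unfolding X(2) tident_tob[OF X(1)] Arr_Typ using i by blast
  show "tdom S (tident S X) = X" "tcod S (tident S X) = X" unfolding X(2) tident_tob[OF X(1)] by (rule Dom_Typ[OF i] Cod_Typ[OF i])+
  show "base_mor S (tident S X) = Ident (Ctx S) (base_obj S X)"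
    unfolding X(2) tident_tob[OF X(1)] base_obj_tob[OF X(1)] base_mor_tmor[OF i] Ident_Ctx[OF c] ..
  show "ext_mor S (tident S X) = Ident (Ctx S) (ext_obj X)"
    unfolding e unfolding X(2) tident_tob[OF X(1)] ext_mor_tmor[OF i] Ident_Ctx[OF X(1)] by (simp add: vars_ext)
qed

text \<open>Together with \<open>ob_Typ\<close> and \<open>comp_Typ\<close> this presents a 1-cell
  as a commuting square between projections. In these terms the 2-category axioms can be checked
  componentwise in \<open>Ctx S\<close>, without returning to raw terms.\<close>

lemma arr_Typ:
  assumes "F \<in> Arr (Typ S)"
  shows "tdom S F \<in> Obj (Typ S)" "tcod S F \<in> Obj (Typ S)"
    "base_mor S F \<in> Arr (Ctx S)" "Dom (Ctx S) (base_mor S F) = base_obj S (tdom S F)" "Cod (Ctx S) (base_mor S F) = base_obj S (tcod S F)"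
    "ext_mor S F \<in> Arr (Ctx S)" "Dom (Ctx S) (ext_mor S F) = ext_obj (tdom S F)" "Cod (Ctx S) (ext_mor S F) = ext_obj (tcod S F)"
    "Comp (Ctx S) (proj S (tcod S F)) (ext_mor S F) = Comp (Ctx S) (base_mor S F) (proj S (tdom S F))"
proof -
  obtain \<Gamma> A \<Delta> B f g where F: "is_tmor S \<Gamma> A \<Delta> B f g" "F = tmor S \<Gamma> A \<Delta> B f g" using assms unfolding Arr_Typ by blast
  note i = is_tmorD[OF F(1)]
  then have m: "is_mor S \<Gamma> \<Delta> f" "is_mor S (A # \<Gamma>) (B # \<Delta>) (g # map (shift 1) f)" and c: "ctxt S (A # \<Gamma>)" "ctxt S (B # \<Delta>)" by blast+
  note d = Dom_Typ[OF F(1), folded F(2)] Cod_Typ[OF F(1), folded F(2)] base_mor_tmor[OF F(1), folded F(2)] ext_mor_tmor[OF F(1), folded F(2)]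
  note pA = is_mor_proj[OF c(1)] and pB = is_mor_proj[OF c(2)]
  note e = proj_tob[OF c(1)] proj_tob[OF c(2)] base_obj_tob[OF c(1)] base_obj_tob[OF c(2)]
  show "tdom S F \<in> Obj (Typ S)" "tcod S F \<in> Obj (Typ S)" unfolding d Obj_Typ using c by blast+
  show "base_mor S F \<in> Arr (Ctx S)" "ext_mor S F \<in> Arr (Ctx S)" unfolding d by (rule Arr_CtxI[OF m(1)] Arr_CtxI[OF m(2)])+
  show "Dom (Ctx S) (base_mor S F) = base_obj S (tdom S F)" "Cod (Ctx S) (base_mor S F) = base_obj S (tcod S F)"
    unfolding d e by (rule Dom_Ctx[OF m(1)] Cod_Ctx[OF m(1)])+
  show "Dom (Ctx S) (ext_mor S F) = ext_obj (tdom S F)" "Cod (Ctx S) (ext_mor S F) = ext_obj (tcod S F)"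
    unfolding ext_obj_def d e Dom_Ctx[OF pA] Dom_Ctx[OF pB] by (rule Dom_Ctx[OF m(2)] Cod_Ctx[OF m(2)])+
  have "length f = length \<Delta>" "\<forall>a \<in> set f. scoped (length \<Gamma>) a"
    using is_morD[OF m(1)] elems_eq_scoped[of \<Gamma> \<Delta> f f] by blast+
  then have "compose (map (shift 1) (vars (length \<Delta>))) (g # map (shift 1) f) = map (shift 1) (compose f (vars (length \<Gamma>)))"
    using compose_vars_right[OF m(1)] by (simp add: compose_vars)
  also have "\<dots> = compose f (map (shift 1) (vars (length \<Gamma>)))"
    by (rule map_shift_compose) (use is_morD[OF m(1)] elems_eq_scoped[of \<Gamma> \<Delta> f f] in \<open>auto simp: vars_def\<close>)
  finally show "Comp (Ctx S) (proj S (tcod S F)) (ext_mor S F) = Comp (Ctx S) (base_mor S F) (proj S (tdom S F))"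
    unfolding d e Comp_Ctx[OF pB m(2)] Comp_Ctx[OF m(1) pA] by simp
qed

lemma comp_Typ:
  assumes "G \<in> Arr (Typ S)" "F \<in> Arr (Typ S)" "tdom S G = tcod S F"
  shows "tcomp S G F \<in> Arr (Typ S)" "tdom S (tcomp S G F) = tdom S F" "tcod S (tcomp S G F) = tcod S G"
    "base_mor S (tcomp S G F) = Comp (Ctx S) (base_mor S G) (base_mor S F)" "ext_mor S (tcomp S G F) = Comp (Ctx S) (ext_mor S G) (ext_mor S F)"
proof -
  obtain \<Gamma> A \<Delta> B f g where F: "is_tmor S \<Gamma> A \<Delta> B f g" "F = tmor S \<Gamma> A \<Delta> B f g" using assms(2) unfolding Arr_Typ by blast
  note i = is_tmorD[OF F(1)]
  from assms(1) obtain \<Delta>0 B0 \<Theta>0 C0 h0 where "is_tmor S \<Delta>0 B0 \<Theta>0 C0 (fst h0) (snd h0)" "G = tmor S \<Delta>0 B0 \<Theta>0 C0 (fst h0) (snd h0)"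
    unfolding Arr_Typ by fastforce
  then have "tcod S G = tob S \<Theta>0 C0" "ctxt S (C0 # \<Theta>0)" using Cod_Typ is_tmorD by blast+
  moreover have "tdom S G = tob S \<Delta> B" unfolding assms(3) F(2) by (rule Cod_Typ[OF F(1)])
  ultimately obtain \<Theta> C f' g' where G: "is_tmor S \<Delta> B \<Theta> C f' g'" "G = tmor S \<Delta> B \<Theta> C f' g'"
    using tarr_dom_cod[OF assms(1)] i by blast
  note j = is_tmorD[OF G(1)]
  note c = is_tmor_comp[OF G(1) F(1)]
  note e = tcomp_tmor[OF G(1) F(1), folded G(2) F(2)]
  have m: "is_mor S \<Gamma> \<Delta> f" "is_mor S (A # \<Gamma>) (B # \<Delta>) (g # map (shift 1) f)" "length f = length \<Delta>" using i by blast+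
  have m': "is_mor S \<Delta> \<Theta> f'" "is_mor S (B # \<Delta>) (C # \<Theta>) (g' # map (shift 1) f')" using j by blast+
  show "tcomp S G F \<in> Arr (Typ S)" unfolding e Arr_Typ using c by blast
  show "tdom S (tcomp S G F) = tdom S F" "tcod S (tcomp S G F) = tcod S G"
    unfolding e unfolding Dom_Typ[OF c] Cod_Typ[OF c] F(2) G(2) Dom_Typ[OF F(1)] Cod_Typ[OF G(1)] by (rule refl)+
  show "base_mor S (tcomp S G F) = Comp (Ctx S) (base_mor S G) (base_mor S F)"
    unfolding e unfolding F(2) G(2) base_mor_tmor[OF c] base_mor_tmor[OF F(1)] base_mor_tmor[OF G(1)] Comp_Ctx[OF m'(1) m(1)] ..
  show "ext_mor S (tcomp S G F) = Comp (Ctx S) (ext_mor S G) (ext_mor S F)"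
    unfolding e unfolding F(2) G(2) ext_mor_tmor[OF c] ext_mor_tmor[OF F(1)] ext_mor_tmor[OF G(1)] Comp_Ctx[OF m'(2) m(2)]
    unfolding ext_compose[OF m'(1) m(3)] ..
qed

text \<open>A 1-cell is determined by the two parallel sides of its square, so equations between
  1-cells follow from equations in \<open>Ctx S\<close>.\<close>

lemma arr_Typ_eqI:
  assumes "F \<in> Arr (Typ S)" "G \<in> Arr (Typ S)" "base_mor S F = base_mor S G" "ext_mor S F = ext_mor S G"
  shows "F = G"
proof -
  obtain \<Gamma> A \<Delta> B f g where F: "is_tmor S \<Gamma> A \<Delta> B f g" "F = tmor S \<Gamma> A \<Delta> B f g" using assms(1) unfolding Arr_Typ by blast
  obtain \<Gamma>' A' \<Delta>' B' f' g' where G: "is_tmor S \<Gamma>' A' \<Delta>' B' f' g'" "G = tmor S \<Gamma>' A' \<Delta>' B' f' g'" using assms(2) unfolding Arr_Typ by blast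
  show ?thesis
    unfolding F(2) G(2) tmor_eq_iff[OF F(1) G(1)] using assms(3,4)
    unfolding F(2) G(2) base_mor_tmor[OF F(1)] base_mor_tmor[OF G(1)] ext_mor_tmor[OF F(1)] ext_mor_tmor[OF G(1)] by blast
qed

lemmas Typ_rules = ob_Typ arr_Typ comp_Typ

lemma Typ_category: "category (Typ S)"
proof (intro category.intro, goal_cases)
  case (1 f) then show ?case by (simp add: Typ_simps arr_Typ)
next
  case (2 f) then show ?case by (simp add: Typ_simps arr_Typ)
next
  case (3 x) then show ?case by (simp add: Typ_simps ob_Typ)
next
  case (4 x) then show ?case by (simp add: Typ_simps ob_Typ)
next
  case (5 x) then show ?case by (simp add: Typ_simps ob_Typ)
next
  case (6 g f) then show ?case by (simp add: Typ_simps comp_Typ)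
next
  case (7 g f) then show ?case by (simp add: Typ_simps comp_Typ)
next
  case (8 g f) then show ?case by (simp add: Typ_simps comp_Typ)
next
  case (9 f)
  then show ?case unfolding Typ_simps
    using C.comp_ident_left[of "base_mor S f"] C.comp_ident_left[of "ext_mor S f"]
    by (intro arr_Typ_eqI) (simp_all add: Typ_rules)
next
  case (10 f)
  then show ?case unfolding Typ_simps
    using C.comp_ident_right[of "base_mor S f"] C.comp_ident_right[of "ext_mor S f"]
    by (intro arr_Typ_eqI) (simp_all add: Typ_rules)
next
  case (11 h g f)
  then show ?case unfolding Typ_simps
    by (intro arr_Typ_eqI) (simp_all add: Typ_rules C.comp_assoc)
qed

lemma cellD:
  assumes "(F, F', \<gamma>, \<alpha>) \<in> Cell (Typ S)"
  shows "F \<in> Arr (Typ S)" "F' \<in> Arr (Typ S)" "tdom S F' = tdom S F" "tcod S F' = tcod S F"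
     "\<gamma> \<in> Cell (Ctx S)" "Src (Ctx S) \<gamma> = ext_mor S F" "Trg (Ctx S) \<gamma> = ext_mor S F'"
     "\<alpha> \<in> Cell (Ctx S)" "Src (Ctx S) \<alpha> = base_mor S F" "Trg (Ctx S) \<alpha> = base_mor S F'"
     "WhL (Ctx S) (proj S (tcod S F)) \<gamma> = WhR (Ctx S) \<alpha> (proj S (tdom S F))"
  using assms by (simp_all add: Cell_Typ)

lemma vid_Typ: "F \<in> Arr (Typ S) \<Longrightarrow> VId (Typ S) F \<in> Cell (Typ S)"
  by (simp add: Typ_simps Cell_Typ C.vid_cell C.whl_vid C.whr_vid Typ_rules)

lemma vcomp_Typ: "(F', G', \<delta>, \<beta>) \<in> Cell (Typ S) \<Longrightarrow> (F, F', \<gamma>, \<alpha>) \<in> Cell (Typ S) \<Longrightarrow>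
   (F, G', VComp (Ctx S) \<delta> \<gamma>, VComp (Ctx S) \<beta> \<alpha>) \<in> Cell (Typ S)"
  by (simp add: Cell_Typ C.vcomp_cell C.whl_vcomp C.whr_vcomp Typ_rules)

text \<open>The commuting square of \<open>H\<close> moves the projection past it, after which the
  compatibility of the given cell applies.\<close>

lemma whl_Typ:
  assumes H: "H \<in> Arr (Typ S)" and c: "(F, F', \<gamma>, \<alpha>) \<in> Cell (Typ S)" and "tdom S H = tcod S F"
  shows "(tcomp S H F, tcomp S H F', WhL (Ctx S) (ext_mor S H) \<gamma>, WhL (Ctx S) (base_mor S H) \<alpha>) \<in> Cell (Typ S)"
proof -
  note a = cellD[OF c] assms
  have "WhL (Ctx S) (proj S (tcod S H)) (WhL (Ctx S) (ext_mor S H) \<gamma>) = WhL (Ctx S) (Comp (Ctx S) (proj S (tcod S H)) (ext_mor S H)) \<gamma>"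
    using a C.whl_comp[of "proj S (tcod S H)" "ext_mor S H" \<gamma>] by (simp add: Typ_rules)
  also have "\<dots> = WhL (Ctx S) (base_mor S H) (WhL (Ctx S) (proj S (tdom S H)) \<gamma>)"
    using a C.whl_comp[of "base_mor S H" "proj S (tdom S H)" \<gamma>] by (simp add: Typ_rules)
  also have "\<dots> = WhR (Ctx S) (WhL (Ctx S) (base_mor S H) \<alpha>) (proj S (tdom S F))"
    using a by (simp add: C.whl_whr Typ_rules)
  finally show ?thesis using a by (simp add: Cell_Typ Typ_rules C.whl_cell)
qed

lemma whr_Typ:
  assumes K: "K \<in> Arr (Typ S)" and c: "(F, F', \<gamma>, \<alpha>) \<in> Cell (Typ S)" and "tdom S F = tcod S K"
  shows "(tcomp S F K, tcomp S F' K, WhR (Ctx S) \<gamma> (ext_mor S K), WhR (Ctx S) \<alpha> (base_mor S K)) \<in> Cell (Typ S)"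
proof -
  note a = cellD[OF c] assms
  have "WhL (Ctx S) (proj S (tcod S F)) (WhR (Ctx S) \<gamma> (ext_mor S K)) = WhR (Ctx S) (WhR (Ctx S) \<alpha> (proj S (tcod S K))) (ext_mor S K)"
    using a C.whl_whr[of "proj S (tcod S F)" "ext_mor S K" \<gamma>] by (simp add: Typ_rules)
  also have "\<dots> = WhR (Ctx S) \<alpha> (Comp (Ctx S) (proj S (tcod S K)) (ext_mor S K))"
    using a C.whr_comp[of "proj S (tcod S K)" "ext_mor S K" \<alpha>] by (simp add: Typ_rules)
  also have "\<dots> = WhR (Ctx S) (WhR (Ctx S) \<alpha> (base_mor S K)) (proj S (tdom S K))"
    using a C.whr_comp[of "base_mor S K" "proj S (tdom S K)" \<alpha>] by (simp add: Typ_rules)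
  finally show ?thesis using a by (simp add: Cell_Typ Typ_rules C.whr_cell)
qed

lemma Typ_hom_category: "category (hom_cat (Typ S) X Y)"
proof (intro category.intro, goal_cases)
  case (1 a) then show ?case by (cases a) (simp add: hom_simps Typ_simps Cell_Typ)
next
  case (2 a) then show ?case by (cases a) (simp add: hom_simps Typ_simps Cell_Typ)
next
  case (3 F) then show ?case using vid_Typ[of F] by (simp add: hom_simps Typ_simps)
next
  case (4 F) then show ?case by (simp add: hom_simps Typ_simps)
next
  case (5 F) then show ?case by (simp add: hom_simps Typ_simps)
next
  case (6 b a) then show ?case by (cases a; cases b) (auto simp: hom_simps Typ_simps intro: vcomp_Typ)
next
  case (7 b a) then show ?case by (cases a; cases b) (simp add: hom_simps Typ_simps)
next
  case (8 b a) then show ?case by (cases a; cases b) (simp add: hom_simps Typ_simps)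
next
  case (9 a)
  obtain F F' \<gamma> \<alpha> where a: "a = (F, F', \<gamma>, \<alpha>)" by (cases a)
  with 9 show ?case using C.vcomp_vid[of \<gamma>] C.vcomp_vid[of \<alpha>] by (simp add: hom_simps Typ_simps Cell_Typ)
next
  case (10 a)
  obtain F F' \<gamma> \<alpha> where a: "a = (F, F', \<gamma>, \<alpha>)" by (cases a)
  with 10 show ?case using C.vcomp_vid[of \<gamma>] C.vcomp_vid[of \<alpha>] by (simp add: hom_simps Typ_simps Cell_Typ)
next
  case (11 c b a) then show ?case by (cases a; cases b; cases c) (simp add: hom_simps Typ_simps Cell_Typ C.vcomp_assoc)
qed

lemma Typ_two_category: "two_category (Typ S)"
proof (intro two_category.intro Typ_category two_category_axioms.intro Typ_hom_category, goal_cases)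
  case (1 a) then show ?case by (cases a) (simp add: Typ_simps Cell_Typ)
next
  case (2 a) then show ?case by (cases a) (simp add: Typ_simps Cell_Typ)
next
  case (3 a) then show ?case by (cases a) (simp add: Typ_simps Cell_Typ)
next
  case (4 a) then show ?case by (cases a) (simp add: Typ_simps Cell_Typ)
next
  case (5 h a)
  obtain F F' \<gamma> \<alpha> where a: "a = (F, F', \<gamma>, \<alpha>)" by (cases a)
  with 5 whl_Typ show ?case by (simp add: Typ_simps)
next
  case (6 k a)
  obtain F F' \<gamma> \<alpha> where a: "a = (F, F', \<gamma>, \<alpha>)" by (cases a)
  with 6 whr_Typ show ?case by (simp add: Typ_simps)
next
  case (7 h f) then show ?case by (simp add: Typ_simps Typ_rules C.whl_vid)
next
  case (8 f k) then show ?case by (simp add: Typ_simps Typ_rules C.whr_vid)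
next
  case (9 h b a)
  obtain F F' \<gamma> \<alpha> where a: "a = (F, F', \<gamma>, \<alpha>)" by (cases a)
  obtain G G' \<delta> \<beta> where b: "b = (G, G', \<delta>, \<beta>)" by (cases b)
  from 9 show ?case unfolding a b by (simp add: Typ_simps Typ_rules Cell_Typ C.whl_vcomp)
next
  case (10 k b a)
  obtain F F' \<gamma> \<alpha> where a: "a = (F, F', \<gamma>, \<alpha>)" by (cases a)
  obtain G G' \<delta> \<beta> where b: "b = (G, G', \<delta>, \<beta>)" by (cases b)
  from 10 show ?case unfolding a b by (simp add: Typ_simps Typ_rules Cell_Typ C.whr_vcomp)
next
  case (11 a)
  obtain F F' \<gamma> \<alpha> where a: "a = (F, F', \<gamma>, \<alpha>)" by (cases a)
  from 11 show ?case unfolding a using C.whl_ident[of \<gamma>] C.whl_ident[of \<alpha>] category.comp_ident_left[OF Typ_category, of F] category.comp_ident_left[OF Typ_category, of F']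
    by (simp add: Typ_simps Typ_rules Cell_Typ)
next
  case (12 a)
  obtain F F' \<gamma> \<alpha> where a: "a = (F, F', \<gamma>, \<alpha>)" by (cases a)
  from 12 show ?case unfolding a using C.whr_ident[of \<gamma>] C.whr_ident[of \<alpha>] category.comp_ident_right[OF Typ_category, of F] category.comp_ident_right[OF Typ_category, of F']
    by (simp add: Typ_simps Typ_rules Cell_Typ)
next
  case (13 h k a)
  obtain F F' \<gamma> \<alpha> where a: "a = (F, F', \<gamma>, \<alpha>)" by (cases a)
  from 13 show ?case unfolding a using category.comp_assoc[OF Typ_category, of h k]
    by (simp add: Typ_simps Typ_rules Cell_Typ C.whl_comp)
next
  case (14 h k a)
  obtain F F' \<gamma> \<alpha> where a: "a = (F, F', \<gamma>, \<alpha>)" by (cases a)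
  from 14 show ?case unfolding a using category.comp_assoc[OF Typ_category, of _ h k]
    by (simp add: Typ_simps Typ_rules Cell_Typ C.whr_comp)
next
  case (15 h k a)
  obtain F F' \<gamma> \<alpha> where a: "a = (F, F', \<gamma>, \<alpha>)" by (cases a)
  from 15 show ?case unfolding a using category.comp_assoc[OF Typ_category, of h _ k]
    by (simp add: Typ_simps Typ_rules Cell_Typ C.whl_whr)
next
  case (16 b a)
  obtain F F' \<gamma> \<alpha> where a: "a = (F, F', \<gamma>, \<alpha>)" by (cases a)
  obtain G G' \<delta> \<beta> where b: "b = (G, G', \<delta>, \<beta>)" by (cases b)
  from 16 show ?case unfolding a b using C.interchange[of \<beta> \<alpha>] C.interchange[of \<delta> \<gamma>] by (simp add: Typ_simps Typ_rules Cell_Typ)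
qed

lemma base_two_functor: "two_functor (Typ S) (Ctx S) (base_obj S) (base_mor S) base_cell"
proof (intro two_functor.intro Typ_two_category Ctx_two_category cat_functor.intro Typ_category Ctx_category
    cat_functor_axioms.intro two_functor_axioms.intro, goal_cases)
  case (7 a) then show ?case by (cases a) (simp add: base_cell_def Cell_Typ)
next
  case (8 a) then show ?case by (cases a) (simp add: base_cell_def Cell_Typ Typ_simps)
next
  case (9 a) then show ?case by (cases a) (simp add: base_cell_def Cell_Typ Typ_simps)
next
  case (11 b a) then show ?case by (cases a; cases b) (simp add: base_cell_def Typ_simps)
next
  case (12 h a) then show ?case by (cases a) (simp add: base_cell_def Typ_simps)
next
  case (13 h a) then show ?case by (cases a) (simp add: base_cell_def Typ_simps)
qed (simp_all add: Typ_simps Typ_rules base_cell_def)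

interpretation T: two_category "Typ S" by (rule Typ_two_category)

text \<open>The two components are inverted separately. Compatibility passes to the inverses because
  the two whiskered inverses are inverse to one and the same cell.\<close>

lemma Typ_inverse:
  assumes "a \<in> Cell (Typ S)"
  shows "\<exists>b. T.inverse_cells a b"
proof -
  obtain F F' \<gamma> \<alpha> where a: "a = (F, F', \<gamma>, \<alpha>)" by (cases a)
  note c = cellD[OF assms[unfolded a]]
  obtain \<beta> where b: "C.inverse_cells \<alpha> \<beta>" using Ctx_inverse[OF c(8)] c(8) unfolding C.inverse_cells_def by blast
  obtain \<delta> where d: "C.inverse_cells \<gamma> \<delta>" using Ctx_inverse[OF c(5)] c(5) unfolding C.inverse_cells_def by blast
  have "C.inverse_cells (WhL (Ctx S) (proj S (tcod S F)) \<gamma>) (WhL (Ctx S) (proj S (tcod S F)) \<delta>)"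
    by (rule C.inverse_whl[OF d]) (simp_all add: c Typ_rules)
  moreover have "C.inverse_cells (WhR (Ctx S) \<alpha> (proj S (tdom S F))) (WhR (Ctx S) \<beta> (proj S (tdom S F)))"
    by (rule C.inverse_whr[OF b]) (simp_all add: c Typ_rules)
  ultimately have "WhL (Ctx S) (proj S (tcod S F)) \<delta> = WhR (Ctx S) \<beta> (proj S (tdom S F))"
    unfolding c(11) by (rule C.inverse_unique)
  then have "(F', F, \<delta>, \<beta>) \<in> Cell (Typ S)" using b d c by (simp add: Cell_Typ C.inverse_cells_def)
  then have "T.inverse_cells a (F', F, \<delta>, \<beta>)"
    using assms b d c by (simp add: a T.inverse_cells_def C.inverse_cells_def Typ_simps)
  then show ?thesis ..
qed

subsection \<open>Liftings\<close>

lemma is_tmor_term: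
  assumes "is_tmor S \<Gamma> A \<Delta> B f g"
  shows "A # \<Gamma> \<turnstile>\<^bsub>S\<^esub> EqTerm g g (subst (ext (map (shift 1) f) Var) B)"
  using assms by (auto simp: is_tmor_def is_mor_def elems_eq_Cons simp del: subst_subst shift_subst)

lemma is_tmorI:
  assumes "ctxt S (A # \<Gamma>)" "ctxt S (B # \<Delta>)" "elems_eq S \<Gamma> \<Delta> f f" "A # \<Gamma> \<turnstile>\<^bsub>S\<^esub> EqTerm g g (subst (ext (map (shift 1) f) Var) B)"
  shows "is_tmor S \<Gamma> A \<Delta> B f g"
  using assms elems_shift1[of \<Delta> A \<Gamma> f f]
  by (simp add: is_tmor_def is_mor_def elems_eq_Cons del: subst_subst shift_subst)

lemma compose_proj: "\<forall>a \<in> set f. scoped n a \<Longrightarrow> compose f (map (shift 1) (vars n)) = map (shift 1) f"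
  unfolding compose_eq shift_eq_subst[abs_def]
  by (intro map_cong refl subst_cong_scoped[of n]) (auto simp: ext_def vars_def)

lemma whl_proj:
  assumes c: "is_cell S K (B # \<Delta>) (b # f) (b' # g) (q # p)"
  shows "is_cell S K \<Delta> f g p" "WhL (Ctx S) (proj S (tob S \<Delta> B)) (cell S K (B # \<Delta>) (b # f) (b' # g) (q # p)) = cell S K \<Delta> f g p"
proof -
  note e = is_cell_elems[OF c]
  then have B: "ctxt S (B # \<Delta>)" and K: "ctxt S K" by blast+
  then have D: "ctxt S \<Delta>" "\<Delta> \<turnstile>\<^bsub>S\<^esub> IsType B" by simp_all
  have fg: "elems_eq S K \<Delta> f f" "elems_eq S K \<Delta> g g" using e by (auto simp: elems_eq_Cons)
  have l: "length f = length \<Delta>" "length g = length \<Delta>" using elems_eq_length[OF fg(1)] elems_eq_length[OF fg(2)] by simp_all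
  have p: "elems_eq S K (Id_at \<Delta> f g) p p" using e elems_eq_Id_at_Cons[OF refl l, of S K B b b' q p q p] by blast
  show cp: "is_cell S K \<Delta> f g p" using fg p K D by (simp add: is_cell_def is_mor_def)
  let ?\<pi> = "map (shift 1) (vars (length \<Delta>))"
  have \<pi>: "compose ?\<pi> (a # h) = h" if "length h = length \<Delta>" for a :: "'c expr" and h using that by simp
  have "WhL (Ctx S) (proj S (tob S \<Delta> B)) (cell S K (B # \<Delta>) (b # f) (b' # g) (q # p)) =
      cell S K \<Delta> f g (path_map (B # \<Delta>) \<Delta> ?\<pi> (b # f) (b' # g) (q # p))"
    unfolding proj_tob[OF B] WhL_Ctx[OF is_mor_proj[OF B] c] \<pi>[OF l(1)] \<pi>[OF l(2)] ..
  also have "\<dots> = cell S K \<Delta> f g p"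
    by (rule cell_eqI'[OF cell_mors(1)[OF cp] cell_mors(2)[OF cp] path_map_proj[OF D(2) K]]) (use e in blast)+
  finally show "WhL (Ctx S) (proj S (tob S \<Delta> B)) (cell S K (B # \<Delta>) (b # f) (b' # g) (q # p)) = cell S K \<Delta> f g p" .
qed

lemma whr_proj:
  assumes c: "is_cell S \<Gamma> \<Delta> f g p" and A: "ctxt S (A # \<Gamma>)"
  shows "is_cell S (A # \<Gamma>) \<Delta> (map (shift 1) f) (map (shift 1) g) (map (shift 1) p)"
    "WhR (Ctx S) (cell S \<Gamma> \<Delta> f g p) (proj S (tob S \<Gamma> A)) = cell S (A # \<Gamma>) \<Delta> (map (shift 1) f) (map (shift 1) g) (map (shift 1) p)"
proof -
  note e = is_cell_elems[OF c]
  have s: "\<forall>a \<in> set f. scoped (length \<Gamma>) a" "\<forall>a \<in> set g. scoped (length \<Gamma>) a" "\<forall>a \<in> set p. scoped (length \<Gamma>) a"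
    using e elems_eq_scoped by blast+
  note cp = compose_proj[OF s(1)] compose_proj[OF s(2)] compose_proj[OF s(3)]
  show "is_cell S (A # \<Gamma>) \<Delta> (map (shift 1) f) (map (shift 1) g) (map (shift 1) p)"
    using is_cell_compose[OF is_mor_proj[OF A] c] unfolding cp .
  show "WhR (Ctx S) (cell S \<Gamma> \<Delta> f g p) (proj S (tob S \<Gamma> A)) = cell S (A # \<Gamma>) \<Delta> (map (shift 1) f) (map (shift 1) g) (map (shift 1) p)"
    unfolding proj_tob[OF A] WhR_Ctx[OF is_mor_proj[OF A] c] cp ..
qed

lemma Arr_TypI: "is_tmor S \<Gamma> A \<Delta> B f g \<Longrightarrow> tmor S \<Gamma> A \<Delta> B f g \<in> Arr (Typ S)"
  unfolding Arr_Typ by blast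

text \<open>Whiskering with a projection leaves only the base part of the total path on one side and
  weakens the base path on the other. Compatibility thus amounts to a single equation between paths
  in the base.\<close>

lemma Cell_Typ_tmor:
  assumes g: "is_tmor S \<Gamma> A \<Delta> B f g" and g': "is_tmor S \<Gamma> A \<Delta> B f' g'" and a: "is_cell S \<Gamma> \<Delta> f f' a"
    and c: "is_cell S (A # \<Gamma>) (B # \<Delta>) (g # map (shift 1) f) (g' # map (shift 1) f') (q # p)"
  shows "(tmor S \<Gamma> A \<Delta> B f g, tmor S \<Gamma> A \<Delta> B f' g', cell S (A # \<Gamma>) (B # \<Delta>) (g # map (shift 1) f) (g' # map (shift 1) f') (q # p), cell S \<Gamma> \<Delta> f f' a)
      \<in> Cell (Typ S) \<longleftrightarrow> elems_eq S (A # \<Gamma>) (Id_at \<Delta> (map (shift 1) f) (map (shift 1) f')) p (map (shift 1) a)"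
proof -
  have A: "ctxt S (A # \<Gamma>)" using is_tmorD[OF g] by blast
  note w = whl_proj[OF c] whr_proj[OF a A]
  have r: "((A # \<Gamma>, \<Delta>, map (shift 1) f), (A # \<Gamma>, \<Delta>, map (shift 1) f)) \<in> mor_rel S"
    "((A # \<Gamma>, \<Delta>, map (shift 1) f'), (A # \<Gamma>, \<Delta>, map (shift 1) f')) \<in> mor_rel S"
    using cell_mors[OF w(1)] is_mor_rel by blast+
  show ?thesis
    unfolding Cell_Typ Dom_Typ[OF g] Dom_Typ[OF g'] Cod_Typ[OF g] Cod_Typ[OF g'] base_mor_tmor[OF g] base_mor_tmor[OF g']
      ext_mor_tmor[OF g] ext_mor_tmor[OF g'] Src_Ctx[OF a] Trg_Ctx[OF a] Src_Ctx[OF c] Trg_Ctx[OF c] w(2,4) cell_eq_iff[OF w(1,3)]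
    using Arr_TypI[OF g] Arr_TypI[OF g'] Cell_CtxI[OF a] Cell_CtxI[OF c] r by (simp add: cell_rel_def)
qed

text \<open>The source of the lifting is the term of the target, transported back along the given
  path. Since the fibre component of a path leads to a transported end point, reflexivity can serve
  as that component.\<close>

lemma Typ_cell_lift:
  assumes "G \<in> Arr (Typ S)" "\<kappa> \<in> Cell (Ctx S)" "Trg (Ctx S) \<kappa> = base_mor S G"
  shows "\<exists>\<gamma>. \<gamma> \<in> Cell (Typ S) \<and> Trg (Typ S) \<gamma> = G \<and> base_cell \<gamma> = \<kappa>"
proof -
  obtain \<Gamma> A \<Delta> B f' g' where G: "is_tmor S \<Gamma> A \<Delta> B f' g'" "G = tmor S \<Gamma> A \<Delta> B f' g'" using assms(1) unfolding Arr_Typ by blast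
  note i = is_tmorD[OF G(1)]
  have m: "is_mor S \<Gamma> \<Delta> f'" and A: "ctxt S (A # \<Gamma>)" and B: "ctxt S (B # \<Delta>)" using i by blast+
  have D: "ctxt S \<Delta>" "\<Delta> \<turnstile>\<^bsub>S\<^esub> IsType B" using B by simp_all
  have "Trg (Ctx S) \<kappa> = mor S \<Gamma> \<Delta> f'" unfolding assms(3) G(2) by (rule base_mor_tmor[OF G(1)])
  from cell_trg[OF assms(2) this m] obtain f a where a: "is_cell S \<Gamma> \<Delta> f f' a" "\<kappa> = cell S \<Gamma> \<Delta> f f' a" by blast
  let ?V = "map (shift 1) :: 'c expr list \<Rightarrow> _"
  note e = is_cell_elems[OF a(1)] and e1 = is_cell_elems[OF whr_proj(1)[OF a(1) A]]
  let ?h = "tr \<Delta> B (?V f) (?V f') (?V a) g'" and ?T = "subst (ext (?V f) Var) B"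
  let ?q = "Refl ?T ?h"
  have h: "A # \<Gamma> \<turnstile>\<^bsub>S\<^esub> EqTerm ?h ?h ?T"
    by (rule tr_cong[OF D(2) A]) (use e1 is_tmor_term[OF G(1)] in blast)+
  have F: "is_tmor S \<Gamma> A \<Delta> B f ?h" by (rule is_tmorI[OF A B _ h]) (use e in blast)
  have "A # \<Gamma> \<turnstile>\<^bsub>S\<^esub> EqType ?T ?T" using h eq_term_presup has_type_presup eq_type_refl by blast
  from Refl_cong[OF this h] have q: "A # \<Gamma> \<turnstile>\<^bsub>S\<^esub> EqTerm ?q ?q (IdT ?T ?h ?h)" .
  have l: "length (?V f) = length \<Delta>" "length (?V f') = length \<Delta>" using e elems_eq_length[of S \<Gamma> \<Delta>] by auto
  have "elems_eq S (A # \<Gamma>) (Id_at (B # \<Delta>) (?h # ?V f) (g' # ?V f')) (?q # ?V a) (?q # ?V a)"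
    unfolding elems_eq_Id_at_Cons[OF refl l] using q e1 by blast
  then have c: "is_cell S (A # \<Gamma>) (B # \<Delta>) (?h # ?V f) (g' # ?V f') (?q # ?V a)"
    using is_tmorD[OF F] is_tmorD[OF G(1)] unfolding is_cell_def by blast
  have "(tmor S \<Gamma> A \<Delta> B f ?h, G, cell S (A # \<Gamma>) (B # \<Delta>) (?h # ?V f) (g' # ?V f') (?q # ?V a), \<kappa>) \<in> Cell (Typ S)"
    unfolding G(2) a(2) Cell_Typ_tmor[OF F G(1) a(1) c] using e1 by blast
  then show ?thesis by (intro exI conjI) (assumption, simp_all add: Typ_simps base_cell_def)
qed

lemma vertical_cell_eq:
  assumes g: "is_tmor S \<Gamma> A \<Delta> B f g" and g': "is_tmor S \<Gamma> A \<Delta> B f g'"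
    and q: "A # \<Gamma> \<turnstile>\<^bsub>S\<^esub> EqTerm q q (IdT (subst (ext (map (shift 1) f) Var) B) g g')"
  shows "is_cell S (A # \<Gamma>) (B # \<Delta>) (g # map (shift 1) f) (g' # map (shift 1) f) (q # refl_at \<Delta> (map (shift 1) f))"
    "A # \<Gamma> \<turnstile>\<^bsub>S\<^esub> EqTerm q' q' (IdT (subst (ext (map (shift 1) f) Var) B) g g') \<Longrightarrow>
     cell S (A # \<Gamma>) (B # \<Delta>) (g # map (shift 1) f) (g' # map (shift 1) f) (q # refl_at \<Delta> (map (shift 1) f)) =
     cell S (A # \<Gamma>) (B # \<Delta>) (g # map (shift 1) f) (g' # map (shift 1) f) (q' # refl_at \<Delta> (map (shift 1) f)) \<longleftrightarrow>
     A # \<Gamma> \<turnstile>\<^bsub>S\<^esub> EqTerm q q' (IdT (subst (ext (map (shift 1) f) Var) B) g g')"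
proof -
  let ?V = "map (shift 1) :: 'c expr list \<Rightarrow> _"
  have A: "ctxt S (A # \<Gamma>)" and B: "ctxt S (B # \<Delta>)" and m: "elems_eq S \<Gamma> \<Delta> f f"
    and m1: "is_mor S (A # \<Gamma>) (B # \<Delta>) (g # ?V f)" "is_mor S (A # \<Gamma>) (B # \<Delta>) (g' # ?V f)"
    using is_tmorD[OF g] is_tmorD[OF g'] by (auto simp: is_mor_def)
  have D: "ctxt S \<Delta>" "\<Delta> \<turnstile>\<^bsub>S\<^esub> IsType B" using B by simp_all
  have V: "elems_eq S (A # \<Gamma>) \<Delta> (?V f) (?V f)" by (rule elems_shift1[OF D(1) A m])
  note I = Id_at_refl[OF D(2) A V is_tmor_term[OF g] is_tmor_term[OF g']]
  have c: "is_cell S (A # \<Gamma>) (B # \<Delta>) (g # ?V f) (g' # ?V f) (q # refl_at \<Delta> (?V f))"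
    if "A # \<Gamma> \<turnstile>\<^bsub>S\<^esub> EqTerm q q (IdT (subst (ext (?V f) Var) B) g g')" for q
    unfolding is_cell_def using that m1 I by blast
  show "is_cell S (A # \<Gamma>) (B # \<Delta>) (g # ?V f) (g' # ?V f) (q # refl_at \<Delta> (?V f))" by (rule c[OF q])
  assume q': "A # \<Gamma> \<turnstile>\<^bsub>S\<^esub> EqTerm q' q' (IdT (subst (ext (?V f) Var) B) g g')"
  show "cell S (A # \<Gamma>) (B # \<Delta>) (g # ?V f) (g' # ?V f) (q # refl_at \<Delta> (?V f)) =
     cell S (A # \<Gamma>) (B # \<Delta>) (g # ?V f) (g' # ?V f) (q' # refl_at \<Delta> (?V f)) \<longleftrightarrow>
     A # \<Gamma> \<turnstile>\<^bsub>S\<^esub> EqTerm q q' (IdT (subst (ext (?V f) Var) B) g g')"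
    unfolding cell_eq_iff[OF c[OF q] c[OF q']] I[symmetric]
    using is_mor_rel[OF m1(1)] is_mor_rel[OF m1(2)] by (simp add: cell_rel_def)
qed

text \<open>Compatibility forces the base part of the total path to equal a reflexivity
  definitionally. Replacing it by that reflexivity changes the representative but not the class, and
  what remains is an element of an identity type of the fibre.\<close>

lemma vertical_cell_iff:
  assumes g: "is_tmor S \<Gamma> A \<Delta> B f g" and g': "is_tmor S \<Gamma> A \<Delta> B f g'"
  shows "(tmor S \<Gamma> A \<Delta> B f g, tmor S \<Gamma> A \<Delta> B f g', \<gamma>, VId (Ctx S) (mor S \<Gamma> \<Delta> f)) \<in> Cell (Typ S) \<longleftrightarrow>
    (\<exists>q. A # \<Gamma> \<turnstile>\<^bsub>S\<^esub> EqTerm q q (IdT (subst (ext (map (shift 1) f) Var) B) g g') \<and>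
      \<gamma> = cell S (A # \<Gamma>) (B # \<Delta>) (g # map (shift 1) f) (g' # map (shift 1) f) (q # refl_at \<Delta> (map (shift 1) f)))" (is "?l \<longleftrightarrow> ?r")
proof -
  let ?V = "map (shift 1) :: 'c expr list \<Rightarrow> _"
  have A: "ctxt S (A # \<Gamma>)" and B: "ctxt S (B # \<Delta>)" and f: "is_mor S \<Gamma> \<Delta> f" and m: "elems_eq S \<Gamma> \<Delta> f f"
    and m1: "is_mor S (A # \<Gamma>) (B # \<Delta>) (g # ?V f)" "is_mor S (A # \<Gamma>) (B # \<Delta>) (g' # ?V f)"
    using is_tmorD[OF g] is_tmorD[OF g'] by (auto simp: is_mor_def)
  have D: "ctxt S \<Delta>" "\<Delta> \<turnstile>\<^bsub>S\<^esub> IsType B" using B by simp_all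
  have V: "elems_eq S (A # \<Gamma>) \<Delta> (?V f) (?V f)" by (rule elems_shift1[OF D(1) A m])
  have l: "length f = length \<Delta>" "length (?V f) = length \<Delta>" using elems_eq_length[OF m] by simp_all
  note I = Id_at_refl[OF D(2) A V is_tmor_term[OF g] is_tmor_term[OF g']]
  have w: "?V (refl_at \<Delta> f) = refl_at \<Delta> (?V f)"
    using map_subst_refl_at[OF D(1) l(1), of "\<lambda>i. Var (i + 1)"] by (simp only: shift_eq_subst[abs_def])
  note r = is_cell_refl[OF f]
  show ?thesis
  proof
    assume l': ?l
    note d = cellD[OF this, unfolded ext_mor_tmor[OF g] ext_mor_tmor[OF g']]
    obtain p where p: "is_cell S (A # \<Gamma>) (B # \<Delta>) (g # ?V f) (g' # ?V f) p" "\<gamma> = cell S (A # \<Gamma>) (B # \<Delta>) (g # ?V f) (g' # ?V f) p"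
      using cell_src_trg[OF d(5-7) m1] by blast
    have "length p = length (B # \<Delta>)" using is_cell_elems[OF p(1)] by blast
    then obtain q p' where qp: "p = q # p'" by (cases p) auto
    have e: "elems_eq S (A # \<Gamma>) (Id_at \<Delta> (?V f) (?V f)) p' (refl_at \<Delta> (?V f))"
      using l' unfolding p(2) VId_Ctx[OF f] qp Cell_Typ_tmor[OF g g' r p(1)[unfolded qp]] w .
    have "elems_eq S (A # \<Gamma>) (Id_at (B # \<Delta>) (g # ?V f) (g' # ?V f)) (q # p') (q # p')"
      using is_cell_elems[OF p(1)] unfolding qp by blast
    with e have e2: "elems_eq S (A # \<Gamma>) (Id_at (B # \<Delta>) (g # ?V f) (g' # ?V f)) (q # p') (q # refl_at \<Delta> (?V f))"
      unfolding elems_eq_Id_at_Cons[OF refl l(2) l(2)] by blast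
    from elems_eq_right[OF is_cell_ctxt[OF p(1)] e2] have "A # \<Gamma> \<turnstile>\<^bsub>S\<^esub> EqTerm q q (IdT (subst (ext (?V f) Var) B) g g')" unfolding I .
    moreover have "\<gamma> = cell S (A # \<Gamma>) (B # \<Delta>) (g # ?V f) (g' # ?V f) (q # refl_at \<Delta> (?V f))"
      unfolding p(2) qp by (rule cell_eqI'[OF m1 e2])
    ultimately show ?r by blast
  next
    assume ?r
    then obtain q where q: "A # \<Gamma> \<turnstile>\<^bsub>S\<^esub> EqTerm q q (IdT (subst (ext (?V f) Var) B) g g')"
      "\<gamma> = cell S (A # \<Gamma>) (B # \<Delta>) (g # ?V f) (g' # ?V f) (q # refl_at \<Delta> (?V f))" by blast
    note c = vertical_cell_eq(1)[OF g g' q(1)]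
    show ?l unfolding q(2) VId_Ctx[OF f] Cell_Typ_tmor[OF g g' r c] w using whl_proj(1)[OF c] unfolding is_cell_def by blast
  qed
qed

text \<open>The term part of the lift is the variable \<open>Var 0\<close>. Composition with the
  lift therefore keeps the term \<open>b\<close>, and by \<open>path_map_vertical\<close> whiskering
  keeps the fibre path \<open>q\<close>; only the context and type in which they are read
  change.\<close>

lemma lift_vertical_cell:
  assumes f: "is_mor S \<Gamma> \<Delta> f" and B: "ctxt S (B # \<Delta>)"
    and b: "is_tmor S \<Xi> C \<Gamma> (subst (ext f Var) B) k b" and b': "is_tmor S \<Xi> C \<Gamma> (subst (ext f Var) B) k b'"
  shows "subst (ext (map (shift 1) k) Var) (subst (ext f Var) B) = subst (ext (map (shift 1) (compose f k)) Var) B"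
    "tcomp S (tmor S \<Gamma> (subst (ext f Var) B) \<Delta> B f (Var 0)) (tmor S \<Xi> C \<Gamma> (subst (ext f Var) B) k b) = tmor S \<Xi> C \<Delta> B (compose f k) b"
    "is_tmor S \<Xi> C \<Delta> B (compose f k) b"
    "C # \<Xi> \<turnstile>\<^bsub>S\<^esub> EqTerm q q (IdT (subst (ext (map (shift 1) (compose f k)) Var) B) b b') \<Longrightarrow>
     WhL (Ctx S) (ext_mor S (tmor S \<Gamma> (subst (ext f Var) B) \<Delta> B f (Var 0)))
      (cell S (C # \<Xi>) (subst (ext f Var) B # \<Gamma>) (b # map (shift 1) k) (b' # map (shift 1) k) (q # refl_at \<Gamma> (map (shift 1) k))) =
     cell S (C # \<Xi>) (B # \<Delta>) (b # map (shift 1) (compose f k)) (b' # map (shift 1) (compose f k)) (q # refl_at \<Delta> (map (shift 1) (compose f k)))"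
proof -
  let ?V = "map (shift 1) :: 'c expr list \<Rightarrow> _" and ?A = "subst (ext f Var) B"
  note u = is_tmor_lift[OF f B]
  have D: "ctxt S \<Gamma>" "ctxt S \<Delta>" "\<Delta> \<turnstile>\<^bsub>S\<^esub> IsType B" "length f = length \<Delta>" "elems_eq S \<Gamma> \<Delta> f f" using B is_morD[OF f] by auto
  have K: "ctxt S (C # \<Xi>)" "is_mor S \<Xi> \<Gamma> k" "length k = length \<Gamma>" using is_tmorD[OF b] by blast+
  have sf: "\<forall>a \<in> set f. scoped (length k) a" using elems_eq_scoped[OF D(5)] K(3) by auto
  have sB: "scoped (length f) B" using is_type_scoped[OF D(3)] D(4) by simp
  have fV: "compose f (?V k) = ?V (compose f k)" using map_shift_compose[OF sf, of 1] ..
  show AT: "subst (ext (?V k) Var) ?A = subst (ext (?V (compose f k)) Var) B"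
    unfolding fV[symmetric] by (rule subst_compose_type[OF sB]) (use sf in simp)
  have s0: "subst (ext (b # ?V k) Var) (Var 0) = b" for b by simp
  show "tcomp S (tmor S \<Gamma> ?A \<Delta> B f (Var 0)) (tmor S \<Xi> C \<Gamma> ?A k b) = tmor S \<Xi> C \<Delta> B (compose f k) b"
    using tcomp_tmor[OF u b] unfolding s0 .
  show tb: "is_tmor S \<Xi> C \<Delta> B (compose f k) b" using is_tmor_comp[OF u b] unfolding s0 .
  have tb': "is_tmor S \<Xi> C \<Delta> B (compose f k) b'" using is_tmor_comp[OF u b'] unfolding s0 .
  assume q: "C # \<Xi> \<turnstile>\<^bsub>S\<^esub> EqTerm q q (IdT (subst (ext (?V (compose f k)) Var) B) b b')"
  have c: "is_cell S (C # \<Xi>) (?A # \<Gamma>) (b # ?V k) (b' # ?V k) (q # refl_at \<Gamma> (?V k))"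
    by (rule vertical_cell_eq(1)[OF b b']) (use q in \<open>simp only: AT\<close>)
  have u1: "is_mor S (?A # \<Gamma>) (B # \<Delta>) (Var 0 # ?V f)" using is_tmorD[OF u] by blast
  have Vk: "elems_eq S (C # \<Xi>) \<Gamma> (?V k) (?V k)" by (rule elems_shift1[OF D(1) K(1)]) (use K(2) in \<open>simp add: is_mor_def\<close>)
  have m1: "is_mor S (C # \<Xi>) (B # \<Delta>) (b # ?V (compose f k))" "is_mor S (C # \<Xi>) (B # \<Delta>) (b' # ?V (compose f k))"
    using is_tmorD[OF tb] is_tmorD[OF tb'] by blast+
  have cc: "compose (Var 0 # ?V f) (b # ?V k) = b # ?V (compose f k)" for b by (simp only: compose_Cons s0 fV)
  have "elems_eq S (C # \<Xi>) (Id_at (B # \<Delta>) (b # ?V (compose f k)) (b' # ?V (compose f k)))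
      (path_map (?A # \<Gamma>) (B # \<Delta>) (Var 0 # ?V f) (b # ?V k) (b' # ?V k) (q # refl_at \<Gamma> (?V k))) (q # refl_at \<Delta> (?V (compose f k)))"
    using path_map_vertical[OF D(5,1,3) K(1) Vk, of b b' q] is_tmor_term[OF tb] is_tmor_term[OF tb'] q unfolding fV by blast
  then show "WhL (Ctx S) (ext_mor S (tmor S \<Gamma> ?A \<Delta> B f (Var 0))) (cell S (C # \<Xi>) (?A # \<Gamma>) (b # ?V k) (b' # ?V k) (q # refl_at \<Gamma> (?V k))) =
     cell S (C # \<Xi>) (B # \<Delta>) (b # ?V (compose f k)) (b' # ?V (compose f k)) (q # refl_at \<Delta> (?V (compose f k)))"
    unfolding ext_mor_tmor[OF u] WhL_Ctx[OF u1 c] cc by (rule cell_eqI'[OF m1])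
qed

interpretation P: two_functor "Typ S" "Ctx S" "base_obj S" "base_mor S" base_cell by (rule base_two_functor)

lemma lift_cases:
  assumes "z \<in> Obj (Typ S)" "u \<in> Arr (Ctx S)" "Cod (Ctx S) u = base_obj S z"
  obtains \<Gamma> \<Delta> f B where "is_mor S \<Gamma> \<Delta> f" "u = mor S \<Gamma> \<Delta> f" "ctxt S (B # \<Delta>)" "z = tob S \<Delta> B"
    "is_tmor S \<Gamma> (subst (ext f Var) B) \<Delta> B f (Var 0)" "chosen_lift S u z = tmor S \<Gamma> (subst (ext f Var) B) \<Delta> B f (Var 0)"
proof -
  obtain \<Delta> B where B: "ctxt S (B # \<Delta>)" "z = tob S \<Delta> B" using assms(1) unfolding Obj_Typ by blast
  have "Cod (Ctx S) u = ob S \<Delta>" unfolding assms(3) B(2) by (rule base_obj_tob[OF B(1)])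
  from arr_cod[OF assms(2) this] B(1) obtain \<Gamma> f where f: "is_mor S \<Gamma> \<Delta> f" "u = mor S \<Gamma> \<Delta> f" by auto
  from that[OF f B is_tmor_lift[OF f(1) B(1)]] chosen_lift_mor[OF f(1) B(1)] f(2) B(2) show ?thesis by blast
qed

lemma comp_type:
  assumes "is_mor S \<Gamma> \<Delta> f" "ctxt S (B # \<Delta>)" "is_mor S \<Xi> \<Gamma> k"
  shows "subst (ext k Var) (subst (ext f Var) B) = subst (ext (compose f k) Var) B"
proof (rule subst_compose_type)
  show "scoped (length f) B" using is_type_scoped[of \<Delta> B] assms(2) is_morD[OF assms(1)] by simp
  show "\<forall>a \<in> set f. scoped (length k) a" using is_morD[OF assms(1)] is_morD[OF assms(3)] elems_eq_scoped[of \<Gamma> \<Delta> f f] by auto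
qed

section \<open>The chosen lifts and the conditions on a 2-fibration\<close>

lemma Typ_cloven: "cloven_fibration (Typ S) (Ctx S) (base_obj S) (base_mor S) (chosen_lift S)"
proof (intro cloven_fibration.intro P.cat_functor_axioms cloven_fibration_axioms.intro)
  fix z u assume zu: "z \<in> Obj (Typ S)" "u \<in> Arr (Ctx S)" "Cod (Ctx S) u = base_obj S z"
  obtain \<Gamma> \<Delta> f B where f: "is_mor S \<Gamma> \<Delta> f" "u = mor S \<Gamma> \<Delta> f" and B: "ctxt S (B # \<Delta>)" "z = tob S \<Delta> B"
    and l: "is_tmor S \<Gamma> (subst (ext f Var) B) \<Delta> B f (Var 0)" "chosen_lift S u z = tmor S \<Gamma> (subst (ext f Var) B) \<Delta> B f (Var 0)"
    by (rule lift_cases[OF zu])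
  let ?A = "subst (ext f Var) B"
  have A: "ctxt S (?A # \<Gamma>)" using is_tmorD[OF l(1)] by blast
  show "Cod (Typ S) (chosen_lift S u z) = z" unfolding l(2) Typ_simps unfolding B(2) by (rule Cod_Typ[OF l(1)])
  show "base_mor S (chosen_lift S u z) = u" unfolding l(2) unfolding f(2) by (rule base_mor_tmor[OF l(1)])
  show "cartesian (Typ S) (Ctx S) (base_obj S) (base_mor S) (chosen_lift S u z)"
    unfolding cartesian_def l(2) Typ_simps Dom_Typ[OF l(1)] Cod_Typ[OF l(1)] base_mor_tmor[OF l(1)] base_obj_tob[OF A]
  proof (intro conjI Arr_TypI l(1) ballI impI, elim conjE)
    fix g k assume g: "g \<in> Arr (Typ S)" "k \<in> Arr (Ctx S)" "tcod S g = tob S \<Delta> B" "Dom (Ctx S) k = base_obj S (tdom S g)"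
      "Cod (Ctx S) k = ob S \<Gamma>" "base_mor S g = Comp (Ctx S) (mor S \<Gamma> \<Delta> f) k"
    obtain \<Xi> D where D: "ctxt S (D # \<Xi>)" "tdom S g = tob S \<Xi> D" using arr_Typ(1)[OF g(1)] unfolding Obj_Typ by blast
    have "Dom (Ctx S) k = ob S \<Xi>" unfolding g(4) D(2) by (rule base_obj_tob[OF D(1)])
    from arr_dom_cod[OF g(2) this g(5)] A D(1) obtain h where h: "is_mor S \<Xi> \<Gamma> h" "k = mor S \<Xi> \<Gamma> h" by auto
    note fh = is_mor_compose[OF f(1) h(1)]
    have "base_mor S g = mor S \<Xi> \<Delta> (compose f h)" unfolding g(6) h(2) by (rule Comp_Ctx[OF f(1) h(1)])
    from tarr_dom_cod_base[OF g(1) D(2) g(3) D(1) B(1) this fh] obtain c where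
      c: "is_tmor S \<Xi> D \<Delta> B (compose f h) c" "g = tmor S \<Xi> D \<Delta> B (compose f h) c" by blast
    have AT: "subst (ext (map (shift 1) h) Var) ?A = subst (ext (map (shift 1) (compose f h)) Var) B"
    proof -
      have "shift 1 (subst (ext h Var) ?A) = shift 1 (subst (ext (compose f h) Var) B)"
        by (simp only: comp_type[OF f(1) B(1) h(1)])
      then show ?thesis
        using shift_subst_closed[of \<Gamma> ?A h] shift_subst_closed[of \<Delta> B "compose f h"] A B(1) is_morD[OF h(1)] is_morD[OF fh]
        by (simp del: shift_subst subst_subst)
    qed
    \<comment> \<open>The factor reuses the term \<open>c\<close> of the given 1-cell. Its type fits
      because substituting f and then h is the same as substituting their composite.\<close>
    have k': "is_tmor S \<Xi> D \<Gamma> ?A h c"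
      by (rule is_tmorI[OF D(1) A]) (use is_morD[OF h(1)] is_tmor_term[OF c(1)] in \<open>simp_all only: AT\<close>)
    have comp: "tcomp S (tmor S \<Gamma> ?A \<Delta> B f (Var 0)) (tmor S \<Xi> D \<Gamma> ?A h e) = tmor S \<Xi> D \<Delta> B (compose f h) e"
      if "is_tmor S \<Xi> D \<Gamma> ?A h e" for e
      using tcomp_tmor[OF l(1) that] by simp
    show "\<exists>!k'. k' \<in> Arr (Typ S) \<and> tdom S k' = tdom S g \<and> tcod S k' = tob S \<Gamma> ?A \<and> base_mor S k' = k \<and>
        tcomp S (tmor S \<Gamma> ?A \<Delta> B f (Var 0)) k' = g"
    proof (rule ex1I[of _ "tmor S \<Xi> D \<Gamma> ?A h c"])
      show "tmor S \<Xi> D \<Gamma> ?A h c \<in> Arr (Typ S) \<and> tdom S (tmor S \<Xi> D \<Gamma> ?A h c) = tdom S g \<and> tcod S (tmor S \<Xi> D \<Gamma> ?A h c) = tob S \<Gamma> ?A \<and>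
          base_mor S (tmor S \<Xi> D \<Gamma> ?A h c) = k \<and> tcomp S (tmor S \<Gamma> ?A \<Delta> B f (Var 0)) (tmor S \<Xi> D \<Gamma> ?A h c) = g"
        unfolding D(2) h(2) Dom_Typ[OF k'] Cod_Typ[OF k'] base_mor_tmor[OF k'] comp[OF k'] unfolding c(2) Dom_Typ[OF c(1)] using Arr_TypI[OF k'] by blast
      fix m assume m: "m \<in> Arr (Typ S) \<and> tdom S m = tdom S g \<and> tcod S m = tob S \<Gamma> ?A \<and> base_mor S m = k \<and>
        tcomp S (tmor S \<Gamma> ?A \<Delta> B f (Var 0)) m = g"
      then have m': "m \<in> Arr (Typ S)" "tdom S m = tob S \<Xi> D" "tcod S m = tob S \<Gamma> ?A" "base_mor S m = mor S \<Xi> \<Gamma> h"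
        unfolding D(2) h(2) by blast+
      from tarr_dom_cod_base[OF m'(1-3) D(1) A m'(4) h(1)] obtain e where e: "is_tmor S \<Xi> D \<Gamma> ?A h e" "m = tmor S \<Xi> D \<Gamma> ?A h e" by blast
      have e2: "is_tmor S \<Xi> D \<Delta> B (compose f h) e" using lift_vertical_cell(3)[OF f(1) B(1) e(1) e(1)] .
      have "tmor S \<Xi> D \<Delta> B (compose f h) e = tmor S \<Xi> D \<Delta> B (compose f h) c"
        using m unfolding e(2) comp[OF e(1)] c(2) by blast
      then have "mor S (D # \<Xi>) (B # \<Delta>) (e # map (shift 1) (compose f h)) = mor S (D # \<Xi>) (B # \<Delta>) (c # map (shift 1) (compose f h))"
        unfolding tmor_eq_iff[OF e2 c(1)] by blast
      then have "D # \<Xi> \<turnstile>\<^bsub>S\<^esub> EqTerm e c (subst (ext (map (shift 1) h) Var) ?A)"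
        using mor_eq_iff is_tmorD[OF e2] is_tmorD[OF c(1)] unfolding AT
        by (auto simp: mor_rel_iff elems_eq_Cons simp del: subst_subst shift_subst)
      moreover have "shift 1 (subst (ext h Var) ?A) = subst (ext (map (shift 1) h) Var) ?A"
        by (rule shift_subst_closed) (use A is_morD[OF h(1)] in auto)
      ultimately show "m = tmor S \<Xi> D \<Gamma> ?A h c"
        unfolding e(2) by (intro tmor_eqI tmor_relI ctxt_eq_refl D(1) A) (use is_morD[OF h(1)] in \<open>simp_all del: shift_subst subst_subst\<close>)
    qed
  qed
qed

lemma Typ_split: "split_fibration (Typ S) (Ctx S) (base_obj S) (base_mor S) (chosen_lift S)"
proof (intro split_fibration.intro Typ_cloven split_fibration_axioms.intro)
  fix z assume "z \<in> Obj (Typ S)"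
  then obtain \<Delta> B where B: "ctxt S (B # \<Delta>)" "z = tob S \<Delta> B" unfolding Obj_Typ by blast
  then have c: "ctxt S \<Delta>" by simp
  have "subst (ext (vars (length \<Delta>)) Var) B = subst Var B"
    using is_type_scoped[of \<Delta> B] B(1) by (intro subst_cong_scoped[of "length \<Delta>"]) (auto simp: ext_def vars_def)
  then show "chosen_lift S (Ident (Ctx S) (base_obj S z)) z = Ident (Typ S) z"
    unfolding B(2) base_obj_tob[OF B(1)] Ident_Ctx[OF c] chosen_lift_mor[OF is_mor_vars[OF c] B(1)] Typ_simps tident_tob[OF B(1)] by simp
next
  fix z u v assume zu: "z \<in> Obj (Typ S)" "u \<in> Arr (Ctx S)" "v \<in> Arr (Ctx S)" "Cod (Ctx S) u = base_obj S z" "Cod (Ctx S) v = Dom (Ctx S) u"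
  obtain \<Gamma> \<Delta> f B where f: "is_mor S \<Gamma> \<Delta> f" "u = mor S \<Gamma> \<Delta> f" and B: "ctxt S (B # \<Delta>)" "z = tob S \<Delta> B"
    and l: "is_tmor S \<Gamma> (subst (ext f Var) B) \<Delta> B f (Var 0)" "chosen_lift S u z = tmor S \<Gamma> (subst (ext f Var) B) \<Delta> B f (Var 0)"
    by (rule lift_cases[OF zu(1,2,4)])
  let ?A = "subst (ext f Var) B"
  have A: "ctxt S (?A # \<Gamma>)" using is_tmorD[OF l(1)] by blast
  have "Cod (Ctx S) v = ob S \<Gamma>" unfolding zu(5) f(2) by (rule Dom_Ctx[OF f(1)])
  from arr_cod[OF zu(3) this] A obtain \<Xi> k where k: "is_mor S \<Xi> \<Gamma> k" "v = mor S \<Xi> \<Gamma> k" by auto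
  have "tcomp S (tmor S \<Gamma> ?A \<Delta> B f (Var 0)) (tmor S \<Xi> (subst (ext k Var) ?A) \<Gamma> ?A k (Var 0)) =
      tmor S \<Xi> (subst (ext (compose f k) Var) B) \<Delta> B (compose f k) (Var 0)"
    using tcomp_tmor[OF l(1) is_tmor_lift[OF k(1) A]] by (simp only: subst.simps ext_simps comp_type[OF f(1) B(1) k(1)])
  then show "chosen_lift S (Comp (Ctx S) u v) z = Comp (Typ S) (chosen_lift S u z) (chosen_lift S v (Dom (Typ S) (chosen_lift S u z)))"
    unfolding l(2) Typ_simps Dom_Typ[OF l(1)] unfolding f(2) k(2) B(2) Comp_Ctx[OF f(1) k(1)]
      chosen_lift_mor[OF is_mor_compose[OF f(1) k(1)] B(1)] chosen_lift_mor[OF k(1) A] by simp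
qed

text \<open>Cells over identities, both from \<open>k\<close> to \<open>k'\<close> and between their
  composites with the lift, are parametrised by the elements of one type of fibre paths, and
  whiskering with the lift acts as the identity on parameters. Existence and uniqueness are then
  immediate.\<close>

lemma Typ_vertical:
  assumes zu: "z \<in> Obj (Typ S)" "u \<in> Arr (Ctx S)" "Cod (Ctx S) u = base_obj S z"
    and k: "k \<in> Arr (Typ S)" "k' \<in> Arr (Typ S)" "Dom (Typ S) k = Dom (Typ S) k'"
      "Cod (Typ S) k = Dom (Typ S) (chosen_lift S u z)" "Cod (Typ S) k' = Dom (Typ S) (chosen_lift S u z)" "base_mor S k = base_mor S k'"
    and \<theta>: "\<theta> \<in> Cell (Typ S)" "Src (Typ S) \<theta> = Comp (Typ S) (chosen_lift S u z) k" "Trg (Typ S) \<theta> = Comp (Typ S) (chosen_lift S u z) k'"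
      "base_cell \<theta> = VId (Ctx S) (Comp (Ctx S) u (base_mor S k))"
  shows "\<exists>!\<theta>'. \<theta>' \<in> Cell (Typ S) \<and> Src (Typ S) \<theta>' = k \<and> Trg (Typ S) \<theta>' = k' \<and> base_cell \<theta>' = VId (Ctx S) (base_mor S k) \<and>
    WhL (Typ S) (chosen_lift S u z) \<theta>' = \<theta>"
proof -
  obtain \<Gamma> \<Delta> f B where f: "is_mor S \<Gamma> \<Delta> f" "u = mor S \<Gamma> \<Delta> f" and B: "ctxt S (B # \<Delta>)" "z = tob S \<Delta> B"
    and l: "is_tmor S \<Gamma> (subst (ext f Var) B) \<Delta> B f (Var 0)" "chosen_lift S u z = tmor S \<Gamma> (subst (ext f Var) B) \<Delta> B f (Var 0)"
    by (rule lift_cases[OF zu])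
  let ?A = "subst (ext f Var) B" and ?V = "map (shift 1) :: 'c expr list \<Rightarrow> _"
  have A: "ctxt S (?A # \<Gamma>)" using is_tmorD[OF l(1)] by blast
  have cod: "tcod S k = tob S \<Gamma> ?A" "tcod S k' = tob S \<Gamma> ?A" using k(4,5) unfolding Typ_simps l(2) Dom_Typ[OF l(1)] by blast+
  obtain \<Xi> C where C: "ctxt S (C # \<Xi>)" "tdom S k = tob S \<Xi> C" using arr_Typ(1)[OF k(1)] unfolding Obj_Typ by blast
  from tarr_dom_cod[OF k(1) C(2) cod(1) C(1) A] obtain h b where b: "is_tmor S \<Xi> C \<Gamma> ?A h b" "k = tmor S \<Xi> C \<Gamma> ?A h b" by blast
  have h: "is_mor S \<Xi> \<Gamma> h" and bh: "base_mor S k = mor S \<Xi> \<Gamma> h" using is_tmorD[OF b(1)] base_mor_tmor[OF b(1)] b(2) by blast+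
  have k'd: "tdom S k' = tob S \<Xi> C" "base_mor S k' = mor S \<Xi> \<Gamma> h" using k(3,6) C(2) bh unfolding Typ_simps by simp_all
  from tarr_dom_cod_base[OF k(2) k'd(1) cod(2) C(1) A k'd(2) h] obtain b' where b': "is_tmor S \<Xi> C \<Gamma> ?A h b'" "k' = tmor S \<Xi> C \<Gamma> ?A h b'" by blast
  note L = lift_vertical_cell[OF f(1) B(1) b(1) b'(1)] and L' = lift_vertical_cell[OF f(1) B(1) b'(1) b'(1)]
  have fh: "is_mor S \<Xi> \<Delta> (compose f h)" by (rule is_mor_compose[OF f(1) h])
  let ?T = "IdT (subst (ext (?V (compose f h)) Var) B) b b'"
  obtain F F' \<gamma> \<alpha> where \<theta>0: "\<theta> = (F, F', \<gamma>, \<alpha>)" by (cases \<theta>)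
  have \<theta>1: "\<theta> = (tmor S \<Xi> C \<Delta> B (compose f h) b, tmor S \<Xi> C \<Delta> B (compose f h) b', \<gamma>, VId (Ctx S) (mor S \<Xi> \<Delta> (compose f h)))"
    using \<theta>(2-4) unfolding \<theta>0 Typ_simps l(2) bh unfolding f(2) Comp_Ctx[OF f(1) h] b(2) b'(2) L(2) L'(2) by (simp add: base_cell_def)
  obtain q where q: "C # \<Xi> \<turnstile>\<^bsub>S\<^esub> EqTerm q q ?T"
    "\<gamma> = cell S (C # \<Xi>) (B # \<Delta>) (b # ?V (compose f h)) (b' # ?V (compose f h)) (q # refl_at \<Delta> (?V (compose f h)))"
    using \<theta>(1) unfolding \<theta>1 vertical_cell_iff[OF L(3) L'(3)] by blast
  let ?c = "\<lambda>q. cell S (C # \<Xi>) (?A # \<Gamma>) (b # ?V h) (b' # ?V h) (q # refl_at \<Gamma> (?V h))"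
  \<comment> \<open>The fibre of \<open>?A\<close> along h is B along the composite of f and h, so
    the type parametrising the cells from \<open>k\<close> to \<open>k'\<close> may be written as
    \<open>?T\<close>.\<close>
  have iff: "(k, k', \<delta>, VId (Ctx S) (base_mor S k)) \<in> Cell (Typ S) \<longleftrightarrow> (\<exists>q. C # \<Xi> \<turnstile>\<^bsub>S\<^esub> EqTerm q q ?T \<and> \<delta> = ?c q)" for \<delta>
    unfolding bh unfolding b(2) b'(2) vertical_cell_iff[OF b(1) b'(1)] L(1) ..
  have wh: "WhL (Typ S) (chosen_lift S u z) (k, k', ?c p, VId (Ctx S) (base_mor S k)) =
     (tmor S \<Xi> C \<Delta> B (compose f h) b, tmor S \<Xi> C \<Delta> B (compose f h) b',
      cell S (C # \<Xi>) (B # \<Delta>) (b # ?V (compose f h)) (b' # ?V (compose f h)) (p # refl_at \<Delta> (?V (compose f h))), VId (Ctx S) (mor S \<Xi> \<Delta> (compose f h)))"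
    if p: "C # \<Xi> \<turnstile>\<^bsub>S\<^esub> EqTerm p p ?T" for p
  proof -
    have "WhL (Ctx S) (mor S \<Gamma> \<Delta> f) (VId (Ctx S) (mor S \<Xi> \<Gamma> h)) = VId (Ctx S) (mor S \<Xi> \<Delta> (compose f h))"
      using C.whl_vid[OF Arr_CtxI[OF f(1)] Arr_CtxI[OF h]] by (simp add: Dom_Ctx[OF f(1)] Cod_Ctx[OF h] Comp_Ctx[OF f(1) h])
    then show ?thesis
      unfolding Typ_simps l(2) bh L(4)[OF p] base_mor_tmor[OF l(1)] unfolding b(2) b'(2) L(2) L'(2) by simp
  qed
  show ?thesis
  proof (rule ex1I[of _ "(k, k', ?c q, VId (Ctx S) (base_mor S k))"])
    have "(k, k', ?c q, VId (Ctx S) (base_mor S k)) \<in> Cell (Typ S)" unfolding iff using q(1) by blast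
    then show "(k, k', ?c q, VId (Ctx S) (base_mor S k)) \<in> Cell (Typ S) \<and> Src (Typ S) (k, k', ?c q, VId (Ctx S) (base_mor S k)) = k \<and>
        Trg (Typ S) (k, k', ?c q, VId (Ctx S) (base_mor S k)) = k' \<and> base_cell (k, k', ?c q, VId (Ctx S) (base_mor S k)) = VId (Ctx S) (base_mor S k) \<and>
        WhL (Typ S) (chosen_lift S u z) (k, k', ?c q, VId (Ctx S) (base_mor S k)) = \<theta>"
      unfolding wh[OF q(1)] \<theta>1 q(2) by (simp add: Typ_simps base_cell_def)
    fix \<theta>' assume \<theta>': "\<theta>' \<in> Cell (Typ S) \<and> Src (Typ S) \<theta>' = k \<and> Trg (Typ S) \<theta>' = k' \<and> base_cell \<theta>' = VId (Ctx S) (base_mor S k) \<and>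
      WhL (Typ S) (chosen_lift S u z) \<theta>' = \<theta>"
    obtain G G' \<delta> \<beta> where "\<theta>' = (G, G', \<delta>, \<beta>)" by (cases \<theta>')
    with \<theta>' have e: "\<theta>' = (k, k', \<delta>, VId (Ctx S) (base_mor S k))" by (simp add: Typ_simps base_cell_def)
    from \<theta>' obtain p where p: "C # \<Xi> \<turnstile>\<^bsub>S\<^esub> EqTerm p p ?T" "\<delta> = ?c p" unfolding e iff by blast
    have "WhL (Typ S) (chosen_lift S u z) \<theta>' = \<theta>" using \<theta>' by blast
    then have "cell S (C # \<Xi>) (B # \<Delta>) (b # ?V (compose f h)) (b' # ?V (compose f h)) (p # refl_at \<Delta> (?V (compose f h))) =
        cell S (C # \<Xi>) (B # \<Delta>) (b # ?V (compose f h)) (b' # ?V (compose f h)) (q # refl_at \<Delta> (?V (compose f h)))"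
      unfolding e p(2) wh[OF p(1)] unfolding \<theta>1 q(2) by blast
    then have pq: "C # \<Xi> \<turnstile>\<^bsub>S\<^esub> EqTerm p q ?T" unfolding vertical_cell_eq(2)[OF L(3) L'(3) p(1) q(1)] .
    \<comment> \<open>The equality of parameters was extracted over \<open>\<Delta>\<close>; since
      \<open>?T\<close> is also the type of fibre paths over \<open>\<Gamma>\<close>, it yields
      equality of the cells there.\<close>
    have "?c p = ?c q"
      using vertical_cell_eq(2)[OF b(1) b'(1), unfolded L(1), OF p(1) q(1)] pq by blast
    then show "\<theta>' = (k, k', ?c q, VId (Ctx S) (base_mor S k))" unfolding e p(2) by simp
  qed
qed

interpretation G: groupoidal_fibration "Typ S" "Ctx S" "base_obj S" "base_mor S" base_cell "chosen_lift S"
  by (intro groupoidal_fibration.intro base_two_functor groupoidal_fibration_axioms.intro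
      Typ_cloven Typ_inverse Typ_cell_lift Typ_vertical)

lemma Typ_globally_split: "\<exists>lift2. globally_split_two_fibration (Typ S) (Ctx S) (base_obj S) (base_mor S) base_cell (chosen_lift S) lift2"
  using globally_split_two_fibration.intro[OF G.cloven_two_fibration globally_split_two_fibration_axioms.intro[OF Typ_split]] by blast

end

theorem proposition3p4p9:
  fixes S :: "'c type_theory"
  assumes "discrete_identity_types S"
  shows "\<exists>lift2. globally_split_two_fibration (Typ S) (Ctx S) (base_obj S) (base_mor S) base_cell
           (chosen_lift S) lift2"
  by (rule discrete_identity_types.Typ_globally_split[OF assms])

end
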